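(* Let $G$ be a soluble group of finite rank and let $k$ be a field which is not locally finite. Then $G$ has a faithful irreducible representation over $k$ if and only if $\mathrm{Soc}(G)$ is a locally cyclic $\mathbb{Z}G$-module, where $G$ acts on $\mathrm{Soc}(G)$ by conjugation, and $\mathrm{char}\,k \notin \pi(\mathrm{Soc}(G))$.
   Context: A group $G$ has finite (Prüfer) rank if there is an integer $r$ such that every finitely generated subgroup of $G$ can be generated by $r$ elements. The socle $\mathrm{Soc}(G)$ is the subgroup of $G$ generated by all minimal normal subgroups of $G$ (and $\mathrm{Soc}(G)=1$ if $G$ has no minimal normal subgroups); for soluble $G$ it is abelian, and is regarded as a $\mathbb{Z}G$-module via conjugation. A module is locally cyclic if each of its finitely generated submodules is cyclic (generated by one element). For a group $X$, $\pi(X)$ denotes the set of primes $p$ such that $X$ has an element of order $p$. A field is locally finite if every finitely generated subfield is finite, i.e. it is an algebraic extension of a finite field. An irreducible representation of $G$ over $k$ is one afforded by a simple $kG$-module (of arbitrary, possibly infinite, $k$-dimension); it is faithful if its kernel is trivial. *)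

theory Defs
  imports "HOL-Algebra.Algebra"
begin

section \<open>Groups\<close>

text \<open>Finite Pruefer rank.\<close>

definition finite_rank :: "('g, 'm) monoid_scheme \<Rightarrow> bool" where
  "finite_rank G \<longleftrightarrow>
     (\<exists>r. \<forall>S. finite S \<and> S \<subseteq> carrier G \<longrightarrow>
        (\<exists>T. finite T \<and> card T \<le> r \<and> T \<subseteq> carrier G \<and> generate G T = generate G S))"

definition minimal_normal :: "'g set \<Rightarrow> ('g, 'm) monoid_scheme \<Rightarrow> bool" where
  "minimal_normal N G \<longleftrightarrow>
     N \<lhd> G \<and> N \<noteq> {\<one>\<^bsub>G\<^esub>} \<and> (\<forall>M. M \<lhd> G \<and> M \<subseteq> N \<longrightarrow> M = {\<one>\<^bsub>G\<^esub>} \<or> M = N)"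

definition socle :: "('g, 'm) monoid_scheme \<Rightarrow> 'g set" where
  "socle G = generate G (\<Union>{N. minimal_normal N G})"

definition prime_orders :: "('g, 'm) monoid_scheme \<Rightarrow> nat set" where
  "prime_orders H = {p. Factorial_Ring.prime p \<and> (\<exists>x\<in>carrier H. group.ord H x = p)}"


section \<open>Fields\<close>

text \<open>The library convention \<open>ord x = 0\<close> for elements of infinite order gives
  characteristic \<open>0\<close> its usual meaning.\<close>

definition ring_char :: "('k, 'n) ring_scheme \<Rightarrow> nat" where
  "ring_char K = group.ord (add_monoid K) \<one>\<^bsub>K\<^esub>"

definition locally_finite_field :: "('k, 'n) ring_scheme \<Rightarrow> bool" where
  "locally_finite_field K \<longleftrightarrow>
     (\<forall>S. finite S \<and> S \<subseteq> carrier K \<longrightarrow> finite (generate_field K S))"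


section \<open>Left modules\<close>

text \<open>The library locale \<open>module\<close> requires a commutative ring of scalars.  The locale
  \<open>submodule\<close> does not, and is used below.  In a module record the ring fields
  \<open>mult\<close> and \<open>one\<close> play no role.\<close>

locale left_module = R?: ring R + M?: abelian_group M
  for R :: "('r, 'a) ring_scheme" (structure) and M :: "('r, 'v, 'b) module_scheme" (structure) +
  assumes smult_closed:
      "\<lbrakk>a \<in> carrier R; x \<in> carrier M\<rbrakk> \<Longrightarrow> a \<odot>\<^bsub>M\<^esub> x \<in> carrier M"
    and smult_l_distr:
      "\<lbrakk>a \<in> carrier R; b \<in> carrier R; x \<in> carrier M\<rbrakk> \<Longrightarrow>
        (a \<oplus>\<^bsub>R\<^esub> b) \<odot>\<^bsub>M\<^esub> x = a \<odot>\<^bsub>M\<^esub> x \<oplus>\<^bsub>M\<^esub> b \<odot>\<^bsub>M\<^esub> x"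
    and smult_r_distr:
      "\<lbrakk>a \<in> carrier R; x \<in> carrier M; y \<in> carrier M\<rbrakk> \<Longrightarrow>
        a \<odot>\<^bsub>M\<^esub> (x \<oplus>\<^bsub>M\<^esub> y) = a \<odot>\<^bsub>M\<^esub> x \<oplus>\<^bsub>M\<^esub> a \<odot>\<^bsub>M\<^esub> y"
    and smult_assoc:
      "\<lbrakk>a \<in> carrier R; b \<in> carrier R; x \<in> carrier M\<rbrakk> \<Longrightarrow>
        (a \<otimes>\<^bsub>R\<^esub> b) \<odot>\<^bsub>M\<^esub> x = a \<odot>\<^bsub>M\<^esub> (b \<odot>\<^bsub>M\<^esub> x)"
    and smult_one:
      "x \<in> carrier M \<Longrightarrow> \<one>\<^bsub>R\<^esub> \<odot>\<^bsub>M\<^esub> x = x"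

definition simple_module ::
    "('r, 'a) ring_scheme \<Rightarrow> ('r, 'v, 'b) module_scheme \<Rightarrow> bool" where
  "simple_module R M \<longleftrightarrow>
     left_module R M \<and> carrier M \<noteq> {\<zero>\<^bsub>M\<^esub>} \<and>
     (\<forall>N. submodule N R M \<longrightarrow> N = {\<zero>\<^bsub>M\<^esub>} \<or> N = carrier M)"

definition submodule_span ::
    "('r, 'a) ring_scheme \<Rightarrow> ('r, 'v, 'b) module_scheme \<Rightarrow> 'v set \<Rightarrow> 'v set" where
  "submodule_span R M S = \<Inter>{N. submodule N R M \<and> S \<subseteq> N}"

definition locally_cyclic ::
    "('r, 'a) ring_scheme \<Rightarrow> ('r, 'v, 'b) module_scheme \<Rightarrow> bool" where
  "locally_cyclic R M \<longleftrightarrow>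
     (\<forall>S. finite S \<and> S \<subseteq> carrier M \<longrightarrow>
        (\<exists>x\<in>carrier M. submodule_span R M S = submodule_span R M {x}))"


section \<open>Group rings\<close>

text \<open>Elements of the group ring are the finitely supported functions \<open>G \<rightarrow> R\<close>,
  extended by \<open>0\<close> outside \<open>carrier G\<close>; multiplication is convolution.\<close>

definition fsupport :: "('r, 'a) ring_scheme \<Rightarrow> ('g \<Rightarrow> 'r) \<Rightarrow> 'g set" where
  "fsupport R f = {x. f x \<noteq> \<zero>\<^bsub>R\<^esub>}"

definition group_ring ::
    "('r, 'a) ring_scheme \<Rightarrow> ('g, 'm) monoid_scheme \<Rightarrow> ('g \<Rightarrow> 'r) ring" where
  "group_ring R G =
     \<lparr>carrier = {f. f \<in> carrier G \<rightarrow> carrier R \<and> fsupport R f \<subseteq> carrier G \<and> finite (fsupport R f)},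
      monoid.mult = (\<lambda>f h x. if x \<in> carrier G
                then \<Oplus>\<^bsub>R\<^esub>y\<in>fsupport R f. f y \<otimes>\<^bsub>R\<^esub> h (inv\<^bsub>G\<^esub> y \<otimes>\<^bsub>G\<^esub> x) else \<zero>\<^bsub>R\<^esub>),
      one = (\<lambda>x. if x = \<one>\<^bsub>G\<^esub> then \<one>\<^bsub>R\<^esub> else \<zero>\<^bsub>R\<^esub>),
      ring.zero = (\<lambda>_. \<zero>\<^bsub>R\<^esub>),
      add = (\<lambda>f h x. f x \<oplus>\<^bsub>R\<^esub> h x)\<rparr>"

text \<open>The image of \<open>g\<close> under \<open>G \<rightarrow> R G\<close>.\<close>

definition group_elem :: "('r, 'a) ring_scheme \<Rightarrow> 'g \<Rightarrow> 'g \<Rightarrow> 'r" where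
  "group_elem R g = (\<lambda>x. if x = g then \<one>\<^bsub>R\<^esub> else \<zero>\<^bsub>R\<^esub>)"


section \<open>Faithful irreducible representations\<close>

definition rep_kernel ::
    "('k, 'n) ring_scheme \<Rightarrow> ('g, 'm) monoid_scheme \<Rightarrow> ('g \<Rightarrow> 'k, 'v, 'b) module_scheme
      \<Rightarrow> 'g set" where
  "rep_kernel K G V =
     {g \<in> carrier G. \<forall>v\<in>carrier V. group_elem K g \<odot>\<^bsub>V\<^esub> v = v}"

definition faithful_irreducible ::
    "('k, 'n) ring_scheme \<Rightarrow> ('g, 'm) monoid_scheme \<Rightarrow> ('g \<Rightarrow> 'k, 'v, 'b) module_scheme
      \<Rightarrow> bool" where
  "faithful_irreducible K G V \<longleftrightarrow>
     simple_module (group_ring K G) V \<and> rep_kernel K G V = {\<one>\<^bsub>G\<^esub>}"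

text \<open>HOL cannot quantify over the type of the vectors inside a formula.  Fixing that type to
  be \<open>('g \<Rightarrow> 'k) set\<close> loses nothing, as every simple module over the group ring is isomorphic
  to one of this type (its elements correspond to cosets of a maximal left ideal): see
  \<open>has_faithful_irreducible_repI\<close> below.\<close>

definition has_faithful_irreducible_rep ::
    "('k, 'n) ring_scheme \<Rightarrow> ('g, 'm) monoid_scheme \<Rightarrow> bool" where
  "has_faithful_irreducible_rep K G \<longleftrightarrow>
     (\<exists>V :: ('g \<Rightarrow> 'k, ('g \<Rightarrow> 'k) set) module. faithful_irreducible K G V)"


section \<open>The conjugation module\<close>

text \<open>Meant for an abelian normal subgroup \<open>A\<close> of \<open>G\<close>, such as the socle of a soluble group
  (see \<open>socle_module\<close> below): the \<open>\<int>G\<close>-module \<open>A\<close>, written additively, with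
  \<open>(\<Sum>\<^sub>g n\<^sub>g g) \<cdot> x = \<Prod>\<^sub>g (g x g\<inverse>)\<^bsup>n\<^sub>g\<^esup>\<close>.\<close>

definition conj_module :: "('g, 'm) monoid_scheme \<Rightarrow> 'g set \<Rightarrow> ('g \<Rightarrow> int, 'g) module" where
  "conj_module G A =
     \<lparr>carrier = A, monoid.mult = undefined, one = undefined,
      ring.zero = \<one>\<^bsub>G\<^esub>, add = (\<otimes>\<^bsub>G\<^esub>),
      smult = (\<lambda>f x. \<Otimes>\<^bsub>G\<lparr>carrier := A\<rparr>\<^esub>g\<in>fsupport \<Z> f. (g \<otimes>\<^bsub>G\<^esub> x \<otimes>\<^bsub>G\<^esub> inv\<^bsub>G\<^esub> g) [^]\<^bsub>G\<^esub> f g)\<rparr>"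


section \<open>Independence of the type of vectors\<close>

lemma left_module_transport:
  assumes M: "left_module R M" and inj: "inj_on \<phi> (carrier M)"
    and carr: "carrier W = \<phi> ` carrier M"
    and zero: "\<zero>\<^bsub>W\<^esub> = \<phi> \<zero>\<^bsub>M\<^esub>"
    and add: "\<And>x y. \<lbrakk>x \<in> carrier M; y \<in> carrier M\<rbrakk> \<Longrightarrow> \<phi> x \<oplus>\<^bsub>W\<^esub> \<phi> y = \<phi> (x \<oplus>\<^bsub>M\<^esub> y)"
    and smult: "\<And>a x. \<lbrakk>a \<in> carrier R; x \<in> carrier M\<rbrakk> \<Longrightarrow> a \<odot>\<^bsub>W\<^esub> \<phi> x = \<phi> (a \<odot>\<^bsub>M\<^esub> x)"
  shows "left_module R W"
proof -
  interpret M: left_module R M by (rule M)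
  have "abelian_group W"
  proof (rule abelian_groupI)
    fix x assume "x \<in> carrier W"
    then obtain x' where x': "x' \<in> carrier M" "x = \<phi> x'" using carr by auto
    have "\<phi> (\<ominus>\<^bsub>M\<^esub> x') \<oplus>\<^bsub>W\<^esub> x = \<zero>\<^bsub>W\<^esub>" using x' by (simp add: add zero M.M.l_neg)
    moreover have "\<phi> (\<ominus>\<^bsub>M\<^esub> x') \<in> carrier W" using x' carr by simp
    ultimately show "\<exists>y\<in>carrier W. y \<oplus>\<^bsub>W\<^esub> x = \<zero>\<^bsub>W\<^esub>" by blast
  qed (auto simp: carr zero add M.M.a_ac)
  then show ?thesis
    by (intro left_module.intro left_module_axioms.intro)
       (auto simp: carr add smult M.ring_axioms M.smult_closed M.smult_l_distr M.smult_r_distr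
          M.smult_assoc M.smult_one)
qed

lemma simple_module_transport:
  assumes M: "simple_module R M" and inj: "inj_on \<phi> (carrier M)"
    and carr: "carrier W = \<phi> ` carrier M"
    and zero: "\<zero>\<^bsub>W\<^esub> = \<phi> \<zero>\<^bsub>M\<^esub>"
    and add: "\<And>x y. \<lbrakk>x \<in> carrier M; y \<in> carrier M\<rbrakk> \<Longrightarrow> \<phi> x \<oplus>\<^bsub>W\<^esub> \<phi> y = \<phi> (x \<oplus>\<^bsub>M\<^esub> y)"
    and smult: "\<And>a x. \<lbrakk>a \<in> carrier R; x \<in> carrier M\<rbrakk> \<Longrightarrow> a \<odot>\<^bsub>W\<^esub> \<phi> x = \<phi> (a \<odot>\<^bsub>M\<^esub> x)"
  shows "simple_module R W"
  unfolding simple_module_def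
proof (intro conjI allI impI)
  interpret M: left_module R M using M unfolding simple_module_def by blast
  show W: "left_module R W"
    using left_module_transport[OF M.left_module_axioms inj carr zero add smult] .
  then interpret W: left_module R W .
  show "carrier W \<noteq> {\<zero>\<^bsub>W\<^esub>}"
  proof
    assume "carrier W = {\<zero>\<^bsub>W\<^esub>}"
    then have "\<phi> x = \<phi> \<zero>\<^bsub>M\<^esub>" if "x \<in> carrier M" for x using that carr zero by auto
    then have "x = \<zero>\<^bsub>M\<^esub>" if "x \<in> carrier M" for x
      using that inj by (meson M.M.zero_closed inj_onD)
    then show False using M unfolding simple_module_def by blast
  qed
  fix N assume N: "submodule N R W"
  interpret N: submodule N R W by (rule N)
  define N' where "N' = {x \<in> carrier M. \<phi> x \<in> N}"
  have NW: "N \<subseteq> carrier W" using N.subset by simp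
  have neg: "\<phi> (\<ominus>\<^bsub>M\<^esub> x) \<in> N" if "x \<in> N'" for x
  proof -
    have "\<phi> (\<ominus>\<^bsub>M\<^esub> x) \<oplus>\<^bsub>W\<^esub> \<phi> x = \<zero>\<^bsub>W\<^esub>" using that by (simp add: N'_def add zero M.M.l_neg)
    then have "\<ominus>\<^bsub>W\<^esub> \<phi> x = \<phi> (\<ominus>\<^bsub>M\<^esub> x)"
      using that carr by (intro W.M.minus_equality) (auto simp: N'_def)
    moreover have "\<ominus>\<^bsub>W\<^esub> \<phi> x \<in> N" using N.m_inv_closed[of "\<phi> x"] that
      by (simp add: N'_def a_inv_def)
    ultimately show ?thesis by simp
  qed
  have "submodule N' R M"
  proof (intro submodule.intro subgroup.intro submodule_axioms.intro)
    show "\<one>\<^bsub>add_monoid M\<^esub> \<in> N'" using N.one_closed zero by (simp add: N'_def)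
    show "x \<otimes>\<^bsub>add_monoid M\<^esub> y \<in> N'" if "x \<in> N'" "y \<in> N'" for x y
      using that N.m_closed[of "\<phi> x" "\<phi> y"] by (auto simp: N'_def add)
    show "inv\<^bsub>add_monoid M\<^esub> x \<in> N'" if "x \<in> N'" for x
      using neg[OF that] that M.M.a_inv_closed[of x] by (simp add: N'_def flip: a_inv_def)
    show "a \<odot>\<^bsub>M\<^esub> x \<in> N'" if "a \<in> carrier R" "x \<in> N'" for a x
      using that N.smult_closed[of a "\<phi> x"] by (auto simp: N'_def smult M.smult_closed)
  qed (auto simp: N'_def)
  moreover have "N = \<phi> ` N'" using NW carr by (auto simp: N'_def)
  ultimately show "N = {\<zero>\<^bsub>W\<^esub>} \<or> N = carrier W"
    using M zero carr unfolding simple_module_def by auto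
qed

lemma faithful_irreducible_transport:
  assumes V: "faithful_irreducible K G V" and K: "ring K"
    and inj: "inj_on \<phi> (carrier V)"
    and carr: "carrier W = \<phi> ` carrier V"
    and zero: "\<zero>\<^bsub>W\<^esub> = \<phi> \<zero>\<^bsub>V\<^esub>"
    and add: "\<And>x y. \<lbrakk>x \<in> carrier V; y \<in> carrier V\<rbrakk> \<Longrightarrow> \<phi> x \<oplus>\<^bsub>W\<^esub> \<phi> y = \<phi> (x \<oplus>\<^bsub>V\<^esub> y)"
    and smult: "\<And>a x. \<lbrakk>a \<in> carrier (group_ring K G); x \<in> carrier V\<rbrakk> \<Longrightarrow>
      a \<odot>\<^bsub>W\<^esub> \<phi> x = \<phi> (a \<odot>\<^bsub>V\<^esub> x)"
  shows "faithful_irreducible K G W"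
proof -
  interpret K: ring K by (rule K)
  have V': "simple_module (group_ring K G) V" using V unfolding faithful_irreducible_def by blast
  then interpret V: left_module "group_ring K G" V unfolding simple_module_def by blast
  have "simple_module (group_ring K G) W"
    using simple_module_transport[OF V' inj carr zero add smult] .
  moreover have "rep_kernel K G W = rep_kernel K G V"
  proof -
    have g: "group_elem K g \<in> carrier (group_ring K G)" if "g \<in> carrier G" for g
    proof -
      have "fsupport K (group_elem K g) \<subseteq> {g}"
        by (auto simp: fsupport_def group_elem_def)
      moreover from this have "finite (fsupport K (group_elem K g))"
        using finite_subset by blast
      ultimately show ?thesis using that
        by (auto simp: group_ring_def group_elem_def)
    qed
    have "group_elem K g \<odot>\<^bsub>W\<^esub> \<phi> v = \<phi> v \<longleftrightarrow> group_elem K g \<odot>\<^bsub>V\<^esub> v = v"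
      if "g \<in> carrier G" "v \<in> carrier V" for g v
      using that g[of g] smult inj V.smult_closed[of "group_elem K g" v] by (auto dest: inj_onD)
    then show ?thesis by (auto simp: rep_kernel_def carr)
  qed
  ultimately show ?thesis using V unfolding faithful_irreducible_def by simp
qed

lemma has_faithful_irreducible_repI:
  fixes K :: "('k, 'n) ring_scheme" and G :: "('g, 'm) monoid_scheme"
    and V :: "('g \<Rightarrow> 'k, 'v, 'b) module_scheme"
  assumes K: "ring K" and V: "faithful_irreducible K G V"
  shows "has_faithful_irreducible_rep K G"
proof -
  let ?S = "group_ring K G"
  have V': "simple_module ?S V" using V unfolding faithful_irreducible_def by blast
  then interpret V: left_module ?S V unfolding simple_module_def by blast
  obtain v where v: "v \<in> carrier V" "v \<noteq> \<zero>\<^bsub>V\<^esub>"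
    using V' V.M.zero_closed unfolding simple_module_def by blast
  define N where "N = (\<lambda>a. a \<odot>\<^bsub>V\<^esub> v) ` carrier ?S"
  have zero_v: "\<zero>\<^bsub>?S\<^esub> \<odot>\<^bsub>V\<^esub> v = \<zero>\<^bsub>V\<^esub>"
    using V.smult_l_distr[of "\<zero>\<^bsub>?S\<^esub>" "\<zero>\<^bsub>?S\<^esub>" v] v
    by (metis V.M.add.r_cancel_one' V.R.zero_closed V.R.l_zero V.smult_closed)
  have neg_v: "\<ominus>\<^bsub>V\<^esub> (a \<odot>\<^bsub>V\<^esub> v) = (\<ominus>\<^bsub>?S\<^esub> a) \<odot>\<^bsub>V\<^esub> v" if "a \<in> carrier ?S" for a
    using that v zero_v V.smult_l_distr[of "\<ominus>\<^bsub>?S\<^esub> a" a v]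
    by (intro V.M.minus_equality) (auto simp: V.R.l_neg V.smult_closed)
  have "submodule N ?S V"
  proof (intro submodule.intro subgroup.intro submodule_axioms.intro)
    show "\<one>\<^bsub>add_monoid V\<^esub> \<in> N" using zero_v by (force simp: N_def)
    show "x \<otimes>\<^bsub>add_monoid V\<^esub> y \<in> N" if "x \<in> N" "y \<in> N" for x y
      using that v by (auto simp: N_def simp flip: V.smult_l_distr)
    show "inv\<^bsub>add_monoid V\<^esub> x \<in> N" if "x \<in> N" for x
      using that neg_v by (auto simp: N_def simp flip: a_inv_def)
    show "a \<odot>\<^bsub>V\<^esub> x \<in> N" if "a \<in> carrier ?S" "x \<in> N" for a x
      using that v by (auto simp: N_def simp flip: V.smult_assoc)
  qed (use v in \<open>auto simp: N_def V.smult_closed\<close>)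
  moreover have "v \<in> N" using V.smult_one[of v] v V.R.one_closed unfolding N_def by (metis imageI)
  ultimately have N: "N = carrier V" using V' v unfolding simple_module_def by auto
  define \<phi> where "\<phi> w = {a \<in> carrier ?S. a \<odot>\<^bsub>V\<^esub> v = w}" for w
  have inj: "inj_on \<phi> (carrier V)"
  proof (rule inj_onI)
    fix x y assume "x \<in> carrier V" "y \<in> carrier V" and eq: "\<phi> x = \<phi> y"
    then have "x \<in> N" using N by simp
    then obtain a where "a \<in> \<phi> x" by (auto simp: N_def \<phi>_def)
    then show "x = y" using eq by (auto simp: \<phi>_def)
  qed
  define \<psi> where "\<psi> = the_inv_into (carrier V) \<phi>"
  have \<psi>: "\<psi> (\<phi> x) = x" if "x \<in> carrier V" for x
    using that inj by (simp add: \<psi>_def the_inv_into_f_f)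
  define W :: "('g \<Rightarrow> 'k, ('g \<Rightarrow> 'k) set) module" where
    "W = \<lparr>carrier = \<phi> ` carrier V, monoid.mult = undefined, one = undefined, ring.zero = \<phi> \<zero>\<^bsub>V\<^esub>,
       add = (\<lambda>x y. \<phi> (\<psi> x \<oplus>\<^bsub>V\<^esub> \<psi> y)), smult = (\<lambda>a x. \<phi> (a \<odot>\<^bsub>V\<^esub> \<psi> x))\<rparr>"
  have "faithful_irreducible K G W"
    by (rule faithful_irreducible_transport[OF V K inj]) (auto simp: W_def \<psi>)
  then show ?thesis unfolding has_faithful_irreducible_rep_def by blast
qed


section \<open>Well-formedness of the constructions\<close>

lemma (in comm_monoid) finprod_swap:
  assumes "finite A" "finite B" "\<And>x y. \<lbrakk>x \<in> A; y \<in> B\<rbrakk> \<Longrightarrow> f x y \<in> carrier G"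
  shows "(\<Otimes>x\<in>A. \<Otimes>y\<in>B. f x y) = (\<Otimes>y\<in>B. \<Otimes>x\<in>A. f x y)"
  using assms(1,3)
proof (induction A rule: finite_induct)
  case empty
  then show ?case by simp
next
  case (insert a A)
  have "(\<Otimes>y\<in>B. \<Otimes>x\<in>insert a A. f x y) = (\<Otimes>y\<in>B. f a y \<otimes> (\<Otimes>x\<in>A. f x y))"
    using insert by (intro finprod_cong') (auto simp: Pi_iff)
  also have "\<dots> = (\<Otimes>y\<in>B. f a y) \<otimes> (\<Otimes>y\<in>B. \<Otimes>x\<in>A. f x y)"
    using insert by (intro finprod_multf) (auto simp: Pi_iff)
  finally show ?case using insert by (auto simp: Pi_iff)
qed

lemma finprod_translate:
  assumes "comm_monoid M" "group G" and y: "y \<in> carrier G" and B: "B \<subseteq> carrier G"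
    and W: "finite W" "(\<lambda>b. y \<otimes>\<^bsub>G\<^esub> b) ` B \<subseteq> W"
    and F: "F \<in> W \<rightarrow> carrier M" "\<And>w. \<lbrakk>w \<in> W; w \<notin> (\<lambda>b. y \<otimes>\<^bsub>G\<^esub> b) ` B\<rbrakk> \<Longrightarrow> F w = \<one>\<^bsub>M\<^esub>"
  shows "finprod M F W = (\<Otimes>\<^bsub>M\<^esub>b\<in>B. F (y \<otimes>\<^bsub>G\<^esub> b))"
proof -
  interpret M: comm_monoid M by fact
  interpret G: group G by fact
  have "finprod M F W = finprod M F ((\<lambda>b. y \<otimes>\<^bsub>G\<^esub> b) ` B)"
    by (rule M.finprod_mono_neutral_cong_right) (use W F in auto)
  also have "\<dots> = (\<Otimes>\<^bsub>M\<^esub>b\<in>B. F (y \<otimes>\<^bsub>G\<^esub> b))"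
    by (rule M.finprod_reindex) (use W F y B in \<open>auto simp: Pi_iff inj_on_def subset_iff\<close>)
  finally show ?thesis .
qed

lemma finsum_translate:
  assumes "abelian_monoid M" "group G" and y: "y \<in> carrier G" and B: "B \<subseteq> carrier G"
    and W: "finite W" "(\<lambda>b. y \<otimes>\<^bsub>G\<^esub> b) ` B \<subseteq> W"
    and F: "F \<in> W \<rightarrow> carrier M" "\<And>w. \<lbrakk>w \<in> W; w \<notin> (\<lambda>b. y \<otimes>\<^bsub>G\<^esub> b) ` B\<rbrakk> \<Longrightarrow> F w = \<zero>\<^bsub>M\<^esub>"
  shows "finsum M F W = (\<Oplus>\<^bsub>M\<^esub>b\<in>B. F (y \<otimes>\<^bsub>G\<^esub> b))"
  unfolding finsum_def
  by (rule finprod_translate[OF abelian_monoid.a_comm_monoid[OF assms(1)] assms(2-6)])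
     (use F in auto)

locale group_ring_setup = R?: ring R + G: group G
  for R :: "('r, 'a) ring_scheme" (structure) and G :: "('g, 'm) monoid_scheme"
begin

abbreviation RG where "RG \<equiv> group_ring R G"

lemma carrier_iff:
  "f \<in> carrier RG \<longleftrightarrow> f \<in> carrier G \<rightarrow> carrier R \<and> fsupport R f \<subseteq> carrier G \<and> finite (fsupport R f)"
  by (simp add: group_ring_def)

lemma coeff_closed: "f \<in> carrier RG \<Longrightarrow> f x \<in> carrier R"
  by (cases "f x = \<zero>") (auto simp: carrier_iff fsupport_def Pi_iff)

lemma coeff_outside: "\<lbrakk>f \<in> carrier RG; x \<notin> carrier G\<rbrakk> \<Longrightarrow> f x = \<zero>"
  by (auto simp: carrier_iff fsupport_def)

lemma carrierI:
  assumes "\<And>x. x \<in> carrier G \<Longrightarrow> f x \<in> carrier R" "finite A" "A \<subseteq> carrier G"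
    "\<And>x. x \<notin> A \<Longrightarrow> f x = \<zero>"
  shows "f \<in> carrier RG"
proof -
  have "fsupport R f \<subseteq> A" using assms(4) by (auto simp: fsupport_def)
  then show ?thesis using assms by (auto simp: carrier_iff dest: finite_subset)
qed

lemma mult_eq:
  assumes "f \<in> carrier RG" "h \<in> carrier RG" "x \<in> carrier G"
    "finite A" "fsupport R f \<subseteq> A"
  shows "(f \<otimes>\<^bsub>RG\<^esub> h) x = (\<Oplus>y\<in>A. f y \<otimes> h (inv\<^bsub>G\<^esub> y \<otimes>\<^bsub>G\<^esub> x))"
proof -
  have "(\<Oplus>y\<in>fsupport R f. f y \<otimes> h (inv\<^bsub>G\<^esub> y \<otimes>\<^bsub>G\<^esub> x)) = (\<Oplus>y\<in>A. f y \<otimes> h (inv\<^bsub>G\<^esub> y \<otimes>\<^bsub>G\<^esub> x))"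
    by (rule add.finprod_mono_neutral_cong_left)
       (use assms in \<open>auto simp: coeff_closed fsupport_def\<close>)
  then show ?thesis using assms by (simp add: group_ring_def)
qed

lemma mult_outside: "x \<notin> carrier G \<Longrightarrow> (f \<otimes>\<^bsub>RG\<^esub> h) x = \<zero>"
  by (simp add: group_ring_def)

lemma supp_closed: "\<lbrakk>f \<in> carrier RG; y \<in> fsupport R f\<rbrakk> \<Longrightarrow> y \<in> carrier G"
  by (auto simp: carrier_iff)

lemma mult_zeroI:
  assumes f: "f \<in> carrier RG" and h: "h \<in> carrier RG" and x: "x \<in> carrier G"
    and nx: "x \<notin> (\<lambda>(a, b). a \<otimes>\<^bsub>G\<^esub> b) ` (fsupport R f \<times> fsupport R h)"
  shows "f y \<otimes> h (inv\<^bsub>G\<^esub> y \<otimes>\<^bsub>G\<^esub> x) = \<zero>"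
proof (cases "y \<in> fsupport R f \<and> inv\<^bsub>G\<^esub> y \<otimes>\<^bsub>G\<^esub> x \<in> fsupport R h")
  case True
  then have "y \<in> carrier G" using f supp_closed by blast
  then have "x = y \<otimes>\<^bsub>G\<^esub> (inv\<^bsub>G\<^esub> y \<otimes>\<^bsub>G\<^esub> x)"
    using x by (simp flip: G.m_assoc)
  then show ?thesis using nx True by force
next
  case False
  then show ?thesis using f h by (auto simp: fsupport_def coeff_closed)
qed

lemma mult_closed:
  assumes f: "f \<in> carrier RG" and h: "h \<in> carrier RG"
  shows "f \<otimes>\<^bsub>RG\<^esub> h \<in> carrier RG"
proof (rule carrierI[where A = "(\<lambda>(a, b). a \<otimes>\<^bsub>G\<^esub> b) ` (fsupport R f \<times> fsupport R h)"])
  have fin: "finite (fsupport R f)" using f by (simp add: carrier_iff)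
  show "(f \<otimes>\<^bsub>RG\<^esub> h) x \<in> carrier R" if "x \<in> carrier G" for x
    using mult_eq[OF f h that fin] f h by (auto simp: coeff_closed)
  show "(f \<otimes>\<^bsub>RG\<^esub> h) x = \<zero>" if "x \<notin> (\<lambda>(a, b). a \<otimes>\<^bsub>G\<^esub> b) ` (fsupport R f \<times> fsupport R h)" for x
  proof (cases "x \<in> carrier G")
    case True
    then show ?thesis
      using mult_eq[OF f h True fin] mult_zeroI[OF f h True that] by (simp add: add.finprod_one_eqI)
  qed (simp add: mult_outside)
qed (use f h in \<open>auto simp: carrier_iff\<close>)

lemma group_elem_closed: "g \<in> carrier G \<Longrightarrow> group_elem R g \<in> carrier RG"
  by (rule carrierI[where A = "{g}"]) (auto simp: group_elem_def)

lemma one_eq: "\<one>\<^bsub>RG\<^esub> = group_elem R \<one>\<^bsub>G\<^esub>"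
  by (simp add: group_ring_def group_elem_def)

lemma add_eq: "(f \<oplus>\<^bsub>RG\<^esub> h) x = f x \<oplus> h x"
  by (simp add: group_ring_def)

lemma zero_eq: "\<zero>\<^bsub>RG\<^esub> x = \<zero>"
  by (simp add: group_ring_def)

lemma add_closed:
  assumes "f \<in> carrier RG" "h \<in> carrier RG"
  shows "f \<oplus>\<^bsub>RG\<^esub> h \<in> carrier RG"
  by (rule carrierI[where A = "fsupport R f \<union> fsupport R h"])
     (use assms in \<open>auto simp: carrier_iff add_eq fsupport_def\<close>)

lemma abelian_group_RG: "abelian_group RG"
proof (rule abelian_groupI)
  fix f assume f: "f \<in> carrier RG"
  have "(\<lambda>x. \<ominus> f x) \<in> carrier RG"
    by (rule carrierI[where A = "fsupport R f"]) (use f in \<open>auto simp: carrier_iff fsupport_def\<close>)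
  moreover have "(\<lambda>x. \<ominus> f x) \<oplus>\<^bsub>RG\<^esub> f = \<zero>\<^bsub>RG\<^esub>"
    using f by (auto simp: add_eq zero_eq coeff_closed l_neg)
  ultimately show "\<exists>h\<in>carrier RG. h \<oplus>\<^bsub>RG\<^esub> f = \<zero>\<^bsub>RG\<^esub>" by blast
next
  show "\<zero>\<^bsub>RG\<^esub> \<in> carrier RG" by (rule carrierI[where A = "{}"]) (auto simp: zero_eq)
qed (auto simp: add_closed fun_eq_iff add_eq zero_eq coeff_closed a_ac)

lemma mult_assoc:
  assumes f: "f \<in> carrier RG" and g: "g \<in> carrier RG" and h: "h \<in> carrier RG"
  shows "(f \<otimes>\<^bsub>RG\<^esub> g) \<otimes>\<^bsub>RG\<^esub> h = f \<otimes>\<^bsub>RG\<^esub> (g \<otimes>\<^bsub>RG\<^esub> h)"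
proof
  fix x
  show "((f \<otimes>\<^bsub>RG\<^esub> g) \<otimes>\<^bsub>RG\<^esub> h) x = (f \<otimes>\<^bsub>RG\<^esub> (g \<otimes>\<^bsub>RG\<^esub> h)) x"
  proof (cases "x \<in> carrier G")
    case False
    then show ?thesis by (simp add: mult_outside)
  next
    case x: True
    let ?A = "fsupport R f" and ?B = "fsupport R g"
    let ?W = "(\<lambda>(a, b). a \<otimes>\<^bsub>G\<^esub> b) ` (?A \<times> ?B)"
    have fin: "finite ?A" "finite ?B" "finite ?W" using f g by (auto simp: carrier_iff)
    have sub: "?A \<subseteq> carrier G" "?B \<subseteq> carrier G" "?W \<subseteq> carrier G"
      using f g by (auto simp: carrier_iff)
    have supp: "fsupport R (f \<otimes>\<^bsub>RG\<^esub> g) \<subseteq> ?W"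
    proof
      fix w assume w: "w \<in> fsupport R (f \<otimes>\<^bsub>RG\<^esub> g)"
      then have wG: "w \<in> carrier G" using mult_closed[OF f g] supp_closed by blast
      show "w \<in> ?W"
      proof (rule ccontr)
        assume nw: "w \<notin> ?W"
        show False
          using w mult_eq[OF f g wG fin(1)] mult_zeroI[OF f g wG nw]
          by (simp add: fsupport_def add.finprod_one_eqI)
      qed
    qed
    note cl = coeff_closed[OF f] coeff_closed[OF g] coeff_closed[OF h]
    have "((f \<otimes>\<^bsub>RG\<^esub> g) \<otimes>\<^bsub>RG\<^esub> h) x = (\<Oplus>w\<in>?W. (f \<otimes>\<^bsub>RG\<^esub> g) w \<otimes> h (inv\<^bsub>G\<^esub> w \<otimes>\<^bsub>G\<^esub> x))"
      by (rule mult_eq[OF mult_closed[OF f g] h x fin(3) supp])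
    also have "\<dots> = (\<Oplus>w\<in>?W. \<Oplus>y\<in>?A. f y \<otimes> (g (inv\<^bsub>G\<^esub> y \<otimes>\<^bsub>G\<^esub> w) \<otimes> h (inv\<^bsub>G\<^esub> w \<otimes>\<^bsub>G\<^esub> x)))"
    proof (rule finsum_cong')
      fix w assume "w \<in> ?W"
      then have "w \<in> carrier G" using sub by blast
      then show "(f \<otimes>\<^bsub>RG\<^esub> g) w \<otimes> h (inv\<^bsub>G\<^esub> w \<otimes>\<^bsub>G\<^esub> x) =
        (\<Oplus>y\<in>?A. f y \<otimes> (g (inv\<^bsub>G\<^esub> y \<otimes>\<^bsub>G\<^esub> w) \<otimes> h (inv\<^bsub>G\<^esub> w \<otimes>\<^bsub>G\<^esub> x)))"
        using fin cl by (simp add: mult_eq[OF f g _ fin(1)] finsum_ldistr m_assoc Pi_def)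
    qed (use cl in auto)
    also have "\<dots> = (\<Oplus>y\<in>?A. \<Oplus>w\<in>?W. f y \<otimes> (g (inv\<^bsub>G\<^esub> y \<otimes>\<^bsub>G\<^esub> w) \<otimes> h (inv\<^bsub>G\<^esub> w \<otimes>\<^bsub>G\<^esub> x)))"
      by (rule add.finprod_swap) (use fin cl in auto)
    also have "\<dots> = (\<Oplus>y\<in>?A. f y \<otimes> (g \<otimes>\<^bsub>RG\<^esub> h) (inv\<^bsub>G\<^esub> y \<otimes>\<^bsub>G\<^esub> x))"
    proof (rule finsum_cong')
      fix y assume yA: "y \<in> ?A"
      then have y: "y \<in> carrier G" using sub by blast
      have "(\<Oplus>w\<in>?W. f y \<otimes> (g (inv\<^bsub>G\<^esub> y \<otimes>\<^bsub>G\<^esub> w) \<otimes> h (inv\<^bsub>G\<^esub> w \<otimes>\<^bsub>G\<^esub> x))) =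
        (\<Oplus>b\<in>?B. f y \<otimes> (g (inv\<^bsub>G\<^esub> y \<otimes>\<^bsub>G\<^esub> (y \<otimes>\<^bsub>G\<^esub> b)) \<otimes> h (inv\<^bsub>G\<^esub> (y \<otimes>\<^bsub>G\<^esub> b) \<otimes>\<^bsub>G\<^esub> x)))"
      proof (rule finsum_translate[OF abelian_monoid_axioms G.group_axioms y sub(2) fin(3)])
        fix w assume w: "w \<in> ?W" and nw: "w \<notin> (\<lambda>b. y \<otimes>\<^bsub>G\<^esub> b) ` ?B"
        have "w \<in> carrier G" using w sub by blast
        then have "w = y \<otimes>\<^bsub>G\<^esub> (inv\<^bsub>G\<^esub> y \<otimes>\<^bsub>G\<^esub> w)" using y by (simp flip: G.m_assoc)
        then have "inv\<^bsub>G\<^esub> y \<otimes>\<^bsub>G\<^esub> w \<notin> ?B" using nw by blast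
        then show "f y \<otimes> (g (inv\<^bsub>G\<^esub> y \<otimes>\<^bsub>G\<^esub> w) \<otimes> h (inv\<^bsub>G\<^esub> w \<otimes>\<^bsub>G\<^esub> x)) = \<zero>"
          using cl by (simp add: fsupport_def)
      qed (use yA cl in auto)
      also have "\<dots> = (\<Oplus>b\<in>?B. f y \<otimes> (g b \<otimes> h (inv\<^bsub>G\<^esub> b \<otimes>\<^bsub>G\<^esub> (inv\<^bsub>G\<^esub> y \<otimes>\<^bsub>G\<^esub> x))))"
      proof (rule finsum_cong')
        fix b assume "b \<in> ?B"
        then have b: "b \<in> carrier G" using sub by blast
        have "inv\<^bsub>G\<^esub> y \<otimes>\<^bsub>G\<^esub> (y \<otimes>\<^bsub>G\<^esub> b) = b" using b y by (simp flip: G.m_assoc)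
        then show "f y \<otimes> (g (inv\<^bsub>G\<^esub> y \<otimes>\<^bsub>G\<^esub> (y \<otimes>\<^bsub>G\<^esub> b)) \<otimes> h (inv\<^bsub>G\<^esub> (y \<otimes>\<^bsub>G\<^esub> b) \<otimes>\<^bsub>G\<^esub> x)) =
            f y \<otimes> (g b \<otimes> h (inv\<^bsub>G\<^esub> b \<otimes>\<^bsub>G\<^esub> (inv\<^bsub>G\<^esub> y \<otimes>\<^bsub>G\<^esub> x)))"
          using b y x by (simp add: G.inv_mult_group G.m_assoc)
      qed (use cl in auto)
      also have "\<dots> = f y \<otimes> (g \<otimes>\<^bsub>RG\<^esub> h) (inv\<^bsub>G\<^esub> y \<otimes>\<^bsub>G\<^esub> x)"
        using fin cl x y by (simp add: mult_eq[OF g h _ fin(2)] finsum_rdistr Pi_def)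
      finally show "(\<Oplus>w\<in>?W. f y \<otimes> (g (inv\<^bsub>G\<^esub> y \<otimes>\<^bsub>G\<^esub> w) \<otimes> h (inv\<^bsub>G\<^esub> w \<otimes>\<^bsub>G\<^esub> x))) =
        f y \<otimes> (g \<otimes>\<^bsub>RG\<^esub> h) (inv\<^bsub>G\<^esub> y \<otimes>\<^bsub>G\<^esub> x)" .
    qed (use cl coeff_closed[OF mult_closed[OF g h]] in auto)
    also have "\<dots> = (f \<otimes>\<^bsub>RG\<^esub> (g \<otimes>\<^bsub>RG\<^esub> h)) x"
      by (rule mult_eq[symmetric, OF f mult_closed[OF g h] x fin(1) order_refl])
    finally show ?thesis .
  qed
qed

lemma group_elem_mult:
  assumes "g \<in> carrier G" "f \<in> carrier RG" "x \<in> carrier G"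
  shows "(group_elem R g \<otimes>\<^bsub>RG\<^esub> f) x = f (inv\<^bsub>G\<^esub> g \<otimes>\<^bsub>G\<^esub> x)"
proof -
  have "fsupport R (group_elem R g) \<subseteq> {g}" by (auto simp: fsupport_def group_elem_def)
  then show ?thesis
    using mult_eq[OF group_elem_closed[OF assms(1)] assms(2,3), of "{g}"] assms
    by (simp add: group_elem_def coeff_closed)
qed

lemma mult_one:
  assumes f: "f \<in> carrier RG"
  shows "f \<otimes>\<^bsub>RG\<^esub> \<one>\<^bsub>RG\<^esub> = f"
proof
  fix x
  show "(f \<otimes>\<^bsub>RG\<^esub> \<one>\<^bsub>RG\<^esub>) x = f x"
  proof (cases "x \<in> carrier G")
    case x: True
    let ?A = "insert x (fsupport R f)"
    have fin: "finite ?A" and sub: "?A \<subseteq> carrier G" using f x by (auto simp: carrier_iff)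
    have "(f \<otimes>\<^bsub>RG\<^esub> \<one>\<^bsub>RG\<^esub>) x = (\<Oplus>y\<in>?A. f y \<otimes> \<one>\<^bsub>RG\<^esub> (inv\<^bsub>G\<^esub> y \<otimes>\<^bsub>G\<^esub> x))"
      by (rule mult_eq) (use f x fin group_elem_closed[OF G.one_closed] in \<open>auto simp: one_eq\<close>)
    also have "\<dots> = (\<Oplus>y\<in>?A. if x = y then f y else \<zero>)"
    proof (rule finsum_cong')
      fix y assume "y \<in> ?A"
      then have y: "y \<in> carrier G" using sub by blast
      have "inv\<^bsub>G\<^esub> y \<otimes>\<^bsub>G\<^esub> x = \<one>\<^bsub>G\<^esub> \<longleftrightarrow> x = y"
        using x y by (metis G.inv_closed G.inv_equality G.inv_inv G.l_inv)
      then show "f y \<otimes> \<one>\<^bsub>RG\<^esub> (inv\<^bsub>G\<^esub> y \<otimes>\<^bsub>G\<^esub> x) = (if x = y then f y else \<zero>)"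
        using coeff_closed[OF f] by (simp add: one_eq group_elem_def)
    qed (use coeff_closed[OF f] in auto)
    also have "\<dots> = f x"
      by (rule finsum_singleton) (use fin coeff_closed[OF f] in auto)
    finally show ?thesis .
  qed (use f in \<open>simp add: mult_outside coeff_outside\<close>)
qed

theorem ring_RG: "ring RG"
proof (rule ringI)
  show "abelian_group RG" by (rule abelian_group_RG)
  show "monoid RG"
  proof (rule monoidI)
    show "\<one>\<^bsub>RG\<^esub> \<in> carrier RG" using group_elem_closed by (simp add: one_eq)
    show "\<one>\<^bsub>RG\<^esub> \<otimes>\<^bsub>RG\<^esub> f = f" if "f \<in> carrier RG" for f
    proof
      fix x show "(\<one>\<^bsub>RG\<^esub> \<otimes>\<^bsub>RG\<^esub> f) x = f x"
        using that by (cases "x \<in> carrier G")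
          (simp_all add: one_eq group_elem_mult mult_outside coeff_outside)
    qed
  qed (auto simp: mult_closed mult_assoc mult_one)
next
  fix f g h assume f: "f \<in> carrier RG" and g: "g \<in> carrier RG" and h: "h \<in> carrier RG"
  note cl = coeff_closed[OF f] coeff_closed[OF g] coeff_closed[OF h]
  let ?A = "fsupport R f \<union> fsupport R g"
  have A: "finite ?A" "fsupport R (f \<oplus>\<^bsub>RG\<^esub> g) \<subseteq> ?A"
    using f g by (auto simp: carrier_iff fsupport_def add_eq)
  show "(f \<oplus>\<^bsub>RG\<^esub> g) \<otimes>\<^bsub>RG\<^esub> h = f \<otimes>\<^bsub>RG\<^esub> h \<oplus>\<^bsub>RG\<^esub> g \<otimes>\<^bsub>RG\<^esub> h"
  proof
    fix x show "((f \<oplus>\<^bsub>RG\<^esub> g) \<otimes>\<^bsub>RG\<^esub> h) x = (f \<otimes>\<^bsub>RG\<^esub> h \<oplus>\<^bsub>RG\<^esub> g \<otimes>\<^bsub>RG\<^esub> h) x"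
    proof (cases "x \<in> carrier G")
      case x: True
      show ?thesis
        using cl by (simp add: mult_eq[OF add_closed[OF f g] h x A] mult_eq[OF f h x A(1)]
            mult_eq[OF g h x A(1)] add_eq l_distr finsum_addf Pi_def)
    qed (simp add: mult_outside add_eq)
  qed
  have H: "finite (fsupport R h)" using h by (simp add: carrier_iff)
  show "h \<otimes>\<^bsub>RG\<^esub> (f \<oplus>\<^bsub>RG\<^esub> g) = h \<otimes>\<^bsub>RG\<^esub> f \<oplus>\<^bsub>RG\<^esub> h \<otimes>\<^bsub>RG\<^esub> g"
  proof
    fix x show "(h \<otimes>\<^bsub>RG\<^esub> (f \<oplus>\<^bsub>RG\<^esub> g)) x = (h \<otimes>\<^bsub>RG\<^esub> f \<oplus>\<^bsub>RG\<^esub> h \<otimes>\<^bsub>RG\<^esub> g) x"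
    proof (cases "x \<in> carrier G")
      case x: True
      show ?thesis
        using cl by (simp add: mult_eq[OF h add_closed[OF f g] x H] mult_eq[OF h f x H]
            mult_eq[OF h g x H] add_eq r_distr finsum_addf Pi_def)
    qed (simp add: mult_outside add_eq)
  qed
qed

end

theorem group_ring_is_ring: "\<lbrakk>ring R; group G\<rbrakk> \<Longrightarrow> ring (group_ring R G)"
  by (rule group_ring_setup.ring_RG) (rule group_ring_setup.intro)

lemma (in comm_group) finprod_int_pow:
  assumes "f \<in> A \<rightarrow> carrier G"
  shows "(\<Otimes>x\<in>A. f x) [^] (n::int) = (\<Otimes>x\<in>A. f x [^] n)"
  using assms
  by (induction A rule: infinite_finite_induct) (auto simp: int_pow_distrib Pi_iff)

lemma (in comm_group) int_pow_sum:
  assumes "x \<in> carrier G"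
  shows "x [^] (\<Sum>i\<in>A. n i :: int) = (\<Otimes>i\<in>A. x [^] n i)"
  using assms by (induction A rule: infinite_finite_induct) (auto simp: int_pow_mult Pi_iff)

lemma hom_finprod:
  assumes "comm_group M" "\<phi> \<in> hom M M" "f \<in> A \<rightarrow> carrier M"
  shows "\<phi> (\<Otimes>\<^bsub>M\<^esub>x\<in>A. f x) = (\<Otimes>\<^bsub>M\<^esub>x\<in>A. \<phi> (f x))"
proof -
  interpret comm_group M by fact
  interpret h: group_hom M M \<phi> by unfold_locales fact
  show ?thesis using assms(3)
    by (induction A rule: infinite_finite_induct) (auto simp: Pi_iff)
qed

theorem conj_module_is_module:
  assumes N: "A \<lhd> G" and comm: "comm_group (G\<lparr>carrier := A\<rparr>)"
  shows "left_module (group_ring \<Z> G) (conj_module G A)"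
proof -
  interpret N: normal A G by (rule N)
  interpret RG: group_ring_setup "\<Z>" G
    by (intro group_ring_setup.intro N.is_group cring.axioms(1) int_is_cring)
  define C where "C = G\<lparr>carrier := A\<rparr>"
  interpret C: comm_group C using comm by (simp add: C_def)
  have C_simps [simp]: "carrier C = A" "monoid.mult C = monoid.mult G" "one C = one G" by (simp_all add: C_def)
  have pow: "x [^]\<^bsub>G\<^esub> n = x [^]\<^bsub>C\<^esub> n" if "x \<in> A" for x and n :: int
    using N.int_pow_consistent[OF N.subgroup_axioms that] by (simp add: C_def)
  define c where "c g x = g \<otimes>\<^bsub>G\<^esub> x \<otimes>\<^bsub>G\<^esub> inv\<^bsub>G\<^esub> g" for g x
  have cA: "c g x \<in> A" if "g \<in> carrier G" "x \<in> A" for g x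
    using that N.inv_op_closed2 by (simp add: c_def)
  have c_mult: "c g (x \<otimes>\<^bsub>G\<^esub> y) = c g x \<otimes>\<^bsub>G\<^esub> c g y" if "g \<in> carrier G" "x \<in> A" "y \<in> A" for g x y
  proof -
    have [simp]: "x \<in> carrier G" "y \<in> carrier G" using that N.subset by auto
    have "inv\<^bsub>G\<^esub> g \<otimes>\<^bsub>G\<^esub> (g \<otimes>\<^bsub>G\<^esub> z) = z" if "z \<in> carrier G" for z
      using that \<open>g \<in> carrier G\<close> by (simp flip: N.m_assoc)
    then show ?thesis using that(1) by (simp add: c_def N.m_assoc)
  qed
  have c_hom: "c g \<in> hom C C" if "g \<in> carrier G" for g
    using that cA c_mult by (auto simp: hom_def)
  have c_c: "c g (c h x) = c (g \<otimes>\<^bsub>G\<^esub> h) x" if "g \<in> carrier G" "h \<in> carrier G" "x \<in> A" for g h x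
    using that N.subset by (auto simp: c_def N.inv_mult_group N.m_assoc subset_iff)
  let ?M = "conj_module G A" and ?S = "group_ring \<Z> G"
  have carr: "carrier ?M = A" "\<zero>\<^bsub>?M\<^esub> = \<one>\<^bsub>G\<^esub>" "add ?M = monoid.mult G" by (simp_all add: conj_module_def)
  have supp: "fsupport \<Z> f \<subseteq> carrier G" "finite (fsupport \<Z> f)" if "f \<in> carrier ?S" for f
    using that by (auto simp: RG.carrier_iff)
  have smult: "f \<odot>\<^bsub>?M\<^esub> x = (\<Otimes>\<^bsub>C\<^esub>g\<in>B. c g x [^]\<^bsub>C\<^esub> f g)"
    if f: "f \<in> carrier ?S" and x: "x \<in> A" and B: "finite B" "fsupport \<Z> f \<subseteq> B" "B \<subseteq> carrier G" for f x B
  proof -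
    have "f \<odot>\<^bsub>?M\<^esub> x = (\<Otimes>\<^bsub>C\<^esub>g\<in>fsupport \<Z> f. c g x [^]\<^bsub>G\<^esub> f g)"
      by (simp add: conj_module_def C_def c_def)
    also have "\<dots> = (\<Otimes>\<^bsub>C\<^esub>g\<in>fsupport \<Z> f. c g x [^]\<^bsub>C\<^esub> f g)"
      by (rule C.finprod_cong') (use supp[OF f] x cA pow C.int_pow_closed in \<open>auto simp: Pi_iff subset_iff\<close>)
    also have "\<dots> = (\<Otimes>\<^bsub>C\<^esub>g\<in>B. c g x [^]\<^bsub>C\<^esub> f g)"
      by (rule C.finprod_mono_neutral_cong_left)
         (use B x cA C.int_pow_closed in \<open>auto simp: Pi_iff subset_iff fsupport_def\<close>)
    finally show ?thesis .
  qed
  have pc: "c g x [^]\<^bsub>C\<^esub> (n::int) \<in> A" if "g \<in> carrier G" "x \<in> A" for g x n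
    using C.int_pow_closed cA that by simp
  have fc: "finprod C F B \<in> A" if "\<And>b. b \<in> B \<Longrightarrow> F b \<in> A" for F and B :: "'a set"
    using C.finprod_closed[of F B] that by auto
  have closed: "f \<odot>\<^bsub>?M\<^esub> x \<in> A" if "f \<in> carrier ?S" "x \<in> A" for f x
  proof -
    have "(\<Otimes>\<^bsub>C\<^esub>g\<in>fsupport \<Z> f. c g x [^]\<^bsub>C\<^esub> f g) \<in> carrier C"
      by (rule C.finprod_closed) (use pc supp(1)[OF that(1)] that in \<open>auto simp: subset_iff\<close>)
    then show ?thesis using smult[OF that supp(2)[OF that(1)] order_refl supp(1)[OF that(1)]] by simp
  qed
  have ab: "abelian_group ?M"
  proof (rule abelian_groupI)
    fix x assume x: "x \<in> carrier ?M"
    then show "\<exists>y\<in>carrier ?M. y \<oplus>\<^bsub>?M\<^esub> x = \<zero>\<^bsub>?M\<^esub>"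
      using C.l_inv_ex[of x] by (simp add: carr)
  qed (use C.m_closed C.m_assoc C.m_comm C.one_closed C.l_one in \<open>simp_all add: carr\<close>)
  show ?thesis
  proof (intro left_module.intro left_module_axioms.intro RG.ring_RG ab)
    fix f h x assume f: "f \<in> carrier ?S" and h: "h \<in> carrier ?S" and x: "x \<in> carrier ?M"
    have xA: "x \<in> A" using x carr by simp
    let ?A = "fsupport \<Z> f" and ?B = "fsupport \<Z> h"
    note F = supp[OF f] and H = supp[OF h]
    have fin: "finite (?A \<union> ?B)" and sub: "?A \<union> ?B \<subseteq> carrier G" using F H by auto
    have "fsupport \<Z> (f \<oplus>\<^bsub>?S\<^esub> h) \<subseteq> ?A \<union> ?B" by (auto simp: fsupport_def RG.add_eq)
    then have "(f \<oplus>\<^bsub>?S\<^esub> h) \<odot>\<^bsub>?M\<^esub> x = (\<Otimes>\<^bsub>C\<^esub>g\<in>?A \<union> ?B. c g x [^]\<^bsub>C\<^esub> (f \<oplus>\<^bsub>?S\<^esub> h) g)"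
      using smult[OF RG.add_closed[OF f h] xA fin _ sub] by simp
    also have "\<dots> = (\<Otimes>\<^bsub>C\<^esub>g\<in>?A \<union> ?B. c g x [^]\<^bsub>C\<^esub> f g \<otimes>\<^bsub>C\<^esub> c g x [^]\<^bsub>C\<^esub> h g)"
      by (rule C.finprod_cong')
         (use sub xA pc cA C.m_closed in \<open>auto simp: RG.add_eq C.int_pow_mult subset_iff\<close>)
    also have "\<dots> = (\<Otimes>\<^bsub>C\<^esub>g\<in>?A \<union> ?B. c g x [^]\<^bsub>C\<^esub> f g) \<otimes>\<^bsub>C\<^esub> (\<Otimes>\<^bsub>C\<^esub>g\<in>?A \<union> ?B. c g x [^]\<^bsub>C\<^esub> h g)"
      by (rule C.finprod_multf) (use sub xA pc in auto)
    finally show "(f \<oplus>\<^bsub>?S\<^esub> h) \<odot>\<^bsub>?M\<^esub> x = f \<odot>\<^bsub>?M\<^esub> x \<oplus>\<^bsub>?M\<^esub> h \<odot>\<^bsub>?M\<^esub> x"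
      using smult[OF f xA fin _ sub] smult[OF h xA fin _ sub] by (simp add: carr)
    let ?W = "(\<lambda>(a, b). a \<otimes>\<^bsub>G\<^esub> b) ` (?A \<times> ?B)"
    have W: "finite ?W" "?W \<subseteq> carrier G" using F H by auto
    have "fsupport \<Z> (f \<otimes>\<^bsub>?S\<^esub> h) \<subseteq> ?W"
    proof
      fix w assume w: "w \<in> fsupport \<Z> (f \<otimes>\<^bsub>?S\<^esub> h)"
      then have wG: "w \<in> carrier G" using RG.mult_closed[OF f h] RG.supp_closed by blast
      show "w \<in> ?W"
      proof (rule ccontr)
        assume nw: "w \<notin> ?W"
        show False
          using w RG.mult_eq[OF f h wG F(2) order_refl] RG.mult_zeroI[OF f h wG nw]
          by (simp add: fsupport_def)
      qed
    qed
    then have "(f \<otimes>\<^bsub>?S\<^esub> h) \<odot>\<^bsub>?M\<^esub> x = (\<Otimes>\<^bsub>C\<^esub>w\<in>?W. c w x [^]\<^bsub>C\<^esub> (f \<otimes>\<^bsub>?S\<^esub> h) w)"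
      using smult[OF RG.mult_closed[OF f h] xA W(1) _ W(2)] by simp
    also have "\<dots> = (\<Otimes>\<^bsub>C\<^esub>w\<in>?W. \<Otimes>\<^bsub>C\<^esub>y\<in>?A. c w x [^]\<^bsub>C\<^esub> (f y * h (inv\<^bsub>G\<^esub> y \<otimes>\<^bsub>G\<^esub> w)))"
    proof (rule C.finprod_cong')
      fix w assume "w \<in> ?W"
      then have wG: "w \<in> carrier G" using W by blast
      have "(f \<otimes>\<^bsub>?S\<^esub> h) w = (\<Sum>y\<in>?A. f y * h (inv\<^bsub>G\<^esub> y \<otimes>\<^bsub>G\<^esub> w))"
        using RG.mult_eq[OF f h wG F(2) order_refl] by (simp add: int_finsum_eq)
      then show "c w x [^]\<^bsub>C\<^esub> (f \<otimes>\<^bsub>?S\<^esub> h) w =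
        (\<Otimes>\<^bsub>C\<^esub>y\<in>?A. c w x [^]\<^bsub>C\<^esub> (f y * h (inv\<^bsub>G\<^esub> y \<otimes>\<^bsub>G\<^esub> w)))"
        using cA[OF wG xA] by (simp add: C.int_pow_sum)
    qed (use W F xA pc fc in \<open>auto simp: subset_iff\<close>)
    also have "\<dots> = (\<Otimes>\<^bsub>C\<^esub>y\<in>?A. \<Otimes>\<^bsub>C\<^esub>w\<in>?W. c w x [^]\<^bsub>C\<^esub> (f y * h (inv\<^bsub>G\<^esub> y \<otimes>\<^bsub>G\<^esub> w)))"
      by (rule C.finprod_swap) (use W F pc xA in \<open>auto simp: subset_iff\<close>)
    also have "\<dots> = (\<Otimes>\<^bsub>C\<^esub>y\<in>?A. c y (h \<odot>\<^bsub>?M\<^esub> x) [^]\<^bsub>C\<^esub> f y)"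
    proof (rule C.finprod_cong')
      fix y assume yA: "y \<in> ?A"
      then have y: "y \<in> carrier G" using F by blast
      have "(\<Otimes>\<^bsub>C\<^esub>w\<in>?W. c w x [^]\<^bsub>C\<^esub> (f y * h (inv\<^bsub>G\<^esub> y \<otimes>\<^bsub>G\<^esub> w))) =
        (\<Otimes>\<^bsub>C\<^esub>b\<in>?B. c (y \<otimes>\<^bsub>G\<^esub> b) x [^]\<^bsub>C\<^esub> (f y * h (inv\<^bsub>G\<^esub> y \<otimes>\<^bsub>G\<^esub> (y \<otimes>\<^bsub>G\<^esub> b))))"
      proof (rule finprod_translate[OF C.comm_monoid_axioms N.is_group y H(1) W(1)])
        fix w assume w: "w \<in> ?W" and nw: "w \<notin> (\<lambda>b. y \<otimes>\<^bsub>G\<^esub> b) ` ?B"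
        have "w \<in> carrier G" using w W by blast
        then have "w = y \<otimes>\<^bsub>G\<^esub> (inv\<^bsub>G\<^esub> y \<otimes>\<^bsub>G\<^esub> w)" using y by (simp flip: N.m_assoc)
        then have "inv\<^bsub>G\<^esub> y \<otimes>\<^bsub>G\<^esub> w \<notin> ?B" using nw by blast
        then show "c w x [^]\<^bsub>C\<^esub> (f y * h (inv\<^bsub>G\<^esub> y \<otimes>\<^bsub>G\<^esub> w)) = \<one>\<^bsub>C\<^esub>"
          by (simp add: fsupport_def)
      qed (use yA W pc xA in \<open>auto simp: subset_iff\<close>)
      also have "\<dots> = (\<Otimes>\<^bsub>C\<^esub>b\<in>?B. c y (c b x [^]\<^bsub>C\<^esub> h b) [^]\<^bsub>C\<^esub> f y)"
      proof (rule C.finprod_cong')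
        fix b assume "b \<in> ?B"
        then have b: "b \<in> carrier G" using H by blast
        have "inv\<^bsub>G\<^esub> y \<otimes>\<^bsub>G\<^esub> (y \<otimes>\<^bsub>G\<^esub> b) = b" using b y by (simp flip: N.m_assoc)
        moreover have "c y (c b x [^]\<^bsub>C\<^esub> h b) = c (y \<otimes>\<^bsub>G\<^esub> b) x [^]\<^bsub>C\<^esub> h b"
          using hom_int_pow[OF c_hom[OF y] _ C.is_group C.is_group, of "c b x" "h b"] c_c[OF y b xA] cA[OF b xA]
          by simp
        moreover have "(c (y \<otimes>\<^bsub>G\<^esub> b) x [^]\<^bsub>C\<^esub> h b) [^]\<^bsub>C\<^esub> f y = c (y \<otimes>\<^bsub>G\<^esub> b) x [^]\<^bsub>C\<^esub> (f y * h b)"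
        proof -
          have "c (y \<otimes>\<^bsub>G\<^esub> b) x \<in> carrier C"
            using cA[OF N.m_closed[OF y b] xA] by simp
          from C.int_pow_pow[OF this] show ?thesis by (simp only: mult.commute)
        qed
        ultimately show "c (y \<otimes>\<^bsub>G\<^esub> b) x [^]\<^bsub>C\<^esub> (f y * h (inv\<^bsub>G\<^esub> y \<otimes>\<^bsub>G\<^esub> (y \<otimes>\<^bsub>G\<^esub> b))) =
            c y (c b x [^]\<^bsub>C\<^esub> h b) [^]\<^bsub>C\<^esub> f y"
          by (simp only:)
      qed (use H pc xA y in \<open>auto simp: subset_iff\<close>)
      also have "\<dots> = (\<Otimes>\<^bsub>C\<^esub>b\<in>?B. c y (c b x [^]\<^bsub>C\<^esub> h b)) [^]\<^bsub>C\<^esub> f y"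
        by (rule C.finprod_int_pow[symmetric]) (use H pc xA y cA in \<open>auto simp: subset_iff\<close>)
      also have "(\<Otimes>\<^bsub>C\<^esub>b\<in>?B. c y (c b x [^]\<^bsub>C\<^esub> h b)) = c y (\<Otimes>\<^bsub>C\<^esub>b\<in>?B. c b x [^]\<^bsub>C\<^esub> h b)"
        by (rule hom_finprod[symmetric, OF C.comm_group_axioms c_hom[OF y]])
           (use H pc xA in \<open>auto simp: subset_iff\<close>)
      also have "(\<Otimes>\<^bsub>C\<^esub>b\<in>?B. c b x [^]\<^bsub>C\<^esub> h b) = h \<odot>\<^bsub>?M\<^esub> x"
        using smult[OF h xA H(2) order_refl H(1)] by simp
      finally show "(\<Otimes>\<^bsub>C\<^esub>w\<in>?W. c w x [^]\<^bsub>C\<^esub> (f y * h (inv\<^bsub>G\<^esub> y \<otimes>\<^bsub>G\<^esub> w))) =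
        c y (h \<odot>\<^bsub>?M\<^esub> x) [^]\<^bsub>C\<^esub> f y" .
    qed (use F pc closed[OF h xA] in \<open>auto simp: subset_iff\<close>)
    also have "\<dots> = f \<odot>\<^bsub>?M\<^esub> (h \<odot>\<^bsub>?M\<^esub> x)"
      using smult[OF f closed[OF h xA] F(2) order_refl F(1)] by simp
    finally show "(f \<otimes>\<^bsub>?S\<^esub> h) \<odot>\<^bsub>?M\<^esub> x = f \<odot>\<^bsub>?M\<^esub> (h \<odot>\<^bsub>?M\<^esub> x)" .
  next
    fix f x y assume f: "f \<in> carrier ?S" and "x \<in> carrier ?M" "y \<in> carrier ?M"
    then have xy: "x \<in> A" "y \<in> A" "x \<otimes>\<^bsub>G\<^esub> y \<in> A" using carr by auto
    note F = supp[OF f]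
    note sm = smult[OF f _ F(2) order_refl F(1)]
    have "(\<Otimes>\<^bsub>C\<^esub>g\<in>fsupport \<Z> f. c g (x \<otimes>\<^bsub>G\<^esub> y) [^]\<^bsub>C\<^esub> f g) =
      (\<Otimes>\<^bsub>C\<^esub>g\<in>fsupport \<Z> f. c g x [^]\<^bsub>C\<^esub> f g \<otimes>\<^bsub>C\<^esub> c g y [^]\<^bsub>C\<^esub> f g)"
    proof (rule C.finprod_cong')
      fix g assume "g \<in> fsupport \<Z> f"
      then have g: "g \<in> carrier G" using F by blast
      show "c g (x \<otimes>\<^bsub>G\<^esub> y) [^]\<^bsub>C\<^esub> f g = c g x [^]\<^bsub>C\<^esub> f g \<otimes>\<^bsub>C\<^esub> c g y [^]\<^bsub>C\<^esub> f g"
        using C.int_pow_distrib[of "c g x" "c g y" "f g"] c_mult[OF g xy(1,2)] cA[OF g] xy by simp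
    qed (use F pc xy in \<open>auto simp: subset_iff\<close>)
    also have "\<dots> = (\<Otimes>\<^bsub>C\<^esub>g\<in>fsupport \<Z> f. c g x [^]\<^bsub>C\<^esub> f g) \<otimes>\<^bsub>C\<^esub> (\<Otimes>\<^bsub>C\<^esub>g\<in>fsupport \<Z> f. c g y [^]\<^bsub>C\<^esub> f g)"
      by (rule C.finprod_multf) (use F pc xy in \<open>auto simp: subset_iff\<close>)
    finally show "f \<odot>\<^bsub>?M\<^esub> (x \<oplus>\<^bsub>?M\<^esub> y) = f \<odot>\<^bsub>?M\<^esub> x \<oplus>\<^bsub>?M\<^esub> f \<odot>\<^bsub>?M\<^esub> y"
      using sm xy by (simp add: carr)
  next
    fix x assume "x \<in> carrier ?M"
    then have x: "x \<in> A" "x \<in> carrier G" using carr N.subset by auto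
    have s: "fsupport \<Z> \<one>\<^bsub>?S\<^esub> \<subseteq> {\<one>\<^bsub>G\<^esub>}" by (auto simp: RG.one_eq group_elem_def fsupport_def)
    have "\<one>\<^bsub>?S\<^esub> \<odot>\<^bsub>?M\<^esub> x = (\<Otimes>\<^bsub>C\<^esub>g\<in>{\<one>\<^bsub>G\<^esub>}. c g x [^]\<^bsub>C\<^esub> \<one>\<^bsub>?S\<^esub> g)"
      by (rule smult) (use x s RG.group_elem_closed in \<open>auto simp: RG.one_eq\<close>)
    also have "\<dots> = x"
      using x by (simp add: RG.one_eq group_elem_def c_def)
    finally show "\<one>\<^bsub>?S\<^esub> \<odot>\<^bsub>?M\<^esub> x = x" .
  qed (simp add: carr closed)
qed

lemma (in group) generate_commuting:
  assumes S: "S \<subseteq> carrier G" "\<And>x y. \<lbrakk>x \<in> S; y \<in> S\<rbrakk> \<Longrightarrow> x \<otimes> y = y \<otimes> x"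
  shows "comm_group (G\<lparr>carrier := generate G S\<rparr>)"
proof -
  have gc: "generate G S \<subseteq> carrier G" using generate_incl[OF S(1)] .
  have step: "x \<otimes> y = y \<otimes> x"
    if "y \<in> generate G S" "x \<in> carrier G" "\<And>s. s \<in> S \<Longrightarrow> x \<otimes> s = s \<otimes> x" for x y
    using that(1)
  proof (induction rule: generate.induct)
    case (inv h)
    then have h: "h \<in> carrier G" "x \<otimes> h = h \<otimes> x" using S that by auto
    show ?case using h that(2)
      by (metis (full_types) inv_closed inv_solve_left inv_solve_right m_assoc m_closed)
  next
    case (eng h1 h2)
    then have "h1 \<in> carrier G" "h2 \<in> carrier G" using gc by auto
    with eng that(2) show ?case by (metis m_assoc)
  qed (use that in auto)
  have "x \<otimes> y = y \<otimes> x" if "x \<in> generate G S" "y \<in> generate G S" for x y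
    using step[OF that(2)] step[OF that(1)] that S gc by (metis subsetD)
  then show ?thesis
    using subgroup_imp_group[OF generate_is_subgroup[OF S(1)]]
    by (auto intro!: group.group_comm_groupI)
qed

theorem socle_abelian_normal:
  assumes "group G" "solvable G"
  shows "socle G \<lhd> G" and "comm_group (G\<lparr>carrier := socle G\<rparr>)"
proof -
  interpret group G by fact
  have sub: "\<Union>{N. minimal_normal N G} \<subseteq> carrier G"
    using normal_imp_subgroup subgroup.subset by (fastforce simp: minimal_normal_def)
  show "socle G \<lhd> G"
    unfolding socle_def
  proof (rule normal_generateI[OF sub])
    fix h g assume "h \<in> \<Union>{N. minimal_normal N G}" "g \<in> carrier G"
    then show "g \<otimes>\<^bsub>G\<^esub> h \<otimes>\<^bsub>G\<^esub> inv\<^bsub>G\<^esub> g \<in> \<Union>{N. minimal_normal N G}"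
      by (auto simp: minimal_normal_def dest: normal.inv_op_closed2)
  qed
  have derived_trivial: "derived G N = {\<one>\<^bsub>G\<^esub>}" if N: "minimal_normal N G" for N
  proof (rule ccontr)
    assume "derived G N \<noteq> {\<one>\<^bsub>G\<^esub>}"
    moreover have "N \<lhd> G" and sg: "subgroup N G"
      using N normal_imp_subgroup unfolding minimal_normal_def by auto
    then have "derived G N \<lhd> G" "derived G N \<subseteq> N"
      using derived_is_normal derived_incl by auto
    ultimately have "derived G N = N" using N unfolding minimal_normal_def by blast
    then have "(derived G ^^ n) N = N" for n by (induction n) auto
    moreover obtain n where "(derived G ^^ n) N = {\<one>\<^bsub>G\<^esub>}"
      using solvable_imp_trivial_derived_seq[OF solvable_subgroup[OF sg assms(2)]] by blast
    ultimately show False using N unfolding minimal_normal_def by simp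
  qed
  show "comm_group (G\<lparr>carrier := socle G\<rparr>)"
    unfolding socle_def
  proof (rule generate_commuting[OF sub])
    fix x y assume "x \<in> \<Union>{N. minimal_normal N G}" "y \<in> \<Union>{N. minimal_normal N G}"
    then obtain N M where NM: "minimal_normal N G" "minimal_normal M G" "x \<in> N" "y \<in> M" by blast
    show "x \<otimes>\<^bsub>G\<^esub> y = y \<otimes>\<^bsub>G\<^esub> x"
    proof (cases "N = M")
      case True
      have "x \<otimes>\<^bsub>G\<^esub> y \<otimes>\<^bsub>G\<^esub> inv\<^bsub>G\<^esub> x \<otimes>\<^bsub>G\<^esub> inv\<^bsub>G\<^esub> y \<in> derived G N"
        unfolding derived_def by (rule generate.incl) (use NM True in blast)
      then have "x \<otimes>\<^bsub>G\<^esub> y \<otimes>\<^bsub>G\<^esub> inv\<^bsub>G\<^esub> x \<otimes>\<^bsub>G\<^esub> inv\<^bsub>G\<^esub> y = \<one>\<^bsub>G\<^esub>" using derived_trivial NM by simp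
      moreover have "x \<in> carrier G" "y \<in> carrier G" using sub NM by auto
      ultimately show ?thesis
        by (metis inv_closed inv_solve_right l_one m_closed one_closed inv_inv)
    next
      case False
      then have "N \<inter> M = {\<one>\<^bsub>G\<^esub>}"
        using NM normal_subgroup_intersect[of N M] unfolding minimal_normal_def
        by (metis inf.absorb_iff2 inf_le2)
      then show ?thesis
        using NM normal_imp_commuting[of N M x y] unfolding minimal_normal_def by simp
    qed
  qed
qed

corollary socle_module:
  assumes "group G" "solvable G"
  shows "left_module (group_ring \<Z> G) (conj_module G (socle G))"
  using conj_module_is_module socle_abelian_normal[OF assms] by blast

end

theory Submission
  imports Defs
begin

text \<open>Write \<open>S\<close> for the socle. Two facts about a soluble group of finite rank are behind everything. Its minimal
normal subgroups are finite elementary abelian groups, so that \<open>S\<close> is the direct product of its finite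
primary parts \<open>S\<^sub>p = {x \<in> S. x\<^sup>p = 1}\<close>, each of them a semisimple module
(\<open>torsion_free_not_minimal\<close>, \<open>minimal_normal_elementary\<close>, \<open>socle_complement\<close>). And a normal subgroup
\<open>B \<subseteq> S\<^sub>p\<close> is generated by one element as a normal subgroup of \<open>G\<close> if and only if there is a
homomorphism \<open>B \<rightarrow> \<int>/p\<close> whose kernel contains no normal subgroup of \<open>G\<close> except the trivial one, a
core-free functional (\<open>cyclic_iff_core_free\<close>). The second fact says that a semisimple module over a
finite field is cyclic exactly if its dual is. To prove it, split off a minimal normal subgroup,
\<open>B = A \<times> M\<close>: being cyclic passes from \<open>M\<close> to \<open>B\<close> exactly if \<open>|Hom(M, A)| < |A|\<close>, and having a
core-free functional does so exactly if \<open>|Hom(A, M)| < |A|\<close>. By semisimplicity the two numbers of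
homomorphisms agree.

Let \<open>V\<close> be a faithful simple module. The vectors fixed by a normal subgroup form a submodule, so no
nontrivial normal subgroup fixes a nonzero vector. In characteristic \<open>p\<close> the finite group \<open>S\<^sub>p\<close> would fix
one, whence \<open>S\<^sub>p = 1\<close>. If \<open>p\<close> is not the characteristic and \<open>B \<subseteq> S\<^sub>p\<close> is normal in \<open>G\<close>, choose a
nonzero vector \<open>u\<close> whose stabiliser \<open>C\<close> in \<open>B\<close> is as large as possible. Then
\<open>(1 + z + \<dots> + z\<^bsup>p-1\<^esup>) u = 0\<close> for \<open>z \<in> B - C\<close>, and a sum over a subgroup of order \<open>p\<^sup>2\<close> shows
that \<open>B/C\<close> is cyclic. So \<open>C\<close> is the kernel of a functional on \<open>B\<close>, and this functional is core-free
because \<open>C\<close> fixes \<open>u\<close>. Hence every such \<open>B\<close> is cyclic, and by the Chinese remainder theorem \<open>S\<close> is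
locally cyclic (\<open>faithful_irreducible_imp_socle\<close>).

For the converse, let \<open>D\<close> be a torsion-free abelian normal subgroup of maximal rank and \<open>F \<le> D\<close> a free
abelian subgroup of that rank. Every nontrivial normal subgroup of \<open>G\<close> contains a nontrivial abelian
one, and so meets \<open>F\<close> or some \<open>S\<^sub>p\<close> (\<open>exists_maximal_torsion_free\<close>, \<open>torsion_meets_socle\<close>). A field
that is not locally finite has multiplicatively independent sets of every finite size
(\<open>independent_sets_if_not_locally_finite\<close>), which gives an injective homomorphism \<open>\<alpha>\<close> from \<open>F\<close> to the
units of the field; local cyclicity gives core-free functionals \<open>\<chi>\<^sub>p\<close> on the groups \<open>S\<^sub>p\<close>. From the
\<open>\<chi>\<^sub>p\<close> one makes a function \<open>\<mu>\<close> on \<open>S\<close> with values \<open>0\<close>, \<open>1\<close>, \<open>-1\<close>, and then a function \<open>u\<close> on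
\<open>G\<close> by \<open>u(s f) = \<mu>(s) \<alpha>(f)\<close> for \<open>s \<in> S\<close>, \<open>f \<in> F\<close> and \<open>u = 0\<close> elsewhere. It is such that the left ideal
of the group ring that annihilates all translates of \<open>u\<close> contains \<open>f - \<alpha>(f)\<close> for \<open>f \<in> F\<close> and
\<open>1 + x + \<dots> + x\<^bsup>p-1\<^esup>\<close> for \<open>x \<in> S\<^sub>p\<close> with \<open>\<chi>\<^sub>p x \<noteq> 0\<close>. The quotient by a maximal left ideal above it
is a simple module with a nonzero vector killed by these elements. If the kernel of the representation
were nontrivial it would contain some \<open>f \<noteq> 1\<close> in \<open>F\<close>, and then \<open>\<alpha>(f) = 1\<close>, or an \<open>x \<in> S\<^sub>p\<close> with
\<open>\<chi>\<^sub>p x \<noteq> 0\<close>, and then \<open>p = 0\<close> in the field; both are impossible.\<close>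


section \<open>Finite rank and multiplicative independence\<close>

definition rank_at_most :: "nat \<Rightarrow> ('g, 'm) monoid_scheme \<Rightarrow> bool" where
  "rank_at_most r G \<longleftrightarrow> (\<forall>S. finite S \<and> S \<subseteq> carrier G \<longrightarrow>
     (\<exists>T. finite T \<and> card T \<le> r \<and> T \<subseteq> carrier G \<and> generate G T = generate G S))"

lemma finite_rank_iff: "finite_rank G \<longleftrightarrow> (\<exists>r. rank_at_most r G)"
  by (simp add: finite_rank_def rank_at_most_def)

lemma (in group) rank_at_most_subgroup:
  assumes r: "rank_at_most r G" and H: "subgroup H G"
  shows "rank_at_most r (G\<lparr>carrier := H\<rparr>)"
  unfolding rank_at_most_def
proof (intro allI impI)
  fix S assume S: "finite S \<and> S \<subseteq> carrier (G\<lparr>carrier := H\<rparr>)"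
  then have SH: "S \<subseteq> H" and "S \<subseteq> carrier G" using subgroup.subset[OF H] by auto
  then obtain T where T: "finite T" "card T \<le> r" "T \<subseteq> carrier G" "generate G T = generate G S"
    using r S unfolding rank_at_most_def by meson
  have "T \<subseteq> generate G S" using T(4) generate.incl[of _ T G] by auto
  then have TH: "T \<subseteq> H" using generate_subgroup_incl[OF SH H] by blast
  show "\<exists>T. finite T \<and> card T \<le> r \<and> T \<subseteq> carrier (G\<lparr>carrier := H\<rparr>) \<and>
      generate (G\<lparr>carrier := H\<rparr>) T = generate (G\<lparr>carrier := H\<rparr>) S"
    using T TH generate_consistent[OF TH H] generate_consistent[OF SH H] by auto
qed

lemma (in group_hom) rank_at_most_image:
  assumes r: "rank_at_most r G" and surj: "h ` carrier G = carrier H"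
  shows "rank_at_most r H"
  unfolding rank_at_most_def
proof (intro allI impI)
  fix S assume S: "finite S \<and> S \<subseteq> carrier H"
  then obtain S' where S': "S' \<subseteq> carrier G" "finite S'" "S = h ` S'"
    using surj finite_subset_image[of S h "carrier G"] by auto
  then obtain T where T: "finite T" "card T \<le> r" "T \<subseteq> carrier G" "generate G T = generate G S'"
    using r unfolding rank_at_most_def by meson
  show "\<exists>T. finite T \<and> card T \<le> r \<and> T \<subseteq> carrier H \<and> generate H T = generate H S"
  proof (intro exI[of _ "h ` T"] conjI)
    show "card (h ` T) \<le> r" using card_image_le[OF T(1), of h] T(2) by simp
    show "generate H (h ` T) = generate H S"
      using generate_img[OF T(3)] generate_img[OF S'(1)] T(4) S'(3) by simp
  qed (use T in auto)
qed

context comm_group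
begin

text \<open>The integral linear combination of the elements of \<open>T\<close> with coefficients \<open>c\<close>, in multiplicative
  notation.\<close>

definition power_product :: "'a set \<Rightarrow> ('a \<Rightarrow> int) \<Rightarrow> 'a" where
  "power_product T c = (\<Otimes>t\<in>T. t [^] c t)"

lemma power_product_closed [simp]: "T \<subseteq> carrier G \<Longrightarrow> power_product T c \<in> carrier G"
  unfolding power_product_def by (rule finprod_closed) auto

lemma power_product_add:
  assumes "T \<subseteq> carrier G"
  shows "power_product T (\<lambda>t. c t + d t) = power_product T c \<otimes> power_product T d"
proof -
  have "power_product T (\<lambda>t. c t + d t) = (\<Otimes>t\<in>T. t [^] c t \<otimes> t [^] d t)"
    unfolding power_product_def using assms by (intro finprod_cong') (auto simp: int_pow_mult)
  also have "\<dots> = power_product T c \<otimes> power_product T d"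
    unfolding power_product_def using assms by (intro finprod_multf) auto
  finally show ?thesis .
qed

lemma power_product_zero: "power_product T (\<lambda>t. 0) = \<one>"
  unfolding power_product_def by simp

lemma power_product_mult:
  assumes "T \<subseteq> carrier G"
  shows "power_product T (\<lambda>t. c t * n) = power_product T c [^] (n::int)"
proof -
  have "power_product T c [^] n = (\<Otimes>t\<in>T. (t [^] c t) [^] n)"
    unfolding power_product_def using assms by (intro finprod_int_pow) auto
  also have "\<dots> = power_product T (\<lambda>t. c t * n)"
    unfolding power_product_def using assms by (intro finprod_cong') (auto simp: int_pow_pow)
  finally show ?thesis by simp
qed

lemma power_product_uminus:
  assumes "T \<subseteq> carrier G"
  shows "power_product T (\<lambda>t. - c t) = inv (power_product T c)"
  using power_product_mult[OF assms, of c "-1"] assms by (simp add: int_pow_neg)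

lemma power_product_diff:
  assumes "T \<subseteq> carrier G"
  shows "power_product T (\<lambda>t. c t - d t) = power_product T c \<otimes> inv (power_product T d)"
  using power_product_add[OF assms, of c "\<lambda>t. - d t"] power_product_uminus[OF assms] by simp

lemma power_product_single:
  assumes "T \<subseteq> carrier G" "finite T" "t \<in> T"
  shows "power_product T (\<lambda>s. if s = t then n else 0) = t [^] n"
proof -
  have "power_product T (\<lambda>s. if s = t then n else 0) = (\<Otimes>s\<in>T. if t = s then t [^] n else \<one>)"
    unfolding power_product_def using assms by (intro finprod_cong') auto
  also have "\<dots> = t [^] n"
    using finprod_singleton[OF assms(3,2), of "\<lambda>_. t [^] n"] assms by auto
  finally show ?thesis .
qed

lemma generate_eq_power_product:
  assumes T: "T \<subseteq> carrier G" "finite T"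
  shows "generate G T = range (power_product T)"
proof
  show "generate G T \<subseteq> range (power_product T)"
  proof
    fix x assume "x \<in> generate G T"
    then show "x \<in> range (power_product T)"
    proof induction
      case one
      show ?case using power_product_zero by (metis rangeI)
    next
      case (incl h)
      show ?case using power_product_single[OF T incl, of 1] incl T by (metis int_pow_1 rangeI subsetD)
    next
      case (inv h)
      have "power_product T (\<lambda>s. if s = h then -1 else 0) = inv h"
        using power_product_single[OF T inv, of "-1"] inv T by (auto simp: int_pow_neg)
      then show ?case by (metis rangeI)
    next
      case (eng h1 h2)
      then obtain c d where "h1 = power_product T c" "h2 = power_product T d" by auto
      then have "h1 \<otimes> h2 = power_product T (\<lambda>t. c t + d t)" using power_product_add[OF T(1)] by simp
      then show ?case by blast
    qed
  qed
  show "range (power_product T) \<subseteq> generate G T"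
  proof
    fix x assume "x \<in> range (power_product T)"
    then obtain c where "x = power_product T c" by auto
    moreover interpret H: subgroup "generate G T" G by (rule generate_is_subgroup[OF T(1)])
    have "(\<Otimes>t\<in>U. t [^] c t) \<in> generate G T" if "U \<subseteq> T" for U
      using finite_subset[OF that T(2)] that
    proof (induction U rule: finite_induct)
      case (insert t U)
      have "t [^] c t \<in> generate G T"
        using insert subgroup_int_pow_closed[OF H.subgroup_axioms, of t "c t"] generate.incl[of t T G] by auto
      with insert T show ?case by (subst finprod_insert) (auto simp: subset_iff)
    qed simp
    ultimately show "x \<in> generate G T" by (simp add: power_product_def)
  qed
qed

definition mult_independent :: "'a set \<Rightarrow> bool" where
  "mult_independent T \<longleftrightarrow> finite T \<and> T \<subseteq> carrier G \<and>
     (\<forall>c. power_product T c = \<one> \<longrightarrow> (\<forall>t\<in>T. c t = 0))"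

lemma mult_independentD:
  "\<lbrakk>mult_independent T; power_product T c = power_product T d; t \<in> T\<rbrakk> \<Longrightarrow> c t = d t"
  using power_product_diff[of T c d] unfolding mult_independent_def
  by (metis diff_eq_diff_eq diff_self r_inv power_product_closed)

text \<open>If \<open>r\<close> elements \<open>T'\<close> generate the same subgroup as \<open>T\<close>, then modulo squares there are at most
  \<open>2\<^sup>r\<close> elements, while independence makes the products over the \<open>2\<^bsup>|T|\<^esup>\<close> subsets of \<open>T\<close> distinct modulo
  squares.\<close>

lemma mult_independent_card:
  assumes r: "rank_at_most r G" and T: "mult_independent T"
  shows "card T \<le> r"
proof -
  have TG: "finite T" "T \<subseteq> carrier G" using T by (auto simp: mult_independent_def)
  obtain T' where T': "finite T'" "card T' \<le> r" "T' \<subseteq> carrier G" "generate G T' = generate G T"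
    using r TG unfolding rank_at_most_def by meson
  have rng: "range (power_product T') = range (power_product T)"
    using generate_eq_power_product TG T' by metis
  define ind :: "'a set \<Rightarrow> 'a \<Rightarrow> int" where "ind U t = (if t \<in> U then 1 else 0)" for U t
  have "\<exists>a. power_product T (ind U) = power_product T' a" for U using rng by (metis rangeE rangeI)
  then obtain a where a: "\<And>U. power_product T (ind U) = power_product T' (a U)" by metis
  \<comment> \<open>the class modulo squares of the product over \<open>U\<close>, read off from the parities of its exponents\<close>
  define f where "f U = {s \<in> T'. odd (a U s)}" for U
  have "inj_on f (Pow T)"
  proof (rule inj_onI)
    fix U U' assume U: "U \<in> Pow T" "U' \<in> Pow T" and eq: "f U = f U'"
    define b where "b s = (a U s - a U' s) div 2" for s
    have "power_product T' (\<lambda>s. a U s - a U' s) = power_product T' (\<lambda>s. b s * 2)"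
      unfolding power_product_def
    proof (rule finprod_cong')
      fix s assume "s \<in> T'"
      then have "even (a U s - a U' s)" using eq by (auto simp: f_def)
      then show "s [^] (a U s - a U' s) = s [^] (b s * 2)" by (simp add: b_def)
    qed (use T' in auto)
    moreover obtain e where e: "power_product T' b = power_product T e" using rng by (metis rangeE rangeI)
    ultimately have "power_product T (\<lambda>t. ind U t - ind U' t) = power_product T (\<lambda>t. e t * 2)"
      using power_product_diff[OF TG(2)] power_product_diff[OF T'(3)] power_product_mult[OF TG(2)]
        power_product_mult[OF T'(3)] a by simp
    then have *: "ind U t - ind U' t = e t * 2" if "t \<in> T" for t
      using mult_independentD[OF T] that by meson
    have "t \<in> U \<longleftrightarrow> t \<in> U'" if "t \<in> T" for t
      using *[OF that] by (auto simp: ind_def split: if_splits) presburger+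
    then show "U = U'" using U by auto
  qed
  then have "card (Pow T) \<le> card (Pow T')"
    by (rule card_inj_on_le) (use T' in \<open>auto simp: f_def\<close>)
  then have "card T \<le> card T'" using TG T' by (simp add: card_Pow)
  then show ?thesis using T' by simp
qed

lemma mult_independent_insert:
  assumes T: "mult_independent T" and x: "x \<in> carrier G"
    and free: "\<And>k::int. x [^] k \<in> generate G T \<Longrightarrow> k = 0"
  shows "mult_independent (insert x T)" "x \<notin> T"
proof -
  have TG: "finite T" "T \<subseteq> carrier G" using T by (auto simp: mult_independent_def)
  show nT: "x \<notin> T"
    using free[of 1] generate.incl[of x T G] x by auto
  show "mult_independent (insert x T)"
    unfolding mult_independent_def
  proof (intro conjI allI impI)
    fix c assume c: "power_product (insert x T) c = \<one>"
    have split: "power_product (insert x T) c = x [^] c x \<otimes> power_product T c"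
      unfolding power_product_def using TG x nT by (subst finprod_insert) auto
    then have "x [^] c x = inv (power_product T c)"
      using c TG x by (metis inv_equality int_pow_closed power_product_closed)
    also have "\<dots> = power_product T (\<lambda>t. - c t)" using power_product_uminus TG by simp
    finally have "c x = 0" using free generate_eq_power_product TG by (metis rangeI)
    moreover from this have "power_product T c = \<one>" using c split TG by simp
    ultimately show "\<forall>t\<in>insert x T. c t = 0" using T by (auto simp: mult_independent_def)
  qed (use TG x in auto)
qed

text \<open>Otherwise \<open>x\<close> could be added to \<open>T\<close>.\<close>

lemma independent_extension_card:
  assumes T: "mult_independent T" and x: "x \<in> carrier G"
    and max: "\<And>T'. mult_independent T' \<Longrightarrow> card T' \<le> card T"
  shows "\<exists>k>0. x [^] (k::nat) \<in> generate G T"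
proof (rule ccontr)
  assume neg: "\<not> ?thesis"
  have TG: "finite T" "T \<subseteq> carrier G" using T by (auto simp: mult_independent_def)
  have "k = 0" if k: "x [^] (k::int) \<in> generate G T" for k
  proof (rule ccontr)
    assume "k \<noteq> 0"
    have "x [^] \<bar>k\<bar> \<in> generate G T"
    proof (cases "k \<ge> 0")
      case False
      then have "\<bar>k\<bar> = - k" by simp
      then show ?thesis using generate_m_inv_closed[OF TG(2) k] x by (simp only: int_pow_neg)
    qed (use k in simp)
    then have "x [^] nat \<bar>k\<bar> \<in> generate G T" using int_pow_int[of G x "nat \<bar>k\<bar>"] by simp
    moreover have "nat \<bar>k\<bar> > 0" using \<open>k \<noteq> 0\<close> by simp
    ultimately show False using neg by blast
  qed
  note ins = mult_independent_insert[OF T x this]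
  then show False using max[OF ins(1)] TG by simp
qed

lemma mult_independent_empty: "mult_independent {}"
  by (simp add: mult_independent_def)

lemma exists_mult_basis:
  assumes r: "rank_at_most r G"
  shows "\<exists>T. mult_independent T \<and> (\<forall>x\<in>carrier G. \<exists>k>0. x [^] (k::nat) \<in> generate G T)"
proof -
  have "\<forall>T. mult_independent T \<longrightarrow> card T < Suc r"
    using mult_independent_card[OF r] by (simp add: less_Suc_eq_le)
  from ex_has_greatest_nat[of mult_independent, OF mult_independent_empty this]
  obtain T where T: "mult_independent T \<and> (\<forall>T'. mult_independent T' \<longrightarrow> card T' \<le> card T)" ..
  then have "\<forall>x\<in>carrier G. \<exists>k>0. x [^] (k::nat) \<in> generate G T"
    using independent_extension_card[of T] by simp
  with T show ?thesis by auto
qed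

text \<open>A group of finite rank and bounded exponent is finite. Relative to \<open>K\<close>: distinct representatives of
  cosets of \<open>K\<close> are products of the same \<open>r\<close> generators, and are told apart by the exponents modulo \<open>e\<close>, so
  that there are at most \<open>e\<^sup>r\<close> of them.\<close>

lemma finite_representatives:
  assumes r: "rank_at_most r G" and B: "subgroup B G" and K: "subgroup K G"
    and e: "e > 0" "\<And>b. b \<in> B \<Longrightarrow> b [^] (e::nat) \<in> K"
  shows "\<exists>E. finite E \<and> E \<subseteq> B \<and> (\<forall>b\<in>B. \<exists>h\<in>E. b \<otimes> inv h \<in> K)"
proof -
  interpret B: subgroup B G by (rule B)
  interpret K: subgroup K G by (rule K)
  define P where "P F \<longleftrightarrow> finite F \<and> F \<subseteq> B \<and> (\<forall>x\<in>F. \<forall>y\<in>F. x \<otimes> inv y \<in> K \<longrightarrow> x = y)" for F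
  have bound: "card F \<le> e ^ r" if F: "P F" for F
  proof -
    have FG: "finite F" "F \<subseteq> B" "F \<subseteq> carrier G" using F B.subset by (auto simp: P_def)
    obtain T where T: "finite T" "card T \<le> r" "T \<subseteq> carrier G" "generate G T = generate G F"
      using r FG unfolding rank_at_most_def by meson
    have TB: "T \<subseteq> B" using T(4) generate.incl[of _ T G] generate_subgroup_incl[OF FG(2) B] by auto
    have "\<exists>c. x = power_product T c" if "x \<in> F" for x
      using that T generate_eq_power_product[of T] generate.incl[of x F G] by auto
    then obtain c where c: "\<And>x. x \<in> F \<Longrightarrow> x = power_product T (c x)" by metis
    define f where "f x = (\<lambda>t\<in>T. nat (c x t mod int e))" for x
    have "inj_on f F"
    proof (rule inj_onI)
      fix x y assume xy: "x \<in> F" "y \<in> F" "f x = f y"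
      have m: "c x t mod int e = c y t mod int e" if "t \<in> T" for t
        using fun_cong[OF xy(3), of t] that e(1) by (simp add: f_def eq_nat_nat_iff)
      define b where "b t = (c x t - c y t) div int e" for t
      have "power_product T (\<lambda>t. c x t - c y t) = power_product T (\<lambda>t. b t * int e)"
        unfolding power_product_def
      proof (rule finprod_cong')
        fix t assume "t \<in> T"
        then have "int e dvd c x t - c y t" using m mod_eq_dvd_iff by blast
        then show "t [^] (c x t - c y t) = t [^] (b t * int e)" by (simp add: b_def)
      qed (use T in auto)
      then have "x \<otimes> inv y = power_product T b [^] e"
        using c xy power_product_diff[OF T(3)] power_product_mult[OF T(3)] by (simp add: int_pow_int)
      moreover have "power_product T b \<in> B"
        using generate_eq_power_product[OF T(3,1)] generate_subgroup_incl[OF TB B] by blast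
      ultimately have "x \<otimes> inv y \<in> K" using e by simp
      then show "x = y" using F xy by (simp add: P_def)
    qed
    moreover have "f ` F \<subseteq> T \<rightarrow>\<^sub>E {..<e}" using e(1) by (auto simp: f_def nat_less_iff)
    ultimately have "card F \<le> card (T \<rightarrow>\<^sub>E {..<e})"
      by (rule card_inj_on_le) (use T in \<open>auto intro: finite_PiE\<close>)
    also have "\<dots> = e ^ card T" using T by (simp add: card_PiE)
    also have "\<dots> \<le> e ^ r" using T e(1) by (simp add: power_increasing)
    finally show ?thesis .
  qed
  have "P {}" by (simp add: P_def)
  moreover have "\<forall>F. P F \<longrightarrow> card F < Suc (e ^ r)" using bound by (simp add: less_Suc_eq_le)
  ultimately have "\<exists>E. P E \<and> (\<forall>F. P F \<longrightarrow> card F \<le> card E)"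
    by (rule ex_has_greatest_nat)
  then obtain E where E: "P E" and "\<forall>F. P F \<longrightarrow> card F \<le> card E" by (elim exE conjE)
  then have max: "\<And>F. P F \<Longrightarrow> card F \<le> card E" by simp
  have "\<exists>h\<in>E. b \<otimes> inv h \<in> K" if b: "b \<in> B" for b
  proof (rule ccontr)
    assume neg: "\<not> ?thesis"
    have sym: "h \<otimes> inv b \<notin> K" if "h \<in> E" for h
    proof
      assume "h \<otimes> inv b \<in> K"
      then have "inv (h \<otimes> inv b) \<in> K" by simp
      moreover have "inv (h \<otimes> inv b) = b \<otimes> inv h"
        using that E b B.subset by (simp add: P_def inv_mult_group subset_iff)
      ultimately show False using neg that by auto
    qed
    have "b \<notin> E" using neg b by (metis B.mem_carrier K.one_closed r_inv)
    moreover have "P (insert b E)" using E b neg sym by (auto simp: P_def)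
    ultimately show False using max[of "insert b E"] E by (simp add: P_def)
  qed
  then show ?thesis using E by (auto simp: P_def)
qed

end


section \<open>Finitely generated subgroups with finite orbits\<close>

lemma common_multiple_exponent:
  assumes "finite A" "\<And>a. a \<in> A \<Longrightarrow> \<exists>k>0. P a (k::nat)"
    and "\<And>a k j. \<lbrakk>a \<in> A; P a k; j > 0\<rbrakk> \<Longrightarrow> P a (k * j)"
  shows "\<exists>e>0. \<forall>a\<in>A. P a e"
  using assms
proof (induction A rule: finite_induct)
  case empty
  then show ?case by auto
next
  case (insert a A)
  then obtain e where e: "e > 0" "\<forall>a\<in>A. P a e" by auto
  obtain k where k: "k > 0" "P a k" using insert.prems(1)[of a] by auto
  have "P b (e * k)" if "b \<in> insert a A" for b
  proof (cases "b = a")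
    case True
    then show ?thesis using insert.prems(2)[of a k e] k e by (simp add: mult.commute)
  next
    case False
    then show ?thesis using insert.prems(2)[of b e k] k e that by auto
  qed
  then show ?case using e k by (intro exI[of _ "e * k"]) auto
qed

context group
begin

definition conjugate :: "'a \<Rightarrow> 'a \<Rightarrow> 'a" where
  "conjugate g x = g \<otimes> x \<otimes> inv g"

lemma conjugate_closed [simp]: "\<lbrakk>g \<in> carrier G; x \<in> carrier G\<rbrakk> \<Longrightarrow> conjugate g x \<in> carrier G"
  by (simp add: conjugate_def)

lemma conjugate_one [simp]: "g \<in> carrier G \<Longrightarrow> conjugate g \<one> = \<one>"
  by (simp add: conjugate_def)

lemma one_conjugate [simp]: "x \<in> carrier G \<Longrightarrow> conjugate \<one> x = x"
  by (simp add: conjugate_def)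

lemma conjugate_mult:
  assumes "g \<in> carrier G" "x \<in> carrier G" "y \<in> carrier G"
  shows "conjugate g (x \<otimes> y) = conjugate g x \<otimes> conjugate g y"
proof -
  have "inv g \<otimes> (g \<otimes> z) = z" if "z \<in> carrier G" for z
    using that assms by (simp flip: m_assoc)
  then show ?thesis using assms by (simp add: conjugate_def m_assoc)
qed

lemma conjugate_conjugate:
  "\<lbrakk>g \<in> carrier G; h \<in> carrier G; x \<in> carrier G\<rbrakk> \<Longrightarrow> conjugate g (conjugate h x) = conjugate (g \<otimes> h) x"
  by (simp add: conjugate_def m_assoc inv_mult_group)

lemma conjugate_inv: "\<lbrakk>g \<in> carrier G; x \<in> carrier G\<rbrakk> \<Longrightarrow> conjugate g (inv x) = inv (conjugate g x)"
  by (simp add: conjugate_def m_assoc inv_mult_group)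

lemma conjugate_pow: "\<lbrakk>g \<in> carrier G; x \<in> carrier G\<rbrakk> \<Longrightarrow> conjugate g (x [^] (n::nat)) = conjugate g x [^] n"
  by (induction n) (auto simp: conjugate_mult)

lemma conjugate_inv_cancel [simp]:
  "\<lbrakk>g \<in> carrier G; x \<in> carrier G\<rbrakk> \<Longrightarrow> conjugate g (conjugate (inv g) x) = x"
  "\<lbrakk>g \<in> carrier G; x \<in> carrier G\<rbrakk> \<Longrightarrow> conjugate (inv g) (conjugate g x) = x"
  by (simp_all add: conjugate_conjugate)

lemma normal_conjugate: "\<lbrakk>N \<lhd> G; g \<in> carrier G; x \<in> N\<rbrakk> \<Longrightarrow> conjugate g x \<in> N"
  unfolding conjugate_def by (rule normal.inv_op_closed2)

lemma normalI_conjugate: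
  assumes "subgroup N G" "\<And>g x. \<lbrakk>g \<in> carrier G; x \<in> N\<rbrakk> \<Longrightarrow> conjugate g x \<in> N"
  shows "N \<lhd> G"
  using assms unfolding conjugate_def by (simp add: normal_inv_iff)

text \<open>Each finite subset \<open>Z\<close> of the group maps the union of finitely many of the sets \<open>y H D\<close>, one of them
  \<open>H D\<close> itself, into itself. This is what remains, modulo \<open>D\<close>, of the fact that a polycyclic group is
  finitely generated: it holds for a suitable finitely generated \<open>H\<close> in every soluble group of finite rank,
  and it permits replacing \<open>G\<close> by \<open>H\<close> up to finitely many translates.\<close>

definition finite_orbits :: "'a set \<Rightarrow> 'a set \<Rightarrow> bool" where
  "finite_orbits H D \<longleftrightarrow> (\<forall>Z. finite Z \<and> Z \<subseteq> carrier G \<longrightarrow>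
     (\<exists>Y. finite Y \<and> Y \<subseteq> carrier G \<and> \<one> \<in> Y \<and>
        (\<forall>z\<in>Z. \<forall>y\<in>Y. \<exists>y'\<in>Y. \<exists>h\<in>H. \<exists>d\<in>D. z \<otimes> y = y' \<otimes> h \<otimes> d)))"

text \<open>The abelian group \<open>N/M\<close> has a finitely generated subgroup modulo which it is torsion. Adding generators
  of that subgroup to \<open>U\<close> gives \<open>H\<close>. If \<open>z y = y' g n\<close> with \<open>g \<in> H\<close> and \<open>n \<in> N\<close>, for the
  finitely many pairs \<open>(z, y)\<close> at hand, then the elements \<open>n\<close> have a common exponent \<open>e\<close> modulo \<open>H \<inter> N\<close> and
  \<open>M\<close>, and the elements of \<open>N\<close> with that exponent form a subgroup with only finitely many cosets. Multiplying
  \<open>Y\<close> by representatives of these cosets gives the new finite set.\<close>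

lemma finite_orbits_step:
  assumes r: "rank_at_most r G" and M: "M \<lhd> G" and N: "N \<lhd> G" and MN: "M \<subseteq> N"
    and comm: "\<And>x y. \<lbrakk>x \<in> N; y \<in> N\<rbrakk> \<Longrightarrow> x \<otimes> y \<otimes> inv x \<otimes> inv y \<in> M"
    and U: "finite U" "U \<subseteq> carrier G" and orb: "finite_orbits (generate G U) N"
  shows "\<exists>U'. finite U' \<and> U' \<subseteq> carrier G \<and> finite_orbits (generate G U') M"
proof -
  interpret M: normal M G by (rule M)
  interpret N: normal N G by (rule N)
  define Q where "Q = G Mod M"
  define q where "q x = M #> x" for x
  interpret Q: group Q unfolding Q_def by (rule M.factorgroup_is_group)
  have q_hom: "q \<in> hom G Q" unfolding q_def Q_def by (rule M.r_coset_hom_Mod)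
  interpret q: group_hom G Q q by unfold_locales (rule q_hom)
  have q_surj: "q ` carrier G = carrier Q"
    by (auto simp: q_def Q_def FactGroup_def RCOSETS_def)
  have q_eq: "\<exists>m\<in>M. x = y \<otimes> m" if "q x = q y" "x \<in> carrier G" "y \<in> carrier G" for x y
  proof -
    have "x \<in> M #> y" using that rcos_self[OF _ M.subgroup_axioms, of x] by (simp add: q_def)
    then have "x \<in> y <# M" using M.coset_eq that by simp
    then show ?thesis by (auto simp: l_coset_def)
  qed
  have q_one: "q x = \<one>\<^bsub>Q\<^esub>" if "x \<in> M" for x
    using that M.rcos_const[of x] by (simp add: q_def Q_def FactGroup_def)
  have NG: "N \<subseteq> carrier G" by (rule N.subset)
  define C where "C = Q\<lparr>carrier := q ` N\<rparr>"
  have qN: "subgroup (q ` N) Q" by (rule q.subgroup_img_is_subgroup[OF N.subgroup_axioms])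
  have C_simps [simp]: "carrier C = q ` N" "monoid.mult C = monoid.mult Q" "one C = one Q" by (simp_all add: C_def)
  have comm_group_C: "comm_group C"
  proof (rule group.group_comm_groupI)
    show "group C" unfolding C_def by (rule subgroup.subgroup_is_group[OF qN Q.is_group])
    fix x y assume "x \<in> carrier C" "y \<in> carrier C"
    then obtain a b where ab: "a \<in> N" "b \<in> N" "x = q a" "y = q b" by auto
    have abG: "a \<in> carrier G" "b \<in> carrier G" using ab NG by auto
    have "a \<otimes> b = (a \<otimes> b \<otimes> inv a \<otimes> inv b) \<otimes> (b \<otimes> a)"
      using abG by (simp add: m_assoc inv_solve_left' flip: inv_mult_group)
    then have "q (a \<otimes> b) = q (a \<otimes> b \<otimes> inv a \<otimes> inv b) \<otimes>\<^bsub>Q\<^esub> q (b \<otimes> a)"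
      using abG by (metis inv_closed m_closed q.hom_mult)
    also have "\<dots> = q (b \<otimes> a)" using q_one[OF comm[OF ab(1,2)]] abG by simp
    finally show "x \<otimes>\<^bsub>C\<^esub> y = y \<otimes>\<^bsub>C\<^esub> x" using ab abG by simp
  qed
  interpret C: comm_group C by (rule comm_group_C)
  have rC: "rank_at_most r C"
    unfolding C_def by (rule Q.rank_at_most_subgroup[OF q.rank_at_most_image[OF r q_surj] qN])
  have pow_C: "x [^]\<^bsub>C\<^esub> (k::nat) = x [^]\<^bsub>Q\<^esub> k" for x k
    unfolding C_def by (rule Q.nat_pow_consistent[symmetric])
  obtain T' where T': "C.mult_independent T'" "\<And>x. x \<in> q ` N \<Longrightarrow> \<exists>k>0. x [^]\<^bsub>C\<^esub> (k::nat) \<in> generate C T'"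
    using C.exists_mult_basis[OF rC] by auto
  then have "finite T'" "T' \<subseteq> q ` N" by (auto simp: C.mult_independent_def)
  then obtain T where T: "finite T" "T \<subseteq> N" "T' = q ` T" using finite_subset_image by meson
  define U' where "U' = U \<union> T"
  have U': "finite U'" "U' \<subseteq> carrier G" using U T NG by (auto simp: U'_def)
  define H where "H = generate G U'"
  interpret H: subgroup H G unfolding H_def by (rule generate_is_subgroup[OF U'(2)])
  have TH: "T \<subseteq> H" and XH: "generate G U \<subseteq> H"
    using generate.incl[of _ U' G] mono_generate[of U U'] by (auto simp: H_def U'_def)
  define K where "K = q ` (N \<inter> H)"
  have NH: "subgroup (N \<inter> H) G" by (rule subgroups_Inter_pair[OF N.subgroup_axioms H.subgroup_axioms])
  have "subgroup K Q" unfolding K_def by (rule q.subgroup_img_is_subgroup[OF NH])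
  then have K: "subgroup K C"
    unfolding C_def by (rule Q.subgroup_incl[OF _ qN]) (auto simp: K_def)
  interpret K: subgroup K C by (rule K)
  have T'K: "generate C T' \<subseteq> K"
    by (rule C.generate_subgroup_incl[OF _ K]) (use T TH in \<open>auto simp: K_def\<close>)
  have "finite_orbits H M"
    unfolding finite_orbits_def
  proof (intro allI impI)
    fix Z assume Z: "finite Z \<and> Z \<subseteq> carrier G"
    then obtain Y where Y: "finite Y" "Y \<subseteq> carrier G" "\<one> \<in> Y"
      and "\<forall>z\<in>Z. \<forall>y\<in>Y. \<exists>y'\<in>Y. \<exists>h\<in>generate G U. \<exists>d\<in>N. z \<otimes> y = y' \<otimes> h \<otimes> d"
      using orb unfolding finite_orbits_def by meson
    then have "\<exists>n\<in>N. \<exists>y'\<in>Y. \<exists>h\<in>H. fst p \<otimes> snd p = y' \<otimes> h \<otimes> n" if "p \<in> Z \<times> Y" for p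
      using that XH by (metis mem_Times_iff subsetD)
    then obtain n where n: "\<And>p. p \<in> Z \<times> Y \<Longrightarrow> n p \<in> N"
      "\<And>p. p \<in> Z \<times> Y \<Longrightarrow> \<exists>y'\<in>Y. \<exists>h\<in>H. fst p \<otimes> snd p = y' \<otimes> h \<otimes> n p" by metis
    have "\<exists>e>0. \<forall>x\<in>n ` (Z \<times> Y). q x [^]\<^bsub>C\<^esub> (e::nat) \<in> K"
    proof (rule common_multiple_exponent)
      fix x assume "x \<in> n ` (Z \<times> Y)"
      then show "\<exists>k>0. q x [^]\<^bsub>C\<^esub> (k::nat) \<in> K" using T'(2)[of "q x"] T'K n(1) by blast
    next
      fix x k j assume "x \<in> n ` (Z \<times> Y)" and k: "q x [^]\<^bsub>C\<^esub> (k::nat) \<in> K"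
      then have "q x \<in> carrier C" using n by auto
      then show "q x [^]\<^bsub>C\<^esub> (k * j) \<in> K"
        using C.nat_pow_pow[of "q x" k j] C.subgroup_int_pow_closed[OF K k, of "int j"] by (simp add: int_pow_int)
    qed (use Z Y in auto)
    then obtain e where e: "e > 0" "\<And>x. x \<in> n ` (Z \<times> Y) \<Longrightarrow> q x [^]\<^bsub>C\<^esub> (e::nat) \<in> K" by blast
    \<comment> \<open>the part of \<open>N/M\<close> of exponent \<open>e\<close> modulo the image of \<open>N \<inter> H\<close>; by finiteness of the rank it is finite over that image\<close>
    define B where "B = {c \<in> carrier C. c [^]\<^bsub>C\<^esub> e \<in> K}"
    have B: "subgroup B C"
    proof (rule C.subgroupI)
      have "\<one>\<^bsub>C\<^esub> \<in> B" unfolding B_def using K.one_closed C.one_closed by (simp del: C_simps)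
      then show "B \<noteq> {}" by blast
    qed (auto simp: B_def C.nat_pow_inv C.nat_pow_distrib simp del: C_simps)
    interpret B: subgroup B C by (rule B)
    obtain E' where E': "finite E'" "E' \<subseteq> B" "\<And>b. b \<in> B \<Longrightarrow> \<exists>h\<in>E'. b \<otimes>\<^bsub>C\<^esub> inv\<^bsub>C\<^esub> h \<in> K"
      using C.finite_representatives[OF rC B K e(1)] by (auto simp: B_def)
    have "E' \<subseteq> q ` N" using E'(2) by (auto simp: B_def)
    then obtain E where E: "finite E" "E \<subseteq> N" "E' = q ` E" using E'(1) finite_subset_image by meson
    define E1 where "E1 = insert \<one> E"
    have E1: "finite E1" "E1 \<subseteq> N" "q ` E1 \<subseteq> B" using E E'(2) B.one_closed by (auto simp: E1_def)
    have rep: "\<exists>h\<in>E1. \<exists>k\<in>N \<inter> H. \<exists>m\<in>M. b = h \<otimes> k \<otimes> m" if b: "b \<in> N" "q b \<in> B" for b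
    proof -
      obtain h where h: "h \<in> E" "q b \<otimes>\<^bsub>C\<^esub> inv\<^bsub>C\<^esub> (q h) \<in> K" using E'(3)[OF b(2)] E by auto
      then obtain k where k: "k \<in> N \<inter> H" "q b \<otimes>\<^bsub>C\<^esub> inv\<^bsub>C\<^esub> (q h) = q k" by (auto simp: K_def)
      have hG: "h \<in> carrier G" and kG: "k \<in> carrier G" and bG: "b \<in> carrier G"
        using b(1) h(1) k(1) E(2) NG by blast+
      have cl: "q b \<in> carrier C" "q h \<in> carrier C" "q k \<in> carrier C" using b h(1) k(1) E(2) by auto
      have "q b = (q b \<otimes>\<^bsub>C\<^esub> inv\<^bsub>C\<^esub> (q h)) \<otimes>\<^bsub>C\<^esub> q h"
        using cl C.m_assoc[of "q b" "inv\<^bsub>C\<^esub> (q h)" "q h"] C.l_inv[of "q h"] C.r_one[of "q b"] C.inv_closed[of "q h"]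
        by simp
      then have "q b = q k \<otimes>\<^bsub>C\<^esub> q h" using k(2) by simp
      also have "\<dots> = q h \<otimes>\<^bsub>C\<^esub> q k" using cl C.m_comm by blast
      also have "\<dots> = q (h \<otimes> k)" using hG kG by simp
      finally obtain m where "m \<in> M" "b = h \<otimes> k \<otimes> m" using q_eq[of b "h \<otimes> k"] bG hG kG by blast
      moreover have "h \<in> E1" using h(1) by (simp add: E1_def)
      ultimately show ?thesis using k(1) by blast
    qed
    define YE where "YE = {y \<otimes> h | y h. y \<in> Y \<and> h \<in> E1}"
    have YE_I: "y \<otimes> h \<in> YE" if "y \<in> Y" "h \<in> E1" for y h using that by (auto simp: YE_def)
    show "\<exists>Y. finite Y \<and> Y \<subseteq> carrier G \<and> \<one> \<in> Y \<and>
        (\<forall>z\<in>Z. \<forall>y\<in>Y. \<exists>y'\<in>Y. \<exists>h\<in>H. \<exists>d\<in>M. z \<otimes> y = y' \<otimes> h \<otimes> d)"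
    proof (intro exI[of _ YE] conjI ballI)
      show "finite YE" unfolding YE_def using Y(1) E1(1) finite_image_set2[of "\<lambda>y. y \<in> Y" "\<lambda>h. h \<in> E1"] by simp
      show "YE \<subseteq> carrier G"
      proof
        fix w assume "w \<in> YE"
        then obtain y h where "w = y \<otimes> h" "y \<in> Y" "h \<in> E1" by (auto simp: YE_def)
        moreover from this have "y \<in> carrier G" "h \<in> carrier G" using Y(2) E1(2) NG by blast+
        ultimately show "w \<in> carrier G" by simp
      qed
      show "\<one> \<in> YE" using YE_I[OF Y(3), of \<one>] by (simp add: E1_def)
      fix z y1 assume z: "z \<in> Z" and "y1 \<in> YE"
      then obtain y h where y: "y \<in> Y" "h \<in> E1" "y1 = y \<otimes> h" by (auto simp: YE_def)
      obtain y' g where y': "y' \<in> Y" "g \<in> H" "z \<otimes> y = y' \<otimes> g \<otimes> n (z, y)"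
        using n(2)[of "(z, y)"] z y by auto
      define x where "x = n (z, y) \<otimes> h"
      have xN: "x \<in> N" and nN: "n (z, y) \<in> N" using n(1)[of "(z, y)"] z y E1 by (auto simp: x_def)
      \<comment> \<open>moving \<open>x \<in> N\<close> to the left of \<open>g \<in> H\<close> keeps its exponent modulo \<open>N \<inter> H\<close>\<close>
      define b where "b = conjugate g x"
      have G: "z \<in> carrier G" "y \<in> carrier G" "y' \<in> carrier G" "g \<in> carrier G" "h \<in> carrier G" "x \<in> carrier G"
        "n (z, y) \<in> carrier G"
        using z Z y(1,2) y'(1,2) Y(2) E1(2) NG xN nN H.subset by blast+
      have "q x \<in> B"
      proof -
        have "q (n (z, y)) \<in> B" using e(2)[of "n (z, y)"] z y nN by (auto simp: B_def)
        moreover have "q h \<in> B" using y E1 by auto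
        ultimately show ?thesis using G B.m_closed[of "q (n (z, y))" "q h"] by (simp add: x_def)
      qed
      then have "q x [^]\<^bsub>Q\<^esub> e \<in> K" by (simp add: B_def pow_C)
      then have "q (x [^] e) \<in> K" using G by (simp add: q.hom_nat_pow)
      then obtain k where k: "k \<in> N \<inter> H" "q (x [^] e) = q k" by (auto simp: K_def)
      then obtain m where m: "m \<in> M" "x [^] e = k \<otimes> m" using q_eq[of "x [^] e" k] G NG by auto
      have kmG: "k \<in> carrier G" "m \<in> carrier G" using k m NG MN by auto
      have bN: "b \<in> N" using normal_conjugate[OF N] G xN by (simp add: b_def)
      have "b [^] e = conjugate g k \<otimes> conjugate g m"
        using G m kmG by (simp add: b_def flip: conjugate_pow conjugate_mult)
      then have "q (b [^] e) = q (conjugate g k)"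
        using q_one[OF normal_conjugate[OF M G(4) m(1)]] G kmG by simp
      moreover have "conjugate g k \<in> N \<inter> H"
        using k G y' normal_conjugate[OF N] by (simp add: conjugate_def)
      ultimately have "q b [^]\<^bsub>C\<^esub> e \<in> K" using bN NG by (auto simp: K_def pow_C q.hom_nat_pow[symmetric])
      then have "q b \<in> B" using bN by (auto simp: B_def)
      from rep[OF bN this] obtain h' k' m' where hkm: "h' \<in> E1" "k' \<in> N \<inter> H" "m' \<in> M" "b = h' \<otimes> k' \<otimes> m'"
        by blast
      have hkmG: "h' \<in> carrier G" "k' \<in> carrier G" "m' \<in> carrier G" using hkm E1 NG MN by auto
      have "z \<otimes> y1 = y' \<otimes> g \<otimes> x" using y(3) y'(3) G by (simp add: x_def flip: m_assoc)
      also have "\<dots> = y' \<otimes> b \<otimes> g" using G by (simp add: b_def conjugate_def m_assoc)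
      also have "\<dots> = (y' \<otimes> h') \<otimes> (k' \<otimes> g) \<otimes> conjugate (inv g) m'"
      proof -
        have "m' \<otimes> g = g \<otimes> conjugate (inv g) m'"
          using G hkmG by (simp add: conjugate_def flip: m_assoc)
        then show ?thesis using G hkmG hkm(4) by (simp add: m_assoc)
      qed
      finally have "z \<otimes> y1 = (y' \<otimes> h') \<otimes> (k' \<otimes> g) \<otimes> conjugate (inv g) m'" .
      moreover have "conjugate (inv g) m' \<in> M" using normal_conjugate[OF M] G hkm by simp
      moreover have "k' \<otimes> g \<in> H" using hkm y' by simp
      moreover have "y' \<otimes> h' \<in> YE" using YE_I y'(1) hkm(1) .
      ultimately show "\<exists>y'\<in>YE. \<exists>h\<in>H. \<exists>d\<in>M. z \<otimes> y1 = y' \<otimes> h \<otimes> d" by blast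
    qed
  qed
  then show ?thesis using U' by (auto simp: H_def)
qed

lemma commutator_in_derived: "\<lbrakk>x \<in> H; y \<in> H\<rbrakk> \<Longrightarrow> x \<otimes> y \<otimes> inv x \<otimes> inv y \<in> derived G H"
  unfolding derived_def by (rule generate.incl) blast

text \<open>Descend along the derived series.\<close>

theorem solvable_finite_orbits:
  assumes sol: "solvable G" and r: "rank_at_most r G"
  shows "\<exists>U. finite U \<and> U \<subseteq> carrier G \<and> finite_orbits (generate G U) {\<one>}"
proof -
  have nrm: "(derived G ^^ i) (carrier G) \<lhd> G" for i
    by (induction i) (auto simp: normal_self derived_is_normal)
  have "\<exists>U. finite U \<and> U \<subseteq> carrier G \<and> finite_orbits (generate G U) ((derived G ^^ i) (carrier G))" for i
  proof (induction i)
    case 0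
    have "finite_orbits (generate G {}) (carrier G)"
      unfolding finite_orbits_def
      by (auto simp: subset_iff intro!: exI[of _ "{\<one>}"] bexI[OF _ generate.one])
    then show ?case by (intro exI[of _ "{}"]) auto
  next
    case (Suc i)
    then obtain U where U: "finite U" "U \<subseteq> carrier G"
      "finite_orbits (generate G U) ((derived G ^^ i) (carrier G))" by blast
    let ?N = "(derived G ^^ i) (carrier G)"
    have "\<exists>U'. finite U' \<and> U' \<subseteq> carrier G \<and> finite_orbits (generate G U') (derived G ?N)"
    proof (rule finite_orbits_step[OF r derived_is_normal[OF nrm] nrm _ _ U])
      show "derived G ?N \<subseteq> ?N" using derived_incl[OF order_refl normal_imp_subgroup[OF nrm]] .
      show "x \<otimes> y \<otimes> inv x \<otimes> inv y \<in> derived G ?N" if "x \<in> ?N" "y \<in> ?N" for x y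
        using commutator_in_derived[OF that] .
    qed
    then show ?case by simp
  qed
  moreover obtain n where "(derived G ^^ n) (carrier G) = {\<one>}"
    using solvable_imp_trivial_derived_seq[OF sol[unfolded solvable_def]] by blast
  ultimately show ?thesis by metis
qed

end


section \<open>Minimal normal subgroups are not torsion-free\<close>

lemma int_prime_power_dvd_imp_zero:
  assumes "Factorial_Ring.prime (l::nat)" "\<And>k. int l ^ k dvd a"
  shows "a = (0::int)"
proof (rule ccontr)
  assume "a \<noteq> 0"
  have "l > 1" using assms(1) prime_gt_1_nat by blast
  then have "nat \<bar>a\<bar> < l ^ nat \<bar>a\<bar>" using power_gt_expt[of l] by simp
  moreover have "int l ^ nat \<bar>a\<bar> \<le> \<bar>a\<bar>"
    using dvd_imp_le_int[OF \<open>a \<noteq> 0\<close> assms(2)[of "nat \<bar>a\<bar>"]] by simp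
  ultimately show False by (simp add: nat_less_iff)
qed

lemma (in group) subgroup_nat_pow_closed: "\<lbrakk>subgroup H G; h \<in> H\<rbrakk> \<Longrightarrow> h [^] (k::nat) \<in> H"
  using subgroup_int_pow_closed[of H h "int k"] by (simp add: int_pow_int)

context group
begin

lemma subgroup_of_powers:
  assumes A: "subgroup A G" and comm: "\<And>x y. \<lbrakk>x \<in> A; y \<in> A\<rbrakk> \<Longrightarrow> x \<otimes> y = y \<otimes> x" and W: "subgroup W G"
  shows "subgroup {a \<in> A. a [^] (n::nat) \<in> W} G"
proof -
  interpret A: subgroup A G by (rule A)
  interpret W: subgroup W G by (rule W)
  show "subgroup {a \<in> A. a [^] n \<in> W} G"
  proof (rule subgroupI)
    show "{a \<in> A. a [^] n \<in> W} \<noteq> {}" using A.one_closed W.one_closed by (auto intro!: exI[of _ \<one>])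
    show "a \<otimes> b \<in> {a \<in> A. a [^] n \<in> W}" if "a \<in> {a \<in> A. a [^] n \<in> W}" "b \<in> {a \<in> A. a [^] n \<in> W}" for a b
      using that comm[of a b] by (auto simp: pow_mult_distrib)
  qed (auto simp: nat_pow_inv)
qed

lemma subgroup_power_image:
  assumes A: "subgroup A G" and comm: "\<And>x y. \<lbrakk>x \<in> A; y \<in> A\<rbrakk> \<Longrightarrow> x \<otimes> y = y \<otimes> x"
  shows "subgroup ((\<lambda>a. a [^] (n::nat)) ` A) G"
proof -
  interpret A: subgroup A G by (rule A)
  show ?thesis
  proof (rule subgroupI)
    show "inv a \<in> (\<lambda>a. a [^] n) ` A" if "a \<in> (\<lambda>a. a [^] n) ` A" for a
      using that by (auto simp: nat_pow_inv[symmetric])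
    show "a \<otimes> b \<in> (\<lambda>a. a [^] n) ` A" if ab: "a \<in> (\<lambda>a. a [^] n) ` A" "b \<in> (\<lambda>a. a [^] n) ` A" for a b
    proof -
      obtain c d where "c \<in> A" "a = c [^] n" "d \<in> A" "b = d [^] n" using ab by auto
      then have "a \<otimes> b = (c \<otimes> d) [^] n" "c \<otimes> d \<in> A" by (simp_all add: pow_mult_distrib comm)
      then show ?thesis by blast
    qed
    show "(\<lambda>a. a [^] n) ` A \<noteq> {}" using A.one_closed by blast
  qed auto
qed

text \<open>The model is \<open>A = \<rat>\<^sup>d\<close> with the action of a finitely generated group \<open>H\<close> of rational matrices:
  then \<open>H\<close> preserves a lattice over \<open>\<int>[1/m]\<close>, and the submodule generated by a vector cannot be all of \<open>A\<close>. In general, let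
  \<open>F\<close> be free abelian of full rank in \<open>A\<close>, let \<open>H\<close> be a finitely generated subgroup with finite orbits
  in the sense above, and let \<open>L\<close> consist of the elements of \<open>A\<close> with an \<open>m\<close>-power exponent modulo
  \<open>F\<close>, where \<open>m\<close> is chosen so that \<open>H\<close> preserves \<open>L\<close>. Take a prime \<open>l > m\<close> and \<open>v \<noteq> 1\<close> in \<open>F\<close>. By minimality
  \<open>v\<close> is a product of conjugates of \<open>v\<^sup>l\<close> and their inverses, so that \<open>v\<close> is an \<open>l\<close>-th power in each subgroup of \<open>A\<close> that
  contains \<open>v\<close> and is invariant under a certain finite set \<open>Z\<close>. Such a subgroup \<open>L1\<close> is generated by finitely many
  translates of \<open>L\<close>, because \<open>H\<close> has finite orbits. The same applies to the group of \<open>l\<^sup>k\<close>-th powers in \<open>L1\<close>, so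
  that \<open>v\<close> is an \<open>l\<^sup>k\<close>-th power in \<open>L1\<close> for every \<open>k\<close>. But \<open>L1\<close> lies in \<open>L\<close> up to a bounded
  exponent, and the exponents of \<open>v\<close> over the basis of \<open>F\<close> would be divisible by all powers of \<open>l\<close>.\<close>

lemma torsion_free_not_minimal:
  assumes sol: "solvable G" and r: "rank_at_most r G" and min: "minimal_normal A G"
    and comm: "\<And>x y. \<lbrakk>x \<in> A; y \<in> A\<rbrakk> \<Longrightarrow> x \<otimes> y = y \<otimes> x"
    and tf: "\<And>x k. \<lbrakk>x \<in> A; k > 0; x [^] (k::nat) = \<one>\<rbrakk> \<Longrightarrow> x = \<one>"
  shows False
proof -
  have AN: "A \<lhd> G" and A1: "A \<noteq> {\<one>}"
    and A_min: "\<And>M. \<lbrakk>M \<lhd> G; M \<subseteq> A\<rbrakk> \<Longrightarrow> M = {\<one>} \<or> M = A"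
    using min by (auto simp: minimal_normal_def)
  interpret A: normal A G by (rule AN)
  have AG: "a \<in> carrier G" if "a \<in> A" for a using that by (rule A.mem_carrier)
  have pow_mult: "(x \<otimes> y) [^] (k::nat) = x [^] k \<otimes> y [^] k" if "x \<in> A" "y \<in> A" for x y k
    using pow_mult_distrib comm that AG by blast
  define C where "C = G\<lparr>carrier := A\<rparr>"
  have C_simps: "carrier C = A" "monoid.mult C = monoid.mult G" "one C = one G" by (simp_all add: C_def)
  interpret C: comm_group C
    by (rule group.group_comm_groupI) (auto simp: C_def comm A.subgroup_is_group is_group)
  have rC: "rank_at_most r C" unfolding C_def by (rule rank_at_most_subgroup[OF r A.subgroup_axioms])
  have pow_C: "x [^]\<^bsub>C\<^esub> (k::nat) = x [^] k" for x k
    unfolding C_def by (rule nat_pow_consistent[symmetric])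
  obtain T where T: "C.mult_independent T" and T_basis: "\<And>x. x \<in> A \<Longrightarrow> \<exists>k>0. x [^] (k::nat) \<in> generate C T"
    using C.exists_mult_basis[OF rC] unfolding pow_C C_simps by blast
  have Tfin: "finite T" and TA: "T \<subseteq> A" using T by (auto simp: C.mult_independent_def C_simps)
  have TG: "T \<subseteq> carrier G" using TA A.subset by blast
  define F where "F = generate C T"
  have F_eq: "F = generate G T"
    unfolding F_def C_def by (rule generate_consistent[OF TA A.subgroup_axioms])
  interpret F: subgroup F G unfolding F_eq by (rule generate_is_subgroup[OF TG])
  have FA: "F \<subseteq> A" unfolding F_eq by (rule generate_subgroup_incl[OF TA A.subgroup_axioms])
  have F_pow: "F = range (C.power_product T)"
    unfolding F_def using C.generate_eq_power_product[of T] Tfin TA by (simp add: C_simps)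

  \<comment> \<open>A bound on denominators: finitely many conjugates of F are within bounded exponent of F.\<close>
  have denom: "\<exists>m>0. \<forall>g\<in>Y. \<forall>f\<in>F. conjugate g f [^] (m::nat) \<in> F"
    if Y: "finite Y" "Y \<subseteq> carrier G" for Y
  proof -
    have "\<exists>m>0. \<forall>c\<in>(\<lambda>(g, t). conjugate g t) ` (Y \<times> T). c [^] (m::nat) \<in> F"
    proof (rule common_multiple_exponent)
      fix c assume "c \<in> (\<lambda>(g, t). conjugate g t) ` (Y \<times> T)"
      then have cA: "c \<in> A" using Y TA normal_conjugate[OF AN] by auto
      then show "\<exists>k>0. c [^] (k::nat) \<in> F" using T_basis unfolding F_def by blast
      fix k j :: nat assume "c [^] k \<in> F"
      from subgroup_nat_pow_closed[OF F.subgroup_axioms this, of j]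
      show "c [^] (k * j) \<in> F" using AG[OF cA] by (simp add: nat_pow_pow)
    qed (use Y Tfin in auto)
    then obtain m where m: "m > 0" "\<And>g t. \<lbrakk>g \<in> Y; t \<in> T\<rbrakk> \<Longrightarrow> conjugate g t [^] (m::nat) \<in> F"
      by fastforce
    have "conjugate g f [^] m \<in> F" if g: "g \<in> Y" and f: "f \<in> F" for g f
    proof -
      have gG: "g \<in> carrier G" using g Y by auto
      have "f \<in> generate G T" using f by (simp add: F_eq)
      then show ?thesis
      proof induction
        case (inv t)
        then show ?case using m(2)[OF g inv] gG TG by (auto simp: conjugate_inv nat_pow_inv)
      next
        case (eng a b)
        have ab: "a \<in> A" "b \<in> A" using eng.hyps FA by (auto simp: F_eq)
        then have "conjugate g a \<in> A" "conjugate g b \<in> A" using normal_conjugate[OF AN gG] by auto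
        then have "conjugate g (a \<otimes> b) [^] m = conjugate g a [^] m \<otimes> conjugate g b [^] m"
          using ab AG gG by (simp add: conjugate_mult pow_mult)
        then show ?case using eng by simp
      qed (use m(2)[OF g] gG in auto)
    qed
    then show ?thesis using m(1) by blast
  qed

  obtain U where U: "finite U" "U \<subseteq> carrier G" "finite_orbits (generate G U) {\<one>}"
    using solvable_finite_orbits[OF sol r] by blast
  define H where "H = generate G U"
  have HG: "H \<subseteq> carrier G" unfolding H_def by (rule generate_incl[OF U(2)])
  have "finite (U \<union> m_inv G ` U)" "U \<union> m_inv G ` U \<subseteq> carrier G" using U by auto
  then obtain m where m: "m > 0" "\<And>g f. \<lbrakk>g \<in> U \<union> m_inv G ` U; f \<in> F\<rbrakk> \<Longrightarrow> conjugate g f [^] (m::nat) \<in> F"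
    using denom by metis

  \<comment> \<open>The analogue of an invariant lattice over the localisation of the integers at m.\<close>
  define L where "L = {a \<in> A. \<exists>k. a [^] (m ^ k) \<in> F}"
  have LA: "L \<subseteq> A" and FL: "F \<subseteq> L" using FA AG by (auto simp: L_def intro!: exI[of _ 0])
  have L_gen: "conjugate g a \<in> L" if g: "g \<in> U \<union> m_inv G ` U" and a: "a \<in> L" for g a
  proof -
    have gG: "g \<in> carrier G" using g U by auto
    obtain k where k: "a [^] (m ^ k) \<in> F" "a \<in> A" using a by (auto simp: L_def)
    have "conjugate g a [^] (m ^ Suc k) = conjugate g (a [^] (m ^ k)) [^] m"
      using gG AG[OF k(2)] by (simp add: conjugate_pow nat_pow_pow mult.commute)
    then have "conjugate g a [^] (m ^ Suc k) \<in> F" using m(2)[OF g k(1)] by simp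
    then show ?thesis using normal_conjugate[OF AN gG k(2)] unfolding L_def by blast
  qed
  have L_inv: "conjugate h a \<in> L" if h: "h \<in> H" and a: "a \<in> L" for h a
    using h[unfolded H_def] a
  proof (induction arbitrary: a)
    case one
    then show ?case using LA AG by auto
  next
    case (eng g h)
    have "g \<in> carrier G" "h \<in> carrier G" using eng.hyps HG by (auto simp: H_def)
    moreover have "a \<in> carrier G" using eng.prems LA AG by blast
    ultimately have "conjugate (g \<otimes> h) a = conjugate g (conjugate h a)" by (simp add: conjugate_conjugate)
    then show ?case using eng by simp
  qed (use L_gen in auto)

  obtain l where l: "Factorial_Ring.prime l" "l > m" using bigger_prime by blast
  have l0: "l > 0" using l by simp
  have cop: "coprime (int l) (int m)"
    using l m(1) prime_imp_coprime[of "l" "m"] nat_dvd_not_less by auto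
  obtain v0 where v0: "v0 \<in> A" "v0 \<noteq> \<one>" using A1 A.one_closed by blast
  obtain k0 where k0: "k0 > 0" "v0 [^] (k0::nat) \<in> F" using T_basis[OF v0(1)] unfolding F_def by blast
  define v where "v = v0 [^] k0"
  have vF: "v \<in> F" and v1: "v \<noteq> \<one>" using k0 tf[OF v0(1) k0(1)] v0 by (auto simp: v_def)
  have vA: "v \<in> A" using vF FA by blast

  \<comment> \<open>By minimality v lies in the normal closure of its l-th power, already using finitely many conjugations.\<close>
  \<comment> \<open>so \<open>a\<close> is an \<open>l\<close>-th power in the smallest subgroup that contains \<open>v\<close> and is invariant under \<open>Z\<close>\<close>
  define ok where "ok Z a \<longleftrightarrow> (\<forall>W. subgroup W G \<and> W \<subseteq> A \<and> v \<in> W \<and> (\<forall>z\<in>Z. \<forall>w\<in>W. conjugate z w \<in> W) \<longrightarrow>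
      (\<exists>w\<in>W. a = w [^] l))" for Z a
  define V where "V = {a \<in> A. \<exists>Z. finite Z \<and> Z \<subseteq> carrier G \<and> ok Z a}"
  have ok_mono: "ok Z' a" if "ok Z a" "Z \<subseteq> Z'" for Z Z' a using that unfolding ok_def by blast
  have "V \<lhd> G"
  proof (rule normalI_conjugate)
    show "subgroup V G"
    proof (rule subgroupI)
      show "V \<subseteq> carrier G" using AG by (auto simp: V_def)
      have "ok {} \<one>" unfolding ok_def using subgroup.one_closed by (metis nat_pow_one)
      then have "\<one> \<in> V" unfolding V_def using A.one_closed by blast
      then show "V \<noteq> {}" by blast
    next
      fix a assume "a \<in> V"
      then obtain Z where Z: "a \<in> A" "finite Z" "Z \<subseteq> carrier G" "ok Z a" by (auto simp: V_def)
      have "ok Z (inv a)"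
        unfolding ok_def
      proof (intro allI impI)
        fix W assume W: "subgroup W G \<and> W \<subseteq> A \<and> v \<in> W \<and> (\<forall>z\<in>Z. \<forall>w\<in>W. conjugate z w \<in> W)"
        then obtain w where w: "w \<in> W" "a = w [^] l" using Z(4) unfolding ok_def by blast
        then have "inv a = (inv w) [^] l" using W AG by (auto simp: nat_pow_inv)
        moreover have "inv w \<in> W" using W w subgroup.m_inv_closed by metis
        ultimately show "\<exists>w\<in>W. inv a = w [^] l" by blast
      qed
      then show "inv a \<in> V" using Z A.m_inv_closed unfolding V_def by blast
    next
      fix a b assume "a \<in> V" "b \<in> V"
      then obtain Z Z' where Z: "a \<in> A" "finite Z" "Z \<subseteq> carrier G" "ok Z a"
        and Z': "b \<in> A" "finite Z'" "Z' \<subseteq> carrier G" "ok Z' b" by (auto simp: V_def)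
      have "ok (Z \<union> Z') (a \<otimes> b)"
        unfolding ok_def
      proof (intro allI impI)
        fix W assume W: "subgroup W G \<and> W \<subseteq> A \<and> v \<in> W \<and> (\<forall>z\<in>Z \<union> Z'. \<forall>w\<in>W. conjugate z w \<in> W)"
        obtain w where w: "w \<in> W" "a = w [^] l" using Z(4) W unfolding ok_def by blast
        obtain w' where w': "w' \<in> W" "b = w' [^] l" using Z'(4) W unfolding ok_def by blast
        have "w \<in> A" "w' \<in> A" using w w' W by auto
        then have "a \<otimes> b = (w \<otimes> w') [^] l" using w w' by (simp add: pow_mult)
        moreover have "w \<otimes> w' \<in> W" using W w w' subgroup.m_closed by metis
        ultimately show "\<exists>w\<in>W. a \<otimes> b = w [^] l" by blast
      qed
      moreover have "finite (Z \<union> Z')" "Z \<union> Z' \<subseteq> carrier G" using Z Z' by auto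
      ultimately show "a \<otimes> b \<in> V" using Z(1) Z'(1) A.m_closed unfolding V_def by blast
    qed
    fix g a assume g: "g \<in> carrier G" and "a \<in> V"
    then obtain Z where Z: "a \<in> A" "finite Z" "Z \<subseteq> carrier G" "ok Z a" by (auto simp: V_def)
    have "ok (insert g Z) (conjugate g a)"
      unfolding ok_def
    proof (intro allI impI)
      fix W assume W: "subgroup W G \<and> W \<subseteq> A \<and> v \<in> W \<and> (\<forall>z\<in>insert g Z. \<forall>w\<in>W. conjugate z w \<in> W)"
      obtain w where w: "w \<in> W" "a = w [^] l" using Z(4) W unfolding ok_def by blast
      have "w \<in> carrier G" using w W AG by auto
      then have "conjugate g a = conjugate g w [^] l" using w g by (simp add: conjugate_pow)
      then show "\<exists>w\<in>W. conjugate g a = w [^] l" using W w by blast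
    qed
    then show "conjugate g a \<in> V"
      using Z g normal_conjugate[OF AN g Z(1)] unfolding V_def
      by (intro CollectI conjI exI[of _ "insert g Z"]) auto
  qed
  moreover have "V \<subseteq> A" by (auto simp: V_def)
  moreover have "v [^] l \<in> V"
  proof -
    have "ok {} (v [^] l)" unfolding ok_def by blast
    then show ?thesis unfolding V_def using subgroup_nat_pow_closed[OF A.subgroup_axioms vA] by blast
  qed
  moreover have "v [^] l \<noteq> \<one>" using tf[OF vA l0] v1 by blast
  ultimately have "V = A" using A_min by blast
  then obtain Z where Z: "finite Z" "Z \<subseteq> carrier G" "ok Z v" using vA by (auto simp: V_def)

  \<comment> \<open>The finitely many translates of L met by Z generate a Z-invariant group, commensurable with L.\<close>
  obtain Y where Y: "finite Y" "Y \<subseteq> carrier G" "\<one> \<in> Y"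
    "\<And>z y. \<lbrakk>z \<in> Z; y \<in> Y\<rbrakk> \<Longrightarrow> \<exists>y'\<in>Y. \<exists>h\<in>H. \<exists>d\<in>{\<one>}. z \<otimes> y = y' \<otimes> h \<otimes> d"
    using U(3) Z(1,2) unfolding finite_orbits_def H_def[symmetric] by meson
  define S where "S = {conjugate y a | y a. y \<in> Y \<and> a \<in> L}"
  have SA: "S \<subseteq> A" using Y(2) LA normal_conjugate[OF AN] by (auto simp: S_def)
  then have SG: "S \<subseteq> carrier G" using A.subset by blast
  define L1 where "L1 = generate G S"
  interpret L1: subgroup L1 G unfolding L1_def by (rule generate_is_subgroup[OF SG])
  have L1A: "L1 \<subseteq> A" unfolding L1_def by (rule generate_subgroup_incl[OF SA A.subgroup_axioms])
  have L1_inv: "conjugate z w \<in> L1" if z: "z \<in> Z" and w: "w \<in> L1" for z w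
  proof -
    have zG: "z \<in> carrier G" using z Z by auto
    have S_inv: "conjugate z s \<in> S" if s: "s \<in> S" for s
    proof -
      obtain y a where ya: "y \<in> Y" "a \<in> L" "s = conjugate y a" using s by (auto simp: S_def)
      obtain y' h where y': "y' \<in> Y" "h \<in> H" "z \<otimes> y = y' \<otimes> h \<otimes> \<one>" using Y(4)[OF z ya(1)] by blast
      have G: "y \<in> carrier G" "y' \<in> carrier G" "h \<in> carrier G" "a \<in> carrier G"
        using ya y' Y(2) HG LA AG by blast+
      have "conjugate z s = conjugate y' (conjugate h a)"
        using ya y' G zG by (simp add: conjugate_conjugate)
      then show ?thesis using L_inv[OF y'(2) ya(2)] y'(1) by (auto simp: S_def)
    qed
    from w[unfolded L1_def] have "conjugate z w \<in> generate G S"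
    proof induction
      case one
      then show ?case using zG generate.one by simp
    next
      case (incl s)
      then show ?case using S_inv generate.incl by metis
    next
      case (inv s)
      then have "conjugate z (inv s) = inv (conjugate z s)" using SG zG by (auto simp: conjugate_inv)
      then show ?case using generate.inv[OF S_inv[OF inv]] by metis
    next
      case (eng a b)
      then have "a \<in> carrier G" "b \<in> carrier G" using generate_in_carrier[OF SG] by auto
      then show ?case using eng zG generate.eng by (simp add: conjugate_mult)
    qed
    then show ?thesis by (simp add: L1_def)
  qed
  obtain n where n: "n > 0" "\<And>g f. \<lbrakk>g \<in> Y; f \<in> F\<rbrakk> \<Longrightarrow> conjugate g f [^] (n::nat) \<in> F"
    using denom[OF Y(1,2)] by metis
  have "subgroup L G"
  proof (rule subgroupI)
    show "L \<subseteq> carrier G" "L \<noteq> {}" using LA AG FL F.one_closed by blast+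
    show "inv a \<in> L" if "a \<in> L" for a
      using that AG by (auto simp: L_def nat_pow_inv)
    fix a b assume "a \<in> L" "b \<in> L"
    then obtain i j where ij: "a \<in> A" "b \<in> A" "a [^] (m ^ i) \<in> F" "b [^] (m ^ j) \<in> F" by (auto simp: L_def)
    have "(a \<otimes> b) [^] (m ^ (i + j)) = (a [^] (m ^ i)) [^] (m ^ j) \<otimes> (b [^] (m ^ j)) [^] (m ^ i)"
      using ij AG by (simp add: pow_mult nat_pow_pow power_add mult.commute)
    then have "(a \<otimes> b) [^] (m ^ (i + j)) \<in> F"
      using subgroup_nat_pow_closed[OF F.subgroup_axioms] ij by simp
    then show "a \<otimes> b \<in> L" using ij unfolding L_def by blast
  qed
  from subgroup_of_powers[OF A.subgroup_axioms comm this]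
  have Ln: "subgroup {a \<in> A. a [^] n \<in> L} G" by blast
  have "S \<subseteq> {a \<in> A. a [^] n \<in> L}"
  proof
    fix s assume "s \<in> S"
    then obtain y a where ya: "y \<in> Y" "a \<in> L" "s = conjugate y a" by (auto simp: S_def)
    obtain k where k: "a [^] (m ^ k) \<in> F" using ya by (auto simp: L_def)
    have G: "y \<in> carrier G" "a \<in> carrier G" using ya Y(2) LA AG by blast+
    have "(s [^] n) [^] (m ^ k) = conjugate y (a [^] (m ^ k)) [^] n"
      using ya G by (simp add: conjugate_pow nat_pow_pow mult.commute)
    then have "(s [^] n) [^] (m ^ k) \<in> F" using n(2)[OF ya(1) k] by simp
    moreover have "s \<in> A" using \<open>s \<in> S\<close> SA by blast
    ultimately show "s \<in> {a \<in> A. a [^] n \<in> L}"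
      using subgroup_nat_pow_closed[OF A.subgroup_axioms, of s n] unfolding L_def by blast
  qed
  then have L1n: "L1 \<subseteq> {a \<in> A. a [^] n \<in> L}"
    unfolding L1_def by (rule generate_subgroup_incl[OF _ Ln])

  have v_div: "\<exists>u\<in>L1. v = u [^] (l ^ k)" for k
  proof (induction k)
    case 0
    have "conjugate \<one> v \<in> S" unfolding S_def using Y(3) vF FL by blast
    then have "v \<in> L1" unfolding L1_def using generate.incl[of v S G] AG[OF vA] by simp
    then show ?case using AG[OF vA] by auto
  next
    case (Suc k)
    let ?W = "(\<lambda>a. a [^] (l ^ k)) ` L1"
    have comm1: "\<And>x y. \<lbrakk>x \<in> L1; y \<in> L1\<rbrakk> \<Longrightarrow> x \<otimes> y = y \<otimes> x" using comm L1A by blast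
    have "subgroup ?W G" by (rule subgroup_power_image[OF L1.subgroup_axioms comm1])
    moreover have "?W \<subseteq> A" using L1A subgroup_nat_pow_closed[OF A.subgroup_axioms] by blast
    moreover have "v \<in> ?W" using Suc by blast
    moreover have "conjugate z w \<in> ?W" if zw: "z \<in> Z" "w \<in> ?W" for z w
    proof -
      obtain u where u: "u \<in> L1" "w = u [^] (l ^ k)" using zw(2) by (elim imageE)
      have "z \<in> carrier G" "u \<in> carrier G" using zw(1) Z(2) u(1) L1A AG by blast+
      then have "conjugate z w = conjugate z u [^] (l ^ k)" unfolding u(2) by (rule conjugate_pow)
      then show ?thesis using L1_inv[OF zw(1) u(1)] by blast
    qed
    ultimately have "subgroup ?W G \<and> ?W \<subseteq> A \<and> v \<in> ?W \<and> (\<forall>z\<in>Z. \<forall>w\<in>?W. conjugate z w \<in> ?W)"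
      by (intro conjI ballI)
    then have "\<exists>w\<in>?W. v = w [^] l" by (rule Z(3)[unfolded ok_def, rule_format])
    then obtain w where w: "w \<in> ?W" "v = w [^] l" by (elim bexE)
    from w(1) have "\<exists>u\<in>L1. w = u [^] (l ^ k)" by (simp only: image_iff)
    then obtain u where u: "w = u [^] (l ^ k)" "u \<in> L1" by (elim bexE)
    have "u \<in> carrier G" using u(2) L1A AG by blast
    then have "(u [^] (l ^ k)) [^] l = u [^] (l ^ Suc k)" by (simp add: nat_pow_pow mult.commute)
    then have "v = u [^] (l ^ Suc k)" using w(2) u(1) by metis
    then show ?case using u(2) by blast
  qed

  obtain c where c: "v = C.power_product T c" using vF F_pow by blast
  have TC: "T \<subseteq> carrier C" using TA by (simp add: C_simps)
  have ipow: "C.power_product T (\<lambda>t. d t * int k) = C.power_product T d [^] (k::nat)" for d k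
    using C.power_product_mult[OF TC, of d "int k"] by (simp add: int_pow_int pow_C)
  have "c t = 0" if t: "t \<in> T" for t
  proof -
    have "int l ^ k dvd c t * int n" for k
    proof -
      obtain u where u: "u \<in> L1" "v = u [^] (l ^ k)" using v_div by blast
      obtain j where "u [^] n \<in> L" "u \<in> A" using u(1) L1n by blast
      then obtain j where "(u [^] n) [^] (m ^ j) \<in> F" and uA: "u \<in> A" by (auto simp: L_def)
      then obtain d where d: "u [^] (n * m ^ j) = C.power_product T d" using F_pow AG by (auto simp: nat_pow_pow)
      have "v [^] (n * m ^ j) = (u [^] (n * m ^ j)) [^] (l ^ k)"
        using u AG[OF uA] by (simp add: nat_pow_pow mult.commute)
      then have "C.power_product T (\<lambda>t. c t * int (n * m ^ j)) = C.power_product T (\<lambda>t. d t * int (l ^ k))"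
        unfolding ipow using c d by simp
      then have "c t * int (n * m ^ j) = d t * int (l ^ k)"
        using C.mult_independentD[OF T _ t] by meson
      then have "int l ^ k dvd (c t * int n) * int m ^ j" by (simp add: mult.assoc)
      then show ?thesis using cop by (simp add: coprime_dvd_mult_left_iff)
    qed
    then have "c t * int n = 0" by (rule int_prime_power_dvd_imp_zero[OF l(1)])
    then show ?thesis using n(1) by simp
  qed
  then have "C.power_product T c = C.power_product T (\<lambda>t. 0)"
    unfolding C.power_product_def using TC by (intro C.finprod_cong') auto
  then show False using c v1 C.power_product_zero by (simp add: C_simps)
qed

end


section \<open>The socle\<close>

context group
begin

text \<open>For \<open>A\<close> inside the socle this is the \<open>\<int>G\<close>-submodule generated by \<open>A\<close>.\<close>

definition normal_closure :: "'a set \<Rightarrow> 'a set" where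
  "normal_closure A = \<Inter>{N. N \<lhd> G \<and> A \<subseteq> N}"

lemma normal_closure_normal:
  assumes "A \<subseteq> carrier G"
  shows "normal_closure A \<lhd> G"
proof (rule normalI_conjugate)
  have ne: "carrier G \<in> {N. N \<lhd> G \<and> A \<subseteq> N}" using assms normal_self by blast
  show "subgroup (normal_closure A) G"
    unfolding normal_closure_def
    by (rule subgroups_Inter) (use ne in \<open>auto simp: normal_imp_subgroup\<close>)
  show "conjugate g x \<in> normal_closure A" if "g \<in> carrier G" "x \<in> normal_closure A" for g x
    using that normal_conjugate unfolding normal_closure_def by blast
qed

lemma normal_closure_incl: "A \<subseteq> normal_closure A"
  unfolding normal_closure_def by blast

lemma normal_closure_least: "\<lbrakk>N \<lhd> G; A \<subseteq> N\<rbrakk> \<Longrightarrow> normal_closure A \<subseteq> N"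
  unfolding normal_closure_def by blast

lemma normal_Int: "\<lbrakk>N \<lhd> G; M \<lhd> G\<rbrakk> \<Longrightarrow> N \<inter> M \<lhd> G"
  by (rule normal_subgroup_intersect)

lemma normal_mult_set:
  assumes "N \<lhd> G" "M \<lhd> G" and comm: "\<And>x y. \<lbrakk>x \<in> N; y \<in> M\<rbrakk> \<Longrightarrow> x \<otimes> y = y \<otimes> x"
  shows "{x \<otimes> y | x y. x \<in> N \<and> y \<in> M} \<lhd> G"
proof (rule normalI_conjugate)
  interpret N: normal N G by fact
  interpret M: normal M G by fact
  show "subgroup {x \<otimes> y | x y. x \<in> N \<and> y \<in> M} G"
  proof (rule subgroupI)
    show "{x \<otimes> y | x y. x \<in> N \<and> y \<in> M} \<subseteq> carrier G" by auto
    show "{x \<otimes> y | x y. x \<in> N \<and> y \<in> M} \<noteq> {}" using N.one_closed M.one_closed by blast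
    fix a assume "a \<in> {x \<otimes> y | x y. x \<in> N \<and> y \<in> M}"
    then obtain x y where a: "a = x \<otimes> y" "x \<in> N" "y \<in> M" by blast
    then have "inv a = inv x \<otimes> inv y" using comm[of "inv x" "inv y"] by (simp add: inv_mult_group)
    then show "inv a \<in> {x \<otimes> y | x y. x \<in> N \<and> y \<in> M}" using a by blast
    fix b assume "b \<in> {x \<otimes> y | x y. x \<in> N \<and> y \<in> M}"
    then obtain x' y' where b: "b = x' \<otimes> y'" "x' \<in> N" "y' \<in> M" by blast
    have "a \<otimes> b = x \<otimes> (y \<otimes> x') \<otimes> y'" using a b by (simp add: m_assoc)
    also have "y \<otimes> x' = x' \<otimes> y" using comm[of x' y] a b by simp
    also have "x \<otimes> (x' \<otimes> y) \<otimes> y' = (x \<otimes> x') \<otimes> (y \<otimes> y')" using a b by (simp add: m_assoc)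
    finally show "a \<otimes> b \<in> {x \<otimes> y | x y. x \<in> N \<and> y \<in> M}" using a b by blast
  qed
  fix g a assume g: "g \<in> carrier G" and "a \<in> {x \<otimes> y | x y. x \<in> N \<and> y \<in> M}"
  then obtain x y where a: "a = x \<otimes> y" "x \<in> N" "y \<in> M" by blast
  then have "conjugate g a = conjugate g x \<otimes> conjugate g y" using g by (simp add: conjugate_mult)
  then show "conjugate g a \<in> {x \<otimes> y | x y. x \<in> N \<and> y \<in> M}"
    using a g normal_conjugate[OF assms(1)] normal_conjugate[OF assms(2)] by blast
qed

lemma mult_exchange:
  assumes G: "x \<in> carrier G" "y \<in> carrier G" "u \<in> carrier G" "v \<in> carrier G" and c: "y \<otimes> u = u \<otimes> y"
  shows "(x \<otimes> y) \<otimes> (u \<otimes> v) = (x \<otimes> u) \<otimes> (y \<otimes> v)"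
proof -
  have "(x \<otimes> y) \<otimes> (u \<otimes> v) = x \<otimes> (y \<otimes> u) \<otimes> v" using G by (simp add: m_assoc)
  also have "\<dots> = (x \<otimes> u) \<otimes> (y \<otimes> v)" unfolding c using G by (simp add: m_assoc)
  finally show ?thesis .
qed

lemma normal_torsion:
  assumes A: "A \<lhd> G" and comm: "\<And>x y. \<lbrakk>x \<in> A; y \<in> A\<rbrakk> \<Longrightarrow> x \<otimes> y = y \<otimes> x"
  shows "{x \<in> A. x [^] (n::nat) = \<one>} \<lhd> G"
proof (rule normalI_conjugate)
  interpret A: normal A G by (rule A)
  show "subgroup {x \<in> A. x [^] n = \<one>} G"
    using subgroup_of_powers[OF A.subgroup_axioms comm triv_subgroup, of n] by simp
  show "conjugate g x \<in> {x \<in> A. x [^] n = \<one>}" if "g \<in> carrier G" "x \<in> {x \<in> A. x [^] n = \<one>}" for g x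
    using that normal_conjugate[OF A] by (auto simp flip: conjugate_pow)
qed

lemma exists_minimal_normal:
  assumes N: "N \<lhd> G" "N \<noteq> {\<one>}" "finite N"
  shows "\<exists>A. minimal_normal A G \<and> A \<subseteq> N"
  using assms
proof (induction "card N" arbitrary: N rule: less_induct)
  case less
  show ?case
  proof (cases "minimal_normal N G")
    case False
    then obtain M where M: "M \<lhd> G" "M \<subseteq> N" "M \<noteq> {\<one>}" "M \<noteq> N"
      using less.prems unfolding minimal_normal_def by blast
    then have "card M < card N" "finite M"
      using less.prems(3) by (auto intro: psubset_card_mono finite_subset)
    then show ?thesis using less.hyps[of M] M by blast
  qed auto
qed

text \<open>Divide the exponent \<open>n\<close> by one of its prime factors as long as the power of \<open>x\<close> stays trivial.\<close>

lemma prime_order_element: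
  assumes x: "x \<in> carrier G" "x \<noteq> \<one>" and n: "n > 0" "x [^] (n::nat) = \<one>"
  shows "\<exists>p k. Factorial_Ring.prime p \<and> (x [^] (k::nat)) [^] (p::nat) = \<one> \<and> x [^] k \<noteq> \<one>"
  using n
proof (induction n rule: less_induct)
  case (less n)
  have "n \<noteq> 1" using less.prems x by auto
  then obtain p where p: "Factorial_Ring.prime p" "p dvd n" using prime_factor_nat by blast
  then obtain k where k: "n = p * k" by auto
  show ?case
  proof (cases "x [^] k = \<one>")
    case True
    have "k < n" "k > 0" using k less.prems(1) prime_gt_1_nat[OF p(1)] by auto
    then show ?thesis using less.IH True by blast
  next
    case False
    have "(x [^] k) [^] p = \<one>" using less.prems(2) x(1) k by (simp add: nat_pow_pow mult.commute)
    then show ?thesis using p(1) False by blast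
  qed
qed

text \<open>In the group of order \<open>p\<close> generated by \<open>x\<close>, the element \<open>x\<^sup>k\<close> is again a generator.\<close>

lemma power_cancel_prime:
  assumes H: "subgroup H G" and x: "x \<in> carrier G" and p: "Factorial_Ring.prime (p::nat)" "x [^] p = \<one>"
    and k: "x [^] (k::nat) \<in> H" "\<not> p dvd k"
  shows "x \<in> H"
proof -
  have "coprime k p" using prime_imp_coprime[OF p(1) k(2)] by (simp add: coprime_commute)
  then obtain u v where uv: "u * int k + v * int p = 1" using bezout_int[of "int k" "int p"] by auto
  have "x = x [^] (int k * u + int p * v)" using uv x by (simp add: mult.commute)
  also have "\<dots> = (x [^] int k) [^] u \<otimes> (x [^] int p) [^] v" using x by (simp only: int_pow_mult int_pow_pow int_pow_closed)
  also have "\<dots> = (x [^] k) [^] u" using x p(2) by (simp add: int_pow_int)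
  finally show ?thesis using subgroup_int_pow_closed[OF H k(1), of u] by simp
qed

end

locale finite_rank_solvable_group = group G for G (structure) +
  assumes sol: "solvable G" and fin_rank: "finite_rank G"
begin

abbreviation S where "S \<equiv> socle G"

lemma socle_normal: "S \<lhd> G"
  by (rule socle_abelian_normal(1)[OF is_group sol])

lemma socle_sub: "x \<in> S \<Longrightarrow> x \<in> carrier G"
  using socle_normal normal_imp_subgroup subgroup.mem_carrier by metis

lemma socle_comm: "\<lbrakk>x \<in> S; y \<in> S\<rbrakk> \<Longrightarrow> x \<otimes> y = y \<otimes> x"
  using comm_monoid.m_comm[OF comm_group.axioms(1)[OF socle_abelian_normal(2)[OF is_group sol]], of x y] by simp

lemma minimal_normal_in_socle: "minimal_normal A G \<Longrightarrow> A \<subseteq> S"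
  unfolding socle_def by (intro subsetI generate.incl) auto

lemma normal_in_socle_comm: "\<lbrakk>A \<subseteq> S; x \<in> A; y \<in> A\<rbrakk> \<Longrightarrow> x \<otimes> y = y \<otimes> x"
  using socle_comm by blast

text \<open>Apply the count of coset representatives to the trivial subgroup.\<close>

lemma finite_bounded_exponent:
  assumes A: "A \<lhd> G" and comm: "\<And>x y. \<lbrakk>x \<in> A; y \<in> A\<rbrakk> \<Longrightarrow> x \<otimes> y = y \<otimes> x"
    and n: "n > 0" "\<And>x. x \<in> A \<Longrightarrow> x [^] (n::nat) = \<one>"
  shows "finite A"
proof -
  interpret A: normal A G by (rule A)
  define C where "C = G\<lparr>carrier := A\<rparr>"
  interpret C: comm_group C
    by (rule group.group_comm_groupI) (auto simp: C_def comm A.subgroup_is_group is_group)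
  obtain r where r: "rank_at_most r G" using fin_rank unfolding finite_rank_iff by blast
  have rC: "rank_at_most r C" unfolding C_def by (rule rank_at_most_subgroup[OF r A.subgroup_axioms])
  have pow: "x [^]\<^bsub>C\<^esub> n \<in> {\<one>\<^bsub>C\<^esub>}" if "x \<in> carrier C" for x
    using that n(2) nat_pow_consistent[of x n A] by (simp add: C_def)
  obtain E where E: "finite E" "E \<subseteq> carrier C" "\<And>b. b \<in> carrier C \<Longrightarrow> \<exists>h\<in>E. b \<otimes>\<^bsub>C\<^esub> inv\<^bsub>C\<^esub> h \<in> {\<one>\<^bsub>C\<^esub>}"
    using C.finite_representatives[OF rC C.subgroup_self C.triv_subgroup n(1) pow] by blast
  have "A \<subseteq> E"
  proof
    fix b assume "b \<in> A"
    then have b: "b \<in> carrier C" by (simp add: C_def)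
    obtain h where h: "h \<in> E" "b \<otimes>\<^bsub>C\<^esub> inv\<^bsub>C\<^esub> h = \<one>\<^bsub>C\<^esub>" using E(3)[OF b] by auto
    then have "b = h" using b E(2) by (metis C.inv_equality C.inv_inv C.inv_closed subsetD)
    then show "b \<in> E" using h by simp
  qed
  then show ?thesis using E(1) finite_subset by blast
qed

text \<open>A minimal normal subgroup is abelian and has torsion, so for some prime \<open>p\<close> its elements of order
  dividing \<open>p\<close> form a nontrivial normal subgroup, hence all of it.\<close>

lemma minimal_normal_elementary:
  assumes A: "minimal_normal A G"
  shows "\<exists>p. Factorial_Ring.prime (p::nat) \<and> (\<forall>x\<in>A. x [^] p = \<one>)"
proof -
  have AS: "A \<subseteq> S" by (rule minimal_normal_in_socle[OF A])
  have AN: "A \<lhd> G" using A by (simp add: minimal_normal_def)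
  obtain r where r: "rank_at_most r G" using fin_rank unfolding finite_rank_iff by blast
  obtain x k where x: "x \<in> A" "k > 0" "x [^] (k::nat) = \<one>" "x \<noteq> \<one>"
    using torsion_free_not_minimal[OF sol r A normal_in_socle_comm[OF AS]] by blast
  obtain p j where p: "Factorial_Ring.prime (p::nat)" "(x [^] (j::nat)) [^] p = \<one>" "x [^] j \<noteq> \<one>"
    using prime_order_element[OF socle_sub[OF subsetD[OF AS x(1)]] x(4,2,3)] by (elim exE conjE)
  let ?P = "{x \<in> A. x [^] p = \<one>}"
  have "?P \<lhd> G" by (rule normal_torsion[OF AN normal_in_socle_comm[OF AS]])
  moreover have "x [^] j \<in> ?P"
    using x p subgroup_nat_pow_closed[OF normal_imp_subgroup[OF AN]] by simp
  ultimately have "?P = A" using A p(3) unfolding minimal_normal_def by blast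
  then show ?thesis using p(1) by blast
qed

definition socle_part :: "nat \<Rightarrow> 'a set" where
  "socle_part p = {x \<in> S. x [^] p = \<one>}"

lemma socle_part_normal: "socle_part p \<lhd> G"
  unfolding socle_part_def by (rule normal_torsion[OF socle_normal socle_comm])

lemma socle_part_finite:
  assumes "p > 0"
  shows "finite (socle_part p)"
proof (rule finite_bounded_exponent[OF socle_part_normal _ assms])
  show "x \<otimes> y = y \<otimes> x" if "x \<in> socle_part p" "y \<in> socle_part p" for x y
    using socle_comm[of x y] that by (simp add: socle_part_def)
qed (simp add: socle_part_def)

lemma socle_exponent:
  assumes "x \<in> S"
  shows "\<exists>P. finite P \<and> (\<forall>p\<in>P. Factorial_Ring.prime (p::nat)) \<and> x [^] (\<Prod>P) = \<one>"
  using assms unfolding socle_def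
proof (induction rule: generate.induct)
  case one
  show ?case by (intro exI[of _ "{}"]) simp
next
  case (incl h)
  then obtain A where A: "minimal_normal A G" "h \<in> A" by auto
  obtain p where "Factorial_Ring.prime (p::nat)" "\<forall>x\<in>A. x [^] p = \<one>"
    using minimal_normal_elementary[OF A(1)] by (elim exE conjE)
  then show ?case using A by (intro exI[of _ "{p}"]) auto
next
  case (inv h)
  then obtain A where A: "minimal_normal A G" "h \<in> A" by auto
  obtain p where p: "Factorial_Ring.prime (p::nat)" "\<forall>x\<in>A. x [^] p = \<one>"
    using minimal_normal_elementary[OF A(1)] by (elim exE conjE)
  have "h \<in> carrier G" using A(2) minimal_normal_in_socle[OF A(1)] socle_sub by blast
  then show ?case using A p by (intro exI[of _ "{p}"]) (auto simp: nat_pow_inv)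
next
  case (eng a b)
  then obtain P Q where P: "finite P" "\<forall>p\<in>P. Factorial_Ring.prime (p::nat)" "a [^] (\<Prod>P) = \<one>"
    and Q: "finite Q" "\<forall>p\<in>Q. Factorial_Ring.prime (p::nat)" "b [^] (\<Prod>Q) = \<one>" by blast
  have ab: "a \<in> S" "b \<in> S" using eng.hyps by (auto simp: socle_def)
  then have abG: "a \<in> carrier G" "b \<in> carrier G" using socle_sub by auto
  obtain i j where ij: "\<Prod>(P \<union> Q) = \<Prod>P * i" "\<Prod>(P \<union> Q) = \<Prod>Q * j"
    using P(1) Q(1) prod_dvd_prod_subset[of "P \<union> Q" P "\<lambda>x. x"] prod_dvd_prod_subset[of "P \<union> Q" Q "\<lambda>x. x"]
    by (auto elim!: dvdE)
  have "a [^] (\<Prod>(P \<union> Q)) = \<one>"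
    using nat_pow_pow[OF abG(1), of "\<Prod>P" i] P(3) ij(1) by simp
  moreover have "b [^] (\<Prod>(P \<union> Q)) = \<one>"
    using nat_pow_pow[OF abG(2), of "\<Prod>Q" j] Q(3) ij(2) by simp
  ultimately have "(a \<otimes> b) [^] (\<Prod>(P \<union> Q)) = \<one>" using abG socle_comm[OF ab] by (simp add: pow_mult_distrib)
  then show ?case using P Q by (intro exI[of _ "P \<union> Q"]) auto
qed

text \<open>The socle is a sum of simple modules, hence semisimple: for \<open>M\<close> maximal with \<open>A \<inter> M = 1\<close>, a minimal
  normal subgroup \<open>N\<close> outside \<open>A M\<close> would satisfy \<open>A \<inter> M N = 1\<close>.\<close>

lemma socle_complement:
  assumes A: "A \<lhd> G" "A \<subseteq> S"
  shows "\<exists>M. M \<lhd> G \<and> M \<subseteq> S \<and> A \<inter> M = {\<one>} \<and> S = {a \<otimes> m | a m. a \<in> A \<and> m \<in> M}"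
proof -
  interpret A: normal A G by (rule A(1))
  define F where "F = {M. M \<lhd> G \<and> M \<subseteq> S \<and> A \<inter> M = {\<one>}}"
  have "\<one> \<in> S" by (rule subgroup.one_closed[OF normal_imp_subgroup[OF socle_normal]])
  then have "{\<one>} \<in> F" using one_is_normal A.one_closed unfolding F_def by blast
  then have "F \<noteq> {}" by blast
  have chain: "\<Union>\<C> \<in> F" if "\<C> \<noteq> {}" "subset.chain F \<C>" for \<C>
  proof -
    have CF: "M \<lhd> G" "M \<subseteq> S" "A \<inter> M = {\<one>}" if "M \<in> \<C>" for M
      using that \<open>subset.chain F \<C>\<close> unfolding F_def subset.chain_def by auto
    have "\<Union>\<C> \<lhd> G"
    proof (rule normalI_conjugate)
      show "subgroup (\<Union>\<C>) G"
      proof (rule subgroupI)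
        show "\<Union>\<C> \<subseteq> carrier G" using CF(2) socle_sub by blast
        show "\<Union>\<C> \<noteq> {}" using that(1) CF(3) by blast
        show "inv a \<in> \<Union>\<C>" if a: "a \<in> \<Union>\<C>" for a
        proof -
          obtain M where M: "M \<in> \<C>" "a \<in> M" using a by (elim UnionE)
          from subgroup.m_inv_closed[OF normal_imp_subgroup[OF CF(1)[OF M(1)]] M(2)] M(1)
          show ?thesis by (rule UnionI[rotated])
        qed
        show "a \<otimes> b \<in> \<Union>\<C>" if ab: "a \<in> \<Union>\<C>" "b \<in> \<Union>\<C>" for a b
        proof -
          obtain M N where MN: "M \<in> \<C>" "N \<in> \<C>" "a \<in> M" "b \<in> N" using ab by (elim UnionE)
          then have "M \<subseteq> N \<or> N \<subseteq> M" using \<open>subset.chain F \<C>\<close> by (auto simp: subset.chain_def)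
          then have "\<exists>K\<in>\<C>. a \<in> K \<and> b \<in> K" using MN by (metis subsetD)
          then obtain K where K: "K \<in> \<C>" "a \<in> K" "b \<in> K" by (elim bexE conjE)
          from subgroup.m_closed[OF normal_imp_subgroup[OF CF(1)[OF K(1)]] K(2,3)] K(1)
          show ?thesis by (rule UnionI[rotated])
        qed
      qed
      show "conjugate g x \<in> \<Union>\<C>" if "g \<in> carrier G" "x \<in> \<Union>\<C>" for g x
        using that CF(1) normal_conjugate by (metis UnionE UnionI)
    qed
    moreover have "\<Union>\<C> \<subseteq> S" using CF(2) by (rule Union_least)
    moreover have "A \<inter> \<Union>\<C> = {\<one>}" using that(1) CF(3) by blast
    ultimately show ?thesis by (simp add: F_def)
  qed
  have "\<exists>M\<in>F. \<forall>U\<in>F. M \<subseteq> U \<longrightarrow> U = M" using subset_Zorn_nonempty[OF \<open>F \<noteq> {}\<close> chain] .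
  then obtain M where M: "M \<in> F" and "\<forall>U\<in>F. M \<subseteq> U \<longrightarrow> U = M" by (elim bexE)
  then have M_max: "\<And>U. \<lbrakk>U \<in> F; M \<subseteq> U\<rbrakk> \<Longrightarrow> U = M" by simp
  have MN: "M \<lhd> G" "M \<subseteq> S" "A \<inter> M = {\<one>}" using M by (auto simp: F_def)
  interpret M: normal M G by (rule MN(1))
  let ?AM = "{a \<otimes> m | a m. a \<in> A \<and> m \<in> M}"
  have commAM: "x \<otimes> y = y \<otimes> x" if "x \<in> A" "y \<in> M" for x y using that A MN socle_comm by blast
  have AM: "?AM \<lhd> G" by (rule normal_mult_set[OF A(1) MN(1) commAM])
  interpret AM: normal ?AM G by (rule AM)
  have AM_sub: "?AM \<subseteq> S"
    using A MN normal_imp_subgroup[OF socle_normal] by (auto intro: subgroup.m_closed)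
  have A_AM: "A \<subseteq> ?AM" and M_AM: "M \<subseteq> ?AM"
  proof -
    have "a = a \<otimes> \<one>" if "a \<in> A" for a using that by simp
    then show "A \<subseteq> ?AM" using M.one_closed by blast
    have "m = \<one> \<otimes> m" if "m \<in> M" for m using that by simp
    then show "M \<subseteq> ?AM" using A.one_closed by blast
  qed
  have "N \<subseteq> ?AM" if N: "minimal_normal N G" for N
  proof (rule ccontr)
    assume nsub: "\<not> N \<subseteq> ?AM"
    have NN: "N \<lhd> G" "N \<subseteq> S" using N minimal_normal_in_socle by (auto simp: minimal_normal_def)
    interpret N: normal N G by (rule NN(1))
    have "N \<inter> ?AM = {\<one>}"
      using N normal_Int[OF NN(1) AM] nsub unfolding minimal_normal_def by blast
    let ?NM = "{n \<otimes> m | n m. n \<in> N \<and> m \<in> M}"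
    have commNM: "x \<otimes> y = y \<otimes> x" if "x \<in> N" "y \<in> M" for x y using that NN MN socle_comm by blast
    have "?NM \<lhd> G" by (rule normal_mult_set[OF NN(1) MN(1) commNM])
    moreover have "?NM \<subseteq> S"
      using NN MN normal_imp_subgroup[OF socle_normal] by (auto intro: subgroup.m_closed)
    moreover have "A \<inter> ?NM = {\<one>}"
    proof -
      have "x = \<one>" if x: "x \<in> A" "x \<in> ?NM" for x
      proof -
        obtain n m where nm: "n \<in> N" "m \<in> M" "x = n \<otimes> m" using x(2) by blast
        then have "n = x \<otimes> inv m" using x(1) by (simp add: m_assoc)
        then have "n \<in> ?AM" using x(1) nm(2) M.m_inv_closed by blast
        then have "n = \<one>" using \<open>N \<inter> ?AM = {\<one>}\<close> nm by blast
        then show ?thesis using x nm MN(3) by auto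
      qed
      moreover have "\<one> \<otimes> \<one> \<in> ?NM" using N.one_closed M.one_closed by blast
      then have "\<one> \<in> ?NM" by simp
      ultimately show ?thesis using A.one_closed by blast
    qed
    ultimately have "?NM \<in> F" by (simp add: F_def)
    moreover have "M \<subseteq> ?NM"
    proof
      fix m assume m: "m \<in> M"
      then have "m = \<one> \<otimes> m" by simp
      then show "m \<in> ?NM" using m N.one_closed by blast
    qed
    ultimately have "?NM = M" by (rule M_max)
    moreover have "N \<subseteq> ?NM"
    proof
      fix n assume n: "n \<in> N"
      then have "n = n \<otimes> \<one>" by simp
      then show "n \<in> ?NM" using n M.one_closed by blast
    qed
    ultimately show False using nsub M_AM by blast
  qed
  then have "S \<subseteq> ?AM"
    unfolding socle_def by (intro generate_subgroup_incl[OF _ AM.subgroup_axioms]) blast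
  then show ?thesis using MN AM_sub by blast
qed

end


section \<open>Equivariant homomorphisms between normal subgroups of the socle\<close>

context finite_rank_solvable_group
begin

definition direct_sum :: "'a set \<Rightarrow> 'a set \<Rightarrow> 'a set \<Rightarrow> bool" where
  "direct_sum B A M \<longleftrightarrow> A \<lhd> G \<and> M \<lhd> G \<and> A \<inter> M = {\<one>} \<and> B = {a \<otimes> m | a m. a \<in> A \<and> m \<in> M} \<and> B \<subseteq> S"

lemma direct_sum_exists:
  assumes B: "B \<lhd> G" "B \<subseteq> S" and A: "A \<lhd> G" "A \<subseteq> B"
  shows "\<exists>M. direct_sum B A M"
proof -
  interpret B: normal B G by (rule B(1))
  interpret A: normal A G by (rule A(1))
  obtain M where M: "M \<lhd> G" "M \<subseteq> S" "A \<inter> M = {\<one>}" "S = {a \<otimes> m | a m. a \<in> A \<and> m \<in> M}"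
    using socle_complement[OF A(1)] A(2) B(2) by blast
  interpret M: normal M G by (rule M(1))
  have "b \<in> {a \<otimes> m | a m. a \<in> A \<and> m \<in> M \<inter> B}" if b: "b \<in> B" for b
  proof -
    obtain a m where am: "a \<in> A" "m \<in> M" "b = a \<otimes> m" using b B(2) M(4) by blast
    then have "inv a \<otimes> b = m" by (simp flip: m_assoc)
    moreover have "inv a \<otimes> b \<in> B" using am(1) A(2) b by (simp add: subsetD)
    ultimately have "m \<in> B" by simp
    then show ?thesis using am by blast
  qed
  moreover have "a \<otimes> m \<in> B" if "a \<in> A" "m \<in> M \<inter> B" for a m using that A(2) by (simp add: subsetD)
  ultimately have "B = {a \<otimes> m | a m. a \<in> A \<and> m \<in> M \<inter> B}" by blast
  moreover have "A \<inter> (M \<inter> B) = {\<one>}" using M(3) A(2) by blast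
  ultimately show ?thesis unfolding direct_sum_def using A(1) normal_Int[OF M(1) B(1)] B(2) by blast
qed

definition equivariant_homs :: "'a set \<Rightarrow> 'a set \<Rightarrow> ('a \<Rightarrow> 'a) set" where
  "equivariant_homs A B = {f \<in> A \<rightarrow>\<^sub>E B.
     (\<forall>x\<in>A. \<forall>y\<in>A. f (x \<otimes> y) = f x \<otimes> f y) \<and> (\<forall>g\<in>carrier G. \<forall>x\<in>A. f (conjugate g x) = conjugate g (f x))}"

lemma equivariant_homsI:
  assumes "\<And>x. x \<in> A \<Longrightarrow> f x \<in> B" "\<And>x y. \<lbrakk>x \<in> A; y \<in> A\<rbrakk> \<Longrightarrow> f (x \<otimes> y) = f x \<otimes> f y"
    "\<And>g x. \<lbrakk>g \<in> carrier G; x \<in> A\<rbrakk> \<Longrightarrow> f (conjugate g x) = conjugate g (f x)" and A: "A \<lhd> G"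
  shows "restrict f A \<in> equivariant_homs A B"
proof -
  interpret A: normal A G by (rule A)
  show ?thesis using assms normal_conjugate[OF A] by (auto simp: equivariant_homs_def)
qed

lemma equivariant_homsD:
  assumes "f \<in> equivariant_homs A B"
  shows "f \<in> A \<rightarrow>\<^sub>E B" "x \<in> A \<Longrightarrow> f x \<in> B" "\<lbrakk>x \<in> A; y \<in> A\<rbrakk> \<Longrightarrow> f (x \<otimes> y) = f x \<otimes> f y"
    "\<lbrakk>g \<in> carrier G; x \<in> A\<rbrakk> \<Longrightarrow> f (conjugate g x) = conjugate g (f x)"
  using assms by (auto simp: equivariant_homs_def)

lemma equivariant_homs_eqI:
  assumes "f \<in> equivariant_homs A B" "g \<in> equivariant_homs A C" "\<And>x. x \<in> A \<Longrightarrow> f x = g x"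
  shows "f = g"
proof
  fix x show "f x = g x"
    using assms equivariant_homsD(1)[OF assms(1)] equivariant_homsD(1)[OF assms(2)]
    by (cases "x \<in> A") (auto simp: PiE_def extensional_def)
qed

lemma finite_equivariant_homs:
  "\<lbrakk>finite A; finite B\<rbrakk> \<Longrightarrow> finite (equivariant_homs A B)"
  by (rule finite_subset[of _ "A \<rightarrow>\<^sub>E B"]) (auto simp: equivariant_homs_def intro: finite_PiE)

lemma equivariant_homs_one:
  assumes "f \<in> equivariant_homs A B" "A \<lhd> G" "B \<subseteq> carrier G"
  shows "f \<one> = \<one>"
proof -
  interpret A: normal A G by fact
  have "f \<one> = f \<one> \<otimes> f \<one>" using equivariant_homsD(3)[OF assms(1), of \<one> \<one>] A.one_closed by simp
  moreover have "f \<one> \<in> carrier G" using equivariant_homsD(2)[OF assms(1) A.one_closed] assms(3) by blast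
  ultimately show ?thesis by (metis l_cancel_one)
qed

lemma equivariant_homs_inv:
  assumes f: "f \<in> equivariant_homs A B" and A: "A \<lhd> G" and B: "B \<subseteq> carrier G" and x: "x \<in> A"
  shows "f (inv x) = inv (f x)"
proof -
  interpret A: normal A G by fact
  have "f (inv x) \<otimes> f x = \<one>"
    using equivariant_homsD(3)[OF f A.m_inv_closed[OF x] x] x equivariant_homs_one[OF f A B] by simp
  moreover have "f (inv x) \<in> carrier G" "f x \<in> carrier G"
    using equivariant_homsD(2)[OF f] A.m_inv_closed[OF x] x B by blast+
  ultimately show ?thesis using inv_equality by force
qed

lemma equivariant_homs_kernel:
  assumes f: "f \<in> equivariant_homs A B" and A: "A \<lhd> G" and B: "B \<subseteq> carrier G"
  shows "{x \<in> A. f x = \<one>} \<lhd> G"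
proof (rule normalI_conjugate)
  interpret A: normal A G by fact
  show "subgroup {x \<in> A. f x = \<one>} G"
  proof (rule subgroupI)
    have "\<one> \<in> {x \<in> A. f x = \<one>}" using equivariant_homs_one[OF f A B] A.one_closed by simp
    then show "{x \<in> A. f x = \<one>} \<noteq> {}" by blast
  qed (auto simp: equivariant_homsD(3)[OF f] equivariant_homs_inv[OF f A B])
  show "conjugate g x \<in> {x \<in> A. f x = \<one>}" if "g \<in> carrier G" "x \<in> {x \<in> A. f x = \<one>}" for g x
    using that equivariant_homsD(4)[OF f] normal_conjugate[OF A] by simp
qed

lemma equivariant_homs_image:
  assumes f: "f \<in> equivariant_homs A B" and A: "A \<lhd> G" and B: "B \<subseteq> carrier G"
  shows "f ` A \<lhd> G"
proof (rule normalI_conjugate)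
  interpret A: normal A G by fact
  show "subgroup (f ` A) G"
  proof (rule subgroupI)
    show "f ` A \<subseteq> carrier G" using equivariant_homsD(2)[OF f] B by blast
    show "f ` A \<noteq> {}" using A.one_closed by blast
    show "inv y \<in> f ` A" if y: "y \<in> f ` A" for y
    proof -
      obtain x where "x \<in> A" "y = f x" using y by auto
      then have "inv y = f (inv x)" "inv x \<in> A" using equivariant_homs_inv[OF f A B] by auto
      then show ?thesis by blast
    qed
    show "y \<otimes> z \<in> f ` A" if yz: "y \<in> f ` A" "z \<in> f ` A" for y z
    proof -
      obtain x w where "x \<in> A" "y = f x" "w \<in> A" "z = f w" using yz by auto
      then have "y \<otimes> z = f (x \<otimes> w)" "x \<otimes> w \<in> A" using equivariant_homsD(3)[OF f] by auto
      then show ?thesis by blast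
    qed
  qed
  show "conjugate g y \<in> f ` A" if g: "g \<in> carrier G" and y: "y \<in> f ` A" for g y
  proof -
    obtain x where "x \<in> A" "y = f x" using y by auto
    then have "conjugate g y = f (conjugate g x)" "conjugate g x \<in> A"
      using equivariant_homsD(4)[OF f g] normal_conjugate[OF A g] by auto
    then show ?thesis by blast
  qed
qed

lemma equivariant_homs_compose:
  assumes f: "f \<in> equivariant_homs A B" and h: "h \<in> equivariant_homs B C" and A: "A \<lhd> G"
  shows "restrict (\<lambda>x. h (f x)) A \<in> equivariant_homs A C"
  by (rule equivariant_homsI) (use A equivariant_homsD[OF f] equivariant_homsD[OF h] in auto)

text \<open>By Schur's lemma a nontrivial homomorphism \<open>f\<close> from \<open>A\<close> to \<open>B\<close> is an isomorphism, and
  \<open>h \<mapsto> f\<inverse> h f\<inverse>\<close> is injective. If there is none, the left hand side is \<open>1\<close>.\<close>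

lemma minimal_homs_card_le:
  assumes A: "minimal_normal A G" "finite A" and B: "minimal_normal B G" "finite B"
  shows "card (equivariant_homs A B) \<le> card (equivariant_homs B A)"
proof -
  have AN: "A \<lhd> G" and BN: "B \<lhd> G" using A B by (auto simp: minimal_normal_def)
  interpret A: normal A G by fact
  interpret B: normal B G by fact
  have AG: "A \<subseteq> carrier G" and BG: "B \<subseteq> carrier G" by (rule A.subset, rule B.subset)
  have fin: "finite (equivariant_homs B A)" by (rule finite_equivariant_homs[OF B(2) A(2)])
  show ?thesis
  proof (cases "\<exists>f\<in>equivariant_homs A B. \<exists>x\<in>A. f x \<noteq> \<one>")
    case True
    then obtain f x where f: "f \<in> equivariant_homs A B" and x: "x \<in> A" "f x \<noteq> \<one>" by blast
    have "{x \<in> A. f x = \<one>} = {\<one>}"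
      using A(1) equivariant_homs_kernel[OF f AN BG] x unfolding minimal_normal_def by blast
    then have ker: "z = \<one>" if "z \<in> A" "f z = \<one>" for z using that by blast
    have inj: "inj_on f A"
    proof (rule inj_onI)
      fix y z assume yz: "y \<in> A" "z \<in> A" "f y = f z"
      then have "f (y \<otimes> inv z) = \<one>"
        using equivariant_homsD(3)[OF f, of y "inv z"] equivariant_homs_inv[OF f AN BG]
          equivariant_homsD(2)[OF f] by simp
      then have "y \<otimes> inv z = \<one>" using ker yz by simp
      then show "y = z" using yz by (metis A.mem_carrier inv_closed inv_equality inv_inv)
    qed
    have "f ` A \<noteq> {\<one>}" using x by blast
    then have surj: "f ` A = B"
      using B(1) equivariant_homs_image[OF f AN BG] equivariant_homsD(2)[OF f]
      unfolding minimal_normal_def by blast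
    define g where "g = the_inv_into A f"
    have fg: "g y \<in> A" "f (g y) = y" if "y \<in> B" for y
      using that the_inv_into_into[OF inj, of y A] f_the_inv_into_f[OF inj, of y] surj by (auto simp: g_def)
    have gf: "g (f x) = x" if "x \<in> A" for x using the_inv_into_f_f[OF inj that] by (simp add: g_def)
    have g: "restrict g B \<in> equivariant_homs B A"
    proof (rule equivariant_homsI[OF fg(1) _ _ BN])
      fix y z assume yz: "y \<in> B" "z \<in> B"
      have "f (g y \<otimes> g z) = y \<otimes> z" using equivariant_homsD(3)[OF f] fg yz by simp
      then show "g (y \<otimes> z) = g y \<otimes> g z" using gf[of "g y \<otimes> g z"] fg(1) yz by simp
    next
      fix h y assume hy: "h \<in> carrier G" "y \<in> B"
      have "f (conjugate h (g y)) = conjugate h y" using equivariant_homsD(4)[OF f] fg hy by simp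
      then show "g (conjugate h y) = conjugate h (g y)"
        using gf[of "conjugate h (g y)"] fg(1) hy normal_conjugate[OF AN] by simp
    qed
    define F where "F \<theta> = restrict (\<lambda>y. restrict g B (restrict (\<lambda>z. \<theta> (restrict g B z)) B y)) B" for \<theta>
    have "F \<theta> \<in> equivariant_homs B A" if "\<theta> \<in> equivariant_homs A B" for \<theta>
      unfolding F_def by (intro equivariant_homs_compose[OF equivariant_homs_compose[OF g that BN] g BN])
    moreover have "inj_on F (equivariant_homs A B)"
    proof (rule inj_onI)
      fix \<theta> \<theta>' assume t: "\<theta> \<in> equivariant_homs A B" "\<theta>' \<in> equivariant_homs A B" "F \<theta> = F \<theta>'"
      show "\<theta> = \<theta>'"
      proof (rule equivariant_homs_eqI[OF t(1,2)])
        fix x assume x: "x \<in> A"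
        then have fx: "f x \<in> B" using equivariant_homsD(2)[OF f] by simp
        have val: "\<theta> x \<in> B" "\<theta>' x \<in> B" using equivariant_homsD(2) t x by auto
        have "F \<theta> (f x) = F \<theta>' (f x)" using t(3) by simp
        then have "g (\<theta> x) = g (\<theta>' x)" using fx val by (simp add: F_def gf x)
        then show "\<theta> x = \<theta>' x" using fg(2) val by metis
      qed
    qed
    ultimately show ?thesis using fin by (intro card_inj_on_le[of F]) auto
  next
    case False
    then have "equivariant_homs A B \<subseteq> {\<lambda>x\<in>A. \<one>}"
      using equivariant_homsD(1) by (fastforce simp: PiE_def extensional_def)
    then have "card (equivariant_homs A B) \<le> 1" using card_mono[of "{\<lambda>x\<in>A. \<one>}"] by fastforce
    moreover have "restrict (\<lambda>x. \<one>) B \<in> equivariant_homs B A"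
      by (rule equivariant_homsI) (use BN A.one_closed in auto)
    then have "card (equivariant_homs B A) > 0" using fin by (auto simp: card_gt_0_iff)
    with \<open>card (equivariant_homs A B) \<le> 1\<close> show ?thesis by simp
  qed
qed

lemma minimal_homs_card_eq:
  assumes "minimal_normal A G" "finite A" "minimal_normal B G" "finite B"
  shows "card (equivariant_homs A B) = card (equivariant_homs B A)"
  using minimal_homs_card_le[OF assms] minimal_homs_card_le[OF assms(3,4,1,2)] by simp

context
  fixes B A M
  assumes ds: "direct_sum B A M"
begin

lemma direct_sum_normal: "A \<lhd> G" "M \<lhd> G" "B \<lhd> G" and direct_sum_S: "B \<subseteq> S" "A \<subseteq> S" "M \<subseteq> S"
  and direct_sum_sub: "A \<subseteq> B" "M \<subseteq> B"
proof -
  have d: "A \<inter> M = {\<one>}" "B = {a \<otimes> m | a m. a \<in> A \<and> m \<in> M}" using ds by (auto simp: direct_sum_def)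
  show AN: "A \<lhd> G" and MN: "M \<lhd> G" and BS: "B \<subseteq> S" using ds by (auto simp: direct_sum_def)
  interpret A: normal A G by (rule AN)
  interpret M: normal M G by (rule MN)
  show AB: "A \<subseteq> B"
  proof
    fix a assume "a \<in> A"
    then have "a = a \<otimes> \<one>" by simp
    then show "a \<in> B" using \<open>a \<in> A\<close> M.one_closed d(2) by blast
  qed
  show MB: "M \<subseteq> B"
  proof
    fix a assume "a \<in> M"
    then have "a = \<one> \<otimes> a" by simp
    then show "a \<in> B" using \<open>a \<in> M\<close> A.one_closed d(2) by blast
  qed
  show "A \<subseteq> S" "M \<subseteq> S" using AB MB BS by auto
  have "x \<otimes> y = y \<otimes> x" if "x \<in> A" "y \<in> M" for x y using that \<open>A \<subseteq> S\<close> \<open>M \<subseteq> S\<close> socle_comm by blast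
  from normal_mult_set[OF AN MN this] show "B \<lhd> G" unfolding d(2) .
qed

lemma direct_sum_unique:
  assumes "a \<in> A" "a' \<in> A" "m \<in> M" "m' \<in> M" "a \<otimes> m = a' \<otimes> m'"
  shows "a = a' \<and> m = m'"
proof -
  interpret A: normal A G by (rule direct_sum_normal)
  interpret M: normal M G by (rule direct_sum_normal)
  have "inv a' \<otimes> a = inv a' \<otimes> (a \<otimes> m) \<otimes> inv m" using assms(1-4) by (simp add: m_assoc)
  also have "\<dots> = m' \<otimes> inv m" using assms by (simp flip: m_assoc)
  finally have eq: "inv a' \<otimes> a = m' \<otimes> inv m" .
  have "inv a' \<otimes> a \<in> A" "m' \<otimes> inv m \<in> M" using assms by auto
  then have one: "inv a' \<otimes> a = \<one>" "m' \<otimes> inv m = \<one>" using eq ds unfolding direct_sum_def by auto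
  have G: "a \<in> carrier G" "a' \<in> carrier G" "m \<in> carrier G" "m' \<in> carrier G" using assms by auto
  have "a = a'" using one(1) G by (metis inv_closed inv_equality inv_inv)
  moreover have "m' = m" using one(2) G by (metis inv_closed inv_equality inv_inv)
  ultimately show ?thesis by simp
qed

definition "proj_left b = (THE a. a \<in> A \<and> (\<exists>m\<in>M. b = a \<otimes> m))"
definition "proj_right b = (THE m. m \<in> M \<and> (\<exists>a\<in>A. b = a \<otimes> m))"

lemma proj_eq: "\<lbrakk>a \<in> A; m \<in> M\<rbrakk> \<Longrightarrow> proj_left (a \<otimes> m) = a" "\<lbrakk>a \<in> A; m \<in> M\<rbrakk> \<Longrightarrow> proj_right (a \<otimes> m) = m"
  unfolding proj_left_def proj_right_def by (rule the_equality; use direct_sum_unique in blast)+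

lemma direct_sumE:
  assumes "b \<in> B"
  obtains a m where "a \<in> A" "m \<in> M" "b = a \<otimes> m"
  using assms ds unfolding direct_sum_def by blast

lemma proj: assumes "b \<in> B"
  shows "proj_left b \<in> A" "proj_right b \<in> M" "b = proj_left b \<otimes> proj_right b"
  using assms by (auto elim!: direct_sumE simp: proj_eq)

lemma direct_sum_mult:
  assumes "a \<in> A" "m \<in> M" "a' \<in> A" "m' \<in> M"
  shows "(a \<otimes> m) \<otimes> (a' \<otimes> m') = (a \<otimes> a') \<otimes> (m \<otimes> m')"
proof -
  interpret A: normal A G by (rule direct_sum_normal)
  interpret M: normal M G by (rule direct_sum_normal)
  have "m \<otimes> a' = a' \<otimes> m" using socle_comm[of m a'] assms direct_sum_S by blast
  then show ?thesis using assms by (intro mult_exchange) auto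
qed

lemma proj_homs: "restrict proj_left B \<in> equivariant_homs B A" "restrict proj_right B \<in> equivariant_homs B M"
proof -
  interpret A: normal A G by (rule direct_sum_normal)
  interpret M: normal M G by (rule direct_sum_normal)
  have c: "conjugate g (a \<otimes> m) = conjugate g a \<otimes> conjugate g m" "conjugate g a \<in> A" "conjugate g m \<in> M"
    if "g \<in> carrier G" "a \<in> A" "m \<in> M" for g a m
    using that normal_conjugate direct_sum_normal by (auto simp: conjugate_mult)
  show "restrict proj_left B \<in> equivariant_homs B A"
  proof (rule equivariant_homsI[OF proj(1) _ _ direct_sum_normal(3)])
    show "proj_left (x \<otimes> y) = proj_left x \<otimes> proj_left y" if "x \<in> B" "y \<in> B" for x y
      using that by (elim direct_sumE) (simp add: proj_eq direct_sum_mult)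
    show "proj_left (conjugate g x) = conjugate g (proj_left x)" if "g \<in> carrier G" "x \<in> B" for g x
      using that by (elim direct_sumE) (simp add: proj_eq c)
  qed
  show "restrict proj_right B \<in> equivariant_homs B M"
  proof (rule equivariant_homsI[OF proj(2) _ _ direct_sum_normal(3)])
    show "proj_right (x \<otimes> y) = proj_right x \<otimes> proj_right y" if "x \<in> B" "y \<in> B" for x y
      using that by (elim direct_sumE) (simp add: proj_eq direct_sum_mult)
    show "proj_right (conjugate g x) = conjugate g (proj_right x)" if "g \<in> carrier G" "x \<in> B" for g x
      using that by (elim direct_sumE) (simp add: proj_eq c)
  qed
qed

text \<open>\<open>Hom(C, A \<oplus> M) = Hom(C, A) \<times> Hom(C, M)\<close>.\<close>

lemma card_homs_into_sum:
  assumes C: "C \<lhd> G"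
  shows "card (equivariant_homs C B) = card (equivariant_homs C A) * card (equivariant_homs C M)"
proof -
  interpret A: normal A G by (rule direct_sum_normal)
  interpret M: normal M G by (rule direct_sum_normal)
  have "bij_betw (\<lambda>(f, h). restrict (\<lambda>x. f x \<otimes> h x) C) (equivariant_homs C A \<times> equivariant_homs C M) (equivariant_homs C B)"
  proof (rule bij_betw_imageI)
    show "inj_on (\<lambda>(f, h). restrict (\<lambda>x. f x \<otimes> h x) C) (equivariant_homs C A \<times> equivariant_homs C M)"
    proof (rule inj_onI, clarify)
      fix f h f' h' assume f: "f \<in> equivariant_homs C A" "f' \<in> equivariant_homs C A"
        and h: "h \<in> equivariant_homs C M" "h' \<in> equivariant_homs C M"
        and eq: "restrict (\<lambda>x. f x \<otimes> h x) C = restrict (\<lambda>x. f' x \<otimes> h' x) C"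
      have *: "f x = f' x \<and> h x = h' x" if "x \<in> C" for x
        using fun_cong[OF eq, of x] that equivariant_homsD(2)[OF f(1)] equivariant_homsD(2)[OF f(2)]
          equivariant_homsD(2)[OF h(1)] equivariant_homsD(2)[OF h(2)]
        by (intro direct_sum_unique) auto
      show "f = f' \<and> h = h'" using equivariant_homs_eqI[OF f] equivariant_homs_eqI[OF h] * by blast
    qed
    show "(\<lambda>(f, h). restrict (\<lambda>x. f x \<otimes> h x) C) ` (equivariant_homs C A \<times> equivariant_homs C M) = equivariant_homs C B"
    proof (intro subset_antisym subsetI)
      fix k assume "k \<in> (\<lambda>(f, h). restrict (\<lambda>x. f x \<otimes> h x) C) ` (equivariant_homs C A \<times> equivariant_homs C M)"
      then obtain f h where f: "f \<in> equivariant_homs C A" and h: "h \<in> equivariant_homs C M"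
        and k: "k = restrict (\<lambda>x. f x \<otimes> h x) C" by auto
      note F = equivariant_homsD[OF f] and H = equivariant_homsD[OF h]
      show "k \<in> equivariant_homs C B"
        unfolding k
      proof (rule equivariant_homsI[OF _ _ _ C])
        show "f x \<otimes> h x \<in> B" if "x \<in> C" for x using F(2)[OF that] H(2)[OF that] ds unfolding direct_sum_def by blast
        show "f (x \<otimes> y) \<otimes> h (x \<otimes> y) = f x \<otimes> h x \<otimes> (f y \<otimes> h y)" if "x \<in> C" "y \<in> C" for x y
          using F(2,3) H(2,3) that by (simp add: direct_sum_mult)
        show "f (conjugate g x) \<otimes> h (conjugate g x) = conjugate g (f x \<otimes> h x)" if "g \<in> carrier G" "x \<in> C" for g x
          using F(2,4) H(2,4) that by (simp add: conjugate_mult)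
      qed
    next
      fix k assume k: "k \<in> equivariant_homs C B"
      let ?f = "restrict (\<lambda>x. restrict proj_left B (k x)) C" and ?h = "restrict (\<lambda>x. restrict proj_right B (k x)) C"
      have f: "?f \<in> equivariant_homs C A" and h: "?h \<in> equivariant_homs C M"
        by (rule equivariant_homs_compose[OF k proj_homs(1) C], rule equivariant_homs_compose[OF k proj_homs(2) C])
      have "k x = restrict (\<lambda>x. ?f x \<otimes> ?h x) C x" for x
        using equivariant_homsD(2)[OF k, of x] proj(3)[of "k x"] equivariant_homsD(1)[OF k]
        by (cases "x \<in> C") (auto simp: PiE_def extensional_def)
      then have "k = (\<lambda>(f, h). restrict (\<lambda>x. f x \<otimes> h x) C) (?f, ?h)" by auto
      then show "k \<in> (\<lambda>(f, h). restrict (\<lambda>x. f x \<otimes> h x) C) ` (equivariant_homs C A \<times> equivariant_homs C M)"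
        using f h by blast
    qed
  qed
  from bij_betw_same_card[OF this] show ?thesis by (simp add: card_cartesian_product)
qed

lemma sum_hom:
  assumes f: "f \<in> equivariant_homs A C" and h: "h \<in> equivariant_homs M C" and C: "C \<lhd> G" "C \<subseteq> S"
  shows "restrict (\<lambda>b. f (proj_left b) \<otimes> h (proj_right b)) B \<in> equivariant_homs B C"
proof (rule equivariant_homsI[OF _ _ _ direct_sum_normal(3)])
  interpret A: normal A G by (rule direct_sum_normal)
  interpret M: normal M G by (rule direct_sum_normal)
  interpret C: normal C G by (rule C)
  note F = equivariant_homsD[OF f] and H = equivariant_homsD[OF h]
  show "f (proj_left b) \<otimes> h (proj_right b) \<in> C" if "b \<in> B" for b using F(2) H(2) proj that by simp
  show "f (proj_left (x \<otimes> y)) \<otimes> h (proj_right (x \<otimes> y)) =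
      f (proj_left x) \<otimes> h (proj_right x) \<otimes> (f (proj_left y) \<otimes> h (proj_right y))" if x: "x \<in> B" and y: "y \<in> B" for x y
  proof -
    obtain a m where am: "a \<in> A" "m \<in> M" "x = a \<otimes> m" using x by (rule direct_sumE)
    obtain a' m' where am': "a' \<in> A" "m' \<in> M" "y = a' \<otimes> m'" using y by (rule direct_sumE)
    have cl: "f a \<in> C" "f a' \<in> C" "h m \<in> C" "h m' \<in> C" using F H am am' by auto
    have "h m \<otimes> f a' = f a' \<otimes> h m" using socle_comm[of "h m" "f a'"] cl C(2) by blast
    then have "f a \<otimes> h m \<otimes> (f a' \<otimes> h m') = f a \<otimes> f a' \<otimes> (h m \<otimes> h m')" using cl by (intro mult_exchange) auto
    then show ?thesis using am am' F(3) H(3) by (simp add: direct_sum_mult proj_eq)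
  qed
  show "f (proj_left (conjugate g x)) \<otimes> h (proj_right (conjugate g x)) = conjugate g (f (proj_left x) \<otimes> h (proj_right x))"
    if g: "g \<in> carrier G" and x: "x \<in> B" for g x
  proof -
    obtain a m where am: "a \<in> A" "m \<in> M" "x = a \<otimes> m" using x by (rule direct_sumE)
    have "conjugate g x = conjugate g a \<otimes> conjugate g m" "conjugate g a \<in> A" "conjugate g m \<in> M"
      using am g normal_conjugate direct_sum_normal by (auto simp: conjugate_mult)
    then show ?thesis using am F(2,4) H(2,4) g by (simp add: proj_eq conjugate_mult)
  qed
qed

text \<open>\<open>Hom(A \<oplus> M, C) = Hom(A, C) \<times> Hom(M, C)\<close>.\<close>

lemma card_homs_from_sum:
  assumes C: "C \<lhd> G" "C \<subseteq> S"
  shows "card (equivariant_homs B C) = card (equivariant_homs A C) * card (equivariant_homs M C)"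
proof -
  interpret A: normal A G by (rule direct_sum_normal)
  interpret M: normal M G by (rule direct_sum_normal)
  interpret C: normal C G by (rule C)
  have res: "restrict k A \<in> equivariant_homs A C" "restrict k M \<in> equivariant_homs M C" if k: "k \<in> equivariant_homs B C" for k
    by (rule equivariant_homsI; use equivariant_homsD[OF k] direct_sum_sub direct_sum_normal in blast)+
  have "bij_betw (\<lambda>k. (restrict k A, restrict k M)) (equivariant_homs B C) (equivariant_homs A C \<times> equivariant_homs M C)"
  proof (rule bij_betw_imageI)
    show "inj_on (\<lambda>k. (restrict k A, restrict k M)) (equivariant_homs B C)"
    proof (rule inj_onI)
      fix k k' assume k: "k \<in> equivariant_homs B C" "k' \<in> equivariant_homs B C"
        and eq: "(restrict k A, restrict k M) = (restrict k' A, restrict k' M)"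
      show "k = k'"
      proof (rule equivariant_homs_eqI[OF k])
        fix x assume "x \<in> B"
        then obtain a m where am: "a \<in> A" "m \<in> M" "x = a \<otimes> m" by (rule direct_sumE)
        have "k a = k' a" "k m = k' m" using eq am by (metis prod.inject restrict_apply')+
        then show "k x = k' x"
          using equivariant_homsD(3)[OF k(1)] equivariant_homsD(3)[OF k(2)] am direct_sum_sub by (metis subsetD)
      qed
    qed
    show "(\<lambda>k. (restrict k A, restrict k M)) ` equivariant_homs B C = equivariant_homs A C \<times> equivariant_homs M C"
    proof (intro subset_antisym subsetI)
      fix p assume "p \<in> (\<lambda>k. (restrict k A, restrict k M)) ` equivariant_homs B C"
      then show "p \<in> equivariant_homs A C \<times> equivariant_homs M C" using res by auto
    next
      fix p assume "p \<in> equivariant_homs A C \<times> equivariant_homs M C"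
      then obtain f h where p: "p = (f, h)" and f: "f \<in> equivariant_homs A C" and h: "h \<in> equivariant_homs M C" by auto
      let ?k = "restrict (\<lambda>b. f (proj_left b) \<otimes> h (proj_right b)) B"
      have k: "?k \<in> equivariant_homs B C" by (rule sum_hom[OF f h C])
      have CG: "C \<subseteq> carrier G" by (rule C.subset)
      have one: "f \<one> = \<one>" "h \<one> = \<one>" using equivariant_homs_one direct_sum_normal f h CG by auto
      have "restrict ?k A = f"
      proof (rule equivariant_homs_eqI[OF res(1)[OF k] f])
        fix x assume x: "x \<in> A"
        then show "restrict ?k A x = f x"
          using proj_eq[of x \<one>] one direct_sum_sub(1) equivariant_homsD(2)[OF f x] by (simp add: subsetD)
      qed
      moreover have "restrict ?k M = h"
      proof (rule equivariant_homs_eqI[OF res(2)[OF k] h])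
        fix x assume x: "x \<in> M"
        then show "restrict ?k M x = h x"
          using proj_eq[of \<one> x] one direct_sum_sub(2) equivariant_homsD(2)[OF h x] by (simp add: subsetD)
      qed
      ultimately have "p = (\<lambda>k. (restrict k A, restrict k M)) ?k" using p by simp
      then show "p \<in> (\<lambda>k. (restrict k A, restrict k M)) ` equivariant_homs B C" using k by (rule image_eqI)
    qed
  qed
  from bij_betw_same_card[OF this] show ?thesis by (simp add: card_cartesian_product)
qed

end

text \<open>Both sides are multiplicative in \<open>B\<close>, which is a direct sum of minimal normal subgroups, and for a
  minimal normal \<open>B\<close> they agree by Schur's lemma.\<close>

lemma minimal_homs_symmetric:
  assumes A: "minimal_normal A G" "finite A" and B: "B \<lhd> G" "B \<subseteq> S" "finite B"
  shows "card (equivariant_homs A B) = card (equivariant_homs B A)"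
  using B
proof (induction "card B" arbitrary: B rule: less_induct)
  case less
  have AN: "A \<lhd> G" and AS: "A \<subseteq> S" using A minimal_normal_in_socle by (auto simp: minimal_normal_def)
  interpret A: normal A G by (rule AN)
  interpret B: normal B G by (rule less.prems(1))
  show ?case
  proof (cases "B = {\<one>}")
    case True
    have "equivariant_homs A {\<one>} = {\<lambda>x\<in>A. \<one>}"
    proof
      show "equivariant_homs A {\<one>} \<subseteq> {\<lambda>x\<in>A. \<one>}"
        using equivariant_homsD(1) by (fastforce simp: PiE_def extensional_def)
      show "{\<lambda>x\<in>A. \<one>} \<subseteq> equivariant_homs A {\<one>}" using equivariant_homsI[of A "\<lambda>x. \<one>" "{\<one>}"] AN by simp
    qed
    moreover have "equivariant_homs {\<one>} A = {\<lambda>x\<in>{\<one>}. \<one>}"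
    proof
      show "equivariant_homs {\<one>} A \<subseteq> {\<lambda>x\<in>{\<one>}. \<one>}"
      proof
        fix f assume f: "f \<in> equivariant_homs {\<one>} A"
        then have "f \<one> = \<one>" using equivariant_homs_one[OF f one_is_normal A.subset] by simp
        then show "f \<in> {\<lambda>x\<in>{\<one>}. \<one>}" using equivariant_homsD(1)[OF f] by (auto simp: PiE_def extensional_def)
      qed
      show "{\<lambda>x\<in>{\<one>}. \<one>} \<subseteq> equivariant_homs {\<one>} A"
        using equivariant_homsI[of "{\<one>}" "\<lambda>x. \<one>" A] one_is_normal A.one_closed by simp
    qed
    ultimately show ?thesis using True by simp
  next
    case False
    then obtain D where D: "minimal_normal D G" "D \<subseteq> B" using exists_minimal_normal less.prems by blast
    have DN: "D \<lhd> G" using D by (simp add: minimal_normal_def)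
    obtain M where ds: "direct_sum B D M" using direct_sum_exists[OF less.prems(1,2) DN D(2)] by blast
    note facts = direct_sum_normal[OF ds] direct_sum_S[OF ds] direct_sum_sub[OF ds]
    obtain d where d: "d \<in> D" "d \<noteq> \<one>"
      using D(1) subgroup.one_closed[OF normal_imp_subgroup[OF DN]] unfolding minimal_normal_def by blast
    then have "d \<notin> M" using ds unfolding direct_sum_def by blast
    then have "M \<subset> B" using facts d by blast
    then have "card M < card B" "finite M" "finite D"
      using less.prems(3) facts by (auto intro: psubset_card_mono finite_subset)
    then have "card (equivariant_homs A M) = card (equivariant_homs M A)" using less.hyps[of M] facts by blast
    then show ?thesis
      using card_homs_into_sum[OF ds AN] card_homs_from_sum[OF ds AN AS]
        minimal_homs_card_eq[OF A D(1) \<open>finite D\<close>] by simp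
  qed
qed

end


section \<open>Cyclic modules and core-free functionals\<close>

context group
begin

text \<open>The homomorphisms from \<open>A\<close> to \<open>\<int>/p\<close>, with representatives \<open>0, \<dots>, p - 1\<close> of the residue classes as
  values.\<close>

definition zp_homs :: "nat \<Rightarrow> 'a set \<Rightarrow> ('a \<Rightarrow> int) set" where
  "zp_homs p A = {c \<in> A \<rightarrow>\<^sub>E {0..<int p}. \<forall>x\<in>A. \<forall>y\<in>A. c (x \<otimes> y) = (c x + c y) mod int p}"

lemma zp_homsD:
  assumes "c \<in> zp_homs p A"
  shows "c \<in> A \<rightarrow>\<^sub>E {0..<int p}" "x \<in> A \<Longrightarrow> c x \<in> {0..<int p}"
    "\<lbrakk>x \<in> A; y \<in> A\<rbrakk> \<Longrightarrow> c (x \<otimes> y) = (c x + c y) mod int p"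
  using assms by (auto simp: zp_homs_def)

lemma zp_homs_mod: "\<lbrakk>c \<in> zp_homs p A; x \<in> A\<rbrakk> \<Longrightarrow> c x mod int p = c x"
  using zp_homsD(2)[of c p A x] by simp

lemma zp_homsI:
  assumes "\<And>x y. \<lbrakk>x \<in> A; y \<in> A\<rbrakk> \<Longrightarrow> c (x \<otimes> y) mod int p = (c x + c y) mod int p" "p > 0" "subgroup A G"
  shows "(\<lambda>x\<in>A. c x mod int p) \<in> zp_homs p A"
  using assms subgroup.m_closed[OF assms(3)] by (auto simp: zp_homs_def mod_simps)

lemma zp_homs_eqI:
  assumes "c \<in> zp_homs p A" "d \<in> zp_homs q A" "\<And>x. x \<in> A \<Longrightarrow> c x = d x"
  shows "c = d"
proof
  fix x show "c x = d x"
    using assms zp_homsD(1)[OF assms(1)] zp_homsD(1)[OF assms(2)]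
    by (cases "x \<in> A") (auto simp: PiE_def extensional_def)
qed

lemma finite_zp_homs: "finite A \<Longrightarrow> finite (zp_homs p A)"
  by (rule finite_subset[of _ "A \<rightarrow>\<^sub>E {0..<int p}"]) (auto simp: zp_homs_def intro: finite_PiE)

lemma zp_homs_one:
  assumes c: "c \<in> zp_homs p A" and A: "subgroup A G"
  shows "c \<one> = 0"
proof -
  have one: "\<one> \<in> A" by (rule subgroup.one_closed[OF A])
  have "(c \<one> + c \<one>) mod int p = c \<one> mod int p"
    using zp_homsD(3)[OF c one one] zp_homs_mod[OF c one] by simp
  then have "int p dvd c \<one>" by (simp add: mod_eq_dvd_iff)
  then show ?thesis using zp_homs_mod[OF c one] by (simp add: dvd_eq_mod_eq_0)
qed

lemma zp_homs_pow:
  assumes c: "c \<in> zp_homs p A" and A: "subgroup A G" and x: "x \<in> A"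
  shows "c (x [^] (n::nat)) = (int n * c x) mod int p"
proof (induction n)
  case 0
  then show ?case using zp_homs_one[OF c A] by simp
next
  case (Suc n)
  have "c (x [^] Suc n) = (c (x [^] n) + c x) mod int p"
    using zp_homsD(3)[OF c subgroup_nat_pow_closed[OF A x] x, of n] by simp
  also have "\<dots> = (int (Suc n) * c x) mod int p" using Suc by (simp add: mod_simps algebra_simps)
  finally show ?case .
qed

lemma zp_homs_inv:
  assumes c: "c \<in> zp_homs p A" and A: "subgroup A G" and x: "x \<in> A"
  shows "c (inv x) = (- c x) mod int p"
proof -
  interpret A: subgroup A G by (rule A)
  have "(c (inv x) + c x) mod int p = 0"
    using zp_homsD(3)[OF c A.m_inv_closed[OF x] x] x zp_homs_one[OF c A] by simp
  then have "int p dvd c (inv x) - (- c x)" by (simp add: dvd_eq_mod_eq_0)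
  then have "c (inv x) mod int p = (- c x) mod int p" by (rule mod_eq_dvd_iff[THEN iffD2])
  then show ?thesis using zp_homs_mod[OF c A.m_inv_closed[OF x]] by simp
qed

lemma elementary_extension:
  assumes p: "Factorial_Ring.prime (p::nat)" and A: "subgroup A G" and exp: "\<And>x. x \<in> A \<Longrightarrow> x [^] p = \<one>"
    and comm: "\<And>x y. \<lbrakk>x \<in> A; y \<in> A\<rbrakk> \<Longrightarrow> x \<otimes> y = y \<otimes> x"
    and D: "subgroup D G" "D \<subseteq> A" and a: "a \<in> A" "a \<notin> D" and gen: "A = {d \<otimes> a [^] (i::nat) | d i. d \<in> D}"
  shows "bij_betw (\<lambda>(d, i). d \<otimes> a [^] i) (D \<times> {..<p}) A"
proof (rule bij_betw_imageI)
  interpret A: subgroup A G by (rule A)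
  interpret D: subgroup D G by (rule D)
  have aG: "a \<in> carrier G" using a by simp
  have apow: "a [^] i = a [^] (i mod p)" for i
  proof -
    have "a [^] (p * (i div p) + i mod p) = (a [^] p) [^] (i div p) \<otimes> a [^] (i mod p)"
      using aG by (simp add: nat_pow_mult nat_pow_pow)
    then show ?thesis using exp[OF a(1)] aG by simp
  qed
  have le: False if "d \<in> D" "d' \<in> D" "i < j" "j < p" "d \<otimes> a [^] i = d' \<otimes> a [^] j" for d d' i j
  proof -
    have "d \<otimes> a [^] i = d' \<otimes> a [^] (j - i) \<otimes> a [^] i"
      using that aG by (simp add: m_assoc nat_pow_mult)
    then have "d = d' \<otimes> a [^] (j - i)" using that aG by simp
    then have "a [^] (j - i) = inv d' \<otimes> d" using that aG by (simp flip: m_assoc)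
    then have "a [^] (j - i) \<in> D" using that by simp
    moreover have "\<not> p dvd (j - i)" using that by (simp add: nat_dvd_not_less)
    ultimately show False using power_cancel_prime[OF D(1) aG p exp[OF a(1)]] a(2) by blast
  qed
  show "inj_on (\<lambda>(d, i). d \<otimes> a [^] i) (D \<times> {..<p})"
  proof (rule inj_onI)
    fix u v assume uv: "u \<in> D \<times> {..<p}" "v \<in> D \<times> {..<p}"
      "(\<lambda>(d, i). d \<otimes> a [^] i) u = (\<lambda>(d, i). d \<otimes> a [^] i) v"
    then obtain d i d' j where *: "u = (d, i)" "v = (d', j)" "d \<in> D" "i < p" "d' \<in> D" "j < p"
      "d \<otimes> a [^] i = d' \<otimes> a [^] j" by auto
    then have "i = j" using le[of d d' i j] le[of d' d j i] by (metis linorder_neqE_nat)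
    moreover from this have "d = d'" using * aG by simp
    ultimately show "u = v" using * by simp
  qed
  show "(\<lambda>(d, i). d \<otimes> a [^] i) ` (D \<times> {..<p}) = A"
  proof
    show "(\<lambda>(d, i). d \<otimes> a [^] i) ` (D \<times> {..<p}) \<subseteq> A"
      using D(2) a subgroup_nat_pow_closed[OF A] by auto
    show "A \<subseteq> (\<lambda>(d, i). d \<otimes> a [^] i) ` (D \<times> {..<p})"
    proof
      fix x assume "x \<in> A"
      then obtain d i where "d \<in> D" "x = d \<otimes> a [^] (i::nat)" using gen by blast
      then have "x = (\<lambda>(d, i). d \<otimes> a [^] i) (d, i mod p)" using apow by simp
      then show "x \<in> (\<lambda>(d, i). d \<otimes> a [^] i) ` (D \<times> {..<p})"
        using \<open>d \<in> D\<close> prime_gt_0_nat[OF p] by (intro image_eqI[of _ _ "(d, i mod p)"]) auto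
    qed
  qed
qed

text \<open>The dual of a finite vector space over \<open>\<int>/p\<close> has the same size as the space. In the induction,
  \<open>A = D \<oplus> \<langle>a\<rangle>\<close> for a maximal proper subgroup \<open>D\<close>, and a functional is given by its restriction to \<open>D\<close>
  and its value at \<open>a\<close>.\<close>

lemma card_zp_homs:
  assumes p: "Factorial_Ring.prime (p::nat)" and A: "subgroup A G" "finite A" and exp: "\<And>x. x \<in> A \<Longrightarrow> x [^] p = \<one>"
    and comm: "\<And>x y. \<lbrakk>x \<in> A; y \<in> A\<rbrakk> \<Longrightarrow> x \<otimes> y = y \<otimes> x"
  shows "card (zp_homs p A) = card A"
  using A exp comm
proof (induction "card A" arbitrary: A rule: less_induct)
  case (less A)
  interpret A: subgroup A G by (rule less.prems(1))
  have p0: "p > 0" using p prime_gt_0_nat by blast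
  show ?case
  proof (cases "A = {\<one>}")
    case True
    have "zp_homs p {\<one>} = {\<lambda>x\<in>{\<one>}. 0}"
    proof (intro subset_antisym subsetI)
      fix c assume c: "c \<in> zp_homs p {\<one>}"
      then show "c \<in> {\<lambda>x\<in>{\<one>}. 0}"
        using zp_homs_one[OF c triv_subgroup] zp_homsD(1)[OF c] by (auto simp: PiE_def extensional_def)
    next
      fix c assume "c \<in> {\<lambda>x\<in>{\<one>}. 0::int}"
      then show "c \<in> zp_homs p {\<one>}" using zp_homsI[of "{\<one>}" "\<lambda>x. 0" p] p0 triv_subgroup by simp
    qed
    then show ?thesis using True by simp
  next
    case False
    define P where "P D \<longleftrightarrow> subgroup D G \<and> D \<subset> A" for D
    have "P {\<one>}" using False triv_subgroup A.one_closed by (auto simp: P_def)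
    moreover have "\<forall>D. P D \<longrightarrow> card D < card A" using less.prems(2) by (auto simp: P_def intro: psubset_card_mono)
    ultimately have "\<exists>D. P D \<and> (\<forall>E. P E \<longrightarrow> card E \<le> card D)"
      by (rule ex_has_greatest_nat)
    then obtain D where D: "subgroup D G" "D \<subset> A" and D_max: "\<And>E. P E \<Longrightarrow> card E \<le> card D"
      by (auto simp: P_def)
    interpret D: subgroup D G by (rule D(1))
    obtain a where a: "a \<in> A" "a \<notin> D" using D(2) by blast
    have aG: "a \<in> carrier G" using a by simp
    have finD: "finite D" and cardD: "card D < card A"
      using D(2) less.prems(2) by (auto intro: finite_subset psubset_card_mono)
    define E where "E = {d \<otimes> a [^] (i::nat) | d i. d \<in> D}"
    have EA: "E \<subseteq> A" unfolding E_def using D(2) subgroup_nat_pow_closed[OF A.subgroup_axioms a(1)] by auto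
    have pa: "a [^] p = \<one>" by (rule less.prems(3)[OF a(1)])
    have apA: "a [^] (i::nat) \<in> A" for i by (rule subgroup_nat_pow_closed[OF A.subgroup_axioms a(1)])
    have DE: "D \<subseteq> E"
    proof
      fix d assume "d \<in> D"
      then have "d = d \<otimes> a [^] (0::nat)" by simp
      then show "d \<in> E" unfolding E_def using \<open>d \<in> D\<close> by blast
    qed
    have aE: "a \<in> E"
    proof -
      have "a = \<one> \<otimes> a [^] (1::nat)" using aG by simp
      then show ?thesis unfolding E_def using D.one_closed by blast
    qed
    have commDa: "a [^] (i::nat) \<otimes> d = d \<otimes> a [^] i" if "d \<in> D" for i d
      using less.prems(4)[OF apA, of d i] that D(2) by blast
    have E: "subgroup E G"
    proof (rule subgroupI)
      show "E \<subseteq> carrier G" "E \<noteq> {}" using EA A.subset aE by auto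
    next
      fix x assume "x \<in> E"
      then obtain d i where x: "d \<in> D" "x = d \<otimes> a [^] (i::nat)" by (auto simp: E_def)
      have "a [^] i \<otimes> a [^] (p * i - i) = a [^] (p * i)" using aG p0 by (simp add: nat_pow_mult)
      also have "\<dots> = \<one>" using pa aG by (simp flip: nat_pow_pow)
      finally have "inv (a [^] i) = a [^] (p * i - i)"
        using aG by (metis inv_equality inv_inv nat_pow_closed)
      then have "inv x = a [^] (p * i - i) \<otimes> inv d" using x aG by (simp add: inv_mult_group)
      then have "inv x = inv d \<otimes> a [^] (p * i - i)" using commDa x by simp
      then show "inv x \<in> E" unfolding E_def using x D.m_inv_closed by blast
    next
      fix x y assume "x \<in> E" "y \<in> E"
      then obtain d i d' j where x: "d \<in> D" "x = d \<otimes> a [^] (i::nat)" and y: "d' \<in> D" "y = d' \<otimes> a [^] (j::nat)"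
        by (auto simp: E_def)
      have "x \<otimes> y = (d \<otimes> d') \<otimes> a [^] (i + j)"
        using x y aG commDa[of d' i] mult_exchange[of d "a [^] i" d' "a [^] j"] by (simp add: nat_pow_mult)
      then show "x \<otimes> y \<in> E" unfolding E_def using x y D.m_closed by blast
    qed
    have EeqA: "E = A"
    proof (rule ccontr)
      assume "E \<noteq> A"
      then have "card E \<le> card D" using D_max E EA by (auto simp: P_def)
      moreover have "D \<subset> E" "finite E" using DE aE a EA less.prems(2) finite_subset by auto
      ultimately show False using psubset_card_mono[of E D] by simp
    qed
    have bij: "bij_betw (\<lambda>(d, i). d \<otimes> a [^] i) (D \<times> {..<p}) A"
      by (rule elementary_extension[OF p A.subgroup_axioms less.prems(3,4) D(1) _ a])
         (use D(2) EeqA E_def in auto)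
    then have cA: "card A = card D * p" by (auto dest: bij_betw_same_card simp: card_cartesian_product)
    have expD: "x [^] p = \<one>" and commD: "x \<otimes> y = y \<otimes> x" if "x \<in> D" "y \<in> D" for x y
      using less.prems(3)[of x] less.prems(4)[of x y] that D(2) by auto
    have "card (zp_homs p D) = card D"
      by (rule less.hyps[OF cardD D(1) finD expD commD])
    moreover have "bij_betw (\<lambda>c. (restrict c D, c a)) (zp_homs p A) (zp_homs p D \<times> {0..<int p})"
    proof (rule bij_betw_imageI)
      show "inj_on (\<lambda>c. (restrict c D, c a)) (zp_homs p A)"
      proof (rule inj_onI)
        fix c c' assume c: "c \<in> zp_homs p A" "c' \<in> zp_homs p A" and eq: "(restrict c D, c a) = (restrict c' D, c' a)"
        show "c = c'"
        proof (rule zp_homs_eqI[OF c])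
          fix x assume "x \<in> A"
          then obtain d i where x: "d \<in> D" "x = d \<otimes> a [^] (i::nat)" using EeqA by (auto simp: E_def)
          have dA: "d \<in> A" using x D by blast
          have "c d = c' d" using eq x(1) by (metis prod.inject restrict_apply')
          then show "c x = c' x"
            using x(2) eq zp_homsD(3)[OF c(1) dA apA] zp_homsD(3)[OF c(2) dA apA]
              zp_homs_pow[OF c(1) A.subgroup_axioms a(1)] zp_homs_pow[OF c(2) A.subgroup_axioms a(1)] by simp
        qed
      qed
      show "(\<lambda>c. (restrict c D, c a)) ` zp_homs p A = zp_homs p D \<times> {0..<int p}"
      proof (intro subset_antisym subsetI)
        fix q assume "q \<in> (\<lambda>c. (restrict c D, c a)) ` zp_homs p A"
        then obtain c where c: "c \<in> zp_homs p A" "q = (restrict c D, c a)" by blast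
        have "restrict c D \<in> zp_homs p D"
          using zp_homsD(2,3)[OF c(1)] D(2) by (auto simp: zp_homs_def subset_iff psubset_eq)
        then show "q \<in> zp_homs p D \<times> {0..<int p}" using c zp_homsD(2)[OF c(1) a(1)] by simp
      next
        fix q assume "q \<in> zp_homs p D \<times> {0..<int p}"
        then obtain c k where q: "q = (c, k)" and c: "c \<in> zp_homs p D" and k: "0 \<le> k" "k < int p" by auto
        define inv_map where "inv_map = the_inv_into (D \<times> {..<p}) (\<lambda>(d, i). d \<otimes> a [^] (i::nat))"
        have inv_eq: "inv_map (d \<otimes> a [^] i) = (d, i)" if "d \<in> D" "i < p" for d i
          using the_inv_into_f_f[OF bij_betw_imp_inj_on[OF bij], of "(d, i)"] that by (simp add: inv_map_def)
        define e where "e x = c (fst (inv_map x)) + int (snd (inv_map x)) * k" for x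
        have e_eq: "e (d \<otimes> a [^] i) mod int p = (c d + int i * k) mod int p" if d: "d \<in> D" for d and i :: nat
        proof -
          have "a [^] (p * (i div p) + i mod p) = (a [^] p) [^] (i div p) \<otimes> a [^] (i mod p)"
            using aG by (simp add: nat_pow_mult nat_pow_pow)
          then have "a [^] i = a [^] (i mod p)" using pa aG by simp
          then have "e (d \<otimes> a [^] i) = c d + int (i mod p) * k"
            using inv_eq[OF d, of "i mod p"] p0 by (simp add: e_def)
          moreover have "int (i mod p) * k mod int p = int i * k mod int p"
            by (simp add: of_nat_mod mod_mult_left_eq)
          ultimately show ?thesis by (metis mod_add_right_eq)
        qed
        have "(\<lambda>x\<in>A. e x mod int p) \<in> zp_homs p A"
        proof (rule zp_homsI[OF _ p0 A.subgroup_axioms])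
          fix x y assume "x \<in> A" "y \<in> A"
          then obtain d i d' j where x: "d \<in> D" "x = d \<otimes> a [^] (i::nat)" and y: "d' \<in> D" "y = d' \<otimes> a [^] (j::nat)"
            using EeqA by (auto simp: E_def)
          have "x \<otimes> y = (d \<otimes> d') \<otimes> a [^] (i + j)"
            using x y aG commDa[of d' i] mult_exchange[of d "a [^] i" d' "a [^] j"] by (simp add: nat_pow_mult)
          then have "e (x \<otimes> y) mod int p = (c (d \<otimes> d') + int (i + j) * k) mod int p" using e_eq x y by simp
          also have "\<dots> = (c d + c d' + int (i + j) * k) mod int p"
            using zp_homsD(3)[OF c x(1) y(1)] by (simp add: mod_add_left_eq)
          also have "c d + c d' + int (i + j) * k = (c d + int i * k) + (c d' + int j * k)"
            by (simp add: algebra_simps)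
          also have "\<dots> mod int p = ((c d + int i * k) mod int p + (c d' + int j * k) mod int p) mod int p"
            by (rule mod_add_eq[symmetric])
          also have "\<dots> = (e x mod int p + e y mod int p) mod int p" using e_eq x y by simp
          also have "\<dots> = (e x + e y) mod int p" by (rule mod_add_eq)
          finally show "e (x \<otimes> y) mod int p = (e x + e y) mod int p" .
        qed
        moreover have "restrict (\<lambda>x\<in>A. e x mod int p) D = c"
        proof (rule ext)
          fix x show "restrict (\<lambda>x\<in>A. e x mod int p) D x = c x"
          proof (cases "x \<in> D")
            case True
            then have "e x mod int p = c x" using e_eq[OF True, of 0] zp_homs_mod[OF c True] by simp
            then show ?thesis using True D(2) by auto
          qed (use zp_homsD(1)[OF c] in \<open>auto simp: PiE_def extensional_def\<close>)
        qed
        moreover have "(\<lambda>x\<in>A. e x mod int p) a = k"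
          using e_eq[OF D.one_closed, of 1] zp_homs_one[OF c D(1)] k a aG by simp
        ultimately show "q \<in> (\<lambda>c. (restrict c D, c a)) ` zp_homs p A" unfolding q by (intro image_eqI) auto
      qed
    qed
    then have "card (zp_homs p A) = card (zp_homs p D) * p"
      by (auto dest: bij_betw_same_card simp: card_cartesian_product)
    ultimately show ?thesis using cA by simp
  qed
qed

text \<open>For a finite elementary abelian \<open>B\<close> this means that \<open>c\<close> generates the dual of \<open>B\<close> as a module.\<close>

definition core_free :: "('a \<Rightarrow> int) \<Rightarrow> 'a set \<Rightarrow> bool" where
  "core_free c B \<longleftrightarrow> (\<forall>N. N \<lhd> G \<and> N \<subseteq> B \<and> (\<forall>x\<in>N. c x = 0) \<longrightarrow> N = {\<one>})"

end

context finite_rank_solvable_group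
begin

lemma equivariant_homs_restrict:
  assumes f: "f \<in> equivariant_homs B A" and L: "L \<lhd> G" "L \<subseteq> B"
  shows "restrict f L \<in> equivariant_homs L A"
proof (rule equivariant_homsI[OF _ _ _ L(1)])
  have LB: "x \<in> B" if "x \<in> L" for x using that L(2) by blast
  show "f x \<in> A" if "x \<in> L" for x by (rule equivariant_homsD(2)[OF f LB[OF that]])
  show "f (x \<otimes> y) = f x \<otimes> f y" if "x \<in> L" "y \<in> L" for x y
    by (rule equivariant_homsD(3)[OF f LB[OF that(1)] LB[OF that(2)]])
  show "f (conjugate g x) = conjugate g (f x)" if "g \<in> carrier G" "x \<in> L" for g x
    by (rule equivariant_homsD(4)[OF f that(1) LB[OF that(2)]])
qed

lemma equivariant_homs_equalizer:
  assumes f: "f \<in> equivariant_homs M A" and h: "h \<in> equivariant_homs M A" and M: "M \<lhd> G" and A: "A \<subseteq> carrier G"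
  shows "{y \<in> M. f y = h y} \<lhd> G"
proof (rule normalI_conjugate)
  interpret M: normal M G by (rule M)
  show "subgroup {y \<in> M. f y = h y} G"
  proof (rule subgroupI)
    have "\<one> \<in> {y \<in> M. f y = h y}" using equivariant_homs_one[OF f M A] equivariant_homs_one[OF h M A] by simp
    then show "{y \<in> M. f y = h y} \<noteq> {}" by blast
  qed (auto simp: equivariant_homs_inv[OF f M A] equivariant_homs_inv[OF h M A]
      equivariant_homsD(3)[OF f] equivariant_homsD(3)[OF h])
  show "conjugate g y \<in> {y \<in> M. f y = h y}" if "g \<in> carrier G" "y \<in> {y \<in> M. f y = h y}" for g y
    using that equivariant_homsD(4)[OF f] equivariant_homsD(4)[OF h] normal_conjugate[OF M] by simp
qed

text \<open>A proper submodule of \<open>A \<oplus> M\<close> that projects onto \<open>M\<close> is the graph of a homomorphism \<open>M \<rightarrow> A\<close>, since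
  \<open>A\<close> is simple. So \<open>a m\<close> generates \<open>A \<oplus> M\<close> if and only if \<open>m\<close> generates \<open>M\<close> and no homomorphism
  \<open>f: M \<rightarrow> A\<close> has \<open>f m = a\<close>. As \<open>m\<close> generates \<open>M\<close>, the homomorphisms are determined by their values at \<open>m\<close>, and
  such an \<open>a\<close> exists if and only if there are fewer than \<open>|A|\<close> of them.\<close>

lemma sum_generator_iff:
  assumes ds: "direct_sum B A M" and A: "minimal_normal A G" and fin: "finite B"
  shows "(\<exists>x\<in>B. normal_closure {x} = B) \<longleftrightarrow>
    (\<exists>m\<in>M. normal_closure {m} = M) \<and> card (equivariant_homs M A) < card A"
proof -
  note N = direct_sum_normal[OF ds] and S = direct_sum_S[OF ds] and sub = direct_sum_sub[OF ds]
  interpret A: normal A G by (rule N(1))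
  interpret M: normal M G by (rule N(2))
  interpret B: normal B G by (rule N(3))
  have AM: "A \<inter> M = {\<one>}" using ds by (simp add: direct_sum_def)
  have finA: "finite A" and finM: "finite M" using fin sub finite_subset by auto
  have finH: "finite (equivariant_homs M A)" by (rule finite_equivariant_homs[OF finM finA])
  have MS: "M \<subseteq> S" and AS: "A \<subseteq> S" using S by auto
  have AG: "A \<subseteq> carrier G" by (rule A.subset)
  have ne: "\<exists>a\<in>A. a \<noteq> \<one>" using A A.one_closed unfolding minimal_normal_def by blast
  have ncB: "normal_closure {x} \<lhd> G" "normal_closure {x} \<subseteq> B" "x \<in> normal_closure {x}" if "x \<in> B" for x
    using normal_closure_normal[of "{x}"] normal_closure_least[OF N(3), of "{x}"] normal_closure_incl[of "{x}"] that by auto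
  show ?thesis
  proof
    assume "\<exists>x\<in>B. normal_closure {x} = B"
    then obtain x where x: "x \<in> B" "normal_closure {x} = B" by blast
    obtain a m where am: "a \<in> A" "m \<in> M" "x = a \<otimes> m" using x(1) by (rule direct_sumE[OF ds])
    have mG: "m \<in> carrier G" using am by simp
    have nm: "normal_closure {m} \<lhd> G" "normal_closure {m} \<subseteq> M" "m \<in> normal_closure {m}"
      using normal_closure_normal[of "{m}"] normal_closure_least[OF N(2), of "{m}"] normal_closure_incl[of "{m}"] am by auto
    have "normal_closure {m} = M"
    proof -
      let ?N = "{a \<otimes> y | a y. a \<in> A \<and> y \<in> normal_closure {m}}"
      have "?N \<lhd> G"
      proof (rule normal_mult_set[OF N(1) nm(1)])
        fix u v assume "u \<in> A" "v \<in> normal_closure {m}"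
        then show "u \<otimes> v = v \<otimes> u" using socle_comm[of u v] AS MS nm(2) by blast
      qed
      moreover have "x \<in> ?N" using am nm(3) by blast
      ultimately have "B \<subseteq> ?N" using normal_closure_least[of ?N "{x}"] x(2) by simp
      have "y \<in> normal_closure {m}" if y: "y \<in> M" for y
      proof -
        have "y \<in> ?N" using \<open>B \<subseteq> ?N\<close> y sub by blast
        then obtain b z where bz: "b \<in> A" "z \<in> normal_closure {m}" "y = b \<otimes> z" by blast
        have zM: "z \<in> M" using bz nm by blast
        have "\<one> \<otimes> y = b \<otimes> z" using bz y by simp
        then have "y = z" using direct_sum_unique[OF ds A.one_closed bz(1) y zM] by simp
        then show ?thesis using bz by simp
      qed
      then show ?thesis using nm(2) by blast
    qed
    moreover have "card (equivariant_homs M A) < card A"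
    proof -
      have "inj_on (\<lambda>f. f m) (equivariant_homs M A)"
      proof (rule inj_onI)
        fix f h assume f: "f \<in> equivariant_homs M A" and h: "h \<in> equivariant_homs M A" and eq: "f m = h m"
        let ?E = "{y \<in> M. f y = h y}"
        have "?E \<lhd> G" by (rule equivariant_homs_equalizer[OF f h N(2) AG])
        then have "normal_closure {m} \<subseteq> ?E" using normal_closure_least[of ?E "{m}"] am eq by simp
        then have "f y = h y" if "y \<in> M" for y using that \<open>normal_closure {m} = M\<close> by blast
        then show "f = h" by (rule equivariant_homs_eqI[OF f h])
      qed
      moreover have "(\<lambda>f. f m) ` equivariant_homs M A \<subseteq> A - {a}"
      proof
        fix z assume "z \<in> (\<lambda>f. f m) ` equivariant_homs M A"
        then obtain f where f: "f \<in> equivariant_homs M A" "z = f m" by blast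
        have "f m \<noteq> a"
        proof
          assume fm: "f m = a"
          let ?h = "restrict (\<lambda>b. f (restrict (proj_right A M) B b)) B"
          let ?E = "{b \<in> B. restrict (proj_left A M) B b = ?h b}"
          have "?h \<in> equivariant_homs B A"
            by (rule equivariant_homs_compose[OF proj_homs(2)[OF ds] f(1) N(3)])
          then have "?E \<lhd> G" by (rule equivariant_homs_equalizer[OF proj_homs(1)[OF ds] _ N(3) AG])
          moreover have "{x} \<subseteq> ?E" using am x(1) fm proj_eq[OF ds am(1,2)] by simp
          ultimately have "B \<subseteq> ?E" using normal_closure_least x(2) by metis
          moreover obtain b where b: "b \<in> A" "b \<noteq> \<one>" using ne by blast
          moreover have bB: "b \<in> B" using b(1) sub by blast
          ultimately have "b \<in> ?E" by blast
          then have "proj_left A M b = f (proj_right A M b)" using bB by simp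
          then have "b = f \<one>" using proj_eq[OF ds b(1) M.one_closed] b(1) by simp
          then show False using b equivariant_homs_one[OF f(1) N(2) AG] by simp
        qed
        then show "z \<in> A - {a}" using f equivariant_homsD(2)[OF f(1) am(2)] by simp
      qed
      ultimately have "card (equivariant_homs M A) \<le> card (A - {a})"
        using finA by (intro card_inj_on_le) auto
      also have "\<dots> < card A" by (rule card_Diff1_less[OF finA am(1)])
      finally show ?thesis .
    qed
    ultimately show "(\<exists>m\<in>M. normal_closure {m} = M) \<and> card (equivariant_homs M A) < card A" using am(2) by blast
  next
    assume asm: "(\<exists>m\<in>M. normal_closure {m} = M) \<and> card (equivariant_homs M A) < card A"
    then obtain m where m: "m \<in> M" "normal_closure {m} = M" by blast
    have "card ((\<lambda>f. f m) ` equivariant_homs M A) < card A" using card_image_le[OF finH, of "\<lambda>f. f m"] asm by simp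
    then obtain a where a: "a \<in> A" "\<And>f. f \<in> equivariant_homs M A \<Longrightarrow> f m \<noteq> a"
      using card_mono[of "(\<lambda>f. f m) ` equivariant_homs M A" A] finH by (metis finite_imageI imageI not_less subsetI)
    define x where "x = a \<otimes> m"
    have xB: "x \<in> B" using a m ds unfolding x_def direct_sum_def by blast
    define L where "L = normal_closure {x}"
    have L: "L \<lhd> G" "L \<subseteq> B" "x \<in> L" using ncB[OF xB] by (auto simp: L_def)
    interpret L: normal L G by (rule L(1))
    have onto: "\<exists>c\<in>A. c \<otimes> y \<in> L" if y: "y \<in> M" for y
    proof -
      let ?N = "{y \<in> M. \<exists>c\<in>A. c \<otimes> y \<in> L}"
      have "?N \<lhd> G"
      proof (rule normalI_conjugate)
        show "subgroup ?N G"
        proof (rule subgroupI)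
          have "\<one> \<otimes> \<one> \<in> L" using L.one_closed by simp
          then show "?N \<noteq> {}" using M.one_closed A.one_closed by blast
          fix y assume "y \<in> ?N"
          then obtain c where c: "y \<in> M" "c \<in> A" "c \<otimes> y \<in> L" by blast
          have "inv c \<otimes> inv y = inv (c \<otimes> y)"
            using socle_comm[of "inv y" "inv c"] c AS MS by (simp add: inv_mult_group subsetD)
          then have "inv c \<otimes> inv y \<in> L" using c by simp
          then show "inv y \<in> ?N" using c A.m_inv_closed by auto
          fix z assume "z \<in> ?N"
          then obtain d where d: "z \<in> M" "d \<in> A" "d \<otimes> z \<in> L" by blast
          have "(c \<otimes> d) \<otimes> (y \<otimes> z) \<in> L" using L.m_closed[OF c(3) d(3)] direct_sum_mult[OF ds c(2,1) d(2,1)] by simp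
          then show "y \<otimes> z \<in> ?N" using c d A.m_closed by auto
        qed auto
        fix g y assume g: "g \<in> carrier G" and "y \<in> ?N"
        then obtain c where c: "y \<in> M" "c \<in> A" "c \<otimes> y \<in> L" by blast
        have "conjugate g (c \<otimes> y) = conjugate g c \<otimes> conjugate g y" using c g by (simp add: conjugate_mult)
        then have "conjugate g c \<otimes> conjugate g y \<in> L" using normal_conjugate[OF L(1) g c(3)] by simp
        then show "conjugate g y \<in> ?N" using c g normal_conjugate N by blast
      qed
      moreover have "m \<in> ?N" using m a L(3) by (auto simp: x_def)
      ultimately have "M \<subseteq> ?N" using normal_closure_least[of ?N "{m}"] m(2) by simp
      then show ?thesis using y by blast
    qed
    have "A \<subseteq> L"
    proof (rule ccontr)
      assume "\<not> A \<subseteq> L"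
      then have LA: "A \<inter> L = {\<one>}" using A normal_Int[OF N(1) L(1)] unfolding minimal_normal_def by blast
      define f where "f y = (SOME c. c \<in> A \<and> c \<otimes> y \<in> L)" for y
      have f: "f y \<in> A" "f y \<otimes> y \<in> L" if "y \<in> M" for y
        using someI_ex[of "\<lambda>c. c \<in> A \<and> c \<otimes> y \<in> L"] onto[OF that] by (auto simp: f_def)
      have f_uniq: "c = d" if "y \<in> M" "c \<in> A" "d \<in> A" "c \<otimes> y \<in> L" "d \<otimes> y \<in> L" for c d y
      proof -
        have "y \<otimes> (inv y \<otimes> inv d) = inv d" using that by (simp flip: m_assoc)
        then have "(c \<otimes> y) \<otimes> inv (d \<otimes> y) = c \<otimes> inv d" using that by (simp add: inv_mult_group m_assoc)
        moreover have "(c \<otimes> y) \<otimes> inv (d \<otimes> y) \<in> L" using that by simp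
        ultimately have "c \<otimes> inv d \<in> A \<inter> L" using that by simp
        then have "c \<otimes> inv d = \<one>" using LA by blast
        then show ?thesis using that by (metis A.mem_carrier inv_closed inv_equality inv_inv)
      qed
      have "restrict f M \<in> equivariant_homs M A"
      proof (rule equivariant_homsI[OF f(1) _ _ N(2)])
        fix y z assume yz: "y \<in> M" "z \<in> M"
        have "(f y \<otimes> f z) \<otimes> (y \<otimes> z) \<in> L"
          using L.m_closed[OF f(2)[OF yz(1)] f(2)[OF yz(2)]] direct_sum_mult[OF ds f(1)[OF yz(1)] yz(1) f(1)[OF yz(2)] yz(2)] by simp
        then show "f (y \<otimes> z) = f y \<otimes> f z" using f_uniq[of "y \<otimes> z"] f yz by simp
      next
        fix g y assume g: "g \<in> carrier G" and y: "y \<in> M"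
        have gM: "conjugate g y \<in> M" and gA: "conjugate g (f y) \<in> A"
          using normal_conjugate[OF N(2) g y] normal_conjugate[OF N(1) g f(1)[OF y]] by auto
        have "conjugate g (f y \<otimes> y) = conjugate g (f y) \<otimes> conjugate g y" using f(1)[OF y] g y by (simp add: conjugate_mult)
        then have "conjugate g (f y) \<otimes> conjugate g y \<in> L" using normal_conjugate[OF L(1) g f(2)[OF y]] by simp
        then show "f (conjugate g y) = conjugate g (f y)" using f_uniq[OF gM f(1)[OF gM] gA f(2)[OF gM]] by simp
      qed
      moreover have "f m = a" using f_uniq[OF m(1) f(1)[OF m(1)] a(1) f(2)[OF m(1)]] L(3) by (simp add: x_def)
      ultimately show False using a(2)[of "restrict f M"] m(1) by simp
    qed
    have "M \<subseteq> L"
    proof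
      fix y assume y: "y \<in> M"
      obtain c where c: "c \<in> A" "c \<otimes> y \<in> L" using onto[OF y] by blast
      have "inv c \<otimes> (c \<otimes> y) \<in> L" using c \<open>A \<subseteq> L\<close> by (simp add: subsetD)
      moreover have "inv c \<otimes> (c \<otimes> y) = y" using c y by (simp flip: m_assoc)
      ultimately show "y \<in> L" by simp
    qed
    have "B \<subseteq> L"
    proof
      fix b assume "b \<in> B"
      then obtain a' m' where "a' \<in> A" "m' \<in> M" "b = a' \<otimes> m'" by (rule direct_sumE[OF ds])
      then show "b \<in> L" using \<open>A \<subseteq> L\<close> \<open>M \<subseteq> L\<close> L.m_closed by blast
    qed
    then show "\<exists>x\<in>B. normal_closure {x} = B" using L(2) xB by (auto simp: L_def)
  qed
qed

text \<open>The dual of the previous lemma. A nontrivial submodule of \<open>A \<oplus> M\<close> that meets \<open>M\<close> trivially is the graph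
  of a homomorphism \<open>f: A \<rightarrow> M\<close>, and a functional given by \<open>d\<close> on \<open>A\<close> and \<open>c\<close> on \<open>M\<close> vanishes on it
  if and only if \<open>d = - c \<circ> f\<close>. So the functional is core-free if and only if \<open>c\<close> is and \<open>d\<close> is not of this form.
  For core-free \<open>c\<close> different \<open>f\<close> give different functionals \<open>- c \<circ> f\<close>, and there are \<open>|A|\<close> functionals on
  \<open>A\<close>.\<close>

lemma sum_core_free_iff:
  assumes ds: "direct_sum B A M" and A: "minimal_normal A G" and fin: "finite B"
    and p: "Factorial_Ring.prime p" and exp: "\<And>x. x \<in> B \<Longrightarrow> x [^] p = \<one>"
  shows "(\<exists>c\<in>zp_homs p B. core_free c B) \<longleftrightarrow>
    (\<exists>c\<in>zp_homs p M. core_free c M) \<and> card (equivariant_homs A M) < card A"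
proof -
  note N = direct_sum_normal[OF ds] and S = direct_sum_S[OF ds] and sub = direct_sum_sub[OF ds]
  interpret A: normal A G by (rule N(1))
  interpret M: normal M G by (rule N(2))
  interpret B: normal B G by (rule N(3))
  have p0: "p > 0" using p prime_gt_0_nat by blast
  have AM: "A \<inter> M = {\<one>}" using ds by (simp add: direct_sum_def)
  have finA: "finite A" and finM: "finite M" using fin sub finite_subset by auto
  have finH: "finite (equivariant_homs A M)" by (rule finite_equivariant_homs[OF finA finM])
  have finZ: "finite (zp_homs p A)" by (rule finite_zp_homs[OF finA])
  have MG: "M \<subseteq> carrier G" by (rule M.subset)
  have ne: "\<exists>a\<in>A. a \<noteq> \<one>" using A A.one_closed unfolding minimal_normal_def by blast
  have expA: "x [^] p = \<one>" and commA: "x \<otimes> y = y \<otimes> x" if "x \<in> A" "y \<in> A" for x y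
    using exp[of x] socle_comm[of x y] that sub S by auto
  have cardA: "card (zp_homs p A) = card A" by (rule card_zp_homs[OF p A.subgroup_axioms finA expA commA])
  have restr: "restrict c D \<in> zp_homs p D" if "c \<in> zp_homs p B" "D \<subseteq> B" "subgroup D G" for c D
    using zp_homsD(2,3)[OF that(1)] that(2) subgroup.m_closed[OF that(3)] by (auto simp: zp_homs_def subset_iff)
  \<comment> \<open>The functional on A obtained from one on M by means of a homomorphism from A to M, negated.\<close>
  define pull where "pull c f = (\<lambda>a\<in>A. (- c (f a)) mod int p)" for c :: "'a \<Rightarrow> int" and f
  have pull: "pull c f \<in> zp_homs p A" if c: "c \<in> zp_homs p M" and f: "f \<in> equivariant_homs A M" for c f
    unfolding pull_def
  proof (rule zp_homsI[OF _ p0 A.subgroup_axioms])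
    fix x y assume xy: "x \<in> A" "y \<in> A"
    have "c (f (x \<otimes> y)) = (c (f x) + c (f y)) mod int p"
      using equivariant_homsD(2,3)[OF f] xy zp_homsD(3)[OF c] by simp
    then have "(- c (f (x \<otimes> y))) mod int p = (- (c (f x) + c (f y))) mod int p" by (simp add: mod_minus_eq)
    then show "(- c (f (x \<otimes> y))) mod int p = (- c (f x) + - c (f y)) mod int p" by (simp add: algebra_simps)
  qed
  have pull_inj: "inj_on (pull c) (equivariant_homs A M)" if c: "c \<in> zp_homs p M" "core_free c M" for c
  proof (rule inj_onI)
    fix f h assume f: "f \<in> equivariant_homs A M" and h: "h \<in> equivariant_homs A M" and eq: "pull c f = pull c h"
    define k where "k a = f a \<otimes> inv (h a)" for a
    have val: "f a \<in> M" "h a \<in> M" if "a \<in> A" for a using that equivariant_homsD(2)[OF f] equivariant_homsD(2)[OF h] by auto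
    have k: "restrict k A \<in> equivariant_homs A M"
    proof (rule equivariant_homsI[OF _ _ _ N(1)])
      show "k x \<in> M" if "x \<in> A" for x using val[OF that] by (simp add: k_def)
      show "k (x \<otimes> y) = k x \<otimes> k y" if xy: "x \<in> A" "y \<in> A" for x y
      proof -
        note v = val[OF xy(1)] val[OF xy(2)]
        have "inv (h x) \<otimes> f y = f y \<otimes> inv (h x)" using socle_comm[of "inv (h x)" "f y"] v S by (simp add: subsetD)
        then have "k x \<otimes> k y = (f x \<otimes> f y) \<otimes> (inv (h x) \<otimes> inv (h y))"
          unfolding k_def using v by (intro mult_exchange) auto
        moreover have "inv (h x \<otimes> h y) = inv (h x) \<otimes> inv (h y)"
          using socle_comm[of "inv (h x)" "inv (h y)"] v S by (simp add: inv_mult_group subsetD)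
        ultimately show ?thesis using equivariant_homsD(3)[OF f xy] equivariant_homsD(3)[OF h xy] by (simp add: k_def)
      qed
      show "k (conjugate g x) = conjugate g (k x)" if gx: "g \<in> carrier G" "x \<in> A" for g x
        using equivariant_homsD(4)[OF f gx] equivariant_homsD(4)[OF h gx] val[OF gx(2)] gx(1)
        by (simp add: k_def conjugate_mult conjugate_inv)
    qed
    have ck: "c y = 0" if "y \<in> restrict k A ` A" for y
    proof -
      obtain a where a: "a \<in> A" "y = k a" using \<open>y \<in> restrict k A ` A\<close> by auto
      note v = val[OF a(1)]
      have "(- c (f a)) mod int p = (- c (h a)) mod int p" using fun_cong[OF eq, of a] a by (simp add: pull_def)
      then have "int p dvd (- c (f a)) - (- c (h a))" by (rule mod_eq_dvd_iff[THEN iffD1])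
      then have "(c (f a) - c (h a)) mod int p = 0" by (simp add: dvd_eq_mod_eq_0[symmetric] dvd_diff_commute)
      moreover have "c y = (c (f a) + (- c (h a)) mod int p) mod int p"
        using zp_homsD(3)[OF c(1), of "f a" "inv (h a)"] v zp_homs_inv[OF c(1) M.subgroup_axioms v(2)] a(2) by (simp add: k_def)
      ultimately show ?thesis by (simp add: mod_add_right_eq)
    qed
    have "restrict k A ` A = {\<one>}"
      using c(2) equivariant_homs_image[OF k N(1) MG] equivariant_homsD(2)[OF k] ck unfolding core_free_def by blast
    then have k1: "k a = \<one>" if "a \<in> A" for a using that by (metis imageI restrict_apply' singletonD)
    show "f = h"
    proof (rule equivariant_homs_eqI[OF f h])
      fix a assume a: "a \<in> A"
      have "f a \<in> carrier G" "h a \<in> carrier G" using val[OF a] by auto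
      then show "f a = h a" using k1[OF a] unfolding k_def by (metis inv_closed inv_equality inv_inv)
    qed
  qed
  show ?thesis
  proof
    assume "\<exists>c\<in>zp_homs p B. core_free c B"
    then obtain c where c: "c \<in> zp_homs p B" "core_free c B" by blast
    have cM: "restrict c M \<in> zp_homs p M" and cA: "restrict c A \<in> zp_homs p A"
      using restr[OF c(1)] sub A.subgroup_axioms M.subgroup_axioms by auto
    have cfM: "core_free (restrict c M) M"
      unfolding core_free_def
    proof (intro allI impI)
      fix N assume "N \<lhd> G \<and> N \<subseteq> M \<and> (\<forall>x\<in>N. restrict c M x = 0)"
      then have "N \<lhd> G" "N \<subseteq> B" "\<forall>x\<in>N. c x = 0" using sub by (auto simp: subset_iff)
      then show "N = {\<one>}" using c(2) unfolding core_free_def by blast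
    qed
    have "pull (restrict c M) ` equivariant_homs A M \<subseteq> zp_homs p A - {restrict c A}"
    proof
      fix z assume "z \<in> pull (restrict c M) ` equivariant_homs A M"
      then obtain f where f: "f \<in> equivariant_homs A M" and z: "z = pull (restrict c M) f" by blast
      have "z \<noteq> restrict c A"
      proof
        assume zc: "z = restrict c A"
        have eq: "(- c (f a)) mod int p = c a" if a: "a \<in> A" for a
        proof -
          have "z a = (- c (f a)) mod int p" using a equivariant_homsD(2)[OF f a] by (simp add: z pull_def)
          moreover have "z a = c a" using a by (simp add: zc)
          ultimately show ?thesis by simp
        qed
        let ?k = "\<lambda>a\<in>A. a \<otimes> f a"
        have k: "?k \<in> equivariant_homs A B"
        proof (rule equivariant_homsI[OF _ _ _ N(1)])
          note F = equivariant_homsD[OF f]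
          show "x \<otimes> f x \<in> B" if "x \<in> A" for x using that F(2)[OF that] ds unfolding direct_sum_def by blast
          show "x \<otimes> y \<otimes> f (x \<otimes> y) = x \<otimes> f x \<otimes> (y \<otimes> f y)" if "x \<in> A" "y \<in> A" for x y
            using that F(2,3) by (simp add: direct_sum_mult[OF ds])
          show "conjugate g x \<otimes> f (conjugate g x) = conjugate g (x \<otimes> f x)" if "g \<in> carrier G" "x \<in> A" for g x
            using that F(2,4) by (simp add: conjugate_mult)
        qed
        have "c y = 0" if "y \<in> ?k ` A" for y
        proof -
          obtain a where a: "a \<in> A" "y = a \<otimes> f a" using \<open>y \<in> ?k ` A\<close> by auto
          have fa: "f a \<in> M" by (rule equivariant_homsD(2)[OF f a(1)])
          have "c y = (c a + c (f a)) mod int p" using zp_homsD(3)[OF c(1), of a "f a"] a fa sub by auto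
          also have "\<dots> = ((- c (f a)) mod int p + c (f a)) mod int p" using eq[OF a(1)] by simp
          also have "\<dots> = 0" by (simp add: mod_add_left_eq)
          finally show ?thesis .
        qed
        moreover have "?k ` A \<lhd> G" by (rule equivariant_homs_image[OF k N(1) B.subset])
        moreover have "?k ` A \<subseteq> B" using equivariant_homsD(2)[OF k] by blast
        ultimately have "?k ` A = {\<one>}" using c(2) unfolding core_free_def by blast
        moreover obtain a where a: "a \<in> A" "a \<noteq> \<one>" using ne by blast
        ultimately have "a \<otimes> f a = \<one>" by (metis imageI restrict_apply' singletonD)
        then have "a \<otimes> f a = \<one> \<otimes> \<one>" by simp
        then have "a = \<one>"
          using direct_sum_unique[OF ds a(1) A.one_closed equivariant_homsD(2)[OF f a(1)] M.one_closed] by simp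
        then show False using a(2) by simp
      qed
      then show "z \<in> zp_homs p A - {restrict c A}" using pull[OF cM f] z by simp
    qed
    then have "card (equivariant_homs A M) \<le> card (zp_homs p A - {restrict c A})"
      by (rule card_inj_on_le[OF pull_inj[OF cM cfM]]) (use finZ in simp)
    also have "\<dots> < card (zp_homs p A)" by (rule card_Diff1_less[OF finZ cA])
    finally have "card (equivariant_homs A M) < card A" using cardA by simp
    with cM cfM show "(\<exists>c\<in>zp_homs p M. core_free c M) \<and> card (equivariant_homs A M) < card A" by blast
  next
    assume asm: "(\<exists>c\<in>zp_homs p M. core_free c M) \<and> card (equivariant_homs A M) < card A"
    then obtain c where c: "c \<in> zp_homs p M" "core_free c M" by blast
    have "card (pull c ` equivariant_homs A M) < card (zp_homs p A)"
      using card_image_le[OF finH, of "pull c"] asm cardA by simp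
    then have "\<not> zp_homs p A \<subseteq> pull c ` equivariant_homs A M"
      using card_mono[of "pull c ` equivariant_homs A M" "zp_homs p A"] finH by auto
    then obtain d where d: "d \<in> zp_homs p A" "\<And>f. f \<in> equivariant_homs A M \<Longrightarrow> d \<noteq> pull c f" by blast
    define e where "e b = d (proj_left A M b) + c (proj_right A M b)" for b
    let ?e = "\<lambda>b\<in>B. e b mod int p"
    have e: "?e \<in> zp_homs p B"
    proof (rule zp_homsI[OF _ p0 B.subgroup_axioms])
      fix x y assume x: "x \<in> B" and y: "y \<in> B"
      obtain a m where am: "a \<in> A" "m \<in> M" "x = a \<otimes> m" using x by (rule direct_sumE[OF ds])
      obtain a' m' where am': "a' \<in> A" "m' \<in> M" "y = a' \<otimes> m'" using y by (rule direct_sumE[OF ds])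
      have "e (x \<otimes> y) = (d a + d a') mod int p + (c m + c m') mod int p"
        using am am' zp_homsD(3)[OF d(1)] zp_homsD(3)[OF c(1)]
        by (simp add: e_def proj_eq[OF ds] direct_sum_mult[OF ds])
      then have "e (x \<otimes> y) mod int p = (d a + d a' + (c m + c m')) mod int p" by (simp add: mod_add_eq)
      also have "\<dots> = (e x + e y) mod int p" using am am' by (simp add: e_def proj_eq[OF ds] algebra_simps)
      finally show "e (x \<otimes> y) mod int p = (e x + e y) mod int p" .
    qed
    have e_eq: "?e (a \<otimes> m) = (d a + c m) mod int p" if "a \<in> A" "m \<in> M" for a m
    proof -
      have "a \<otimes> m \<in> B" using that ds unfolding direct_sum_def by blast
      then show ?thesis using that by (simp add: e_def proj_eq[OF ds])
    qed
    have "core_free ?e B"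
      unfolding core_free_def
    proof (intro allI impI, elim conjE)
      fix L assume L: "L \<lhd> G" "L \<subseteq> B" "\<forall>x\<in>L. ?e x = 0"
      interpret L: normal L G by (rule L(1))
      have "c m = 0" if m: "m \<in> L \<inter> M" for m
        using L(3) e_eq[OF A.one_closed, of m] m zp_homs_one[OF d(1) A.subgroup_axioms] zp_homs_mod[OF c(1), of m] by auto
      then have LM: "L \<inter> M = {\<one>}" using c(2) normal_Int[OF L(1) N(2)] unfolding core_free_def by blast
      let ?P = "restrict (proj_left A M) B"
      have P: "?P \<in> equivariant_homs B A" by (rule proj_homs(1)[OF ds])
      have PL: "restrict ?P L \<in> equivariant_homs L A"
        by (rule equivariant_homs_restrict[OF P L(1,2)])
      have img: "restrict ?P L ` L \<lhd> G" "restrict ?P L ` L \<subseteq> A"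
        using equivariant_homs_image[OF PL L(1) A.subset] equivariant_homsD(2)[OF PL] by blast+
      have LB: "b \<in> B" if "b \<in> L" for b using that L(2) by blast
      show "L = {\<one>}"
      proof (cases "restrict ?P L ` L = {\<one>}")
        case True
        have "x \<in> M" if x: "x \<in> L" for x
        proof -
          have "?P x = \<one>" using True x by (metis imageI restrict_apply' singletonD)
          then have "proj_left A M x = \<one>" using LB[OF x] by simp
          then show ?thesis using proj[OF ds LB[OF x]] by (metis M.mem_carrier l_one)
        qed
        then show ?thesis using LM by blast
      next
        case False
        then have surj: "restrict ?P L ` L = A" using A img unfolding minimal_normal_def by blast
        have ex: "\<exists>m\<in>M. a \<otimes> m \<in> L" if a: "a \<in> A" for a
        proof -
          obtain x where x: "x \<in> L" "a = restrict ?P L x" using a surj by blast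
          then have "a = proj_left A M x" using LB by simp
          then have "x = a \<otimes> proj_right A M x" using proj(3)[OF ds LB[OF x(1)]] by simp
          then show ?thesis using x(1) proj(2)[OF ds LB[OF x(1)]] by metis
        qed
        have uniq: "m = n" if "a \<in> A" "m \<in> M" "n \<in> M" "a \<otimes> m \<in> L" "a \<otimes> n \<in> L" for a m n
        proof -
          have "inv (a \<otimes> m) \<otimes> (a \<otimes> n) = inv m \<otimes> (inv a \<otimes> (a \<otimes> n))"
            using that by (simp add: inv_mult_group m_assoc)
          also have "inv a \<otimes> (a \<otimes> n) = n" using that by (simp flip: m_assoc)
          finally have "inv m \<otimes> n \<in> L" using that by (metis L.m_closed L.m_inv_closed)
          moreover have "inv m \<otimes> n \<in> M" using that by simp
          ultimately have "inv m \<otimes> n = \<one>" using LM by blast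
          then show ?thesis using that by (metis M.mem_carrier inv_closed inv_equality inv_inv)
        qed
        define f where "f a = (SOME m. m \<in> M \<and> a \<otimes> m \<in> L)" for a
        have f: "f a \<in> M" "a \<otimes> f a \<in> L" if "a \<in> A" for a
          using someI_ex[of "\<lambda>m. m \<in> M \<and> a \<otimes> m \<in> L"] ex[OF that] by (auto simp: f_def)
        have fh: "restrict f A \<in> equivariant_homs A M"
        proof (rule equivariant_homsI[OF f(1) _ _ N(1)])
          fix x y assume xy: "x \<in> A" "y \<in> A"
          have "(x \<otimes> y) \<otimes> (f x \<otimes> f y) \<in> L"
            using L.m_closed[OF f(2)[OF xy(1)] f(2)[OF xy(2)]] direct_sum_mult[OF ds xy(1) f(1)[OF xy(1)] xy(2) f(1)[OF xy(2)]] by simp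
          then show "f (x \<otimes> y) = f x \<otimes> f y" using uniq[of "x \<otimes> y"] f xy by simp
        next
          fix g x assume g: "g \<in> carrier G" and x: "x \<in> A"
          have gA: "conjugate g x \<in> A" and gM: "conjugate g (f x) \<in> M"
            using normal_conjugate[OF N(1) g x] normal_conjugate[OF N(2) g f(1)[OF x]] by auto
          have "conjugate g (x \<otimes> f x) = conjugate g x \<otimes> conjugate g (f x)" using f(1)[OF x] g x by (simp add: conjugate_mult)
          then have "conjugate g x \<otimes> conjugate g (f x) \<in> L" using normal_conjugate[OF L(1) g f(2)[OF x]] by simp
          then show "f (conjugate g x) = conjugate g (f x)" using uniq[OF gA f(1)[OF gA] gM f(2)[OF gA]] by simp
        qed
        have "d = pull c (restrict f A)"
        proof (rule zp_homs_eqI[OF d(1) pull[OF c(1) fh]])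
          fix a assume a: "a \<in> A"
          have "(d a + c (f a)) mod int p = 0" using L(3) f(2)[OF a] e_eq[OF a f(1)[OF a]] by simp
          then have "int p dvd d a - (- c (f a))" by (simp add: dvd_eq_mod_eq_0)
          then have "d a mod int p = (- c (f a)) mod int p" by (rule mod_eq_dvd_iff[THEN iffD2])
          then show "d a = pull c (restrict f A) a" using a zp_homs_mod[OF d(1) a] by (simp add: pull_def)
        qed
        then show ?thesis using d(2)[OF fh] by blast
      qed
    qed
    then show "\<exists>c\<in>zp_homs p B. core_free c B" using e by blast
  qed
qed

text \<open>Split off a minimal normal subgroup \<open>A\<close>, say \<open>B = A \<oplus> M\<close>. The two preceding lemmas reduce both sides to
  the corresponding statements on \<open>M\<close>, together with inequalities that agree by \<open>minimal_homs_symmetric\<close>.\<close>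

theorem cyclic_iff_core_free:
  assumes p: "Factorial_Ring.prime p"
  shows "\<lbrakk>B \<lhd> G; B \<subseteq> S; finite B; \<And>x. x \<in> B \<Longrightarrow> x [^] p = \<one>\<rbrakk> \<Longrightarrow>
    (\<exists>x\<in>B. normal_closure {x} = B) \<longleftrightarrow> (\<exists>c\<in>zp_homs p B. core_free c B)"
proof (induction "card B" arbitrary: B rule: less_induct)
  case less
  interpret B: normal B G by (rule less.prems(1))
  show ?case
  proof (cases "B = {\<one>}")
    case True
    have "(\<lambda>x\<in>B. 0 mod int p) \<in> zp_homs p B"
      by (rule zp_homsI) (use p prime_gt_0_nat B.subgroup_axioms in auto)
    moreover have "core_free c B" for c
      unfolding core_free_def True
    proof (intro allI impI)
      fix N assume N: "N \<lhd> G \<and> N \<subseteq> {\<one>} \<and> (\<forall>x\<in>N. c x = 0)"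
      then have "\<one> \<in> N" using subgroup.one_closed normal_imp_subgroup by blast
      then show "N = {\<one>}" using N by blast
    qed
    ultimately have "\<exists>c\<in>zp_homs p B. core_free c B" by blast
    moreover have "normal_closure {\<one>} = {\<one>}"
      using normal_closure_incl[of "{\<one>}"] normal_closure_least[OF one_is_normal, of "{\<one>}"] by blast
    then have "\<exists>x\<in>B. normal_closure {x} = B" using True by blast
    ultimately show ?thesis by blast
  next
    case False
    then obtain A where A: "minimal_normal A G" "A \<subseteq> B" using exists_minimal_normal less.prems by blast
    have AN: "A \<lhd> G" using A by (simp add: minimal_normal_def)
    obtain M where ds: "direct_sum B A M" using direct_sum_exists[OF less.prems(1,2) AN A(2)] by blast
    note facts = direct_sum_normal[OF ds] direct_sum_S[OF ds] direct_sum_sub[OF ds]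
    obtain d where d: "d \<in> A" "d \<noteq> \<one>"
      using A(1) subgroup.one_closed[OF normal_imp_subgroup[OF AN]] unfolding minimal_normal_def by blast
    then have "d \<notin> M" using ds unfolding direct_sum_def by blast
    then have "M \<subset> B" using facts d by blast
    then have M: "card M < card B" "finite M" and finA: "finite A"
      using less.prems(3) facts A(2) by (auto intro: psubset_card_mono finite_subset)
    have expM: "x [^] p = \<one>" if "x \<in> M" for x using that less.prems(4) facts by blast
    have "(\<exists>x\<in>M. normal_closure {x} = M) \<longleftrightarrow> (\<exists>c\<in>zp_homs p M. core_free c M)"
      by (rule less.hyps[OF M(1) facts(2) facts(6) M(2) expM])
    moreover have "card (equivariant_homs A M) = card (equivariant_homs M A)"
      by (rule minimal_homs_symmetric[OF A(1) finA facts(2) facts(6) M(2)])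
    ultimately show ?thesis
      using sum_generator_iff[OF ds A(1) less.prems(3)] sum_core_free_iff[OF ds A(1) less.prems(3) p less.prems(4)] by simp
  qed
qed

end


section \<open>Representations and their fixed vectors\<close>

locale group_representation = group_ring_setup K G + V: left_module "group_ring K G" V
  for K :: "('k, 'n) ring_scheme" (structure) and G :: "('g, 'm) monoid_scheme"
    and V :: "('g \<Rightarrow> 'k, 'v, 'b) module_scheme" +
  assumes K_field: "field K"
begin

text \<open>The element \<open>k g\<close> of the group ring.\<close>

definition single :: "'k \<Rightarrow> 'g \<Rightarrow> 'g \<Rightarrow> 'k" where
  "single k g = (\<lambda>x. if x = g then k else \<zero>)"

definition act :: "'g \<Rightarrow> 'v \<Rightarrow> 'v" where
  "act g v = group_elem K g \<odot>\<^bsub>V\<^esub> v"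

lemma single_closed: "\<lbrakk>k \<in> carrier K; g \<in> carrier G\<rbrakk> \<Longrightarrow> single k g \<in> carrier RG"
  by (rule carrierI[where A = "{g}"]) (auto simp: single_def)

lemma group_elem_single: "group_elem K g = single \<one> g"
  by (simp add: group_elem_def single_def)

lemma single_mult:
  assumes k: "k \<in> carrier K" "l \<in> carrier K" and g: "g \<in> carrier G" "h \<in> carrier G"
  shows "single k g \<otimes>\<^bsub>RG\<^esub> single l h = single (k \<otimes> l) (g \<otimes>\<^bsub>G\<^esub> h)"
proof
  fix x
  show "(single k g \<otimes>\<^bsub>RG\<^esub> single l h) x = single (k \<otimes> l) (g \<otimes>\<^bsub>G\<^esub> h) x"
  proof (cases "x \<in> carrier G")
    case True
    have supp: "fsupport K (single k g) \<subseteq> {g}" by (auto simp: fsupport_def single_def)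
    have "(single k g \<otimes>\<^bsub>RG\<^esub> single l h) x = (\<Oplus>y\<in>{g}. single k g y \<otimes> single l h (inv\<^bsub>G\<^esub> y \<otimes>\<^bsub>G\<^esub> x))"
      by (rule mult_eq[OF single_closed[OF k(1) g(1)] single_closed[OF k(2) g(2)] True _ supp]) simp
    also have "\<dots> = k \<otimes> single l h (inv\<^bsub>G\<^esub> g \<otimes>\<^bsub>G\<^esub> x)"
      using k by (simp add: single_def)
    also have "inv\<^bsub>G\<^esub> g \<otimes>\<^bsub>G\<^esub> x = h \<longleftrightarrow> x = g \<otimes>\<^bsub>G\<^esub> h"
      using G.inv_solve_left'[OF g(2) g(1) True] by auto
    then have "k \<otimes> single l h (inv\<^bsub>G\<^esub> g \<otimes>\<^bsub>G\<^esub> x) = single (k \<otimes> l) (g \<otimes>\<^bsub>G\<^esub> h) x"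
      using k by (simp add: single_def)
    finally show ?thesis .
  next
    case False
    then have "x \<noteq> g \<otimes>\<^bsub>G\<^esub> h" using g by auto
    then show ?thesis using False by (simp add: mult_outside single_def)
  qed
qed

lemma act_closed [simp]: "\<lbrakk>g \<in> carrier G; v \<in> carrier V\<rbrakk> \<Longrightarrow> act g v \<in> carrier V"
  by (simp add: act_def V.smult_closed group_elem_closed)

lemma act_act: "\<lbrakk>g \<in> carrier G; h \<in> carrier G; v \<in> carrier V\<rbrakk> \<Longrightarrow> act g (act h v) = act (g \<otimes>\<^bsub>G\<^esub> h) v"
  by (simp add: act_def group_elem_closed single_closed group_elem_single single_mult flip: V.smult_assoc)

lemma act_one [simp]: "v \<in> carrier V \<Longrightarrow> act \<one>\<^bsub>G\<^esub> v = v"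
  using V.smult_one by (simp add: act_def one_eq)

lemma act_add: "\<lbrakk>g \<in> carrier G; v \<in> carrier V; w \<in> carrier V\<rbrakk> \<Longrightarrow> act g (v \<oplus>\<^bsub>V\<^esub> w) = act g v \<oplus>\<^bsub>V\<^esub> act g w"
  by (simp add: act_def V.smult_r_distr group_elem_closed)

lemma act_zero [simp]: "g \<in> carrier G \<Longrightarrow> act g \<zero>\<^bsub>V\<^esub> = \<zero>\<^bsub>V\<^esub>"
  using act_add[of g "\<zero>\<^bsub>V\<^esub>" "\<zero>\<^bsub>V\<^esub>"]
  by (metis V.M.add.r_cancel_one' V.M.zero_closed V.M.l_zero act_closed)

lemma act_neg: "\<lbrakk>g \<in> carrier G; v \<in> carrier V\<rbrakk> \<Longrightarrow> act g (\<ominus>\<^bsub>V\<^esub> v) = \<ominus>\<^bsub>V\<^esub> act g v"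
  by (rule V.M.minus_equality[symmetric]) (simp_all add: V.M.l_neg flip: act_add)

lemma act_finsum:
  assumes "g \<in> carrier G" "f \<in> A \<rightarrow> carrier V"
  shows "act g (finsum V f A) = (\<Oplus>\<^bsub>V\<^esub>i\<in>A. act g (f i))"
  using assms(2) by (induction A rule: infinite_finite_induct) (use assms(1) in \<open>auto simp: act_add Pi_iff\<close>)

lemma smult_zero_left: "v \<in> carrier V \<Longrightarrow> \<zero>\<^bsub>RG\<^esub> \<odot>\<^bsub>V\<^esub> v = \<zero>\<^bsub>V\<^esub>"
  using V.smult_l_distr[of "\<zero>\<^bsub>RG\<^esub>" "\<zero>\<^bsub>RG\<^esub>" v]
  by (metis V.M.add.r_cancel_one' V.R.zero_closed V.R.l_zero V.smult_closed)

text \<open>The elements \<open>k g\<close> span the group ring additively.\<close>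

lemma submodule_spanning:
  assumes W: "subgroup W (add_monoid V)"
    and closed: "\<And>k g w. \<lbrakk>k \<in> carrier K; g \<in> carrier G; w \<in> W\<rbrakk> \<Longrightarrow> single k g \<odot>\<^bsub>V\<^esub> w \<in> W"
  shows "submodule W RG V"
proof (rule submodule.intro[OF W], rule submodule_axioms.intro)
  interpret W: subgroup W "add_monoid V" by (rule W)
  fix f w assume f: "f \<in> carrier RG" and w: "w \<in> W"
  have wV: "w \<in> carrier V" using subsetD[OF W.subset w] by simp
  have "finite B \<Longrightarrow> \<forall>f. f \<in> carrier RG \<and> fsupport K f \<subseteq> B \<longrightarrow> f \<odot>\<^bsub>V\<^esub> w \<in> W" for B
  proof (induction B rule: finite_induct)
    case empty
    have "f \<odot>\<^bsub>V\<^esub> w \<in> W" if "fsupport K f \<subseteq> {}" for f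
    proof -
      have "f = \<zero>\<^bsub>RG\<^esub>" using that by (auto simp: fsupport_def group_ring_def)
      then show ?thesis using smult_zero_left[OF wV] W.one_closed by simp
    qed
    then show ?case by blast
  next
    case (insert g B)
    show ?case
    proof (intro allI impI, elim conjE)
      fix f assume f: "f \<in> carrier RG" "fsupport K f \<subseteq> insert g B"
      show "f \<odot>\<^bsub>V\<^esub> w \<in> W"
      proof (cases "g \<in> carrier G")
        case False
        then have "f g = \<zero>" by (rule coeff_outside[OF f(1)])
        then have "fsupport K f \<subseteq> B" using f(2) by (auto simp: fsupport_def)
        then show ?thesis using insert.IH f(1) by blast
      next
        case True
        define f' where "f' x = (if x = g then \<zero> else f x)" for x
        have f': "f' \<in> carrier RG"
          by (rule carrierI[where A = "fsupport K f"]) (use f(1) in \<open>auto simp: carrier_iff fsupport_def f'_def\<close>)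
        have "fsupport K f' \<subseteq> B" using f(2) by (auto simp: fsupport_def f'_def)
        then have "f' \<odot>\<^bsub>V\<^esub> w \<in> W" using insert.IH f' by blast
        moreover have "single (f g) g \<odot>\<^bsub>V\<^esub> w \<in> W" by (rule closed[OF coeff_closed[OF f(1)] True w])
        moreover have "f = single (f g) g \<oplus>\<^bsub>RG\<^esub> f'"
          using coeff_closed[OF f(1)] by (auto simp: fun_eq_iff add_eq single_def f'_def)
        then have "f \<odot>\<^bsub>V\<^esub> w = single (f g) g \<odot>\<^bsub>V\<^esub> w \<oplus>\<^bsub>V\<^esub> f' \<odot>\<^bsub>V\<^esub> w"
          using V.smult_l_distr[OF single_closed[OF coeff_closed[OF f(1)] True] f' wV] by metis
        ultimately show ?thesis using W.m_closed by simp
      qed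
    qed
  qed
  then show "f \<odot>\<^bsub>V\<^esub> w \<in> W" using f by (auto simp: carrier_iff)
qed

definition fixed_by :: "'g set \<Rightarrow> 'v set" where
  "fixed_by N = {v \<in> carrier V. \<forall>n\<in>N. act n v = v}"

text \<open>\<open>n g w = g (g\<inverse> n g) w = g w\<close> for a vector \<open>w\<close> fixed by the normal subgroup \<open>N\<close>.\<close>

lemma fixed_by_submodule:
  assumes N: "N \<lhd> G"
  shows "submodule (fixed_by N) RG V"
proof (rule submodule_spanning)
  interpret N: normal N G by (rule N)
  show "subgroup (fixed_by N) (add_monoid V)"
  proof (intro subgroup.intro)
    show "inv\<^bsub>add_monoid V\<^esub> v \<in> fixed_by N" if "v \<in> fixed_by N" for v
      using that by (auto simp: fixed_by_def act_neg simp flip: a_inv_def)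
  qed (auto simp: fixed_by_def act_add)
  fix k g w assume k: "k \<in> carrier K" and g: "g \<in> carrier G" and w: "w \<in> fixed_by N"
  have wV: "w \<in> carrier V" using w by (simp add: fixed_by_def)
  have "act n (single k g \<odot>\<^bsub>V\<^esub> w) = single k g \<odot>\<^bsub>V\<^esub> w" if n: "n \<in> N" for n
  proof -
    have nG: "n \<in> carrier G" using n by simp
    define n' where "n' = inv\<^bsub>G\<^esub> g \<otimes>\<^bsub>G\<^esub> n \<otimes>\<^bsub>G\<^esub> g"
    have n': "n' \<in> N" "n' \<in> carrier G" using N.inv_op_closed1[OF g n] by (auto simp: n'_def)
    have "g \<otimes>\<^bsub>G\<^esub> n' = n \<otimes>\<^bsub>G\<^esub> g" using g nG by (simp add: n'_def flip: G.m_assoc)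
    then have "group_elem K n \<otimes>\<^bsub>RG\<^esub> single k g = single k g \<otimes>\<^bsub>RG\<^esub> group_elem K n'"
      using k g nG n' by (simp add: group_elem_single single_mult)
    then have "act n (single k g \<odot>\<^bsub>V\<^esub> w) = single k g \<odot>\<^bsub>V\<^esub> act n' w"
      using k g nG n' wV by (simp add: act_def group_elem_closed single_closed flip: V.smult_assoc)
    also have "act n' w = w" using w n' by (simp add: fixed_by_def)
    finally show ?thesis .
  qed
  then show "single k g \<odot>\<^bsub>V\<^esub> w \<in> fixed_by N" using k g wV by (simp add: fixed_by_def V.smult_closed single_closed)
qed

lemma add_pow_scalar:
  assumes "v \<in> carrier V"
  shows "[(n::nat)] \<cdot>\<^bsub>V\<^esub> v = single ([n] \<cdot> \<one>) \<one>\<^bsub>G\<^esub> \<odot>\<^bsub>V\<^esub> v"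
proof (induction n)
  case 0
  have "single \<zero> \<one>\<^bsub>G\<^esub> = \<zero>\<^bsub>RG\<^esub>" by (auto simp: single_def group_ring_def)
  then show ?case using smult_zero_left[OF assms] by (simp add: V.M.add.nat_pow_0)
next
  case (Suc n)
  have "single ([Suc n] \<cdot> \<one>) \<one>\<^bsub>G\<^esub> = single ([n] \<cdot> \<one>) \<one>\<^bsub>G\<^esub> \<oplus>\<^bsub>RG\<^esub> \<one>\<^bsub>RG\<^esub>"
    by (auto simp: single_def fun_eq_iff add_eq one_eq group_elem_def)
  moreover have "single ([n] \<cdot> \<one>) \<one>\<^bsub>G\<^esub> \<in> carrier RG" by (rule single_closed) auto
  ultimately have "single ([Suc n] \<cdot> \<one>) \<one>\<^bsub>G\<^esub> \<odot>\<^bsub>V\<^esub> v = single ([n] \<cdot> \<one>) \<one>\<^bsub>G\<^esub> \<odot>\<^bsub>V\<^esub> v \<oplus>\<^bsub>V\<^esub> v"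
    using V.smult_l_distr[of _ "\<one>\<^bsub>RG\<^esub>" v] V.smult_one assms by simp
  then show ?case using Suc assms by simp
qed

lemma add_pow_zero:
  assumes "v \<in> carrier V" "[n] \<cdot> \<one> = \<zero>"
  shows "[(n::nat)] \<cdot>\<^bsub>V\<^esub> v = \<zero>\<^bsub>V\<^esub>"
proof -
  have "single \<zero> \<one>\<^bsub>G\<^esub> = \<zero>\<^bsub>RG\<^esub>" by (auto simp: single_def group_ring_def)
  then show ?thesis using add_pow_scalar[OF assms(1), of n] assms smult_zero_left by simp
qed

lemma scalar_cancel:
  assumes v: "v \<in> carrier V" and k: "k \<in> carrier K" "k \<noteq> \<zero>" and z: "single k \<one>\<^bsub>G\<^esub> \<odot>\<^bsub>V\<^esub> v = \<zero>\<^bsub>V\<^esub>"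
  shows "v = \<zero>\<^bsub>V\<^esub>"
proof -
  interpret field K by (rule K_field)
  have i: "inv k \<in> carrier K" "inv k \<otimes> k = \<one>" using k by (simp_all add: field_Units)
  have "v = (single (inv k) \<one>\<^bsub>G\<^esub> \<otimes>\<^bsub>RG\<^esub> single k \<one>\<^bsub>G\<^esub>) \<odot>\<^bsub>V\<^esub> v"
    using act_one[OF v] i k by (simp add: single_mult act_def group_elem_single)
  also have "\<dots> = single (inv k) \<one>\<^bsub>G\<^esub> \<odot>\<^bsub>V\<^esub> \<zero>\<^bsub>V\<^esub>"
    using z i k v by (simp add: V.smult_assoc single_closed)
  also have "\<dots> = \<zero>\<^bsub>V\<^esub>"
    using V.smult_r_distr[of "single (inv k) \<one>\<^bsub>G\<^esub>" "\<zero>\<^bsub>V\<^esub>" "\<zero>\<^bsub>V\<^esub>"] single_closed[OF i(1) G.one_closed]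
    by (metis V.M.add.r_cancel_one' V.M.zero_closed V.M.l_zero V.smult_closed)
  finally show ?thesis .
qed

lemma add_pow_cancel:
  assumes v: "v \<in> carrier V" and n: "[n] \<cdot> \<one> \<noteq> \<zero>" and z: "[(n::nat)] \<cdot>\<^bsub>V\<^esub> v = \<zero>\<^bsub>V\<^esub>"
  shows "v = \<zero>\<^bsub>V\<^esub>"
  by (rule scalar_cancel[OF v _ n]) (use z add_pow_scalar[OF v, of n] in auto)

definition stabilizer :: "'g set \<Rightarrow> 'v \<Rightarrow> 'g set" where
  "stabilizer B v = {b \<in> B. act b v = v}"

lemma stabilizer_subgroup:
  assumes B: "subgroup B G" and v: "v \<in> carrier V"
  shows "subgroup (stabilizer B v) G"
proof (rule G.subgroupI)
  interpret B: subgroup B G by (rule B)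
  show "stabilizer B v \<subseteq> carrier G" by (auto simp: stabilizer_def)
  have "\<one>\<^bsub>G\<^esub> \<in> stabilizer B v" using v by (simp add: stabilizer_def)
  then show "stabilizer B v \<noteq> {}" by blast
  show "inv\<^bsub>G\<^esub> b \<in> stabilizer B v" if b: "b \<in> stabilizer B v" for b
  proof -
    have bB: "b \<in> B" "act b v = v" using b by (auto simp: stabilizer_def)
    have "act (inv\<^bsub>G\<^esub> b) (act b v) = v" using bB(1) v by (simp add: act_act)
    then show ?thesis using bB by (simp add: stabilizer_def)
  qed
  show "b \<otimes>\<^bsub>G\<^esub> c \<in> stabilizer B v" if "b \<in> stabilizer B v" "c \<in> stabilizer B v" for b c
    using that v by (simp add: stabilizer_def flip: act_act)
qed

text \<open>Let \<open>u\<close> be a nonzero vector whose stabiliser in \<open>B\<close> has maximal order. A nonzero vector fixed by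
  that stabiliser cannot be fixed by any further element of \<open>B\<close>.\<close>

lemma maximal_stabilizer:
  assumes B: "subgroup B G" "finite B" and ne: "carrier V \<noteq> {\<zero>\<^bsub>V\<^esub>}"
  shows "\<exists>u\<in>carrier V. u \<noteq> \<zero>\<^bsub>V\<^esub> \<and>
    (\<forall>w\<in>fixed_by (stabilizer B u). \<forall>x\<in>B. act x w = w \<longrightarrow> x \<in> stabilizer B u \<or> w = \<zero>\<^bsub>V\<^esub>)"
proof -
  define P where "P u \<longleftrightarrow> u \<in> carrier V \<and> u \<noteq> \<zero>\<^bsub>V\<^esub>" for u
  obtain u0 where "P u0" using ne V.M.zero_closed by (auto simp: P_def)
  moreover have "\<forall>u. P u \<longrightarrow> card (stabilizer B u) < Suc (card B)"
    using card_mono[OF B(2)] by (auto simp: stabilizer_def less_Suc_eq_le)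
  ultimately have "\<exists>u. P u \<and> (\<forall>w. P w \<longrightarrow> card (stabilizer B w) \<le> card (stabilizer B u))"
    by (rule ex_has_greatest_nat)
  then obtain u where u: "P u" and max: "\<And>w. P w \<Longrightarrow> card (stabilizer B w) \<le> card (stabilizer B u)" by blast
  have "x \<in> stabilizer B u" if w: "w \<in> fixed_by (stabilizer B u)" "w \<noteq> \<zero>\<^bsub>V\<^esub>" and x: "x \<in> B" "act x w = w" for w x
  proof -
    have "stabilizer B u \<subseteq> stabilizer B w" using w by (auto simp: fixed_by_def stabilizer_def)
    moreover have "card (stabilizer B w) \<le> card (stabilizer B u)" using w by (intro max) (auto simp: P_def fixed_by_def)
    moreover have "finite (stabilizer B w)" using B(2) by (simp add: stabilizer_def)
    ultimately have "stabilizer B u = stabilizer B w" by (intro card_seteq) auto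
    then show ?thesis using x by (simp add: stabilizer_def)
  qed
  then show ?thesis using u unfolding P_def by blast
qed

lemma fixed_by_act:
  assumes C: "C \<subseteq> B" and B: "subgroup B G" and comm: "\<And>x y. \<lbrakk>x \<in> B; y \<in> B\<rbrakk> \<Longrightarrow> x \<otimes>\<^bsub>G\<^esub> y = y \<otimes>\<^bsub>G\<^esub> x"
    and x: "x \<in> B" and w: "w \<in> fixed_by C"
  shows "act x w \<in> fixed_by C"
proof -
  interpret B: subgroup B G by (rule B)
  have wV: "w \<in> carrier V" using w by (simp add: fixed_by_def)
  have "act c (act x w) = act x w" if c: "c \<in> C" for c
  proof -
    have cB: "c \<in> B" using c C by blast
    have "act c (act x w) = act (x \<otimes>\<^bsub>G\<^esub> c) w" using comm[OF cB x] cB x wV by (simp add: act_act)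
    also have "\<dots> = act x (act c w)" using cB x wV by (simp add: act_act)
    also have "act c w = w" using w c by (simp add: fixed_by_def)
    finally show ?thesis .
  qed
  then show ?thesis using x wV by (simp add: fixed_by_def)
qed

lemma fixed_by_finsum:
  assumes "C \<subseteq> carrier G" "\<And>i. i \<in> I \<Longrightarrow> f i \<in> fixed_by C"
  shows "finsum V f I \<in> fixed_by C"
proof -
  have f: "f \<in> I \<rightarrow> carrier V" using assms(2) by (auto simp: fixed_by_def)
  have "act c (finsum V f I) = finsum V f I" if "c \<in> C" for c
  proof -
    have "act c (finsum V f I) = (\<Oplus>\<^bsub>V\<^esub>i\<in>I. act c (f i))" using that assms(1) f by (intro act_finsum) auto
    also have "\<dots> = finsum V f I"
      using assms(2) that f by (intro V.M.finsum_cong') (auto simp: fixed_by_def)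
    finally show ?thesis .
  qed
  then show ?thesis using f by (simp add: fixed_by_def)
qed

text \<open>Multiplication by \<open>z\<close> permutes the summands of \<open>w + z w + \<dots> + z\<^bsup>p-1\<^esup> w\<close> cyclically.\<close>

lemma norm_fixed:
  assumes z: "z \<in> carrier G" and p: "p > 0" "z [^]\<^bsub>G\<^esub> (p::nat) = \<one>\<^bsub>G\<^esub>" and w: "w \<in> carrier V"
  shows "act z (\<Oplus>\<^bsub>V\<^esub>i\<in>{..<p}. act (z [^]\<^bsub>G\<^esub> i) w) = (\<Oplus>\<^bsub>V\<^esub>i\<in>{..<p}. act (z [^]\<^bsub>G\<^esub> i) w)"
proof -
  obtain q where q: "p = Suc q" using p(1) gr0_conv_Suc by auto
  define f where "f i = act (z [^]\<^bsub>G\<^esub> i) w" for i :: nat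
  have cl: "f i \<in> carrier V" for i using z w by (simp add: f_def)
  have f_Suc: "act z (f i) = f (Suc i)" for i
    unfolding f_def G.nat_pow_Suc2[OF z] using z w by (simp add: act_act)
  have f_p: "f (Suc q) = f 0" using p(2) w unfolding f_def q by (simp del: G.nat_pow_Suc)
  have "act z (\<Oplus>\<^bsub>V\<^esub>i\<in>{..<p}. f i) = (\<Oplus>\<^bsub>V\<^esub>i\<in>{..<p}. act z (f i))"
    by (rule act_finsum[OF z]) (use cl in auto)
  also have "\<dots> = (\<Oplus>\<^bsub>V\<^esub>i\<in>insert q {..<q}. f (Suc i))"
    by (simp add: f_Suc q lessThan_Suc)
  also have "\<dots> = f (Suc q) \<oplus>\<^bsub>V\<^esub> (\<Oplus>\<^bsub>V\<^esub>i\<in>{..<q}. f (Suc i))"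
    using cl by (intro V.M.finsum_insert) auto
  also have "(\<Oplus>\<^bsub>V\<^esub>i\<in>{..<q}. f (Suc i)) = (\<Oplus>\<^bsub>V\<^esub>i\<in>Suc ` {..<q}. f i)"
    using V.M.add.finprod_reindex[of f Suc "{..<q}"] cl by (simp add: finsum_def)
  also have "f (Suc q) \<oplus>\<^bsub>V\<^esub> \<dots> = (\<Oplus>\<^bsub>V\<^esub>i\<in>insert 0 (Suc ` {..<q}). f i)"
    unfolding f_p using cl by (intro V.M.finsum_insert[symmetric]) auto
  also have "insert 0 (Suc ` {..<q}) = {..<p}" unfolding q by (rule lessThan_Suc_eq_insert_0[symmetric])
  finally show ?thesis by (simp add: f_def)
qed

lemma pascal_sum:
  assumes w: "\<And>i. w i \<in> carrier V"
  shows "(\<Oplus>\<^bsub>V\<^esub>j\<in>{..Suc n}. [(Suc n choose j)] \<cdot>\<^bsub>V\<^esub> w j) =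
    (\<Oplus>\<^bsub>V\<^esub>j\<in>{..n}. [(n choose j)] \<cdot>\<^bsub>V\<^esub> w j) \<oplus>\<^bsub>V\<^esub> (\<Oplus>\<^bsub>V\<^esub>j\<in>{..n}. [(n choose j)] \<cdot>\<^bsub>V\<^esub> w (Suc j))"
proof -
  have cl: "[k] \<cdot>\<^bsub>V\<^esub> w i \<in> carrier V" for k :: nat and i using w by simp
  have shift: "(\<Oplus>\<^bsub>V\<^esub>j\<in>{..Suc n}. f j) = f 0 \<oplus>\<^bsub>V\<^esub> (\<Oplus>\<^bsub>V\<^esub>j\<in>{..n}. f (Suc j))" if f: "\<And>j. f j \<in> carrier V" for f and n :: nat
  proof -
    have "(\<Oplus>\<^bsub>V\<^esub>j\<in>{..n}. f (Suc j)) = (\<Oplus>\<^bsub>V\<^esub>j\<in>Suc ` {..n}. f j)"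
      using V.M.add.finprod_reindex[of f Suc "{..n}"] f by (simp add: finsum_def)
    moreover have "(\<Oplus>\<^bsub>V\<^esub>j\<in>insert 0 (Suc ` {..n}). f j) = f 0 \<oplus>\<^bsub>V\<^esub> (\<Oplus>\<^bsub>V\<^esub>j\<in>Suc ` {..n}. f j)"
      using f by (intro V.M.finsum_insert) auto
    ultimately show ?thesis by (simp add: atMost_Suc_eq_insert_0)
  qed
  have "(\<Oplus>\<^bsub>V\<^esub>j\<in>{..n}. [(Suc n choose Suc j)] \<cdot>\<^bsub>V\<^esub> w (Suc j)) =
      (\<Oplus>\<^bsub>V\<^esub>j\<in>{..n}. [(n choose j)] \<cdot>\<^bsub>V\<^esub> w (Suc j) \<oplus>\<^bsub>V\<^esub> [(n choose Suc j)] \<cdot>\<^bsub>V\<^esub> w (Suc j))"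
    using w by (intro V.M.finsum_cong') (auto simp: V.M.add.nat_pow_mult)
  also have "\<dots> = (\<Oplus>\<^bsub>V\<^esub>j\<in>{..n}. [(n choose j)] \<cdot>\<^bsub>V\<^esub> w (Suc j)) \<oplus>\<^bsub>V\<^esub> (\<Oplus>\<^bsub>V\<^esub>j\<in>{..n}. [(n choose Suc j)] \<cdot>\<^bsub>V\<^esub> w (Suc j))"
    using w by (intro V.M.finsum_addf) auto
  finally have split: "(\<Oplus>\<^bsub>V\<^esub>j\<in>{..n}. [(Suc n choose Suc j)] \<cdot>\<^bsub>V\<^esub> w (Suc j)) = \<dots>" .
  have "w 0 \<oplus>\<^bsub>V\<^esub> (\<Oplus>\<^bsub>V\<^esub>j\<in>{..n}. [(n choose Suc j)] \<cdot>\<^bsub>V\<^esub> w (Suc j)) = (\<Oplus>\<^bsub>V\<^esub>j\<in>{..Suc n}. [(n choose j)] \<cdot>\<^bsub>V\<^esub> w j)"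
    using shift[of "\<lambda>j. [(n choose j)] \<cdot>\<^bsub>V\<^esub> w j" n] w by simp
  also have "\<dots> = (\<Oplus>\<^bsub>V\<^esub>j\<in>{..n}. [(n choose j)] \<cdot>\<^bsub>V\<^esub> w j)"
    using V.M.finsum_insert[of "{..n}" "Suc n" "\<lambda>j. [(n choose j)] \<cdot>\<^bsub>V\<^esub> w j"] w
    by (simp add: atMost_Suc binomial_eq_0)
  finally have tail: "w 0 \<oplus>\<^bsub>V\<^esub> (\<Oplus>\<^bsub>V\<^esub>j\<in>{..n}. [(n choose Suc j)] \<cdot>\<^bsub>V\<^esub> w (Suc j)) = (\<Oplus>\<^bsub>V\<^esub>j\<in>{..n}. [(n choose j)] \<cdot>\<^bsub>V\<^esub> w j)" .
  have fin: "(\<Oplus>\<^bsub>V\<^esub>j\<in>{..n}. [(n choose j)] \<cdot>\<^bsub>V\<^esub> w (Suc j)) \<in> carrier V"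
    "(\<Oplus>\<^bsub>V\<^esub>j\<in>{..n}. [(n choose Suc j)] \<cdot>\<^bsub>V\<^esub> w (Suc j)) \<in> carrier V"
    using w by (auto intro!: V.M.finsum_closed)
  have "(\<Oplus>\<^bsub>V\<^esub>j\<in>{..Suc n}. [(Suc n choose j)] \<cdot>\<^bsub>V\<^esub> w j) =
      w 0 \<oplus>\<^bsub>V\<^esub> ((\<Oplus>\<^bsub>V\<^esub>j\<in>{..n}. [(n choose j)] \<cdot>\<^bsub>V\<^esub> w (Suc j)) \<oplus>\<^bsub>V\<^esub> (\<Oplus>\<^bsub>V\<^esub>j\<in>{..n}. [(n choose Suc j)] \<cdot>\<^bsub>V\<^esub> w (Suc j)))"
    using shift[of "\<lambda>j. [(Suc n choose j)] \<cdot>\<^bsub>V\<^esub> w j" n] w split by (simp del: binomial_Suc_Suc)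
  also have "\<dots> = (\<Oplus>\<^bsub>V\<^esub>j\<in>{..n}. [(n choose j)] \<cdot>\<^bsub>V\<^esub> w j) \<oplus>\<^bsub>V\<^esub> (\<Oplus>\<^bsub>V\<^esub>j\<in>{..n}. [(n choose j)] \<cdot>\<^bsub>V\<^esub> w (Suc j))"
    unfolding tail[symmetric] using w[of 0] fin V.M.a_ac by simp
  finally show ?thesis .
qed

text \<open>The binomial expansion of \<open>x\<^sup>n = (1 + (x - 1))\<^sup>n\<close>, where \<open>w i = (x - 1)\<^sup>i (w 0)\<close>.\<close>

lemma act_pow_expand:
  assumes x: "x \<in> carrier G" and w: "\<And>i. w i \<in> carrier V" and step: "\<And>i. act x (w i) = w i \<oplus>\<^bsub>V\<^esub> w (Suc i)"
  shows "act (x [^]\<^bsub>G\<^esub> n) (w 0) = (\<Oplus>\<^bsub>V\<^esub>j\<in>{..n}. [(n choose j)] \<cdot>\<^bsub>V\<^esub> w j)"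
proof (induction n)
  case 0
  then show ?case using w by simp
next
  case (Suc n)
  have pow: "act x ([k] \<cdot>\<^bsub>V\<^esub> v) = [k] \<cdot>\<^bsub>V\<^esub> act x v" if "v \<in> carrier V" for k :: nat and v
    by (induction k) (use that x in \<open>auto simp: act_add\<close>)
  have "act (x [^]\<^bsub>G\<^esub> Suc n) (w 0) = act x (act (x [^]\<^bsub>G\<^esub> n) (w 0))"
    using x w by (simp only: G.nat_pow_Suc2 act_act G.nat_pow_closed)
  also have "\<dots> = (\<Oplus>\<^bsub>V\<^esub>j\<in>{..n}. act x ([(n choose j)] \<cdot>\<^bsub>V\<^esub> w j))"
    unfolding Suc.IH by (rule act_finsum[OF x]) (use w in auto)
  also have "\<dots> = (\<Oplus>\<^bsub>V\<^esub>j\<in>{..n}. [(n choose j)] \<cdot>\<^bsub>V\<^esub> w j \<oplus>\<^bsub>V\<^esub> [(n choose j)] \<cdot>\<^bsub>V\<^esub> w (Suc j))"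
    using w by (intro V.M.finsum_cong') (auto simp: pow step V.M.add.nat_pow_distrib)
  also have "\<dots> = (\<Oplus>\<^bsub>V\<^esub>j\<in>{..n}. [(n choose j)] \<cdot>\<^bsub>V\<^esub> w j) \<oplus>\<^bsub>V\<^esub> (\<Oplus>\<^bsub>V\<^esub>j\<in>{..n}. [(n choose j)] \<cdot>\<^bsub>V\<^esub> w (Suc j))"
    using w by (intro V.M.finsum_addf) auto
  also have "\<dots> = (\<Oplus>\<^bsub>V\<^esub>j\<in>{..Suc n}. [(Suc n choose j)] \<cdot>\<^bsub>V\<^esub> w j)" by (rule pascal_sum[OF w, symmetric])
  finally show ?case .
qed

text \<open>In characteristic \<open>p\<close> we have \<open>(x - 1)\<^sup>p = x\<^sup>p - 1 = 0\<close>, so the last nonzero vector among the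
  \<open>(x - 1)\<^sup>i u\<close> is fixed by \<open>x\<close>.\<close>

lemma order_p_fixed_vector:
  assumes p: "Factorial_Ring.prime (p::nat)" "[p] \<cdot> \<one> = \<zero>" and x: "x \<in> carrier G" "x [^]\<^bsub>G\<^esub> p = \<one>\<^bsub>G\<^esub>"
    and U: "subgroup U (add_monoid V)" "\<And>v. v \<in> U \<Longrightarrow> act x v \<in> U" and u: "u \<in> U" "u \<noteq> \<zero>\<^bsub>V\<^esub>"
  shows "\<exists>v\<in>U. v \<noteq> \<zero>\<^bsub>V\<^esub> \<and> act x v = v"
proof -
  interpret U: subgroup U "add_monoid V" by (rule U(1))
  define \<delta> where "\<delta> v = act x v \<ominus>\<^bsub>V\<^esub> v" for v
  define w where "w i = (\<delta> ^^ i) u" for i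
  have UV: "v \<in> carrier V" if "v \<in> U" for v using that U.subset by auto
  have "\<delta> v \<in> U" if "v \<in> U" for v
    using U.m_closed[OF U(2)[OF that] U.m_inv_closed[OF that]] by (simp add: \<delta>_def a_minus_def a_inv_def)
  then have wU: "w i \<in> U" for i by (induction i) (auto simp: w_def u)
  then have wV: "w i \<in> carrier V" for i using UV by blast
  have step: "act x (w i) = w i \<oplus>\<^bsub>V\<^esub> w (Suc i)" for i
  proof -
    have "w (Suc i) = act x (w i) \<ominus>\<^bsub>V\<^esub> w i" by (simp add: w_def \<delta>_def)
    then show ?thesis using wV[of i] x(1) V.M.a_comm V.M.minus_eq
      by (metis V.M.a_inv_closed V.M.add.inv_solve_right' V.M.add.m_closed act_closed)
  qed
  have "w 0 = (\<Oplus>\<^bsub>V\<^esub>j\<in>{..p}. [(p choose j)] \<cdot>\<^bsub>V\<^esub> w j)"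
    using act_pow_expand[of x w p, OF x(1) wV step] x(2) wV by simp
  also have "\<dots> = (\<Oplus>\<^bsub>V\<^esub>j\<in>{0, p}. [(p choose j)] \<cdot>\<^bsub>V\<^esub> w j)"
  proof (rule V.M.add.finprod_mono_neutral_cong_right)
    show "[(p choose i)] \<cdot>\<^bsub>V\<^esub> w i = \<zero>\<^bsub>V\<^esub>" if "i \<in> {..p} - {0, p}" for i
    proof -
      from that have "p dvd (p choose i)" using p(1) by (intro dvd_choose_prime) auto
      then obtain k where k: "p choose i = p * k" by auto
      have "[(p * k)] \<cdot>\<^bsub>V\<^esub> w i = [k] \<cdot>\<^bsub>V\<^esub> ([p] \<cdot>\<^bsub>V\<^esub> w i)" using wV V.M.add.nat_pow_pow by simp
      also have "\<dots> = \<zero>\<^bsub>V\<^esub>" using add_pow_zero[OF wV p(2)] by simp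
      finally show ?thesis by (simp add: k)
    qed
  qed (use wV in auto)
  also have "\<dots> = w 0 \<oplus>\<^bsub>V\<^esub> w p" using wV p(1) by (simp add: prime_gt_0_nat)
  finally have "w p = \<zero>\<^bsub>V\<^esub>" using V.M.add.l_cancel_one'[OF wV wV] by blast
  then have ex: "\<exists>n. w n = \<zero>\<^bsub>V\<^esub>" by blast
  define n where "n = (LEAST n. w n = \<zero>\<^bsub>V\<^esub>)"
  have n: "w n = \<zero>\<^bsub>V\<^esub>" unfolding n_def using ex by (rule LeastI_ex)
  moreover have "w 0 \<noteq> \<zero>\<^bsub>V\<^esub>" using u by (simp add: w_def)
  ultimately obtain m where m: "n = Suc m" using not0_implies_Suc by metis
  have "w m \<noteq> \<zero>\<^bsub>V\<^esub>" using not_less_Least[of m "\<lambda>n. w n = \<zero>\<^bsub>V\<^esub>"] m n_def by auto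
  moreover have "act x (w m) = w m" using step[of m] n m wV by simp
  ultimately show ?thesis using wU by blast
qed

lemma fixed_by_subgroup: "C \<subseteq> carrier G \<Longrightarrow> subgroup (fixed_by C) (add_monoid V)"
proof (intro subgroup.intro)
  assume C: "C \<subseteq> carrier G"
  show "inv\<^bsub>add_monoid V\<^esub> v \<in> fixed_by C" if "v \<in> fixed_by C" for v
    using that C by (auto simp: fixed_by_def act_neg subset_iff simp flip: a_inv_def)
  show "\<one>\<^bsub>add_monoid V\<^esub> \<in> fixed_by C" using C by (auto simp: fixed_by_def)
  show "v \<otimes>\<^bsub>add_monoid V\<^esub> w \<in> fixed_by C" if "v \<in> fixed_by C" "w \<in> fixed_by C" for v w
    using that C by (auto simp: fixed_by_def act_add subset_iff)
qed (auto simp: fixed_by_def)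

end

locale faithful_simple_representation = group_representation +
  assumes simple: "simple_module RG V" and faithful: "rep_kernel K G V = {\<one>\<^bsub>G\<^esub>}"
begin

text \<open>The fixed vectors of \<open>N\<close> form a nonzero submodule, hence everything, and \<open>N\<close> acts trivially.\<close>

lemma fixed_vector_trivial:
  assumes N: "N \<lhd> G" and v: "v \<in> fixed_by N" "v \<noteq> \<zero>\<^bsub>V\<^esub>"
  shows "N = {\<one>\<^bsub>G\<^esub>}"
proof -
  interpret N: normal N G by (rule N)
  have "fixed_by N = carrier V"
    using simple fixed_by_submodule[OF N] v unfolding simple_module_def by blast
  then have "N \<subseteq> rep_kernel K G V" using N.subset by (auto simp: fixed_by_def rep_kernel_def act_def)
  then show ?thesis using faithful N.one_closed by blast
qed

lemma nonzero: "carrier V \<noteq> {\<zero>\<^bsub>V\<^esub>}"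
  using simple by (simp add: simple_module_def)

context
  fixes B and p :: nat
  assumes B: "B \<lhd> G" "finite B" and comm: "\<And>x y. \<lbrakk>x \<in> B; y \<in> B\<rbrakk> \<Longrightarrow> x \<otimes>\<^bsub>G\<^esub> y = y \<otimes>\<^bsub>G\<^esub> x"
    and p: "Factorial_Ring.prime p" and exp: "\<And>x. x \<in> B \<Longrightarrow> x [^]\<^bsub>G\<^esub> p = \<one>\<^bsub>G\<^esub>"
begin

text \<open>A vector \<open>u\<close> with maximal stabiliser in \<open>B\<close> is fixed by all of \<open>B\<close>: an element \<open>x\<close> outside the
  stabiliser acts on the fixed space of the stabiliser and has a nonzero fixed vector there.\<close>

lemma elementary_normal_trivial:
  assumes char: "[p] \<cdot> \<one> = \<zero>"
  shows "B = {\<one>\<^bsub>G\<^esub>}"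
proof -
  interpret B: normal B G by (rule B(1))
  obtain u where u: "u \<in> carrier V" "u \<noteq> \<zero>\<^bsub>V\<^esub>" and
    max: "\<And>w x. \<lbrakk>w \<in> fixed_by (stabilizer B u); x \<in> B; act x w = w\<rbrakk> \<Longrightarrow> x \<in> stabilizer B u \<or> w = \<zero>\<^bsub>V\<^esub>"
    using maximal_stabilizer[OF B.subgroup_axioms B(2) nonzero] by blast
  have C: "stabilizer B u \<subseteq> B" "stabilizer B u \<subseteq> carrier G" by (auto simp: stabilizer_def)
  have uC: "u \<in> fixed_by (stabilizer B u)" using u by (auto simp: fixed_by_def stabilizer_def)
  have "stabilizer B u = B"
  proof (rule ccontr)
    assume "stabilizer B u \<noteq> B"
    then obtain x where x: "x \<in> B" "x \<notin> stabilizer B u" using C by blast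
    have "\<exists>v\<in>fixed_by (stabilizer B u). v \<noteq> \<zero>\<^bsub>V\<^esub> \<and> act x v = v"
    proof (rule order_p_fixed_vector[OF p char _ exp[OF x(1)] fixed_by_subgroup[OF C(2)] _ uC u(2)])
      show "x \<in> carrier G" using x by simp
      show "act x v \<in> fixed_by (stabilizer B u)" if "v \<in> fixed_by (stabilizer B u)" for v
        by (rule fixed_by_act[OF C(1) B.subgroup_axioms comm x(1) that])
    qed
    then show False using max x by blast
  qed
  then show ?thesis using fixed_vector_trivial[OF B(1)] uC u(2) by simp
qed

text \<open>Let \<open>C\<close> be a maximal stabiliser in \<open>B\<close> of a nonzero vector \<open>u\<close>. For \<open>z\<close> in \<open>B\<close> but not in \<open>C\<close> the vector
  \<open>u + z u + \<dots> + z\<^bsup>p-1\<^esup> u\<close> is fixed by \<open>C\<close> and by \<open>z\<close>, hence is zero. It follows that \<open>B/C\<close>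
  has order at most \<open>p\<close>, so that \<open>C\<close> is the kernel of a functional. A normal subgroup of \<open>G\<close> inside \<open>C\<close> fixes
  \<open>u\<close> and is therefore trivial.\<close>

lemma core_free_functional_exists:
  assumes char: "[p] \<cdot> \<one> \<noteq> \<zero>"
  shows "\<exists>c\<in>G.zp_homs p B. G.core_free c B"
proof -
  interpret B: normal B G by (rule B(1))
  have p0: "p > 0" by (rule prime_gt_0_nat[OF p])
  obtain u where u: "u \<in> carrier V" "u \<noteq> \<zero>\<^bsub>V\<^esub>" and
    max: "\<And>w x. \<lbrakk>w \<in> fixed_by (stabilizer B u); x \<in> B; act x w = w\<rbrakk> \<Longrightarrow> x \<in> stabilizer B u \<or> w = \<zero>\<^bsub>V\<^esub>"
    using maximal_stabilizer[OF B.subgroup_axioms B(2) nonzero] by blast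
  define C where "C = stabilizer B u"
  have CB: "C \<subseteq> B" and CG: "C \<subseteq> carrier G" by (auto simp: C_def stabilizer_def)
  have uC: "u \<in> fixed_by C" using u by (auto simp: C_def fixed_by_def stabilizer_def)
  have C: "subgroup C G" unfolding C_def by (rule stabilizer_subgroup[OF B.subgroup_axioms u(1)])
  interpret C: subgroup C G by (rule C)
  have core: "N = {\<one>\<^bsub>G\<^esub>}" if "N \<lhd> G" "N \<subseteq> C" for N
    using fixed_vector_trivial[OF that(1), of u] uC u(2) that(2) by (auto simp: fixed_by_def)
  have norm: "(\<Oplus>\<^bsub>V\<^esub>i\<in>{..<p}. act (z [^]\<^bsub>G\<^esub> i) u) = \<zero>\<^bsub>V\<^esub>" if z: "z \<in> B" "z \<notin> C" for z
  proof -
    have zG: "z \<in> carrier G" using z by simp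
    have "act z (\<Oplus>\<^bsub>V\<^esub>i\<in>{..<p}. act (z [^]\<^bsub>G\<^esub> i) u) = (\<Oplus>\<^bsub>V\<^esub>i\<in>{..<p}. act (z [^]\<^bsub>G\<^esub> i) u)"
      by (rule norm_fixed[OF zG p0 exp[OF z(1)] u(1)])
    moreover have "(\<Oplus>\<^bsub>V\<^esub>i\<in>{..<p}. act (z [^]\<^bsub>G\<^esub> i) u) \<in> fixed_by C"
    proof (rule fixed_by_finsum[OF CG])
      show "act (z [^]\<^bsub>G\<^esub> i) u \<in> fixed_by C" for i :: nat
        by (rule fixed_by_act[OF CB B.subgroup_axioms comm G.subgroup_nat_pow_closed[OF B.subgroup_axioms z(1)] uC])
    qed
    ultimately show ?thesis using max[folded C_def] z by blast
  qed
  \<comment> \<open>\<open>x\<close> generates \<open>B\<close> modulo \<open>C\<close>. If \<open>y\<close> were a counterexample, consider the sum of \<open>(x\<^sup>i y)\<^sup>j u\<close> over all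
      \<open>i, j < p\<close>. The inner sums over \<open>j\<close> vanish. Summing over \<open>i\<close> first gives zero for \<open>j \<noteq> 0\<close>, and \<open>p u\<close>
      for \<open>j = 0\<close>; so \<open>p u = 0\<close>.\<close>
  have cover: "\<exists>i<p. x [^]\<^bsub>G\<^esub> i \<otimes>\<^bsub>G\<^esub> y \<in> C" if x: "x \<in> B" "x \<notin> C" and y: "y \<in> B" for x y
  proof (rule ccontr)
    assume neg: "\<not> ?thesis"
    have xG: "x \<in> carrier G" "y \<in> carrier G" using x y by auto
    have xp: "x [^]\<^bsub>G\<^esub> (i::nat) \<in> B" "y [^]\<^bsub>G\<^esub> (i::nat) \<in> B" for i
      using G.subgroup_nat_pow_closed[OF B.subgroup_axioms] x y by auto
    define T where "T i j = act (y [^]\<^bsub>G\<^esub> j) (act ((x [^]\<^bsub>G\<^esub> j) [^]\<^bsub>G\<^esub> i) u)" for i j :: nat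
    have T: "T i j \<in> carrier V" for i j using xG u by (simp add: T_def)
    have "act ((x [^]\<^bsub>G\<^esub> i \<otimes>\<^bsub>G\<^esub> y) [^]\<^bsub>G\<^esub> j) u = T i j" for i j :: nat
    proof -
      have "(x [^]\<^bsub>G\<^esub> i \<otimes>\<^bsub>G\<^esub> y) [^]\<^bsub>G\<^esub> j = (x [^]\<^bsub>G\<^esub> i) [^]\<^bsub>G\<^esub> j \<otimes>\<^bsub>G\<^esub> y [^]\<^bsub>G\<^esub> j"
        by (rule G.pow_mult_distrib[OF comm[OF xp(1) y]]) (use xG in auto)
      also have "(x [^]\<^bsub>G\<^esub> i) [^]\<^bsub>G\<^esub> j = (x [^]\<^bsub>G\<^esub> j) [^]\<^bsub>G\<^esub> i" using xG by (simp add: G.nat_pow_pow mult.commute)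
      also have "(x [^]\<^bsub>G\<^esub> j) [^]\<^bsub>G\<^esub> i \<otimes>\<^bsub>G\<^esub> y [^]\<^bsub>G\<^esub> j = y [^]\<^bsub>G\<^esub> j \<otimes>\<^bsub>G\<^esub> (x [^]\<^bsub>G\<^esub> j) [^]\<^bsub>G\<^esub> i"
        by (rule comm) (use xp G.subgroup_nat_pow_closed[OF B.subgroup_axioms] in auto)
      finally show ?thesis using xG u by (simp add: T_def act_act)
    qed
    then have row: "(\<Oplus>\<^bsub>V\<^esub>j\<in>{..<p}. T i j) = \<zero>\<^bsub>V\<^esub>" if "i < p" for i
      using norm[of "x [^]\<^bsub>G\<^esub> i \<otimes>\<^bsub>G\<^esub> y"] neg that B.m_closed[OF xp(1) y] by auto
    have col: "(\<Oplus>\<^bsub>V\<^esub>i\<in>{..<p}. T i j) = (if j = 0 then [p] \<cdot>\<^bsub>V\<^esub> u else \<zero>\<^bsub>V\<^esub>)" if j: "j < p" for j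
    proof (cases "j = 0")
      case True
      have "T i 0 = u" for i using u by (simp add: T_def)
      then show ?thesis using True V.M.add.finprod_const[of u "{..<p}"] u by (simp add: finsum_def add_pow_def)
    next
      case False
      then have "\<not> p dvd j" using j by (simp add: nat_dvd_not_less)
      then have "x [^]\<^bsub>G\<^esub> j \<notin> C" using G.power_cancel_prime[OF C xG(1) p exp[OF x(1)]] x(2) by blast
      then have "(\<Oplus>\<^bsub>V\<^esub>i\<in>{..<p}. act ((x [^]\<^bsub>G\<^esub> j) [^]\<^bsub>G\<^esub> i) u) = \<zero>\<^bsub>V\<^esub>" using norm xp(1) by blast
      moreover have "(\<Oplus>\<^bsub>V\<^esub>i\<in>{..<p}. T i j) = act (y [^]\<^bsub>G\<^esub> j) (\<Oplus>\<^bsub>V\<^esub>i\<in>{..<p}. act ((x [^]\<^bsub>G\<^esub> j) [^]\<^bsub>G\<^esub> i) u)"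
        unfolding T_def by (rule act_finsum[symmetric]) (use xG u in auto)
      ultimately show ?thesis using False xG by simp
    qed
    have "(\<Oplus>\<^bsub>V\<^esub>i\<in>{..<p}. \<Oplus>\<^bsub>V\<^esub>j\<in>{..<p}. T i j) = (\<Oplus>\<^bsub>V\<^esub>i\<in>{..<p}. \<zero>\<^bsub>V\<^esub>)"
      by (rule V.M.finsum_cong') (use row in auto)
    then have "\<zero>\<^bsub>V\<^esub> = (\<Oplus>\<^bsub>V\<^esub>i\<in>{..<p}. \<Oplus>\<^bsub>V\<^esub>j\<in>{..<p}. T i j)" by simp
    also have "\<dots> = (\<Oplus>\<^bsub>V\<^esub>j\<in>{..<p}. \<Oplus>\<^bsub>V\<^esub>i\<in>{..<p}. T i j)"
      using V.M.add.finprod_swap[of "{..<p}" "{..<p}" T] T by (simp add: finsum_def)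
    also have "\<dots> = (\<Oplus>\<^bsub>V\<^esub>j\<in>{..<p}. if 0 = j then [p] \<cdot>\<^bsub>V\<^esub> u else \<zero>\<^bsub>V\<^esub>)"
      by (rule V.M.finsum_cong') (use col u in auto)
    also have "\<dots> = [p] \<cdot>\<^bsub>V\<^esub> u"
      by (rule V.M.finsum_singleton) (use p0 u in auto)
    finally show False using add_pow_cancel[OF u(1) char] u(2) by simp
  qed
  show ?thesis
  proof (cases "C = B")
    case True
    have "(\<lambda>x\<in>B. 0 mod int p) \<in> G.zp_homs p B"
      by (rule G.zp_homsI) (use p0 B.subgroup_axioms in auto)
    moreover have "G.core_free (\<lambda>x\<in>B. 0 mod int p) B" unfolding G.core_free_def using core True by blast
    ultimately show ?thesis by blast
  next
    case False
    then obtain x where x: "x \<in> B" "x \<notin> C" using CB by blast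
    have xG: "x \<in> carrier G" using x by simp
    have xp: "x [^]\<^bsub>G\<^esub> (i::nat) \<in> B" for i using G.subgroup_nat_pow_closed[OF B.subgroup_axioms x(1)] .
    \<comment> \<open>minus the exponent of \<open>y\<close> over the generator \<open>x\<close> of \<open>B/C\<close>\<close>
    define e where "e y = (SOME i. i < p \<and> x [^]\<^bsub>G\<^esub> i \<otimes>\<^bsub>G\<^esub> y \<in> C)" for y
    have e: "e y < p" "x [^]\<^bsub>G\<^esub> e y \<otimes>\<^bsub>G\<^esub> y \<in> C" if "y \<in> B" for y
      using someI_ex[OF cover[OF x that]] by (auto simp: e_def)
    have lt: False if "i < j" "j < p" "y \<in> B" "x [^]\<^bsub>G\<^esub> i \<otimes>\<^bsub>G\<^esub> y \<in> C" "x [^]\<^bsub>G\<^esub> j \<otimes>\<^bsub>G\<^esub> y \<in> C" for i j :: nat and y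
    proof -
      have yG: "y \<in> carrier G" using that by simp
      have "x [^]\<^bsub>G\<^esub> j \<otimes>\<^bsub>G\<^esub> y = x [^]\<^bsub>G\<^esub> (j - i) \<otimes>\<^bsub>G\<^esub> (x [^]\<^bsub>G\<^esub> i \<otimes>\<^bsub>G\<^esub> y)"
        using that(1) xG yG by (simp add: G.nat_pow_mult flip: G.m_assoc)
      then have "x [^]\<^bsub>G\<^esub> (j - i) = (x [^]\<^bsub>G\<^esub> j \<otimes>\<^bsub>G\<^esub> y) \<otimes>\<^bsub>G\<^esub> inv\<^bsub>G\<^esub> (x [^]\<^bsub>G\<^esub> i \<otimes>\<^bsub>G\<^esub> y)"
        using xG yG by (simp add: G.m_assoc)
      then have "x [^]\<^bsub>G\<^esub> (j - i) \<in> C" using that by simp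
      moreover have "\<not> p dvd (j - i)" using that by (simp add: nat_dvd_not_less)
      ultimately show False using G.power_cancel_prime[OF C xG p exp[OF x(1)]] x(2) by blast
    qed
    have x_mod: "x [^]\<^bsub>G\<^esub> i = x [^]\<^bsub>G\<^esub> (i mod p)" for i :: nat
    proof -
      have "x [^]\<^bsub>G\<^esub> (p * (i div p) + i mod p) = (x [^]\<^bsub>G\<^esub> p) [^]\<^bsub>G\<^esub> (i div p) \<otimes>\<^bsub>G\<^esub> x [^]\<^bsub>G\<^esub> (i mod p)"
        using xG by (simp add: G.nat_pow_mult G.nat_pow_pow)
      then show ?thesis using exp[OF x(1)] xG by simp
    qed
    have e_eq: "e y = i mod p" if "y \<in> B" "x [^]\<^bsub>G\<^esub> i \<otimes>\<^bsub>G\<^esub> y \<in> C" for i y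
    proof -
      have "x [^]\<^bsub>G\<^esub> (i mod p) \<otimes>\<^bsub>G\<^esub> y \<in> C" using that(2) x_mod[of i] by simp
      moreover have "i mod p < p" using p0 by simp
      ultimately show ?thesis
        using lt[of "e y" "i mod p" y] lt[of "i mod p" "e y" y] e[OF that(1)] that(1) by (metis linorder_neqE_nat)
    qed
    have "(\<lambda>y\<in>B. int (e y) mod int p) \<in> G.zp_homs p B"
    proof (rule G.zp_homsI[OF _ p0 B.subgroup_axioms])
      fix y z assume yz: "y \<in> B" "z \<in> B"
      have G: "y \<in> carrier G" "z \<in> carrier G" using yz by auto
      have "(x [^]\<^bsub>G\<^esub> e y \<otimes>\<^bsub>G\<^esub> y) \<otimes>\<^bsub>G\<^esub> (x [^]\<^bsub>G\<^esub> e z \<otimes>\<^bsub>G\<^esub> z) = x [^]\<^bsub>G\<^esub> (e y + e z) \<otimes>\<^bsub>G\<^esub> (y \<otimes>\<^bsub>G\<^esub> z)"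
        using G.mult_exchange[of "x [^]\<^bsub>G\<^esub> e y" y "x [^]\<^bsub>G\<^esub> e z" z] comm[OF yz(1) xp] G xG by (simp add: G.nat_pow_mult)
      then have "x [^]\<^bsub>G\<^esub> (e y + e z) \<otimes>\<^bsub>G\<^esub> (y \<otimes>\<^bsub>G\<^esub> z) \<in> C"
        using C.m_closed[OF e(2)[OF yz(1)] e(2)[OF yz(2)]] by simp
      then have "e (y \<otimes>\<^bsub>G\<^esub> z) = (e y + e z) mod p" using yz by (intro e_eq) auto
      then show "int (e (y \<otimes>\<^bsub>G\<^esub> z)) mod int p = (int (e y) + int (e z)) mod int p"
        by (simp add: of_nat_mod)
    qed
    moreover have "G.core_free (\<lambda>y\<in>B. int (e y) mod int p) B"
      unfolding G.core_free_def
    proof (intro allI impI, elim conjE)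
      fix N assume N: "N \<lhd> G" "N \<subseteq> B" "\<forall>y\<in>N. (\<lambda>y\<in>B. int (e y) mod int p) y = 0"
      have "y \<in> C" if y: "y \<in> N" for y
      proof -
        have yB: "y \<in> B" using y N by blast
        then have "int (e y) mod int p = 0" using N(3) y by auto
        then have "e y = 0" using e(1)[OF yB] by (simp flip: of_nat_mod)
        then show ?thesis using e(2)[OF yB] yB by simp
      qed
      then show "N = {\<one>\<^bsub>G\<^esub>}" using core[OF N(1)] by blast
    qed
    ultimately show ?thesis by blast
  qed
qed

end

end


section \<open>From a faithful irreducible representation to the socle\<close>

lemma (in group) ord_eq_prime_iff:
  assumes p: "Factorial_Ring.prime (p::nat)" and x: "x \<in> carrier G"
  shows "ord x = p \<longleftrightarrow> x \<noteq> \<one> \<and> x [^] p = \<one>"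
proof
  assume o: "ord x = p"
  have "x \<noteq> \<one>" using o p by auto
  then show "x \<noteq> \<one> \<and> x [^] p = \<one>" using pow_ord_eq_1[OF x] o by simp
next
  assume "x \<noteq> \<one> \<and> x [^] p = \<one>"
  then have "ord x dvd p" "x \<noteq> \<one>" using pow_eq_id[OF x, of p] by auto
  moreover have "x = \<one>" if "ord x = 1" using pow_ord_eq_1[OF x] x unfolding that by simp
  ultimately have "ord x dvd p" "ord x \<noteq> 1" by auto
  then show "ord x = p" using p prime_nat_iff by blast
qed

lemma ring_char_eq_prime_iff:
  assumes "field K" "Factorial_Ring.prime (p::nat)"
  shows "ring_char K = p \<longleftrightarrow> [p] \<cdot>\<^bsub>K\<^esub> \<one>\<^bsub>K\<^esub> = \<zero>\<^bsub>K\<^esub>"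
proof -
  interpret K: field K by fact
  show ?thesis
    using K.add.ord_eq_prime_iff[OF assms(2) K.one_closed] by (simp add: ring_char_def add_pow_def)
qed

context finite_rank_solvable_group
begin

lemma prime_orders_socle: "p \<in> prime_orders (G\<lparr>carrier := S\<rparr>) \<longleftrightarrow> Factorial_Ring.prime p \<and> socle_part p \<noteq> {\<one>}"
proof (cases "Factorial_Ring.prime p")
  case True
  interpret S: subgroup S G by (rule normal_imp_subgroup[OF socle_normal])
  interpret C: group "G\<lparr>carrier := S\<rparr>" by (rule S.subgroup_is_group[OF is_group])
  have "\<one> \<in> socle_part p" by (simp add: socle_part_def)
  moreover have "group.ord (G\<lparr>carrier := S\<rparr>) x = p \<longleftrightarrow> x \<noteq> \<one> \<and> x [^] p = \<one>" if "x \<in> S" for x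
    using C.ord_eq_prime_iff[OF True, of x] that by (simp add: nat_pow_consistent[symmetric])
  ultimately show ?thesis using True unfolding prime_orders_def socle_part_def by auto
qed (simp add: prime_orders_def)

lemma conj_module_smult_group_elem:
  assumes g: "g \<in> carrier G" and x: "x \<in> S"
  shows "group_elem \<Z> g \<odot>\<^bsub>conj_module G S\<^esub> x = conjugate g x"
proof -
  interpret C: comm_group "G\<lparr>carrier := S\<rparr>" by (rule socle_abelian_normal(2)[OF is_group sol])
  have "fsupport \<Z> (group_elem \<Z> g) = {g}" by (auto simp: fsupport_def group_elem_def)
  moreover have "conjugate g x \<in> S" using normal_conjugate[OF socle_normal g x] .
  moreover have "conjugate g x \<in> carrier G" using g socle_sub[OF x] by simp
  ultimately show ?thesis by (simp add: conj_module_def group_elem_def conjugate_def)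
qed

text \<open>A submodule is closed under the actions of \<open>g\<close> and of \<open>-1\<close>, so it is a normal subgroup; conversely a
  normal subgroup contains the products of integral powers of conjugates of its elements.\<close>

lemma conj_module_submodule_iff:
  "submodule N (group_ring \<Z> G) (conj_module G S) \<longleftrightarrow> N \<lhd> G \<and> N \<subseteq> S"
proof -
  interpret M: left_module "group_ring \<Z> G" "conj_module G S" by (rule socle_module[OF is_group sol])
  interpret R: group_ring_setup "\<Z>" G
    by (intro group_ring_setup.intro is_group cring.axioms(1) int_is_cring)
  have M_simps: "carrier (conj_module G S) = S" "\<zero>\<^bsub>conj_module G S\<^esub> = \<one>" "add (conj_module G S) = monoid.mult G"
    by (simp_all add: conj_module_def)
  have M_neg: "\<ominus>\<^bsub>conj_module G S\<^esub> x = inv x" if "x \<in> S" for x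
  proof (rule M.M.minus_equality)
    have "inv x \<in> S" using subgroup.m_inv_closed[OF normal_imp_subgroup[OF socle_normal] that] .
    then show "inv x \<in> carrier (conj_module G S)" "x \<in> carrier (conj_module G S)" using that by (simp_all add: M_simps)
    show "inv x \<oplus>\<^bsub>conj_module G S\<^esub> x = \<zero>\<^bsub>conj_module G S\<^esub>" using socle_sub[OF that] by (simp add: M_simps)
  qed
  have "N \<lhd> G \<and> N \<subseteq> S" if N: "submodule N (group_ring \<Z> G) (conj_module G S)"
  proof -
    interpret N: submodule N "group_ring \<Z> G" "conj_module G S" by (rule N)
    have NS: "N \<subseteq> S" using N.subset by (simp add: M_simps)
    have "N \<lhd> G"
    proof (rule normalI_conjugate)
      show "subgroup N G"
      proof (rule subgroupI)
        show "N \<subseteq> carrier G" using NS socle_sub by blast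
        show "N \<noteq> {}" using N.one_closed by blast
        show "inv x \<in> N" if "x \<in> N" for x
          using N.m_inv_closed[OF that] M_neg[OF subsetD[OF NS that]] by (simp add: a_inv_def)
        show "x \<otimes> y \<in> N" if "x \<in> N" "y \<in> N" for x y
          using N.m_closed[OF that] by (simp add: M_simps)
      qed
      show "conjugate g x \<in> N" if "g \<in> carrier G" "x \<in> N" for g x
        using N.smult_closed[OF R.group_elem_closed[OF that(1)] that(2)]
        unfolding conj_module_smult_group_elem[OF that(1) subsetD[OF NS that(2)]] .
    qed
    then show "N \<lhd> G \<and> N \<subseteq> S" using NS by simp
  qed
  moreover have "submodule N (group_ring \<Z> G) (conj_module G S)" if N: "N \<lhd> G \<and> N \<subseteq> S"
  proof -
    interpret N: normal N G using N by blast
    interpret C: comm_group "G\<lparr>carrier := S\<rparr>" by (rule socle_abelian_normal(2)[OF is_group sol])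
    show "submodule N (group_ring \<Z> G) (conj_module G S)"
    proof (intro submodule.intro subgroup.intro submodule_axioms.intro)
      show "inv\<^bsub>add_monoid (conj_module G S)\<^esub> x \<in> N" if "x \<in> N" for x
      proof -
        have "x \<in> S" using that N by blast
        from M_neg[OF this] show ?thesis using N.m_inv_closed[OF that] by (simp add: a_inv_def)
      qed
      fix f x assume f: "f \<in> carrier (group_ring \<Z> G)" and x: "x \<in> N"
      have "(\<Otimes>\<^bsub>G\<lparr>carrier := S\<rparr>\<^esub>g\<in>B. (g \<otimes> x \<otimes> inv g) [^] f g) \<in> N" if "B \<subseteq> carrier G" for B
        using that
      proof (induction B rule: infinite_finite_induct)
        case (insert g B)
        have conj: "(h \<otimes> x \<otimes> inv h) [^] f h \<in> N" if "h \<in> insert g B" for h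
          using subgroup_int_pow_closed[OF N.subgroup_axioms N.inv_op_closed2[of h x]] that insert.prems x by blast
        then have "(\<Otimes>\<^bsub>G\<lparr>carrier := S\<rparr>\<^esub>g\<in>insert g B. (g \<otimes> x \<otimes> inv g) [^] f g) =
            ((g \<otimes> x \<otimes> inv g) [^] f g) \<otimes> (\<Otimes>\<^bsub>G\<lparr>carrier := S\<rparr>\<^esub>g\<in>B. (g \<otimes> x \<otimes> inv g) [^] f g)"
          using insert.hyps N by (subst C.finprod_insert) auto
        moreover have "(\<Otimes>\<^bsub>G\<lparr>carrier := S\<rparr>\<^esub>g\<in>B. (g \<otimes> x \<otimes> inv g) [^] f g) \<in> N" using insert by blast
        ultimately show ?case using conj[of g] by simp
      qed simp_all
      moreover have "fsupport \<Z> f \<subseteq> carrier G" using f by (simp add: R.carrier_iff)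
      ultimately show "f \<odot>\<^bsub>conj_module G S\<^esub> x \<in> N" by (simp add: conj_module_def)
    qed (use N in \<open>auto simp: M_simps\<close>)
  qed
  ultimately show ?thesis by blast
qed

lemma submodule_span_eq_normal_closure:
  assumes "A \<subseteq> S"
  shows "submodule_span (group_ring \<Z> G) (conj_module G S) A = normal_closure A"
proof -
  have "normal_closure A \<lhd> G" by (rule normal_closure_normal) (use assms socle_sub in blast)
  moreover have "normal_closure A \<subseteq> S" by (rule normal_closure_least[OF socle_normal assms])
  ultimately have "submodule_span (group_ring \<Z> G) (conj_module G S) A \<subseteq> normal_closure A"
    unfolding submodule_span_def conj_module_submodule_iff using normal_closure_incl by blast
  moreover have "normal_closure A \<subseteq> submodule_span (group_ring \<Z> G) (conj_module G S) A"
    unfolding submodule_span_def conj_module_submodule_iff normal_closure_def by blast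
  ultimately show ?thesis by blast
qed

lemma locally_cyclic_iff:
  "locally_cyclic (group_ring \<Z> G) (conj_module G S) \<longleftrightarrow>
    (\<forall>A. finite A \<and> A \<subseteq> S \<longrightarrow> (\<exists>x\<in>S. normal_closure A = normal_closure {x}))"
proof -
  have "carrier (conj_module G S) = S" by (simp add: conj_module_def)
  then show ?thesis
    unfolding locally_cyclic_def using submodule_span_eq_normal_closure by (metis empty_subsetI insert_subset)
qed

lemma coprime_power_mem:
  assumes L: "subgroup L G" and x: "x \<in> carrier G" and cop: "coprime m (n::nat)"
    and mem: "x [^] m \<in> L" "x [^] n \<in> L"
  shows "x \<in> L"
proof -
  obtain u v where uv: "u * int m + v * int n = 1" using bezout_int[of "int m" "int n"] cop by auto
  have "x = x [^] (int m * u + int n * v)" using uv x by (simp add: mult.commute)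
  also have "\<dots> = (x [^] int m) [^] u \<otimes> (x [^] int n) [^] v" using x by (simp only: int_pow_mult int_pow_pow int_pow_closed)
  also have "\<dots> = (x [^] m) [^] u \<otimes> (x [^] n) [^] v" by (simp add: int_pow_int)
  also have "\<dots> \<in> L" using subgroup_int_pow_closed[OF L] mem subgroup.m_closed[OF L] by blast
  finally show ?thesis .
qed

text \<open>The Chinese remainder theorem: the product of generators of the primary parts generates, because each
  factor is a power of the product modulo the primes of the other factors.\<close>

lemma cyclic_of_primary_parts:
  assumes cyc: "\<And>p B. \<lbrakk>Factorial_Ring.prime p; B \<lhd> G; B \<subseteq> socle_part p\<rbrakk> \<Longrightarrow> \<exists>x\<in>B. normal_closure {x} = B"
    and N: "N \<lhd> G" "N \<subseteq> S" and P: "finite P" "\<And>p. p \<in> P \<Longrightarrow> Factorial_Ring.prime p"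
    and exp: "\<And>x. x \<in> N \<Longrightarrow> x [^] (\<Prod>P :: nat) = \<one>"
  shows "\<exists>x\<in>N. normal_closure {x} = N"
proof -
  interpret N: normal N G by (rule N(1))
  have cop: "coprime p (\<Prod>Q)" if "insert p Q \<subseteq> P" "p \<notin> Q" for p Q
  proof (rule prod_coprime_right)
    fix q assume "q \<in> Q"
    then show "coprime p q" using that P(2) by (intro primes_coprime) auto
  qed
  have "\<exists>x\<in>N. x [^] (\<Prod>Q) = \<one> \<and> (\<forall>p\<in>Q. N \<inter> socle_part p \<subseteq> normal_closure {x})" if "Q \<subseteq> P" for Q
    using finite_subset[OF that P(1)] that
  proof (induction Q rule: finite_induct)
    case empty
    show ?case using N.one_closed by (intro bexI[of _ \<one>]) auto
  next
    case (insert p Q)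
    then obtain x where x: "x \<in> N" "x [^] (\<Prod>Q) = \<one>" "\<And>q. q \<in> Q \<Longrightarrow> N \<inter> socle_part q \<subseteq> normal_closure {x}" by auto
    have Np: "N \<inter> socle_part p \<lhd> G" by (rule normal_Int[OF N(1) socle_part_normal])
    have "\<exists>g\<in>N \<inter> socle_part p. normal_closure {g} = N \<inter> socle_part p"
      by (rule cyc[OF P(2) Np]) (use insert.prems in auto)
    then obtain g where g: "g \<in> N \<inter> socle_part p" "normal_closure {g} = N \<inter> socle_part p" by (elim bexE)
    have gp: "g \<in> N" "g [^] p = \<one>" using g by (auto simp: socle_part_def)
    have G: "x \<in> carrier G" "g \<in> carrier G" using x gp by auto
    have pow: "(x \<otimes> g) [^] (k::nat) = x [^] k \<otimes> g [^] k" for k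
      by (rule pow_mult_distrib[OF socle_comm[OF subsetD[OF N(2) x(1)] subsetD[OF N(2) gp(1)]] G])
    let ?L = "normal_closure {x \<otimes> g}"
    have L: "?L \<lhd> G" by (rule normal_closure_normal) (use G in simp)
    have Ls: "subgroup ?L G" by (rule normal_imp_subgroup[OF L])
    have xgL: "x \<otimes> g \<in> ?L" using normal_closure_incl by blast
    have c: "coprime p (\<Prod>Q)" using cop insert by blast
    have one: "\<one> \<in> ?L" by (rule subgroup.one_closed[OF Ls])
    have "x [^] p \<in> ?L" using subgroup_nat_pow_closed[OF Ls xgL, of p] pow[of p] gp(2) G by simp
    then have xL: "x \<in> ?L" using coprime_power_mem[OF Ls G(1) c] x(2) one by simp
    have "g [^] (\<Prod>Q) \<in> ?L" using subgroup_nat_pow_closed[OF Ls xgL, of "\<Prod>Q"] pow[of "\<Prod>Q"] x(2) G by simp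
    then have gL: "g \<in> ?L" using coprime_power_mem[OF Ls G(2) c] gp(2) one by simp
    have "N \<inter> socle_part q \<subseteq> ?L" if q: "q \<in> insert p Q" for q
    proof (cases "q = p")
      case True
      then show ?thesis using normal_closure_least[OF L, of "{g}"] gL g(2) by simp
    next
      case False
      then show ?thesis using normal_closure_least[OF L, of "{x}"] xL x(3)[of q] q by blast
    qed
    moreover have "(x \<otimes> g) [^] (\<Prod>(insert p Q)) = \<one>"
    proof -
      have "x [^] (p * \<Prod>Q) = \<one>" using x(2) nat_pow_pow[OF G(1), of "\<Prod>Q" p] by (simp add: mult.commute)
      moreover have "g [^] (p * \<Prod>Q) = \<one>" using gp(2) nat_pow_pow[OF G(2), of p "\<Prod>Q"] by simp
      ultimately show ?thesis using insert.hyps pow by simp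
    qed
    ultimately show ?case using N.m_closed[OF x(1) gp(1)] by blast
  qed
  from this[OF order_refl] obtain x where x: "x \<in> N" and x_part': "\<forall>p\<in>P. N \<inter> socle_part p \<subseteq> normal_closure {x}"
    by (elim bexE conjE)
  have x_part: "N \<inter> socle_part p \<subseteq> normal_closure {x}" if "p \<in> P" for p by (rule bspec[OF x_part' that])
  let ?L = "normal_closure {x}"
  have L: "?L \<lhd> G" by (rule normal_closure_normal) (use x in simp)
  have Ls: "subgroup ?L G" by (rule normal_imp_subgroup[OF L])
  have "\<forall>n\<in>N. n [^] (\<Prod>Q) = \<one> \<longrightarrow> n \<in> ?L" if "Q \<subseteq> P" for Q
    using finite_subset[OF that P(1)] that
  proof (induction Q rule: finite_induct)
    case empty
    then show ?case using subgroup.one_closed[OF Ls] by auto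
  next
    case (insert p Q)
    show ?case
    proof (intro ballI impI)
      fix n assume n: "n \<in> N" "n [^] (\<Prod>(insert p Q)) = \<one>"
      have nG: "n \<in> carrier G" using n by simp
      have e: "(n [^] p) [^] (\<Prod>Q) = \<one>" "(n [^] (\<Prod>Q)) [^] p = \<one>"
        using n(2) insert.hyps nG by (simp_all add: nat_pow_pow mult.commute)
      have mem: "n [^] p \<in> N" "n [^] (\<Prod>Q) \<in> N" using subgroup_nat_pow_closed[OF N.subgroup_axioms n(1)] by auto
      have "n [^] p \<in> ?L" using insert.IH insert.prems mem e by blast
      moreover have "n [^] (\<Prod>Q) \<in> ?L" using x_part[of p] insert.prems mem(2) e(2) N(2) by (auto simp: socle_part_def)
      ultimately show "n \<in> ?L" using coprime_power_mem[OF Ls nG, of p "\<Prod>Q"] cop insert by blast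
    qed
  qed
  then have "N \<subseteq> ?L" using exp by blast
  moreover have "?L \<subseteq> N" by (rule normal_closure_least[OF N(1)]) (use x in simp)
  ultimately show ?thesis using x by blast
qed

text \<open>A finite subset of the socle generates a submodule whose exponent divides a product of distinct primes.\<close>

lemma locally_cyclic_if_parts_cyclic:
  assumes cyc: "\<And>p B. \<lbrakk>Factorial_Ring.prime p; B \<lhd> G; B \<subseteq> socle_part p\<rbrakk> \<Longrightarrow> \<exists>x\<in>B. normal_closure {x} = B"
  shows "locally_cyclic (group_ring \<Z> G) (conj_module G S)"
  unfolding locally_cyclic_iff
proof (intro allI impI, elim conjE)
  fix A assume A: "finite A" "A \<subseteq> S"
  have "\<exists>P. finite P \<and> (\<forall>p\<in>P. Factorial_Ring.prime (p::nat)) \<and> (\<forall>x\<in>A. x [^] (\<Prod>P) = \<one>)"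
    using A
  proof (induction A rule: finite_induct)
    case empty
    then show ?case by (intro exI[of _ "{}"]) auto
  next
    case (insert a A)
    then obtain P where P: "finite P" "\<forall>p\<in>P. Factorial_Ring.prime (p::nat)" "\<forall>x\<in>A. x [^] (\<Prod>P) = \<one>" by auto
    obtain Q where Q: "finite Q" "\<forall>p\<in>Q. Factorial_Ring.prime (p::nat)" "a [^] (\<Prod>Q) = \<one>"
      using socle_exponent[of a] insert.prems by auto
    obtain i j where ij: "\<Prod>(P \<union> Q) = \<Prod>P * i" "\<Prod>(P \<union> Q) = \<Prod>Q * j"
      using P(1) Q(1) prod_dvd_prod_subset[of "P \<union> Q" P "\<lambda>x. x"] prod_dvd_prod_subset[of "P \<union> Q" Q "\<lambda>x. x"]
      by (auto elim!: dvdE)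
    have "a [^] (\<Prod>(P \<union> Q)) = \<one>"
      using nat_pow_pow[OF socle_sub, of a "\<Prod>Q" j] Q(3) ij(2) insert.prems by simp
    moreover have "x [^] (\<Prod>(P \<union> Q)) = \<one>" if "x \<in> A" for x
    proof -
      have "x \<in> carrier G" using that insert.prems socle_sub by blast
      from nat_pow_pow[OF this, of "\<Prod>P" i] show ?thesis using P(3) that ij(1) by simp
    qed
    ultimately show ?case using P Q by (intro exI[of _ "P \<union> Q"]) auto
  qed
  then obtain P where P: "finite P" "\<forall>p\<in>P. Factorial_Ring.prime (p::nat)" "\<forall>x\<in>A. x [^] (\<Prod>P) = \<one>" by blast
  let ?N = "normal_closure A"
  have N: "?N \<lhd> G" by (rule normal_closure_normal) (use A socle_sub in blast)
  have NS: "?N \<subseteq> S" by (rule normal_closure_least[OF socle_normal A(2)])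
  have "?N \<subseteq> {x \<in> S. x [^] (\<Prod>P) = \<one>}"
    by (rule normal_closure_least[OF normal_torsion[OF socle_normal socle_comm]]) (use A P in auto)
  then have "\<exists>x\<in>?N. normal_closure {x} = ?N" by (intro cyclic_of_primary_parts[OF cyc N NS P(1)]) (use P in auto)
  then show "\<exists>x\<in>S. normal_closure A = normal_closure {x}" using NS by blast
qed

text \<open>In the characteristic \<open>p\<close> of the field the \<open>p\<close>-part of the socle is trivial; for other primes there
  are core-free functionals, so the primary parts are cyclic.\<close>

theorem faithful_irreducible_imp_socle:
  fixes K :: "('k, 'n) ring_scheme"
  assumes K: "field K" and V: "faithful_irreducible K G V"
  shows "locally_cyclic (group_ring \<Z> G) (conj_module G S)"
    and "ring_char K \<notin> prime_orders (G\<lparr>carrier := S\<rparr>)"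
proof -
  interpret K: field K by (rule K)
  interpret V: left_module "group_ring K G" V
    using V by (simp add: faithful_irreducible_def simple_module_def)
  interpret V: faithful_simple_representation K G V
    by (unfold_locales) (use V in \<open>simp_all add: faithful_irreducible_def\<close>)
  have part: "finite B" "x \<in> B \<Longrightarrow> y \<in> B \<Longrightarrow> x \<otimes> y = y \<otimes> x" "x \<in> B \<Longrightarrow> x [^] p = \<one>" "B \<subseteq> S"
    if "Factorial_Ring.prime p" "B \<subseteq> socle_part p" for p B x y
    using that finite_subset[OF that(2) socle_part_finite[OF prime_gt_0_nat]] socle_comm[of x y]
    by (auto simp: socle_part_def)
  have triv: "B = {\<one>}" if "Factorial_Ring.prime p" "B \<lhd> G" "B \<subseteq> socle_part p" "[p] \<cdot>\<^bsub>K\<^esub> \<one>\<^bsub>K\<^esub> = \<zero>\<^bsub>K\<^esub>" for p B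
    using V.elementary_normal_trivial[OF that(2) _ _ that(1) _ that(4)] part[OF that(1,3)] by blast
  show "locally_cyclic (group_ring \<Z> G) (conj_module G S)"
  proof (rule locally_cyclic_if_parts_cyclic)
    fix p B assume p: "Factorial_Ring.prime p" and B: "B \<lhd> G" "B \<subseteq> socle_part p"
    have "\<exists>c\<in>zp_homs p B. core_free c B"
    proof (cases "[p] \<cdot>\<^bsub>K\<^esub> \<one>\<^bsub>K\<^esub> = \<zero>\<^bsub>K\<^esub>")
      case True
      then have B1: "B = {\<one>}" using triv p B by blast
      have "(\<lambda>x\<in>B. 0 mod int p) \<in> zp_homs p B"
        by (rule zp_homsI) (use p prime_gt_0_nat normal_imp_subgroup[OF B(1)] in auto)
      moreover have "core_free c B" for c
        unfolding core_free_def B1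
      proof (intro allI impI)
        fix N assume N: "N \<lhd> G \<and> N \<subseteq> {\<one>} \<and> (\<forall>x\<in>N. c x = 0)"
        then have "\<one> \<in> N" using subgroup.one_closed normal_imp_subgroup by blast
        then show "N = {\<one>}" using N by blast
      qed
      ultimately show ?thesis by blast
    next
      case False
      then show ?thesis
        using V.core_free_functional_exists[OF B(1) part(1)[OF p B(2)] part(2)[OF p B(2)] p part(3)[OF p B(2)]] by blast
    qed
    then show "\<exists>x\<in>B. normal_closure {x} = B"
      using cyclic_iff_core_free[OF p B(1) part(4)[OF p B(2)] part(1)[OF p B(2)] part(3)[OF p B(2)]] by blast
  qed
  show "ring_char K \<notin> prime_orders (G\<lparr>carrier := S\<rparr>)"
  proof
    assume "ring_char K \<in> prime_orders (G\<lparr>carrier := S\<rparr>)"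
    then have p: "Factorial_Ring.prime (ring_char K)" "socle_part (ring_char K) \<noteq> {\<one>}"
      by (auto simp: prime_orders_socle)
    then have "[ring_char K] \<cdot>\<^bsub>K\<^esub> \<one>\<^bsub>K\<^esub> = \<zero>\<^bsub>K\<^esub>" using ring_char_eq_prime_iff[OF K p(1)] by simp
    then show False using triv[OF p(1) socle_part_normal order_refl] p(2) by blast
  qed
qed

end


section \<open>Independent units of a field\<close>

lemma (in field) units_of_carrier_eq: "carrier (units_of R) = carrier R - {\<zero>}"
  by (simp add: units_of_carrier field_Units)

definition comaximal :: "('r, 'a) ring_scheme \<Rightarrow> 'r \<Rightarrow> 'r \<Rightarrow> bool" where
  "comaximal R x y \<longleftrightarrow> (\<exists>r\<in>carrier R. \<exists>s\<in>carrier R. r \<otimes>\<^bsub>R\<^esub> x \<oplus>\<^bsub>R\<^esub> s \<otimes>\<^bsub>R\<^esub> y = \<one>\<^bsub>R\<^esub>)"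

lemma (in cring) comaximal_one: "x \<in> carrier R \<Longrightarrow> comaximal R x \<one>"
  unfolding comaximal_def by (intro bexI[of _ \<zero>] bexI[of _ \<one>]) auto

lemma (in cring) comaximal_mult:
  assumes "x \<in> carrier R" "y \<in> carrier R" "z \<in> carrier R" "comaximal R x y" "comaximal R x z"
  shows "comaximal R x (y \<otimes> z)"
proof -
  obtain r s where rs: "r \<in> carrier R" "s \<in> carrier R" "r \<otimes> x \<oplus> s \<otimes> y = \<one>"
    using assms(4) unfolding comaximal_def by blast
  obtain a b where ab: "a \<in> carrier R" "b \<in> carrier R" "a \<otimes> x \<oplus> b \<otimes> z = \<one>"
    using assms(5) unfolding comaximal_def by blast
  have "\<one> = (r \<otimes> x \<oplus> s \<otimes> y) \<otimes> (a \<otimes> x \<oplus> b \<otimes> z)" using rs ab by simp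
  also have "\<dots> = (r \<otimes> (a \<otimes> x \<oplus> b \<otimes> z) \<oplus> s \<otimes> y \<otimes> a) \<otimes> x \<oplus> (s \<otimes> b) \<otimes> (y \<otimes> z)"
    using rs(1,2) ab(1,2) assms(1-3) by algebra
  finally show ?thesis unfolding comaximal_def
    using rs(1,2) ab(1,2) assms(1-3) by (intro bexI[of _ "r \<otimes> (a \<otimes> x \<oplus> b \<otimes> z) \<oplus> s \<otimes> y \<otimes> a"] bexI[of _ "s \<otimes> b"]) auto
qed

lemma (in cring) comaximal_dvd_unit:
  assumes x: "x \<in> carrier R" "y \<in> carrier R" "z \<in> carrier R" and c: "comaximal R x y" and eq: "x \<otimes> z = y"
  shows "x \<in> Units R"
proof -
  obtain r s where rs: "r \<in> carrier R" "s \<in> carrier R" "r \<otimes> x \<oplus> s \<otimes> y = \<one>"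
    using c unfolding comaximal_def by blast
  have "(r \<oplus> s \<otimes> z) \<otimes> x = r \<otimes> x \<oplus> s \<otimes> (x \<otimes> z)" using rs(1,2) x by algebra
  then have "(r \<oplus> s \<otimes> z) \<otimes> x = \<one>" using rs(3) eq by simp
  then show ?thesis using rs(1,2) x m_comm[of x "r \<oplus> s \<otimes> z"] unfolding Units_def by auto
qed

text \<open>Euclid's proof of the infinity of primes. If \<open>P\<close> is a common multiple of the elements found so far, then
  \<open>e = 1 + t P\<close> is comaximal to all of them. A nontrivial power of \<open>e\<close> that is a product of powers
  of them would make \<open>e\<close> divide an element comaximal to it, so that \<open>e\<close> would be a unit. The set \<open>D\<close> of
  multipliers \<open>P\<close> is a device to keep all \<open>1 + t P\<close> nonzero non-units.\<close>

lemma euclid_independent_sets: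
  fixes R :: "('r, 'a) ring_scheme" and K :: "('k, 'b) ring_scheme"
  assumes K: "field K" and R: "cring R" and h: "h \<in> ring_hom R K" and inj: "inj_on h (carrier R)"
    and t: "t \<in> carrier R" and one: "\<one>\<^bsub>R\<^esub> \<in> D" and DR: "D \<subseteq> carrier R"
    and step: "\<And>P. P \<in> D \<Longrightarrow> \<one>\<^bsub>R\<^esub> \<oplus>\<^bsub>R\<^esub> t \<otimes>\<^bsub>R\<^esub> P \<notin> Units R \<and> \<one>\<^bsub>R\<^esub> \<oplus>\<^bsub>R\<^esub> t \<otimes>\<^bsub>R\<^esub> P \<noteq> \<zero>\<^bsub>R\<^esub> \<and>
        P \<otimes>\<^bsub>R\<^esub> (\<one>\<^bsub>R\<^esub> \<oplus>\<^bsub>R\<^esub> t \<otimes>\<^bsub>R\<^esub> P) \<in> D"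
  shows "\<exists>T. comm_group.mult_independent (units_of K) T \<and> card T = n"
proof -
  interpret K: field K by (rule K)
  interpret R: cring R by (rule R)
  interpret h: ring_hom_cring R K h by (intro ring_hom_cring.intro ring_hom_cring_axioms.intro R.is_cring K.is_cring h)
  interpret M: comm_group "units_of K" by (rule K.units_comm_group)
  note [simp] = K.units_of_carrier_eq units_of_mult units_of_one
  have h0: "h x \<noteq> \<zero>\<^bsub>K\<^esub>" if "x \<in> carrier R" "x \<noteq> \<zero>\<^bsub>R\<^esub>" for x
    using that inj h.hom_zero R.zero_closed unfolding inj_on_def by metis
  have "\<exists>T P. M.mult_independent T \<and> card T = n \<and> P \<in> D \<and>
      (\<forall>x\<in>T. \<exists>e\<in>carrier R. \<exists>d\<in>carrier R. x = h e \<and> P = e \<otimes>\<^bsub>R\<^esub> d)"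
  proof (induction n)
    case 0
    show ?case by (intro exI[of _ "{}"] exI[of _ "\<one>\<^bsub>R\<^esub>"]) (use M.mult_independent_empty one in auto)
  next
    case (Suc n)
    then obtain T P where T: "M.mult_independent T" "card T = n" and P: "P \<in> D"
      and div: "\<And>x. x \<in> T \<Longrightarrow> \<exists>e\<in>carrier R. \<exists>d\<in>carrier R. x = h e \<and> P = e \<otimes>\<^bsub>R\<^esub> d" by blast
    have PR: "P \<in> carrier R" using P DR by blast
    define e where "e = \<one>\<^bsub>R\<^esub> \<oplus>\<^bsub>R\<^esub> t \<otimes>\<^bsub>R\<^esub> P"
    have e: "e \<in> carrier R" "e \<notin> Units R" "e \<noteq> \<zero>\<^bsub>R\<^esub>" "P \<otimes>\<^bsub>R\<^esub> e \<in> D"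
      using step[OF P] t PR by (auto simp: e_def)
    have Tfin: "finite T" "T \<subseteq> carrier (units_of K)" using T(1) by (auto simp: M.mult_independent_def)
    have he: "h e \<in> carrier (units_of K)" using h0 e by simp
    have cm: "comaximal R e d" if d: "d \<in> carrier R" "d' \<in> carrier R" "P = d \<otimes>\<^bsub>R\<^esub> d'" for d d'
    proof -
      have "\<one>\<^bsub>R\<^esub> \<otimes>\<^bsub>R\<^esub> e \<oplus>\<^bsub>R\<^esub> (\<ominus>\<^bsub>R\<^esub> (t \<otimes>\<^bsub>R\<^esub> d')) \<otimes>\<^bsub>R\<^esub> d = \<one>\<^bsub>R\<^esub>"
        unfolding e_def d(3) using d(1,2) t by algebra
      then show ?thesis unfolding comaximal_def using t d by blast
    qed
    \<comment> \<open>elements of the subgroup generated by \<open>T\<close> are fractions \<open>h a / h b\<close> with \<open>a\<close> and \<open>b\<close> comaximal to \<open>e\<close>\<close>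
    have gen: "\<exists>a\<in>carrier R. \<exists>b\<in>carrier R. comaximal R e a \<and> comaximal R e b \<and> g \<otimes>\<^bsub>K\<^esub> h b = h a \<and> g \<in> carrier K"
      if "g \<in> generate (units_of K) T" for g
      using that
    proof (induction rule: generate.induct)
      case one
      show ?case using R.comaximal_one[OF e(1)] by (intro bexI[of _ "\<one>\<^bsub>R\<^esub>"]) auto
    next
      case (incl x)
      obtain d d' where d: "d \<in> carrier R" "d' \<in> carrier R" "x = h d" "P = d \<otimes>\<^bsub>R\<^esub> d'" using div[OF incl] by blast
      then show ?case using R.comaximal_one[OF e(1)] cm[OF d(1,2,4)]
        by (intro bexI[of _ d] bexI[of _ "\<one>\<^bsub>R\<^esub>"]) auto
    next
      case (inv x)
      obtain d d' where d: "d \<in> carrier R" "d' \<in> carrier R" "x = h d" "P = d \<otimes>\<^bsub>R\<^esub> d'" using div[OF inv] by blast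
      have x: "x \<in> carrier (units_of K)" using inv Tfin by blast
      have "inv\<^bsub>units_of K\<^esub> x \<in> carrier (units_of K)" using x by (rule M.inv_closed)
      moreover have "inv\<^bsub>units_of K\<^esub> x \<otimes>\<^bsub>units_of K\<^esub> x = \<one>\<^bsub>units_of K\<^esub>" using x by (rule M.l_inv)
      ultimately show ?case using R.comaximal_one[OF e(1)] cm[OF d(1,2,4)] d
        by (intro bexI[of _ "\<one>\<^bsub>R\<^esub>"] bexI[of _ d]) auto
    next
      case (eng g g')
      obtain a b where a: "a \<in> carrier R" "b \<in> carrier R" "comaximal R e a" "comaximal R e b"
        "g \<otimes>\<^bsub>K\<^esub> h b = h a" "g \<in> carrier K" using eng.IH(1) by blast
      obtain a' b' where a': "a' \<in> carrier R" "b' \<in> carrier R" "comaximal R e a'" "comaximal R e b'"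
        "g' \<otimes>\<^bsub>K\<^esub> h b' = h a'" "g' \<in> carrier K" using eng.IH(2) by blast
      have "(g \<otimes>\<^bsub>K\<^esub> g') \<otimes>\<^bsub>K\<^esub> h (b \<otimes>\<^bsub>R\<^esub> b') = (g \<otimes>\<^bsub>K\<^esub> h b) \<otimes>\<^bsub>K\<^esub> (g' \<otimes>\<^bsub>K\<^esub> h b')"
        using a(1,2,6) a'(1,2,6) K.m_ac by simp
      then have "(g \<otimes>\<^bsub>K\<^esub> g') \<otimes>\<^bsub>K\<^esub> h (b \<otimes>\<^bsub>R\<^esub> b') = h (a \<otimes>\<^bsub>R\<^esub> a')" using a a' by simp
      then show ?case
        using a a' R.comaximal_mult[OF e(1) a(1) a'(1) a(3) a'(3)] R.comaximal_mult[OF e(1) a(2) a'(2) a(4) a'(4)]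
        by (intro bexI[of _ "a \<otimes>\<^bsub>R\<^esub> a'"] bexI[of _ "b \<otimes>\<^bsub>R\<^esub> b'"]) auto
    qed
    have no_dvd: False if nd: "k > 0" "a \<in> carrier R" "b \<in> carrier R" "comaximal R e a" "h e [^]\<^bsub>K\<^esub> (k::nat) \<otimes>\<^bsub>K\<^esub> h b = h a" for k a b
    proof -
      obtain j where j: "k = Suc j" using nd(1) gr0_conv_Suc by auto
      have "h (e [^]\<^bsub>R\<^esub> (i::nat)) = h e [^]\<^bsub>K\<^esub> i" for i
        by (induction i) (use e in auto)
      then have "h (e [^]\<^bsub>R\<^esub> k \<otimes>\<^bsub>R\<^esub> b) = h a" using nd e by simp
      then have "e [^]\<^bsub>R\<^esub> k \<otimes>\<^bsub>R\<^esub> b = a" using inj nd e by (meson R.m_closed R.nat_pow_closed inj_onD)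
      then have "e \<otimes>\<^bsub>R\<^esub> (e [^]\<^bsub>R\<^esub> j \<otimes>\<^bsub>R\<^esub> b) = a" using e(1) nd(3) unfolding j by (simp add: R.m_ac)
      then show False using R.comaximal_dvd_unit[OF e(1) nd(2) _ nd(4), of "e [^]\<^bsub>R\<^esub> j \<otimes>\<^bsub>R\<^esub> b"] e(1,2) nd(3) by simp
    qed
    have free: "k = 0" if k: "h e [^]\<^bsub>units_of K\<^esub> (k::int) \<in> generate (units_of K) T" for k
    proof (rule ccontr)
      assume "k \<noteq> 0"
      define m where "m = nat \<bar>k\<bar>"
      have m: "m > 0" using \<open>k \<noteq> 0\<close> by (simp add: m_def)
      have pow: "h e [^]\<^bsub>units_of K\<^esub> m = h e [^]\<^bsub>K\<^esub> m" by (simp add: nat_pow_def units_of_def)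
      have "h e [^]\<^bsub>units_of K\<^esub> m \<in> generate (units_of K) T"
      proof (cases "k \<ge> 0")
        case True
        then show ?thesis using k int_pow_int[of "units_of K" "h e" m] by (simp add: m_def)
      next
        case False
        then have "k = - int m" by (simp add: m_def)
        then have "inv\<^bsub>units_of K\<^esub> (h e [^]\<^bsub>units_of K\<^esub> m) \<in> generate (units_of K) T"
          using k M.int_pow_neg_int[OF he, of m] by simp
        from M.generate_m_inv_closed[OF Tfin(2) this] show ?thesis using M.nat_pow_closed[OF he, of m] by (simp only: M.inv_inv)
      qed
      from gen[OF this] obtain a b where "a \<in> carrier R" "b \<in> carrier R" "comaximal R e a"
        "h e [^]\<^bsub>K\<^esub> m \<otimes>\<^bsub>K\<^esub> h b = h a" unfolding pow by blast
      then show False using no_dvd[OF m] by blast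
    qed
    note ins = M.mult_independent_insert[OF T(1) he free]
    have "\<exists>e'\<in>carrier R. \<exists>d\<in>carrier R. x = h e' \<and> P \<otimes>\<^bsub>R\<^esub> e = e' \<otimes>\<^bsub>R\<^esub> d" if x: "x \<in> insert (h e) T" for x
    proof (cases "x = h e")
      case True
      then show ?thesis using e PR R.m_comm by (intro bexI[of _ e] bexI[of _ P]) auto
    next
      case False
      then obtain e' d where "e' \<in> carrier R" "d \<in> carrier R" "x = h e'" "P = e' \<otimes>\<^bsub>R\<^esub> d" using x div by blast
      then show ?thesis using e R.m_assoc by (intro bexI[of _ e'] bexI[of _ "d \<otimes>\<^bsub>R\<^esub> e"]) auto
    qed
    moreover have "card (insert (h e) T) = Suc n" using ins(2) T(2) Tfin(1) by simp
    ultimately show ?case using ins(1) e(4) by blast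
  qed
  then show ?thesis by blast
qed

lemma (in ring) dimension_finite:
  assumes "dimension n K E" "finite K"
  shows "finite E"
  using assms
proof (induction rule: dimension.induct)
  case (Suc_dim v E n K)
  have "line_extension K v E \<subseteq> (\<lambda>(k, u). k \<otimes> v \<oplus> u) ` (K \<times> E)"
    unfolding line_extension_mem_iff[THEN ext] subset_iff using line_extension_mem_iff by auto
  then show ?case using Suc_dim finite_subset by (metis finite_SigmaI finite_imageI)
qed auto

context field
begin

lemma int_embed_hom: "(\<lambda>n::int. [n] \<cdot> \<one>) \<in> ring_hom \<Z> R"
proof (rule ring_hom_memI)
  fix a b :: int
  have "([a] \<cdot> \<one>) \<otimes> ([b] \<cdot> \<one>) = [a] \<cdot> ([b] \<cdot> \<one>)" by (simp add: add_pow_ldistr_int)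
  also have "\<dots> = [(a * b)] \<cdot> \<one>" using add.int_pow_pow[of \<one> a b] add.int_pow_pow[of \<one> b a] by (simp add: add_pow_def mult.commute)
  finally show "[(a \<otimes>\<^bsub>\<Z>\<^esub> b)] \<cdot> \<one> = ([a] \<cdot> \<one>) \<otimes> ([b] \<cdot> \<one>)" by simp
  show "[(a \<oplus>\<^bsub>\<Z>\<^esub> b)] \<cdot> \<one> = ([a] \<cdot> \<one>) \<oplus> ([b] \<cdot> \<one>)" by (simp add: add.int_pow_mult)
qed (auto simp: add.int_pow_1)

text \<open>The integers embed into the field. Only positive multipliers \<open>P\<close> are admitted, since \<open>1 + P\<close> must not
  be \<open>0\<close> or a unit.\<close>

lemma independent_char_zero:
  assumes "\<And>n. n > 0 \<Longrightarrow> [(n::nat)] \<cdot> \<one> \<noteq> \<zero>"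
  shows "\<exists>T. comm_group.mult_independent (units_of R) T \<and> card T = n"
proof (rule euclid_independent_sets[OF field_axioms int_is_cring int_embed_hom])
  show "inj_on (\<lambda>n::int. [n] \<cdot> \<one>) (carrier \<Z>)"
  proof (rule inj_onI)
    fix a b :: int assume eq: "[a] \<cdot> \<one> = [b] \<cdot> \<one>"
    have *: "[(nat k)] \<cdot> \<one> = [k] \<cdot> \<one>" if "k \<ge> 0" for k :: int
      using that int_pow_int[of "add_monoid R" \<one> "nat k"] by (simp add: add_pow_def)
    have "[(a - b)] \<cdot> \<one> = \<zero>" "[(b - a)] \<cdot> \<one> = \<zero>"
      using eq add.int_pow_diff[of \<one> a b] add.int_pow_diff[of \<one> b a] add.r_inv[OF add.int_pow_closed[OF one_closed, of b]] by (simp_all add: add_pow_def)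
    then show "a = b" using assms[of "nat (a - b)"] assms[of "nat (b - a)"] *[of "a - b"] *[of "b - a"]
      by (cases "a < b"; cases "b < a") auto
  qed
  fix P :: int assume P: "P \<in> {P. P \<ge> 1}"
  have "1 + P \<notin> Units \<Z>"
  proof
    assume "1 + P \<in> Units \<Z>"
    then obtain b :: int where "(1 + P) * b = 1" unfolding Units_def by auto
    then have "\<bar>1 + P\<bar> = 1" by (metis zmult_eq_1_iff abs_1 abs_minus_cancel)
    then show False using P by simp
  qed
  moreover have "P * (1 + P) \<ge> 1" using mult_mono[of 1 P 1 "1 + P"] P by simp 
  ultimately show "\<one>\<^bsub>\<Z>\<^esub> \<oplus>\<^bsub>\<Z>\<^esub> 1 \<otimes>\<^bsub>\<Z>\<^esub> P \<notin> Units \<Z> \<and> \<one>\<^bsub>\<Z>\<^esub> \<oplus>\<^bsub>\<Z>\<^esub> 1 \<otimes>\<^bsub>\<Z>\<^esub> P \<noteq> \<zero>\<^bsub>\<Z>\<^esub> \<and>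
      P \<otimes>\<^bsub>\<Z>\<^esub> (\<one>\<^bsub>\<Z>\<^esub> \<oplus>\<^bsub>\<Z>\<^esub> 1 \<otimes>\<^bsub>\<Z>\<^esub> P) \<in> {P. P \<ge> 1}"
    using P \<open>P * (1 + P) \<ge> 1\<close> by auto
qed auto

text \<open>The multiples of \<open>1\<close> are finite in number, and multiplication by a nonzero one permutes them.\<close>

lemma finite_prime_subfield:
  assumes n: "n > 0" "[(n::nat)] \<cdot> \<one> = \<zero>"
  shows "\<exists>F. subfield F R \<and> finite F"
proof (intro exI conjI)
  define F where "F = (\<lambda>k::int. [k] \<cdot> \<one>) ` UNIV"
  interpret h: ring_hom_cring "\<Z>" R "\<lambda>k::int. [k] \<cdot> \<one>"
    by (intro ring_hom_cring.intro ring_hom_cring_axioms.intro int_is_cring is_cring int_embed_hom)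
  have one: "\<one> \<in> F" unfolding F_def using h.hom_one by (metis rangeI)
  have FR: "F \<subseteq> carrier R" by (auto simp: F_def)
  have m_closed: "x \<otimes> y \<in> F" if "x \<in> F" "y \<in> F" for x y
  proof -
    obtain a b :: int where "x = [a] \<cdot> \<one>" "y = [b] \<cdot> \<one>" using \<open>x \<in> F\<close> \<open>y \<in> F\<close> by (auto simp: F_def)
    then have "x \<otimes> y = [(a * b)] \<cdot> \<one>" using h.hom_mult[of a b] by simp
    then show ?thesis unfolding F_def by (rule range_eqI)
  qed
  have "F \<subseteq> (\<lambda>k::int. [k] \<cdot> \<one>) ` {0..<int n}"
  proof
    fix x assume "x \<in> F"
    then obtain k :: int where k: "x = [k] \<cdot> \<one>" by (auto simp: F_def)
    have n0: "[(int n)] \<cdot> \<one> = \<zero>" using n(2) by (simp add: add_pow_def int_pow_int)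
    have "[(int n * (k div int n) + k mod int n)] \<cdot> \<one> = ([(int n)] \<cdot> \<one>) \<otimes> ([(k div int n)] \<cdot> \<one>) \<oplus> [(k mod int n)] \<cdot> \<one>"
      using h.hom_add[of "int n * (k div int n)" "k mod int n"] h.hom_mult[of "int n" "k div int n"] by simp
    then have "x = [(k mod int n)] \<cdot> \<one>" using k n0 by simp
    moreover have "k mod int n \<in> {0..<int n}" using n(1) by simp
    ultimately show "x \<in> (\<lambda>k::int. [k] \<cdot> \<one>) ` {0..<int n}" by (rule image_eqI)
  qed
  then show fin: "finite F" using finite_subset by blast
  show "subfield F R"
  proof (rule subfieldI')
    show "subring F R"
    proof (rule subringI[OF FR one _ m_closed])
      show "\<ominus> x \<in> F" if "x \<in> F" for x
      proof -
        obtain a :: int where "x = [a] \<cdot> \<one>" using \<open>x \<in> F\<close> by (auto simp: F_def)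
        then have "\<ominus> x = [(- a)] \<cdot> \<one>" using h.hom_a_inv[of a] by simp
        then show ?thesis unfolding F_def by (rule range_eqI)
      qed
      show "x \<oplus> y \<in> F" if "x \<in> F" "y \<in> F" for x y
      proof -
        obtain a b :: int where "x = [a] \<cdot> \<one>" "y = [b] \<cdot> \<one>" using \<open>x \<in> F\<close> \<open>y \<in> F\<close> by (auto simp: F_def)
        then have "x \<oplus> y = [(a + b)] \<cdot> \<one>" using h.hom_add[of a b] by simp
        then show ?thesis unfolding F_def by (rule range_eqI)
      qed
    qed
    show "inv x \<in> F" if x: "x \<in> F - {\<zero>}" for x
    proof -
      have xR: "x \<in> carrier R" "x \<noteq> \<zero>" using x FR by auto
      have "inj_on (\<lambda>y. x \<otimes> y) F"
        using xR FR m_lcancel by (intro inj_onI) (metis subsetD)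
      then have "(\<lambda>y. x \<otimes> y) ` F = F"
        using fin m_closed x by (intro endo_inj_surj) auto
      then obtain y where y: "y \<in> F" "x \<otimes> y = \<one>" using one by (metis imageE)
      then have "inv x = y" using xR FR by (metis comm_inv_char subsetD)
      then show ?thesis using y by simp
    qed
  qed
qed

text \<open>The polynomial ring over \<open>F\<close> embeds into the field by evaluation at \<open>x\<close>, and \<open>1 + X P\<close> has positive
  degree for every nonzero \<open>P\<close>.\<close>

lemma independent_transcendental:
  assumes F: "subfield F R" and x: "x \<in> carrier R" and tr: "transcendental F x"
  shows "\<exists>T. comm_group.mult_independent (units_of R) T \<and> card T = n"
proof -
  have Fr: "subring F R" by (rule subfieldE(1)[OF F])
  interpret P: domain "F [X]" by (rule univ_poly_is_domain[OF Fr])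
  have X: "X \<in> carrier (F [X])" by (rule var_closed(1)[OF Fr])
  have zero: "\<zero>\<^bsub>F [X]\<^esub> = []" and one: "\<one>\<^bsub>F [X]\<^esub> = [\<one>]" by (simp_all add: univ_poly_def)
  show ?thesis
  proof (rule euclid_independent_sets[OF field_axioms P.is_cring])
    show "(\<lambda>p. eval p x) \<in> ring_hom (F [X]) R" by (rule eval_is_hom[OF Fr x])
    show "inj_on (\<lambda>p. eval p x) (carrier (F [X]))" using tr by (simp add: transcendental_def)
    show "X \<in> carrier (F [X])" by (rule X)
    show "\<one>\<^bsub>F [X]\<^esub> \<in> carrier (F [X]) - {\<zero>\<^bsub>F [X]\<^esub>}" using P.one_closed P.one_not_zero by blast
    fix q assume q: "q \<in> carrier (F [X]) - {\<zero>\<^bsub>F [X]\<^esub>}"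
    let ?e = "\<one>\<^bsub>F [X]\<^esub> \<oplus>\<^bsub>F [X]\<^esub> X \<otimes>\<^bsub>F [X]\<^esub> q"
    have e: "?e \<in> carrier (F [X])" using X q by simp
    have dX: "degree X = 1" by (simp add: var_def)
    have "polynomial F q" "q \<noteq> []" using q zero by (auto simp: univ_poly_carrier)
    then have dXq: "degree (X \<otimes>\<^bsub>F [X]\<^esub> q) = Suc (degree q)"
      using poly_mult_degree_eq[OF Fr var_closed(2)[OF Fr], of q] dX by (simp add: univ_poly_mult var_def del: poly_mult.simps)
    have "degree ?e = Suc (degree q)"
    proof -
      have "?e = poly_add [\<one>] (X \<otimes>\<^bsub>F [X]\<^esub> q)" by (simp add: univ_poly_add one)
      moreover have "degree (poly_add [\<one>] (X \<otimes>\<^bsub>F [X]\<^esub> q)) = max (degree [\<one>]) (degree (X \<otimes>\<^bsub>F [X]\<^esub> q))"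
        by (rule poly_add_degree_eq[OF Fr]) (use X q dXq P.one_closed one in \<open>auto simp: univ_poly_carrier\<close>)
      ultimately show ?thesis using dXq by simp
    qed
    then have "?e \<notin> Units (F [X])" "?e \<noteq> []" using univ_poly_units'[OF F, of ?e] by auto
    then show "?e \<notin> Units (F [X]) \<and> ?e \<noteq> \<zero>\<^bsub>F [X]\<^esub> \<and> q \<otimes>\<^bsub>F [X]\<^esub> ?e \<in> carrier (F [X]) - {\<zero>\<^bsub>F [X]\<^esub>}"
      using q e P.integral zero by auto
  qed auto
qed

text \<open>Either the characteristic is zero, or an infinite finitely generated subfield contains an element that is
  transcendental over the prime field: otherwise that subfield would be finite-dimensional over a finite field.\<close>

theorem independent_sets_if_not_locally_finite:
  assumes "\<not> locally_finite_field R"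
  shows "\<exists>T. comm_group.mult_independent (units_of R) T \<and> card T = n"
proof (cases "\<exists>m>0. [(m::nat)] \<cdot> \<one> = \<zero>")
  case False
  then show ?thesis using independent_char_zero by blast
next
  case True
  then obtain F where F: "subfield F R" "finite F" using finite_prime_subfield by blast
  obtain A where A: "finite A" "A \<subseteq> carrier R" "infinite (generate_field R A)"
    using assms unfolding locally_finite_field_def by blast
  obtain xs where xs: "set xs = A" using A(1) finite_list by blast
  have "\<exists>x\<in>A. transcendental F x"
  proof (rule ccontr)
    assume "\<not> ?thesis"
    then have alg: "(algebraic over F) x" if "x \<in> set xs" for x using that xs by (auto simp: over_def)
    have xsR: "set xs \<subseteq> carrier R" using xs A by simp
    have "finite_dimension F (finite_extension F xs)"
      by (rule finite_extension_finite_dimension(1)[OF F(1) xsR alg])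
    then have "finite (finite_extension F xs)"
      unfolding finite_dimension_def using dimension_finite F(2) by blast
    moreover have "subfield (finite_extension F xs) R" by (rule finite_extension_is_subfield[OF F(1) xsR alg])
    moreover have "A \<subseteq> finite_extension F xs" using finite_extension_mem[OF subfieldE(1)[OF F(1)] xsR] xs by simp
    ultimately have "finite (generate_field R A)" using generate_field_min_subfield1[OF A(2)] finite_subset by blast
    then show False using A(3) by blast
  qed
  then show ?thesis using independent_transcendental[OF F(1)] A(2) by blast
qed

end


section \<open>Simple quotients of the regular module\<close>

lemma left_module_image:
  assumes M: "left_module R M"
    and carr: "carrier W = \<phi> ` carrier M"
    and zero: "\<zero>\<^bsub>W\<^esub> = \<phi> \<zero>\<^bsub>M\<^esub>"
    and add: "\<And>x y. \<lbrakk>x \<in> carrier M; y \<in> carrier M\<rbrakk> \<Longrightarrow> \<phi> x \<oplus>\<^bsub>W\<^esub> \<phi> y = \<phi> (x \<oplus>\<^bsub>M\<^esub> y)"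
    and smult: "\<And>a x. \<lbrakk>a \<in> carrier R; x \<in> carrier M\<rbrakk> \<Longrightarrow> a \<odot>\<^bsub>W\<^esub> \<phi> x = \<phi> (a \<odot>\<^bsub>M\<^esub> x)"
  shows "left_module R W"
proof -
  interpret M: left_module R M by (rule M)
  have "abelian_group W"
  proof (rule abelian_groupI)
    fix x assume "x \<in> carrier W"
    then obtain x' where x': "x' \<in> carrier M" "x = \<phi> x'" using carr by auto
    then have "\<phi> (\<ominus>\<^bsub>M\<^esub> x') \<oplus>\<^bsub>W\<^esub> x = \<zero>\<^bsub>W\<^esub>" by (simp add: add zero M.M.l_neg)
    moreover have "\<phi> (\<ominus>\<^bsub>M\<^esub> x') \<in> carrier W" using x' carr by simp
    ultimately show "\<exists>y\<in>carrier W. y \<oplus>\<^bsub>W\<^esub> x = \<zero>\<^bsub>W\<^esub>" by blast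
  qed (auto simp: carr zero add M.M.a_ac)
  then show ?thesis
    by (intro left_module.intro left_module_axioms.intro)
       (auto simp: carr add smult M.ring_axioms M.smult_closed M.smult_l_distr M.smult_r_distr
          M.smult_assoc M.smult_one)
qed

lemma submodule_neg:
  assumes "abelian_group W" "submodule N R W" "x \<in> N"
  shows "\<ominus>\<^bsub>W\<^esub> x \<in> N"
  using subgroup.m_inv_closed[OF submodule.axioms(1)[OF assms(2)] assms(3)] by (simp add: a_inv_def)

lemma submodule_preimage:
  assumes M: "left_module R M" and W: "left_module R W"
    and closed: "\<And>x. x \<in> carrier M \<Longrightarrow> \<phi> x \<in> carrier W"
    and add: "\<And>x y. \<lbrakk>x \<in> carrier M; y \<in> carrier M\<rbrakk> \<Longrightarrow> \<phi> (x \<oplus>\<^bsub>M\<^esub> y) = \<phi> x \<oplus>\<^bsub>W\<^esub> \<phi> y"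
    and smult: "\<And>a x. \<lbrakk>a \<in> carrier R; x \<in> carrier M\<rbrakk> \<Longrightarrow> \<phi> (a \<odot>\<^bsub>M\<^esub> x) = a \<odot>\<^bsub>W\<^esub> \<phi> x"
    and N: "submodule N R W"
  shows "submodule {x \<in> carrier M. \<phi> x \<in> N} R M"
proof -
  interpret M: left_module R M by (rule M)
  interpret W: left_module R W by (rule W)
  interpret N: submodule N R W by (rule N)
  interpret h: abelian_group_hom M W \<phi>
    by (intro abelian_group_homI M.M.abelian_group_axioms W.M.abelian_group_axioms group_hom.intro
        M.M.a_group W.M.a_group group_hom_axioms.intro homI) (auto simp: closed add)
  show ?thesis
  proof (intro submodule.intro subgroup.intro submodule_axioms.intro)
    show "\<one>\<^bsub>add_monoid M\<^esub> \<in> {x \<in> carrier M. \<phi> x \<in> N}" using N.one_closed by simp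
    show "x \<otimes>\<^bsub>add_monoid M\<^esub> y \<in> {x \<in> carrier M. \<phi> x \<in> N}"
      if "x \<in> {x \<in> carrier M. \<phi> x \<in> N}" "y \<in> {x \<in> carrier M. \<phi> x \<in> N}" for x y
      using that N.m_closed[of "\<phi> x" "\<phi> y"] by auto
    show "inv\<^bsub>add_monoid M\<^esub> x \<in> {x \<in> carrier M. \<phi> x \<in> N}" if "x \<in> {x \<in> carrier M. \<phi> x \<in> N}" for x
      using that submodule_neg[OF W.M.abelian_group_axioms N, of "\<phi> x"] by (simp flip: a_inv_def)
    show "a \<odot>\<^bsub>M\<^esub> x \<in> {x \<in> carrier M. \<phi> x \<in> N}"
      if "a \<in> carrier R" "x \<in> {x \<in> carrier M. \<phi> x \<in> N}" for a x
      using that N.smult_closed[of a "\<phi> x"] by (auto simp: smult M.smult_closed)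
  qed auto
qed

text \<open>The quotient \<open>M/J\<close>, with a chosen representative \<open>\<phi> x\<close> in place of the coset of \<open>x\<close>, so that its
  elements have the same type as those of \<open>M\<close>. Its submodules correspond to the submodules of \<open>M\<close> above \<open>J\<close>.\<close>

lemma simple_quotient:
  fixes M :: "('r, 'v, 'b) module_scheme"
  assumes M: "left_module R M" and J: "submodule J R M" "J \<noteq> carrier M"
    and max: "\<And>N. \<lbrakk>submodule N R M; J \<subseteq> N\<rbrakk> \<Longrightarrow> N = J \<or> N = carrier M"
  shows "\<exists>(W :: ('r, 'v) module) \<phi>. simple_module R W \<and> \<phi> ` carrier M = carrier W \<and>
    (\<forall>a\<in>carrier R. \<forall>x\<in>carrier M. \<phi> (a \<odot>\<^bsub>M\<^esub> x) = a \<odot>\<^bsub>W\<^esub> \<phi> x) \<and> (\<forall>x\<in>carrier M. \<phi> x = \<zero>\<^bsub>W\<^esub> \<longleftrightarrow> x \<in> J)"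
proof -
  interpret M: left_module R M by (rule M)
  interpret J: submodule J R M by (rule J(1))
  have JM: "x \<in> carrier M" if "x \<in> J" for x using subsetD[OF J.subset that] by simp
  have J_add: "x \<oplus>\<^bsub>M\<^esub> y \<in> J" if "x \<in> J" "y \<in> J" for x y using J.m_closed[OF that] by simp
  have J_neg: "\<ominus>\<^bsub>M\<^esub> x \<in> J" if "x \<in> J" for x by (rule submodule_neg[OF M.M.abelian_group_axioms J(1) that])
  define cl where "cl x y \<longleftrightarrow> y \<in> carrier M \<and> (\<exists>j\<in>J. y = x \<oplus>\<^bsub>M\<^esub> j)" for x y
  define \<phi> where "\<phi> x = (SOME y. cl x y)" for x
  have zJ: "\<zero>\<^bsub>M\<^esub> \<in> J" using J.one_closed by simp
  have \<phi>: "\<exists>j\<in>J. \<phi> x = x \<oplus>\<^bsub>M\<^esub> j" if "x \<in> carrier M" for x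
  proof -
    have "cl x x" using that zJ by (auto simp: cl_def intro!: bexI[of _ "\<zero>\<^bsub>M\<^esub>"])
    then have "cl x (\<phi> x)" unfolding \<phi>_def by (rule someI)
    then show ?thesis by (simp add: cl_def)
  qed
  have \<phi>_closed: "\<phi> x \<in> carrier M" if "x \<in> carrier M" for x using \<phi>[OF that] that JM by auto
  have shift: "\<phi> (x \<oplus>\<^bsub>M\<^esub> j) = \<phi> x" if x: "x \<in> carrier M" and j: "j \<in> J" for x j
  proof -
    have "cl (x \<oplus>\<^bsub>M\<^esub> j) y \<longleftrightarrow> cl x y" for y
    proof
      assume "cl (x \<oplus>\<^bsub>M\<^esub> j) y"
      then show "cl x y" using x j JM J_add by (auto simp: cl_def M.M.a_assoc)
    next
      assume "cl x y"
      then obtain j' where j': "y \<in> carrier M" "j' \<in> J" "y = x \<oplus>\<^bsub>M\<^esub> j'" by (auto simp: cl_def)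
      then have "y = (x \<oplus>\<^bsub>M\<^esub> j) \<oplus>\<^bsub>M\<^esub> (\<ominus>\<^bsub>M\<^esub> j \<oplus>\<^bsub>M\<^esub> j')" using x j JM by (simp add: M.M.a_assoc M.M.r_neg1 M.M.r_neg2)
      then show "cl (x \<oplus>\<^bsub>M\<^esub> j) y" using j' J_add[OF J_neg[OF j] j'(2)] by (auto simp: cl_def)
    qed
    then show ?thesis by (simp add: \<phi>_def)
  qed
  define W :: "('r, 'v) module" where "W = \<lparr>carrier = \<phi> ` carrier M, monoid.mult = undefined, one = undefined,
     ring.zero = \<phi> \<zero>\<^bsub>M\<^esub>, add = (\<lambda>x y. \<phi> (x \<oplus>\<^bsub>M\<^esub> y)), smult = (\<lambda>a x. \<phi> (a \<odot>\<^bsub>M\<^esub> x))\<rparr>"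
  have carr: "carrier W = \<phi> ` carrier M" and zero: "\<zero>\<^bsub>W\<^esub> = \<phi> \<zero>\<^bsub>M\<^esub>" by (simp_all add: W_def)
  have add: "\<phi> x \<oplus>\<^bsub>W\<^esub> \<phi> y = \<phi> (x \<oplus>\<^bsub>M\<^esub> y)" if xy: "x \<in> carrier M" "y \<in> carrier M" for x y
  proof -
    from \<phi>[OF xy(1)] obtain j where j: "j \<in> J" "\<phi> x = x \<oplus>\<^bsub>M\<^esub> j" ..
    from \<phi>[OF xy(2)] obtain j' where j': "j' \<in> J" "\<phi> y = y \<oplus>\<^bsub>M\<^esub> j'" ..
    have "\<phi> x \<oplus>\<^bsub>M\<^esub> \<phi> y = (x \<oplus>\<^bsub>M\<^esub> y) \<oplus>\<^bsub>M\<^esub> (j \<oplus>\<^bsub>M\<^esub> j')" using xy j j' JM by (simp add: M.M.a_ac)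
    then show ?thesis using shift J_add j j' xy by (simp add: W_def)
  qed
  have smult: "a \<odot>\<^bsub>W\<^esub> \<phi> x = \<phi> (a \<odot>\<^bsub>M\<^esub> x)" if a: "a \<in> carrier R" and x: "x \<in> carrier M" for a x
  proof -
    from \<phi>[OF x] obtain j where j: "j \<in> J" "\<phi> x = x \<oplus>\<^bsub>M\<^esub> j" ..
    then have "a \<odot>\<^bsub>M\<^esub> \<phi> x = a \<odot>\<^bsub>M\<^esub> x \<oplus>\<^bsub>M\<^esub> a \<odot>\<^bsub>M\<^esub> j" using a x JM by (simp add: M.smult_r_distr)
    then show ?thesis using shift J.smult_closed[OF a j(1)] M.smult_closed[OF a x] by (simp add: W_def)
  qed
  have WM: "left_module R W" by (rule left_module_image[OF M carr zero add smult])
  interpret W: left_module R W by (rule WM)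
  have ker: "\<phi> x = \<zero>\<^bsub>W\<^esub> \<longleftrightarrow> x \<in> J" if x: "x \<in> carrier M" for x
  proof
    assume "\<phi> x = \<zero>\<^bsub>W\<^esub>"
    from \<phi>[OF x] obtain j where j: "j \<in> J" "\<phi> x = x \<oplus>\<^bsub>M\<^esub> j" ..
    from \<phi>[OF M.M.zero_closed] obtain j' where j': "j' \<in> J" "\<phi> \<zero>\<^bsub>M\<^esub> = \<zero>\<^bsub>M\<^esub> \<oplus>\<^bsub>M\<^esub> j'" ..
    have "x \<oplus>\<^bsub>M\<^esub> j = j'" using \<open>\<phi> x = \<zero>\<^bsub>W\<^esub>\<close> j j' zero JM by simp
    then have "(x \<oplus>\<^bsub>M\<^esub> j) \<oplus>\<^bsub>M\<^esub> \<ominus>\<^bsub>M\<^esub> j \<in> J" using J_add J_neg j j' by simp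
    then show "x \<in> J" using x j JM by (simp add: M.M.a_assoc M.M.r_neg)
  next
    assume "x \<in> J"
    then show "\<phi> x = \<zero>\<^bsub>W\<^esub>" using shift[OF M.M.zero_closed, of x] x zero by simp
  qed
  have "simple_module R W"
    unfolding simple_module_def
  proof (intro conjI allI impI WM)
    show "carrier W \<noteq> {\<zero>\<^bsub>W\<^esub>}" using J(2) ker JM carr by blast
    fix N assume N: "submodule N R W"
    interpret N: submodule N R W by (rule N)
    have "submodule {x \<in> carrier M. \<phi> x \<in> N} R M"
      by (rule submodule_preimage[OF M WM _ _ _ N]) (simp_all add: carr add smult)
    moreover have "J \<subseteq> {x \<in> carrier M. \<phi> x \<in> N}"
    proof
      fix x assume x: "x \<in> J"
      have "\<phi> x = \<zero>\<^bsub>W\<^esub>" using ker[OF JM[OF x]] x by blast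
      then show "x \<in> {x \<in> carrier M. \<phi> x \<in> N}" using JM[OF x] N.one_closed by simp
    qed
    ultimately consider "{x \<in> carrier M. \<phi> x \<in> N} = J" | "{x \<in> carrier M. \<phi> x \<in> N} = carrier M" using max by blast
    then show "N = {\<zero>\<^bsub>W\<^esub>} \<or> N = carrier W"
    proof cases
      case 1
      have "y = \<zero>\<^bsub>W\<^esub>" if y: "y \<in> N" for y
      proof -
        have "y \<in> carrier W" using subsetD[OF N.subset y] by simp
        then obtain x where "x \<in> carrier M" "y = \<phi> x" using carr by auto
        then show ?thesis using 1 y ker by blast
      qed
      then have "N \<subseteq> {\<zero>\<^bsub>W\<^esub>}" by blast
      moreover have "\<zero>\<^bsub>W\<^esub> \<in> N" using N.one_closed by simp
      ultimately show ?thesis by blast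
    next
      case 2
      have "carrier W \<subseteq> N"
        unfolding carr
      proof (rule image_subsetI)
        fix x assume "x \<in> carrier M"
        then have "x \<in> {x \<in> carrier M. \<phi> x \<in> N}" by (rule subsetD[OF equalityD2[OF 2]])
        then show "\<phi> x \<in> N" by simp
      qed
      then show ?thesis using N.subset by auto
    qed
  qed
  moreover have "\<forall>a\<in>carrier R. \<forall>x\<in>carrier M. \<phi> (a \<odot>\<^bsub>M\<^esub> x) = a \<odot>\<^bsub>W\<^esub> \<phi> x" using smult by simp
  ultimately show ?thesis using carr ker by (intro exI[of _ W] exI[of _ \<phi>]) simp
qed

definition regular_module :: "('r, 'a) ring_scheme \<Rightarrow> ('r, 'r) module" where
  "regular_module R = \<lparr>carrier = carrier R, monoid.mult = undefined, one = undefined,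
     ring.zero = \<zero>\<^bsub>R\<^esub>, add = (\<oplus>\<^bsub>R\<^esub>), smult = (\<otimes>\<^bsub>R\<^esub>)\<rparr>"

lemma regular_module_simps:
  "carrier (regular_module R) = carrier R" "\<zero>\<^bsub>regular_module R\<^esub> = \<zero>\<^bsub>R\<^esub>"
  "x \<oplus>\<^bsub>regular_module R\<^esub> y = x \<oplus>\<^bsub>R\<^esub> y" "a \<odot>\<^bsub>regular_module R\<^esub> x = a \<otimes>\<^bsub>R\<^esub> x"
  by (simp_all add: regular_module_def)

lemma (in ring) regular_left_module: "left_module R (regular_module R)"
proof (intro left_module.intro left_module_axioms.intro ring_axioms)
  show "abelian_group (regular_module R)"
    by (rule abelian_groupI) (auto simp: regular_module_simps a_ac intro: bexI[of _ "\<ominus> _"] l_neg)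
qed (auto simp: regular_module_simps l_distr r_distr m_assoc)

text \<open>By Zorn's lemma \<open>I\<close> lies in a maximal left ideal \<open>J\<close>; take the quotient of the ring by \<open>J\<close> and the image
  of \<open>1\<close>.\<close>

lemma (in ring) exists_simple_module:
  assumes I: "submodule I R (regular_module R)" and one: "\<one> \<notin> I"
  shows "\<exists>(W :: ('a, 'a) module). simple_module R W \<and>
    (\<exists>v\<in>carrier W. v \<noteq> \<zero>\<^bsub>W\<^esub> \<and> (\<forall>a\<in>I. a \<odot>\<^bsub>W\<^esub> v = \<zero>\<^bsub>W\<^esub>))"
proof -
  let ?M = "regular_module R"
  interpret M: left_module R ?M by (rule regular_left_module)
  define F where "F = {N. submodule N R ?M \<and> I \<subseteq> N \<and> \<one> \<notin> N}"
  have sub: "submodule (\<Union>C) R ?M" if C: "C \<noteq> {}" "C \<subseteq> F" "\<And>A B. \<lbrakk>A \<in> C; B \<in> C\<rbrakk> \<Longrightarrow> A \<subseteq> B \<or> B \<subseteq> A" for C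
  proof -
    have s: "submodule N R ?M" if "N \<in> C" for N using that C(2) by (auto simp: F_def)
    have g: "subgroup N (add_monoid ?M)" if "N \<in> C" for N using s[OF that] by (rule submodule.axioms)
    show ?thesis
    proof (intro submodule.intro subgroup.intro submodule_axioms.intro)
      show "\<Union>C \<subseteq> carrier (add_monoid ?M)" using g subgroup.subset by blast
      show "\<one>\<^bsub>add_monoid ?M\<^esub> \<in> \<Union>C" using g subgroup.one_closed C(1) by blast
      show "inv\<^bsub>add_monoid ?M\<^esub> x \<in> \<Union>C" if "x \<in> \<Union>C" for x
      proof -
        obtain N where N: "N \<in> C" "x \<in> N" using \<open>x \<in> \<Union>C\<close> by blast
        show ?thesis using subgroup.m_inv_closed[OF g[OF N(1)] N(2)] N(1) by blast
      qed
      show "a \<odot>\<^bsub>?M\<^esub> x \<in> \<Union>C" if "a \<in> carrier R" "x \<in> \<Union>C" for a x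
      proof -
        obtain N where N: "N \<in> C" "x \<in> N" using \<open>x \<in> \<Union>C\<close> by blast
        show ?thesis using submodule.smult_closed[OF s[OF N(1)] \<open>a \<in> carrier R\<close> N(2)] N(1) by blast
      qed
      show "x \<otimes>\<^bsub>add_monoid ?M\<^esub> y \<in> \<Union>C" if xy: "x \<in> \<Union>C" "y \<in> \<Union>C" for x y
      proof -
        obtain N N' where N: "N \<in> C" "x \<in> N" "N' \<in> C" "y \<in> N'" using xy by blast
        then obtain L where L: "L \<in> C" "x \<in> L" "y \<in> L" using C(3)[OF N(1,3)] by blast
        show ?thesis using subgroup.m_closed[OF g[OF L(1)] L(2,3)] L(1) by blast
      qed
    qed
  qed
  have "\<exists>J\<in>F. \<forall>N\<in>F. J \<subseteq> N \<longrightarrow> N = J"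
  proof (rule subset_Zorn_nonempty)
    show "F \<noteq> {}" using I one by (auto simp: F_def)
    fix C assume C: "C \<noteq> {}" "subset.chain F C"
    have CF: "C \<subseteq> F" and ch: "\<And>A B. \<lbrakk>A \<in> C; B \<in> C\<rbrakk> \<Longrightarrow> A \<subseteq> B \<or> B \<subseteq> A"
      using C(2) unfolding subset.chain_def by auto
    show "\<Union>C \<in> F" using sub[OF C(1) CF ch] C(1) CF by (fastforce simp: F_def)
  qed
  then obtain J where J: "J \<in> F" and max: "\<And>N. \<lbrakk>N \<in> F; J \<subseteq> N\<rbrakk> \<Longrightarrow> N = J" by blast
  have Js: "submodule J R ?M" "J \<noteq> carrier ?M" and IJ: "I \<subseteq> J" and one_J: "\<one> \<notin> J"
    using J one_closed by (auto simp: F_def regular_module_simps)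
  have "N = J \<or> N = carrier ?M" if N: "submodule N R ?M" "J \<subseteq> N" for N
  proof (cases "\<one> \<in> N")
    case True
    have "a \<in> N" if "a \<in> carrier R" for a
      using submodule.smult_closed[OF N(1) that True] that by (simp add: regular_module_simps)
    moreover have "N \<subseteq> carrier R"
      using subgroup.subset[OF submodule.axioms(1)[OF N(1)]] by (simp add: regular_module_simps)
    ultimately show ?thesis by (auto simp: regular_module_simps)
  next
    case False
    then show ?thesis using max[of N] N IJ by (simp add: F_def)
  qed
  from simple_quotient[OF regular_left_module Js this]
  obtain W :: "('a, 'a) module" and \<phi> where W: "simple_module R W" "\<phi> ` carrier ?M = carrier W"
    and sm: "\<And>a x. \<lbrakk>a \<in> carrier R; x \<in> carrier ?M\<rbrakk> \<Longrightarrow> \<phi> (a \<odot>\<^bsub>?M\<^esub> x) = a \<odot>\<^bsub>W\<^esub> \<phi> x"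
    and ker: "\<And>x. x \<in> carrier ?M \<Longrightarrow> \<phi> x = \<zero>\<^bsub>W\<^esub> \<longleftrightarrow> x \<in> J" by blast
  have "\<phi> \<one> \<in> carrier W" using W(2) by (auto simp: regular_module_simps)
  moreover have "\<phi> \<one> \<noteq> \<zero>\<^bsub>W\<^esub>" using ker[of \<one>] one_J by (simp add: regular_module_simps)
  moreover have "a \<odot>\<^bsub>W\<^esub> \<phi> \<one> = \<zero>\<^bsub>W\<^esub>" if "a \<in> I" for a
  proof -
    have a: "a \<in> carrier R" "a \<in> J"
      using that IJ subgroup.subset[OF submodule.axioms(1)[OF Js(1)]] by (auto simp: regular_module_simps)
    then show ?thesis using sm[of a \<one>] ker[of a] by (simp add: regular_module_simps)
  qed
  ultimately show ?thesis using W(1) by blast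
qed


section \<open>Torsion-free abelian normal subgroups\<close>

lemma (in comm_group) power_product_cong:
  assumes "T \<subseteq> carrier G" "\<And>t. t \<in> T \<Longrightarrow> c t = d t"
  shows "power_product T c = power_product T d"
  unfolding power_product_def by (rule finprod_cong') (use assms in auto)

text \<open>Independent sets are bases of free abelian groups, so a bijection between them extends to an isomorphism
  of the groups that they generate.\<close>

lemma independent_embedding:
  assumes "comm_group G" "comm_group H" and T: "comm_group.mult_independent G T"
    and L: "comm_group.mult_independent H L" and card: "card T = card L"
  shows "\<exists>lam. (\<forall>f\<in>generate G T. lam f \<in> carrier H) \<and>
    (\<forall>f\<in>generate G T. \<forall>f'\<in>generate G T. lam (f \<otimes>\<^bsub>G\<^esub> f') = lam f \<otimes>\<^bsub>H\<^esub> lam f') \<and>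
    (\<forall>f\<in>generate G T. lam f = \<one>\<^bsub>H\<^esub> \<longrightarrow> f = \<one>\<^bsub>G\<^esub>)"
proof -
  interpret G: comm_group G by fact
  interpret H: comm_group H by fact
  have TG: "finite T" "T \<subseteq> carrier G" using T by (auto simp: G.mult_independent_def)
  have LH: "finite L" "L \<subseteq> carrier H" using L by (auto simp: H.mult_independent_def)
  obtain b where b: "bij_betw b L T" using finite_same_card_bij[OF LH(1) TG(1)] card by auto
  have bT: "b l \<in> T" if "l \<in> L" for l using b that by (auto simp: bij_betw_def)
  define ex where "ex f = (SOME c. f = G.power_product T c)" for f
  define lam where "lam f = H.power_product L (\<lambda>l. ex f (b l))" for f
  have gen: "generate G T = range (G.power_product T)" by (rule G.generate_eq_power_product[OF TG(2,1)])
  have ex: "f = G.power_product T (ex f)" if f: "f \<in> generate G T" for f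
  proof -
    obtain c where "f = G.power_product T c" using f unfolding gen by blast
    then show ?thesis unfolding ex_def by (rule someI[of "\<lambda>c. f = G.power_product T c"])
  qed
  have mult: "lam (f \<otimes>\<^bsub>G\<^esub> f') = lam f \<otimes>\<^bsub>H\<^esub> lam f'" if f: "f \<in> generate G T" "f' \<in> generate G T" for f f'
  proof -
    have "f \<otimes>\<^bsub>G\<^esub> f' \<in> generate G T" by (rule generate.eng[OF f])
    then have "G.power_product T (ex (f \<otimes>\<^bsub>G\<^esub> f')) = f \<otimes>\<^bsub>G\<^esub> f'" using ex by simp
    also have "\<dots> = G.power_product T (\<lambda>t. ex f t + ex f' t)"
      using G.power_product_add[OF TG(2)] ex[OF f(1)] ex[OF f(2)] by metis
    finally have "ex (f \<otimes>\<^bsub>G\<^esub> f') t = ex f t + ex f' t" if "t \<in> T" for t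
      using G.mult_independentD[OF T _ that] by blast
    then have "lam (f \<otimes>\<^bsub>G\<^esub> f') = H.power_product L (\<lambda>l. ex f (b l) + ex f' (b l))"
      unfolding lam_def by (intro H.power_product_cong[OF LH(2)]) (use bT in auto)
    then show ?thesis unfolding lam_def using H.power_product_add[OF LH(2)] by metis
  qed
  have inj: "f = \<one>\<^bsub>G\<^esub>" if f: "f \<in> generate G T" "lam f = \<one>\<^bsub>H\<^esub>" for f
  proof -
    have z: "ex f (b l) = 0" if "l \<in> L" for l
      using L f(2) that unfolding lam_def H.mult_independent_def by blast
    have "ex f t = 0" if t: "t \<in> T" for t
    proof -
      have "t \<in> b ` L" using b t by (simp add: bij_betw_def)
      then show ?thesis using z by blast
    qed
    then have "G.power_product T (ex f) = G.power_product T (\<lambda>t. 0)" by (intro G.power_product_cong[OF TG(2)])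
    then show ?thesis using ex[OF f(1)] G.power_product_zero by metis
  qed
  have "lam f \<in> carrier H" for f unfolding lam_def by (rule H.power_product_closed[OF LH(2)])
  then show ?thesis using mult inj by blast
qed

lemma (in group) power_product_consistent:
  assumes H: "subgroup H G" "subgroup H' G" "H \<subseteq> H'"
    and C: "comm_group (G\<lparr>carrier := H\<rparr>)" "comm_group (G\<lparr>carrier := H'\<rparr>)" and T: "finite T" "T \<subseteq> H"
  shows "comm_group.power_product (G\<lparr>carrier := H\<rparr>) T c = comm_group.power_product (G\<lparr>carrier := H'\<rparr>) T c"
proof -
  interpret C: comm_group "G\<lparr>carrier := H\<rparr>" by fact
  interpret C': comm_group "G\<lparr>carrier := H'\<rparr>" by fact
  have p: "t [^]\<^bsub>G\<lparr>carrier := H\<rparr>\<^esub> c t = t [^] c t" "t [^]\<^bsub>G\<lparr>carrier := H'\<rparr>\<^esub> c t = t [^] c t" if "t \<in> H" for t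
    using int_pow_consistent[OF H(1), of t] int_pow_consistent[OF H(2), of t] that H(3) by auto
  show ?thesis
    unfolding C.power_product_def C'.power_product_def
    using T
  proof (induction T rule: finite_induct)
    case (insert t T)
    have "t [^] c t \<in> H" if "t \<in> H" for t using C.int_pow_closed[of t "c t"] p(1)[OF that] that by simp
    then show ?case using insert H(3) p by (auto simp: Pi_iff subset_iff)
  qed simp
qed

lemma (in group) commute_if_commutator_trivial:
  assumes G: "x \<in> carrier G" "y \<in> carrier G" and c: "x \<otimes> y \<otimes> inv x \<otimes> inv y = \<one>"
  shows "x \<otimes> y = y \<otimes> x"
proof -
  have "inv (inv y) = x \<otimes> y \<otimes> inv x" by (rule inv_equality[OF c]) (use G in auto)
  then have "(x \<otimes> y \<otimes> inv x) \<otimes> x = y \<otimes> x" using G by simp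
  moreover have "(x \<otimes> y \<otimes> inv x) \<otimes> x = x \<otimes> y" using G by (simp add: m_assoc)
  ultimately show ?thesis by simp
qed

context finite_rank_solvable_group
begin

text \<open>Intersect \<open>M\<close> with the last term of the derived series that it meets nontrivially; the commutators lie in
  the next term.\<close>

lemma abelian_normal_subgroup:
  assumes M: "M \<lhd> G" "M \<noteq> {\<one>}"
  shows "\<exists>A. A \<lhd> G \<and> A \<subseteq> M \<and> A \<noteq> {\<one>} \<and> (\<forall>x\<in>A. \<forall>y\<in>A. x \<otimes> y = y \<otimes> x)"
proof -
  define D where "D i = (derived G ^^ i) (carrier G)" for i
  have nrm: "D i \<lhd> G" for i
    by (induction i) (auto simp: D_def normal_self derived_is_normal)
  obtain n where n: "D n = {\<one>}"
    using solvable_imp_trivial_derived_seq[OF sol[unfolded solvable_def]] by (auto simp: D_def)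
  have M1: "\<one> \<in> M" using M(1) by (intro subgroup.one_closed normal_imp_subgroup)
  have "M \<inter> D 0 \<noteq> {\<one>}" using M subgroup.subset[OF normal_imp_subgroup[OF M(1)]] by (auto simp: D_def)
  \<comment> \<open>the series stays trivial once it is trivial\<close>
  moreover have "\<forall>i. M \<inter> D i \<noteq> {\<one>} \<longrightarrow> i < n"
  proof (intro allI impI, rule ccontr)
    fix i assume i: "M \<inter> D i \<noteq> {\<one>}" "\<not> i < n"
    have "D (n + j) = {\<one>}" for j
    proof (induction j)
      case (Suc j)
      have "derived G {\<one>} \<subseteq> {\<one>}" by (rule derived_incl[OF order_refl triv_subgroup])
      moreover have "\<one> \<in> D (n + Suc j)" by (rule subgroup.one_closed[OF normal_imp_subgroup[OF nrm]])
      ultimately show ?case using Suc by (auto simp: D_def)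
    qed (simp add: n)
    from this[of "i - n"] show False using i M1 by simp
  qed
  ultimately have "\<exists>i. M \<inter> D i \<noteq> {\<one>} \<and> (\<forall>j. M \<inter> D j \<noteq> {\<one>} \<longrightarrow> j \<le> i)"
    by (rule ex_has_greatest_nat)
  then obtain i where i: "M \<inter> D i \<noteq> {\<one>}" and max: "\<And>j. M \<inter> D j \<noteq> {\<one>} \<Longrightarrow> j \<le> i" by blast
  have triv: "M \<inter> D (Suc i) = {\<one>}" using max[of "Suc i"] by auto
  interpret A: normal "M \<inter> D i" G by (rule normal_Int[OF M(1) nrm])
  have "x \<otimes> y = y \<otimes> x" if xy: "x \<in> M \<inter> D i" "y \<in> M \<inter> D i" for x y
  proof -
    have G: "x \<in> carrier G" "y \<in> carrier G" using A.mem_carrier xy by auto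
    have "x \<otimes> y \<otimes> inv x \<otimes> inv y \<in> M \<inter> D i"
      using A.m_closed[OF A.m_closed[OF A.m_closed[OF xy] A.m_inv_closed[OF xy(1)]] A.m_inv_closed[OF xy(2)]] .
    moreover have "x \<otimes> y \<otimes> inv x \<otimes> inv y \<in> D (Suc i)" using commutator_in_derived xy by (simp add: D_def)
    ultimately have c: "x \<otimes> y \<otimes> inv x \<otimes> inv y = \<one>" using triv by blast
    show ?thesis by (rule commute_if_commutator_trivial[OF G c])
  qed
  then show ?thesis using i A.normal_axioms by blast
qed

text \<open>The elements of \<open>A\<close> of exponent \<open>n\<close> form a finite normal subgroup, which contains a minimal one.\<close>

lemma torsion_meets_socle:
  assumes A: "A \<lhd> G" "\<And>x y. \<lbrakk>x \<in> A; y \<in> A\<rbrakk> \<Longrightarrow> x \<otimes> y = y \<otimes> x"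
    and x: "x \<in> A" "x \<noteq> \<one>" "n > 0" "x [^] (n::nat) = \<one>"
  shows "\<exists>p. Factorial_Ring.prime p \<and> A \<inter> socle_part p \<noteq> {\<one>}"
proof -
  let ?N = "{x \<in> A. x [^] n = \<one>}"
  have N: "?N \<lhd> G" by (rule normal_torsion[OF A])
  have "finite ?N" by (rule finite_bounded_exponent[OF N _ x(3)]) (use A(2) in auto)
  moreover have "?N \<noteq> {\<one>}" using x by blast
  ultimately obtain B where B: "minimal_normal B G" "B \<subseteq> ?N" using exists_minimal_normal[OF N] by blast
  obtain p where p: "Factorial_Ring.prime (p::nat)" "\<And>x. x \<in> B \<Longrightarrow> x [^] p = \<one>"
    using minimal_normal_elementary[OF B(1)] by blast
  have "B \<subseteq> A \<inter> socle_part p" using B p(2) minimal_normal_in_socle[OF B(1)] by (auto simp: socle_part_def)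
  moreover have "B \<noteq> {\<one>}" "B \<noteq> {}"
    using B(1) subgroup.one_closed[OF normal_imp_subgroup, of B G] by (auto simp: minimal_normal_def)
  ultimately have "A \<inter> socle_part p \<noteq> {\<one>}" by (metis subset_singletonD)
  then show ?thesis using p(1) by blast
qed

definition torsion_free_abelian :: "'a set \<Rightarrow> bool" where
  "torsion_free_abelian A \<longleftrightarrow> A \<lhd> G \<and> (\<forall>x\<in>A. \<forall>y\<in>A. x \<otimes> y = y \<otimes> x) \<and>
     (\<forall>x\<in>A. \<forall>k>0. x [^] (k::nat) = \<one> \<longrightarrow> x = \<one>)"

lemma torsion_free_abelian_comm_group:
  assumes "torsion_free_abelian A"
  shows "comm_group (G\<lparr>carrier := A\<rparr>)"
proof -
  have "subgroup A G" using assms normal_imp_subgroup by (auto simp: torsion_free_abelian_def)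
  then show ?thesis
    by (intro group.group_comm_groupI subgroup.subgroup_is_group is_group) (use assms in \<open>auto simp: torsion_free_abelian_def\<close>)
qed

lemma commute_if_trivial_intersection:
  assumes A: "A \<lhd> G" and B: "B \<lhd> G" and AB: "A \<inter> B = {\<one>}" and a: "a \<in> A" and b: "b \<in> B"
  shows "a \<otimes> b = b \<otimes> a"
proof -
  interpret A: normal A G by fact
  interpret B: normal B G by fact
  have G: "a \<in> carrier G" "b \<in> carrier G" using a b by auto
  have "a \<otimes> (b \<otimes> inv a \<otimes> inv b) \<in> A" using A.inv_op_closed2[OF G(2), of "inv a"] a by simp
  moreover have "(a \<otimes> b \<otimes> inv a) \<otimes> inv b \<in> B" using B.inv_op_closed2[OF G(1) b] b by simp
  ultimately have c: "a \<otimes> b \<otimes> inv a \<otimes> inv b = \<one>" using AB G by (auto simp: m_assoc)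
  show ?thesis by (rule commute_if_commutator_trivial[OF G c])
qed

lemma torsion_free_product:
  assumes D: "torsion_free_abelian D" and B: "torsion_free_abelian B" and DB: "D \<inter> B = {\<one>}"
  shows "torsion_free_abelian {x \<otimes> y | x y. x \<in> D \<and> y \<in> B}"
proof -
  have DN: "D \<lhd> G" and BN: "B \<lhd> G"
    and Dc: "\<And>x y. \<lbrakk>x \<in> D; y \<in> D\<rbrakk> \<Longrightarrow> x \<otimes> y = y \<otimes> x" and Bc: "\<And>x y. \<lbrakk>x \<in> B; y \<in> B\<rbrakk> \<Longrightarrow> x \<otimes> y = y \<otimes> x"
    and Dt: "\<And>x k. \<lbrakk>x \<in> D; k > 0; x [^] (k::nat) = \<one>\<rbrakk> \<Longrightarrow> x = \<one>"
    and Bt: "\<And>x k. \<lbrakk>x \<in> B; k > 0; x [^] (k::nat) = \<one>\<rbrakk> \<Longrightarrow> x = \<one>"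
    using D B unfolding torsion_free_abelian_def by blast+
  interpret D: normal D G by (rule DN)
  interpret B: normal B G by (rule BN)
  note DBc = commute_if_trivial_intersection[OF DN BN DB]
  show ?thesis
    unfolding torsion_free_abelian_def
  proof (intro conjI ballI allI impI)
    show "{x \<otimes> y | x y. x \<in> D \<and> y \<in> B} \<lhd> G" by (rule normal_mult_set[OF DN BN DBc])
    fix z assume "z \<in> {x \<otimes> y | x y. x \<in> D \<and> y \<in> B}"
    then obtain x y where xy: "x \<in> D" "y \<in> B" "z = x \<otimes> y" by blast
    have G: "x \<in> carrier G" "y \<in> carrier G" using xy by auto
    show "z \<otimes> z' = z' \<otimes> z" if z': "z' \<in> {x \<otimes> y | x y. x \<in> D \<and> y \<in> B}" for z'
    proof -
      obtain x' y' where xy': "x' \<in> D" "y' \<in> B" "z' = x' \<otimes> y'" using z' by blast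
      have G': "x' \<in> carrier G" "y' \<in> carrier G" using xy' by auto
      have "(x \<otimes> y) \<otimes> (x' \<otimes> y') = (x \<otimes> x') \<otimes> (y \<otimes> y')"
        using mult_exchange[OF G G' DBc[OF xy'(1) xy(2), symmetric]] .
      also have "\<dots> = (x' \<otimes> x) \<otimes> (y' \<otimes> y)" using Dc[OF xy(1) xy'(1)] Bc[OF xy(2) xy'(2)] by simp
      also have "\<dots> = (x' \<otimes> y') \<otimes> (x \<otimes> y)"
        using mult_exchange[OF G' G DBc[OF xy(1) xy'(2), symmetric]] by simp
      finally show ?thesis using xy xy' by simp
    qed
    fix k :: nat assume k: "k > 0" "z [^] k = \<one>"
    have e: "x [^] k \<otimes> y [^] k = \<one>" using k(2) pow_mult_distrib[OF DBc[OF xy(1,2)] G] xy(3) by simp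
    have pD: "x [^] k \<in> D" and pB: "y [^] k \<in> B"
      using subgroup_nat_pow_closed[OF D.subgroup_axioms xy(1)] subgroup_nat_pow_closed[OF B.subgroup_axioms xy(2)] by auto
    have "x [^] k = inv (y [^] k)" using e G by (metis inv_equality inv_inv nat_pow_closed)
    then have "x [^] k \<in> D \<inter> B" using pD B.m_inv_closed[OF pB] by simp
    then have "x [^] k = \<one>" using DB by simp
    moreover then have "y [^] k = \<one>" using e G by simp
    ultimately show "z = \<one>" using Dt[OF xy(1) k(1)] Bt[OF xy(2) k(1)] xy(3) by simp
  qed
qed

text \<open>Take \<open>D\<close> of maximal rank, with a maximal independent set \<open>T\<close>. A torsion-free abelian normal subgroup
  \<open>B\<close> that met \<open>D\<close> trivially would commute with \<open>D\<close>, and \<open>D B\<close> would have larger rank. So \<open>B\<close> meets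
  \<open>D\<close>, and a suitable power of a nontrivial element of \<open>B \<inter> D\<close> lies in the group generated by \<open>T\<close>.\<close>

lemma exists_maximal_torsion_free:
  shows "\<exists>D T. torsion_free_abelian D \<and> comm_group.mult_independent (G\<lparr>carrier := D\<rparr>) T \<and>
    (\<forall>B. torsion_free_abelian B \<and> B \<noteq> {\<one>} \<longrightarrow> (\<exists>y\<in>B \<inter> generate G T. y \<noteq> \<one>))"
proof -
  obtain r where r: "rank_at_most r G" using fin_rank unfolding finite_rank_iff by blast
  define P where "P n \<longleftrightarrow> (\<exists>D T. torsion_free_abelian D \<and> comm_group.mult_independent (G\<lparr>carrier := D\<rparr>) T \<and> card T = n)" for n
  have sub: "subgroup D G" if "torsion_free_abelian D" for D
    using that normal_imp_subgroup by (auto simp: torsion_free_abelian_def)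
  have "torsion_free_abelian {\<one>}" using one_is_normal by (auto simp: torsion_free_abelian_def)
  moreover then have "comm_group.mult_independent (G\<lparr>carrier := {\<one>}\<rparr>) {}"
    using comm_group.mult_independent_empty[OF torsion_free_abelian_comm_group] by blast
  ultimately have "P 0" unfolding P_def by (metis card.empty)
  moreover have "\<forall>n. P n \<longrightarrow> n < Suc r"
    using comm_group.mult_independent_card[OF torsion_free_abelian_comm_group rank_at_most_subgroup[OF r sub]]
    unfolding P_def by (metis less_Suc_eq_le)
  ultimately have "\<exists>n. P n \<and> (\<forall>m. P m \<longrightarrow> m \<le> n)" by (rule ex_has_greatest_nat)
  then obtain n where n: "P n" and max: "\<And>m. P m \<Longrightarrow> m \<le> n" by blast
  obtain D T where D: "torsion_free_abelian D" and T: "comm_group.mult_independent (G\<lparr>carrier := D\<rparr>) T" "card T = n"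
    using n unfolding P_def by blast
  interpret D: subgroup D G by (rule sub[OF D])
  interpret C: comm_group "G\<lparr>carrier := D\<rparr>" by (rule torsion_free_abelian_comm_group[OF D])
  have TD: "finite T" "T \<subseteq> D" using T(1) by (auto simp: C.mult_independent_def)
  have "\<exists>y\<in>B \<inter> generate G T. y \<noteq> \<one>" if B: "torsion_free_abelian B" "B \<noteq> {\<one>}" for B
  proof -
    interpret B: subgroup B G by (rule sub[OF B(1)])
    have "B \<inter> D \<noteq> {\<one>}"
    proof
      assume "B \<inter> D = {\<one>}"
      then have DB: "D \<inter> B = {\<one>}" by blast
      obtain b where b: "b \<in> B" "b \<noteq> \<one>" using B(2) B.one_closed by blast
      define E where "E = {x \<otimes> y | x y. x \<in> D \<and> y \<in> B}"
      have E: "torsion_free_abelian E" unfolding E_def by (rule torsion_free_product[OF D B(1) DB])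
      interpret E: comm_group "G\<lparr>carrier := E\<rparr>" by (rule torsion_free_abelian_comm_group[OF E])
      have DE: "D \<subseteq> E" 
      proof
        fix x assume x: "x \<in> D"
        then have "x = x \<otimes> \<one>" by simp
        then show "x \<in> E" unfolding E_def using x B.one_closed by blast
      qed
      have bE: "b \<in> E" 
      proof -
        have "b = \<one> \<otimes> b" using b(1) by simp
        then show ?thesis unfolding E_def using b(1) D.one_closed by blast
      qed
      have ind: "E.mult_independent T"
        using T(1) TD DE power_product_consistent[OF D.subgroup_axioms sub[OF E] DE C.comm_group_axioms E.comm_group_axioms TD]
        unfolding C.mult_independent_def E.mult_independent_def by auto
      have free: "k = 0" if k: "b [^]\<^bsub>G\<lparr>carrier := E\<rparr>\<^esub> (k::int) \<in> generate (G\<lparr>carrier := E\<rparr>) T" for k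
      proof (rule ccontr)
        assume "k \<noteq> 0"
        have "b [^] k \<in> generate G T"
          using k generate_consistent[OF _ sub[OF E], of T] TD(2) DE int_pow_consistent[OF sub[OF E] bE] by auto
        also have "generate G T \<subseteq> D" by (rule generate_subgroup_incl[OF TD(2) D.subgroup_axioms])
        finally have "b [^] k \<in> D \<inter> B" using subgroup_int_pow_closed[OF B.subgroup_axioms b(1)] by simp
        then have bk: "b [^] k = \<one>" using DB by simp
        then have "b [^] (nat \<bar>k\<bar>) = \<one>"
          using b(1) int_pow_int[of G b "nat \<bar>k\<bar>"] int_pow_neg[of b k] by (cases "k \<ge> 0") auto
        moreover have "nat \<bar>k\<bar> > 0" using \<open>k \<noteq> 0\<close> by simp
        ultimately show False using B(1) b unfolding torsion_free_abelian_def by blast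
      qed
      have "b \<in> carrier (G\<lparr>carrier := E\<rparr>)" using bE by simp
      note ins = E.mult_independent_insert[OF ind this free]
      have "P (Suc n)" unfolding P_def using E ins TD(1) T(2) by (metis card_insert_disjoint)
      then show False using max by fastforce
    qed
    then obtain y where y: "y \<in> B" "y \<in> D" "y \<noteq> \<one>" using B.one_closed D.one_closed by blast
    have "\<exists>k>0. y [^]\<^bsub>G\<lparr>carrier := D\<rparr>\<^esub> (k::nat) \<in> generate (G\<lparr>carrier := D\<rparr>) T"
    proof (rule C.independent_extension_card[OF T(1)])
      fix T' assume "C.mult_independent T'"
      then show "card T' \<le> card T" using max[of "card T'"] D T(2) unfolding P_def by blast
    qed (simp add: y)
    then obtain k :: nat where k: "k > 0" "y [^] k \<in> generate G T"
      using generate_consistent[OF TD(2) D.subgroup_axioms] by (auto simp: nat_pow_consistent[symmetric])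
    have "y [^] k \<noteq> \<one>" using B(1) y k(1) unfolding torsion_free_abelian_def by blast
    moreover have "y [^] k \<in> B" by (rule subgroup_nat_pow_closed[OF B.subgroup_axioms y(1)])
    ultimately show ?thesis using k(2) by blast
  qed
  then show ?thesis using D T(1) by blast
qed

end


section \<open>The simple module of a function on the group\<close>

context group_representation
begin

lemma finsum_smult:
  assumes "finite A" "F \<in> A \<rightarrow> carrier RG" "v \<in> carrier V"
  shows "(\<Oplus>\<^bsub>RG\<^esub>i\<in>A. F i) \<odot>\<^bsub>V\<^esub> v = (\<Oplus>\<^bsub>V\<^esub>i\<in>A. F i \<odot>\<^bsub>V\<^esub> v)"
  using assms(1,2)
proof (induction A rule: finite_induct)
  case (insert a A)
  have F: "F a \<in> carrier RG" "F \<in> A \<rightarrow> carrier RG" using insert.prems by auto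
  have "(\<Oplus>\<^bsub>RG\<^esub>i\<in>insert a A. F i) \<odot>\<^bsub>V\<^esub> v = (F a \<oplus>\<^bsub>RG\<^esub> (\<Oplus>\<^bsub>RG\<^esub>i\<in>A. F i)) \<odot>\<^bsub>V\<^esub> v"
    using insert F by simp
  also have "\<dots> = F a \<odot>\<^bsub>V\<^esub> v \<oplus>\<^bsub>V\<^esub> (\<Oplus>\<^bsub>V\<^esub>i\<in>A. F i \<odot>\<^bsub>V\<^esub> v)"
    using V.smult_l_distr[OF F(1) V.R.finsum_closed[OF F(2)] assms(3)] insert.IH[OF F(2)] by simp
  also have "\<dots> = (\<Oplus>\<^bsub>V\<^esub>i\<in>insert a A. F i \<odot>\<^bsub>V\<^esub> v)"
    using insert F V.smult_closed assms(3) by (simp add: Pi_iff)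
  finally show ?case .
qed (simp add: smult_zero_left assms(3))

lemma rep_kernel_normal: "rep_kernel K G V \<lhd> G"
proof (rule G.normalI_conjugate)
  have k: "g \<in> rep_kernel K G V \<longleftrightarrow> g \<in> carrier G \<and> (\<forall>v\<in>carrier V. act g v = v)" for g
    by (simp add: rep_kernel_def act_def)
  show "subgroup (rep_kernel K G V) G"
  proof (rule G.subgroupI)
    show "rep_kernel K G V \<subseteq> carrier G" using k by blast
    have "\<one>\<^bsub>G\<^esub> \<in> rep_kernel K G V" unfolding k by simp
    then show "rep_kernel K G V \<noteq> {}" by blast
    show "g \<otimes>\<^bsub>G\<^esub> h \<in> rep_kernel K G V" if gh: "g \<in> rep_kernel K G V" "h \<in> rep_kernel K G V" for g h
      using gh unfolding k by (simp flip: act_act)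
    show "inv\<^bsub>G\<^esub> g \<in> rep_kernel K G V" if g: "g \<in> rep_kernel K G V" for g
    proof -
      have "act (inv\<^bsub>G\<^esub> g) v = v" if v: "v \<in> carrier V" for v
      proof -
        have gG: "g \<in> carrier G" "act g v = v" using g v unfolding k by auto
        have "act (inv\<^bsub>G\<^esub> g) (act g v) = v"
          using act_act[OF G.inv_closed[OF gG(1)] gG(1) v] gG(1) v by simp
        then show ?thesis unfolding gG(2) .
      qed
      then show ?thesis using g unfolding k by simp
    qed
  qed
  fix g x assume g: "g \<in> carrier G" and x: "x \<in> rep_kernel K G V"
  have "act (G.conjugate g x) v = v" if v: "v \<in> carrier V" for v
  proof -
    have "act (G.conjugate g x) v = act g (act x (act (inv\<^bsub>G\<^esub> g) v))"
      using g x v unfolding k by (simp add: act_act G.conjugate_def G.m_assoc)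
    also have "act x (act (inv\<^bsub>G\<^esub> g) v) = act (inv\<^bsub>G\<^esub> g) v" using x g v unfolding k by simp
    finally show ?thesis using g v by (simp add: act_act)
  qed
  then show "G.conjugate g x \<in> rep_kernel K G V" using g x unfolding k by simp
qed

end

locale group_functional = group_ring_setup K G
  for K :: "('k, 'n) ring_scheme" (structure) and G :: "('g, 'm) monoid_scheme" +
  fixes u :: "'g \<Rightarrow> 'k"
  assumes K_field: "field K" and u_closed: "g \<in> carrier G \<Longrightarrow> u g \<in> carrier K"

sublocale group_functional \<subseteq> reg: group_representation K G "regular_module (group_ring K G)"
  by (intro group_representation.intro group_representation_axioms.intro group_ring_setup_axioms K_field
      ring.regular_left_module ring_RG)

context group_functional
begin

text \<open>The linear extension of \<open>g \<mapsto> u (h g)\<close> to the group ring, evaluated at \<open>f\<close>.\<close>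

definition value_at :: "'g \<Rightarrow> ('g \<Rightarrow> 'k) \<Rightarrow> 'k" where
  "value_at h f = (\<Oplus>g\<in>fsupport K f. f g \<otimes> u (h \<otimes>\<^bsub>G\<^esub> g))"

lemma value_at_superset:
  assumes f: "f \<in> carrier RG" and h: "h \<in> carrier G" and B: "finite B" "fsupport K f \<subseteq> B" "B \<subseteq> carrier G"
  shows "value_at h f = (\<Oplus>g\<in>B. f g \<otimes> u (h \<otimes>\<^bsub>G\<^esub> g))"
  unfolding value_at_def
  by (rule add.finprod_mono_neutral_cong_left)
     (use B h subsetD[OF B(3)] in \<open>auto simp: coeff_closed[OF f] u_closed fsupport_def\<close>)

lemma value_at_closed: "\<lbrakk>f \<in> carrier RG; h \<in> carrier G\<rbrakk> \<Longrightarrow> value_at h f \<in> carrier K"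
  unfolding value_at_def by (rule finsum_closed) (auto simp: coeff_closed u_closed supp_closed)

lemma value_at_add:
  assumes f: "f \<in> carrier RG" "f' \<in> carrier RG" and h: "h \<in> carrier G"
  shows "value_at h (f \<oplus>\<^bsub>RG\<^esub> f') = value_at h f \<oplus> value_at h f'"
proof -
  let ?B = "fsupport K f \<union> fsupport K f'"
  have B: "finite ?B" "?B \<subseteq> carrier G" using f by (auto simp: carrier_iff)
  have s: "fsupport K (f \<oplus>\<^bsub>RG\<^esub> f') \<subseteq> ?B" by (auto simp: fsupport_def add_eq)
  have BG: "g \<in> carrier G" if "g \<in> ?B" for g using that B(2) by blast
  have "value_at h (f \<oplus>\<^bsub>RG\<^esub> f') = (\<Oplus>g\<in>?B. f g \<otimes> u (h \<otimes>\<^bsub>G\<^esub> g) \<oplus> f' g \<otimes> u (h \<otimes>\<^bsub>G\<^esub> g))"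
    unfolding value_at_superset[OF reg.V.R.a_closed[OF f] h B(1) s B(2)]
    by (rule finsum_cong') (use BG h in \<open>auto simp: add_eq l_distr coeff_closed[OF f(1)] coeff_closed[OF f(2)] u_closed\<close>)
  also have "\<dots> = (\<Oplus>g\<in>?B. f g \<otimes> u (h \<otimes>\<^bsub>G\<^esub> g)) \<oplus> (\<Oplus>g\<in>?B. f' g \<otimes> u (h \<otimes>\<^bsub>G\<^esub> g))"
    by (rule finsum_addf) (use BG h in \<open>auto simp: coeff_closed[OF f(1)] coeff_closed[OF f(2)] u_closed\<close>)
  also have "\<dots> = value_at h f \<oplus> value_at h f'"
    using value_at_superset[OF f(1) h B(1) _ B(2)] value_at_superset[OF f(2) h B(1) _ B(2)] by simp
  finally show ?thesis .
qed

lemma value_at_zero: "value_at h \<zero>\<^bsub>RG\<^esub> = \<zero>"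
proof -
  have "fsupport K \<zero>\<^bsub>RG\<^esub> = {}" by (auto simp: fsupport_def group_ring_def)
  then show ?thesis by (simp add: value_at_def)
qed

lemma value_at_single:
  assumes "k \<in> carrier K" "g \<in> carrier G" "h \<in> carrier G"
  shows "value_at h (reg.single k g) = k \<otimes> u (h \<otimes>\<^bsub>G\<^esub> g)"
proof -
  have "value_at h (reg.single k g) = (\<Oplus>x\<in>{g}. reg.single k g x \<otimes> u (h \<otimes>\<^bsub>G\<^esub> x))"
    by (rule value_at_superset[OF reg.single_closed]) (use assms in \<open>auto simp: fsupport_def reg.single_def\<close>)
  then show ?thesis using assms u_closed by (simp add: reg.single_def)
qed

lemma value_at_finsum:
  assumes "finite A" "F \<in> A \<rightarrow> carrier RG" "h \<in> carrier G"
  shows "value_at h (\<Oplus>\<^bsub>RG\<^esub>i\<in>A. F i) = (\<Oplus>i\<in>A. value_at h (F i))"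
  using assms(1,2)
proof (induction A rule: finite_induct)
  case (insert a A)
  have F: "F a \<in> carrier RG" "F \<in> A \<rightarrow> carrier RG" using insert.prems by auto
  have "(\<Oplus>\<^bsub>RG\<^esub>i\<in>insert a A. F i) = F a \<oplus>\<^bsub>RG\<^esub> (\<Oplus>\<^bsub>RG\<^esub>i\<in>A. F i)"
    by (rule reg.V.R.finsum_insert) (use insert F in auto)
  moreover have "(\<Oplus>i\<in>insert a A. value_at h (F i)) = value_at h (F a) \<oplus> (\<Oplus>i\<in>A. value_at h (F i))"
    by (rule finsum_insert) (use insert F assms(3) value_at_closed in auto)
  ultimately show ?case
    using value_at_add[OF F(1) reg.V.R.finsum_closed[OF F(2)] assms(3)] insert.IH[OF F(2)] by simp
qed (simp add: value_at_zero)

lemma value_at_single_mult: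
  assumes k: "k \<in> carrier K" and g: "g \<in> carrier G" and f: "f \<in> carrier RG" and h: "h \<in> carrier G"
  shows "value_at h (reg.single k g \<otimes>\<^bsub>RG\<^esub> f) = k \<otimes> value_at (h \<otimes>\<^bsub>G\<^esub> g) f"
proof -
  interpret field K by (rule K_field)
  let ?B = "fsupport K f" and ?t = "\<lambda>y. g \<otimes>\<^bsub>G\<^esub> y"
  have B: "finite ?B" "?B \<subseteq> carrier G" using f by (auto simp: carrier_iff)
  have BG: "y \<in> carrier G" if "y \<in> ?B" for y using that B(2) by blast
  have sg: "reg.single k g \<in> carrier RG" by (rule reg.single_closed[OF k g])
  have e: "(reg.single k g \<otimes>\<^bsub>RG\<^esub> f) x = k \<otimes> f (inv\<^bsub>G\<^esub> g \<otimes>\<^bsub>G\<^esub> x)" if x: "x \<in> carrier G" for x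
  proof -
    have "(reg.single k g \<otimes>\<^bsub>RG\<^esub> f) x = (\<Oplus>y\<in>{g}. reg.single k g y \<otimes> f (inv\<^bsub>G\<^esub> y \<otimes>\<^bsub>G\<^esub> x))"
      by (rule mult_eq[OF sg f x]) (auto simp: fsupport_def reg.single_def)
    then show ?thesis using k coeff_closed[OF f] by (simp add: reg.single_def)
  qed
  have s: "fsupport K (reg.single k g \<otimes>\<^bsub>RG\<^esub> f) \<subseteq> ?t ` ?B"
  proof
    fix x assume "x \<in> fsupport K (reg.single k g \<otimes>\<^bsub>RG\<^esub> f)"
    then have nz: "(reg.single k g \<otimes>\<^bsub>RG\<^esub> f) x \<noteq> \<zero>" by (simp add: fsupport_def)
    then have x: "x \<in> carrier G" using mult_outside by blast
    have "f (inv\<^bsub>G\<^esub> g \<otimes>\<^bsub>G\<^esub> x) \<noteq> \<zero>" using nz e[OF x] k by auto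
    moreover have "x = g \<otimes>\<^bsub>G\<^esub> (inv\<^bsub>G\<^esub> g \<otimes>\<^bsub>G\<^esub> x)" using g x by (simp flip: G.m_assoc)
    ultimately show "x \<in> ?t ` ?B" by (intro image_eqI[of _ _ "inv\<^bsub>G\<^esub> g \<otimes>\<^bsub>G\<^esub> x"]) (simp_all add: fsupport_def)
  qed
  have tG: "?t ` ?B \<subseteq> carrier G" using g BG by auto
  have inj: "inj_on ?t ?B" by (rule inj_onI) (use g BG G.l_cancel in blast)
  have "value_at h (reg.single k g \<otimes>\<^bsub>RG\<^esub> f) =
      (\<Oplus>x\<in>?t ` ?B. (reg.single k g \<otimes>\<^bsub>RG\<^esub> f) x \<otimes> u (h \<otimes>\<^bsub>G\<^esub> x))"
    by (rule value_at_superset[OF mult_closed[OF sg f] h _ s tG]) (use B in simp)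
  also have "\<dots> = (\<Oplus>y\<in>?B. (reg.single k g \<otimes>\<^bsub>RG\<^esub> f) (g \<otimes>\<^bsub>G\<^esub> y) \<otimes> u (h \<otimes>\<^bsub>G\<^esub> (g \<otimes>\<^bsub>G\<^esub> y)))"
    by (rule add.finprod_reindex[OF _ inj]) (use g h BG in \<open>auto simp: coeff_closed[OF mult_closed[OF sg f]] u_closed\<close>)
  also have "\<dots> = (\<Oplus>y\<in>?B. k \<otimes> (f y \<otimes> u ((h \<otimes>\<^bsub>G\<^esub> g) \<otimes>\<^bsub>G\<^esub> y)))"
  proof (rule finsum_cong'[OF refl])
    fix y assume y: "y \<in> ?B"
    have "inv\<^bsub>G\<^esub> g \<otimes>\<^bsub>G\<^esub> (g \<otimes>\<^bsub>G\<^esub> y) = y" using g BG[OF y] by (simp flip: G.m_assoc)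
    then show "(reg.single k g \<otimes>\<^bsub>RG\<^esub> f) (g \<otimes>\<^bsub>G\<^esub> y) \<otimes> u (h \<otimes>\<^bsub>G\<^esub> (g \<otimes>\<^bsub>G\<^esub> y)) = k \<otimes> (f y \<otimes> u ((h \<otimes>\<^bsub>G\<^esub> g) \<otimes>\<^bsub>G\<^esub> y))"
      using e[of "g \<otimes>\<^bsub>G\<^esub> y"] g h k BG[OF y] coeff_closed[OF f] u_closed by (simp add: G.m_assoc m_assoc)
  qed (use g h k BG in \<open>auto simp: coeff_closed[OF f] u_closed\<close>)
  also have "\<dots> = k \<otimes> value_at (h \<otimes>\<^bsub>G\<^esub> g) f"
    unfolding value_at_def
    by (rule finsum_rdistr[symmetric]) (use B k g h BG in \<open>auto simp: coeff_closed[OF f] u_closed\<close>)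
  finally show ?thesis .
qed

definition annihilator :: "('g \<Rightarrow> 'k) set" where
  "annihilator = {f \<in> carrier RG. \<forall>h\<in>carrier G. value_at h f = \<zero>}"

text \<open>The translates of \<open>u\<close> are permuted by right multiplication: the value of \<open>k g f\<close> at \<open>h\<close> is \<open>k\<close> times
  the value of \<open>f\<close> at \<open>h g\<close>.\<close>

lemma annihilator_submodule: "submodule annihilator RG (regular_module RG)"
proof (rule reg.submodule_spanning)
  note A = reg.V.M.a_group
  show "subgroup annihilator (add_monoid (regular_module RG))"
  proof (rule group.subgroupI[OF A])
    show "annihilator \<subseteq> carrier (add_monoid (regular_module RG))"
      by (auto simp: annihilator_def regular_module_simps)
    have "\<zero>\<^bsub>RG\<^esub> \<in> annihilator" by (simp add: annihilator_def value_at_zero)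
    then show "annihilator \<noteq> {}" by blast
    show "f \<otimes>\<^bsub>add_monoid (regular_module RG)\<^esub> f' \<in> annihilator" if "f \<in> annihilator" "f' \<in> annihilator" for f f'
      using that by (simp add: annihilator_def regular_module_simps value_at_add)
    show "inv\<^bsub>add_monoid (regular_module RG)\<^esub> f \<in> annihilator" if f: "f \<in> annihilator" for f
    proof -
      let ?f = "inv\<^bsub>add_monoid (regular_module RG)\<^esub> f"
      have fc: "f \<in> carrier RG" using f by (simp add: annihilator_def)
      have c: "?f \<in> carrier RG" using group.inv_closed[OF A, of f] fc by (simp add: regular_module_simps)
      have "f \<oplus>\<^bsub>RG\<^esub> ?f = \<zero>\<^bsub>RG\<^esub>" using group.r_inv[OF A, of f] fc by (simp add: regular_module_simps)
      then have sum: "value_at h f \<oplus> value_at h ?f = \<zero>" if "h \<in> carrier G" for h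
        using value_at_add[OF fc c that] value_at_zero by simp
      have "value_at h ?f = \<zero>" if h: "h \<in> carrier G" for h
      proof -
        have "value_at h f = \<zero>" using f h by (simp add: annihilator_def)
        then show ?thesis using sum[OF h] l_zero[OF value_at_closed[OF c h]] by simp
      qed
      then show ?thesis using c by (simp add: annihilator_def)
    qed
  qed
  fix k g f assume k: "k \<in> carrier K" and g: "g \<in> carrier G" and f: "f \<in> annihilator"
  then show "reg.single k g \<odot>\<^bsub>regular_module RG\<^esub> f \<in> annihilator"
    by (simp add: annihilator_def regular_module_simps value_at_single_mult mult_closed reg.single_closed)
qed

text \<open>Let \<open>v\<close> be the image of \<open>1\<close> in a simple quotient of the group ring by a left ideal above the annihilator
  of \<open>u\<close>. If \<open>u (h g) = k u h\<close> for all \<open>h\<close>, then \<open>g - k\<close> kills \<open>v\<close>, and if moreover \<open>g\<close> acts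
  trivially, \<open>(1 - k) v = 0\<close>. Similarly \<open>1 + x + \<dots> + x\<^bsup>p-1\<^esup>\<close> kills \<open>v\<close> if the sums of \<open>u\<close> over
  all \<open>h, h x, \<dots>, h x\<^bsup>p-1\<^esup>\<close> vanish, and it acts as \<open>p\<close> if \<open>x\<close> acts trivially.\<close>

theorem simple_module_of_functional:
  assumes u1: "u \<one>\<^bsub>G\<^esub> \<noteq> \<zero>"
  shows "\<exists>W :: ('g \<Rightarrow> 'k, 'g \<Rightarrow> 'k) module. simple_module RG W \<and> rep_kernel K G W \<lhd> G \<and>
    (\<forall>g\<in>rep_kernel K G W. \<forall>k\<in>carrier K. (\<forall>h\<in>carrier G. u (h \<otimes>\<^bsub>G\<^esub> g) = k \<otimes> u h) \<longrightarrow> k = \<one>) \<and>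
    (\<forall>x\<in>rep_kernel K G W. \<forall>p. (\<forall>h\<in>carrier G. (\<Oplus>i\<in>{..<p}. u (h \<otimes>\<^bsub>G\<^esub> x [^]\<^bsub>G\<^esub> (i::nat))) = \<zero>) \<longrightarrow> [p] \<cdot> \<one> = \<zero>)"
proof -
  interpret F: field K by (rule K_field)
  have "\<one>\<^bsub>RG\<^esub> = reg.single \<one> \<one>\<^bsub>G\<^esub>" unfolding one_eq by (rule reg.group_elem_single)
  then have "value_at \<one>\<^bsub>G\<^esub> \<one>\<^bsub>RG\<^esub> = \<one> \<otimes> u (\<one>\<^bsub>G\<^esub> \<otimes>\<^bsub>G\<^esub> \<one>\<^bsub>G\<^esub>)"
    using value_at_single[OF one_closed G.one_closed G.one_closed] by metis
  also have "\<dots> = u \<one>\<^bsub>G\<^esub>" using u_closed[OF G.one_closed] by simp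
  finally have val: "value_at \<one>\<^bsub>G\<^esub> \<one>\<^bsub>RG\<^esub> = u \<one>\<^bsub>G\<^esub>" .
  have "\<one>\<^bsub>RG\<^esub> \<notin> annihilator"
  proof
    assume "\<one>\<^bsub>RG\<^esub> \<in> annihilator"
    then have "\<forall>h\<in>carrier G. value_at h \<one>\<^bsub>RG\<^esub> = \<zero>" unfolding annihilator_def by blast
    then show False using val u1 G.one_closed by metis
  qed
  from ring.exists_simple_module[OF ring_RG annihilator_submodule this]
  obtain W :: "('g \<Rightarrow> 'k, 'g \<Rightarrow> 'k) module" and v where W: "simple_module RG W" and v: "v \<in> carrier W" "v \<noteq> \<zero>\<^bsub>W\<^esub>"
    and ann: "\<And>f. f \<in> annihilator \<Longrightarrow> f \<odot>\<^bsub>W\<^esub> v = \<zero>\<^bsub>W\<^esub>" by blast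
  interpret W: group_representation K G W
    by (intro group_representation.intro group_representation_axioms.intro group_ring_setup_axioms K_field)
       (use W in \<open>simp add: simple_module_def\<close>)
  have k1: "k = \<one>" if g: "g \<in> rep_kernel K G W" and k: "k \<in> carrier K"
    and e: "\<And>h. h \<in> carrier G \<Longrightarrow> u (h \<otimes>\<^bsub>G\<^esub> g) = k \<otimes> u h" for g k
  proof (rule ccontr)
    assume "k \<noteq> \<one>"
    have gG: "g \<in> carrier G" using g by (simp add: rep_kernel_def)
    have s: "W.single \<one> g \<in> carrier RG" "W.single (\<ominus> k) \<one>\<^bsub>G\<^esub> \<in> carrier RG" "W.single \<one> \<one>\<^bsub>G\<^esub> \<in> carrier RG"
      using gG k by (auto intro: W.single_closed)
    have "value_at h (W.single \<one> g \<oplus>\<^bsub>RG\<^esub> W.single (\<ominus> k) \<one>\<^bsub>G\<^esub>) = \<zero>" if h: "h \<in> carrier G" for h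
      using value_at_add[OF s(1,2) h] value_at_single[of \<one> g h] value_at_single[of "\<ominus> k" "\<one>\<^bsub>G\<^esub>" h]
        gG k h u_closed[OF h] e[OF h] by (simp add: l_minus r_neg)
    then have "W.single \<one> g \<oplus>\<^bsub>RG\<^esub> W.single (\<ominus> k) \<one>\<^bsub>G\<^esub> \<in> annihilator"
      using s by (simp add: annihilator_def)
    then have "W.single \<one> g \<odot>\<^bsub>W\<^esub> v \<oplus>\<^bsub>W\<^esub> W.single (\<ominus> k) \<one>\<^bsub>G\<^esub> \<odot>\<^bsub>W\<^esub> v = \<zero>\<^bsub>W\<^esub>"
      using ann W.V.smult_l_distr[OF s(1,2) v(1)] by simp
    moreover have "W.single \<one> g \<odot>\<^bsub>W\<^esub> v = W.single \<one> \<one>\<^bsub>G\<^esub> \<odot>\<^bsub>W\<^esub> v"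
      using g v W.act_one[OF v(1)] by (simp add: rep_kernel_def W.act_def W.group_elem_single)
    ultimately have "(W.single \<one> \<one>\<^bsub>G\<^esub> \<oplus>\<^bsub>RG\<^esub> W.single (\<ominus> k) \<one>\<^bsub>G\<^esub>) \<odot>\<^bsub>W\<^esub> v = \<zero>\<^bsub>W\<^esub>"
      using W.V.smult_l_distr[OF s(3,2) v(1)] by simp
    moreover have "W.single \<one> \<one>\<^bsub>G\<^esub> \<oplus>\<^bsub>RG\<^esub> W.single (\<ominus> k) \<one>\<^bsub>G\<^esub> = W.single (\<one> \<oplus> \<ominus> k) \<one>\<^bsub>G\<^esub>"
      by (auto simp: fun_eq_iff add_eq W.single_def)
    moreover have "\<one> \<oplus> \<ominus> k \<noteq> \<zero>"
      using \<open>k \<noteq> \<one>\<close> k minus_equality[of \<one> "\<ominus> k"] by auto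
    ultimately show False using W.scalar_cancel[OF v(1), of "\<one> \<oplus> \<ominus> k"] v(2) k by simp
  qed
  have p0: "[p] \<cdot> \<one> = \<zero>" if x: "x \<in> rep_kernel K G W"
    and e: "\<And>h. h \<in> carrier G \<Longrightarrow> (\<Oplus>i\<in>{..<p}. u (h \<otimes>\<^bsub>G\<^esub> x [^]\<^bsub>G\<^esub> (i::nat))) = \<zero>" for x p
  proof (rule ccontr)
    assume p: "[p] \<cdot> \<one> \<noteq> \<zero>"
    have xG: "x \<in> carrier G" using x by (simp add: rep_kernel_def)
    let ?F = "\<lambda>i. W.single \<one> (x [^]\<^bsub>G\<^esub> (i::nat))"
    have F: "?F \<in> {..<p} \<rightarrow> carrier RG" using xG by (auto intro!: W.single_closed)
    have "value_at h (\<Oplus>\<^bsub>RG\<^esub>i\<in>{..<p}. ?F i) = \<zero>" if h: "h \<in> carrier G" for h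
    proof -
      have "value_at h (?F i) = u (h \<otimes>\<^bsub>G\<^esub> x [^]\<^bsub>G\<^esub> i)" for i
        using value_at_single[of \<one> "x [^]\<^bsub>G\<^esub> i" h] h xG u_closed by simp
      then show ?thesis using value_at_finsum[OF _ F h] e[OF h] by simp
    qed
    then have "(\<Oplus>\<^bsub>RG\<^esub>i\<in>{..<p}. ?F i) \<in> annihilator"
      using reg.V.R.finsum_closed[OF F] by (simp add: annihilator_def)
    then have "(\<Oplus>\<^bsub>W\<^esub>i\<in>{..<p}. ?F i \<odot>\<^bsub>W\<^esub> v) = \<zero>\<^bsub>W\<^esub>"
      using ann W.finsum_smult[OF _ F v(1)] by simp
    moreover have "?F i \<odot>\<^bsub>W\<^esub> v = v" for i
    proof -
      have "x [^]\<^bsub>G\<^esub> i \<in> rep_kernel K G W"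
        by (rule G.subgroup_nat_pow_closed[OF normal_imp_subgroup[OF W.rep_kernel_normal] x])
      then show ?thesis using v(1) by (simp add: rep_kernel_def W.group_elem_single)
    qed
    ultimately have "(\<Oplus>\<^bsub>W\<^esub>i\<in>{..<p}. v) = \<zero>\<^bsub>W\<^esub>" by simp
    then have "[p] \<cdot>\<^bsub>W\<^esub> v = \<zero>\<^bsub>W\<^esub>"
      using W.V.M.add.finprod_const[of v "{..<p}"] v(1) by (simp add: finsum_def add_pow_def)
    then show False using W.add_pow_cancel[OF v(1) p] v(2) by simp
  qed
  show ?thesis using W W.rep_kernel_normal k1 p0 by blast
qed

end


section \<open>From the socle to a faithful irreducible representation\<close>

lemma (in group) decomposition_unique:
  assumes A: "subgroup A G" and B: "subgroup B G" and AB: "A \<inter> B = {\<one>}"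
    and ab: "a \<in> A" "b \<in> B" "a' \<in> A" "b' \<in> B" "a \<otimes> b = a' \<otimes> b'"
  shows "a = a' \<and> b = b'"
proof -
  interpret A: subgroup A G by (rule A)
  interpret B: subgroup B G by (rule B)
  have "inv a' \<otimes> a = inv a' \<otimes> (a \<otimes> b) \<otimes> inv b" using ab(1-4) by (simp add: m_assoc)
  also have "\<dots> = b' \<otimes> inv b" unfolding ab(5) using ab(1-4) by (simp flip: m_assoc)
  finally have e: "inv a' \<otimes> a = b' \<otimes> inv b" .
  have "inv a' \<otimes> a \<in> A" using ab by simp
  moreover have "inv a' \<otimes> a \<in> B" unfolding e using ab by simp
  ultimately have "inv a' \<otimes> a = \<one>" using AB by blast
  then have "a' \<otimes> (inv a' \<otimes> a) = a'" using ab(3) by simp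
  then have "a = a'" using ab(1,3) by (simp flip: m_assoc)
  moreover from this have "b = b'"
    using ab l_cancel[OF _ B.mem_carrier[OF ab(2)] B.mem_carrier[OF ab(4)] A.mem_carrier[OF ab(3)]] by simp
  ultimately show ?thesis by blast
qed

context finite_rank_solvable_group
begin

text \<open>\<open>n c(s) = 0\<close> in \<open>\<int>/p\<close>, where \<open>n\<close> is invertible.\<close>

lemma zp_homs_vanish:
  assumes c: "c \<in> zp_homs p S" and s: "s \<in> S" "s [^] (n::nat) = \<one>" and p: "Factorial_Ring.prime (p::nat)" "\<not> p dvd n"
  shows "c s = 0"
proof -
  have sg: "subgroup S G" by (rule normal_imp_subgroup[OF socle_normal])
  have "(int n * c s) mod int p = 0" using zp_homs_pow[OF c sg s(1), of n] s(2) zp_homs_one[OF c sg] by simp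
  then have "int p dvd int n * c s" by auto
  moreover have "Factorial_Ring.prime (int p)" using p(1) by simp
  ultimately have "int p dvd c s" using p(2) by (simp add: prime_dvd_mult_iff)
  then have "c s mod int p = 0" by simp
  then show ?thesis using zp_homs_mod[OF c s(1)] by simp
qed

text \<open>The \<open>p\<close>-part of the socle is finite, so local cyclicity makes it cyclic and it has a core-free functional.
  Composing with the projection from the socle extends this functional.\<close>

lemma socle_character:
  assumes lc: "locally_cyclic (group_ring \<Z> G) (conj_module G S)" and p: "Factorial_Ring.prime p"
  shows "\<exists>c\<in>zp_homs p S. \<forall>N. N \<lhd> G \<and> N \<subseteq> socle_part p \<and> N \<noteq> {\<one>} \<longrightarrow> (\<exists>x\<in>N. c x \<noteq> 0)"
proof -
  let ?A = "socle_part p"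
  note AN = socle_part_normal[of p]
  have AS: "?A \<subseteq> S" by (auto simp: socle_part_def)
  have fin: "finite ?A" by (rule socle_part_finite[OF prime_gt_0_nat[OF p]])
  obtain x where x: "normal_closure ?A = normal_closure {x}"
    using lc fin AS unfolding locally_cyclic_iff by blast
  have cl: "normal_closure ?A = ?A"
    using normal_closure_least[OF AN order_refl] normal_closure_incl[of ?A] by blast
  have "x \<in> ?A" using x cl normal_closure_incl[of "{x}"] by blast
  then have "\<exists>x\<in>?A. normal_closure {x} = ?A" using x cl by auto
  then obtain c where c: "c \<in> zp_homs p ?A" "core_free c ?A"
    using cyclic_iff_core_free[OF p AN AS fin] by (auto simp: socle_part_def)
  obtain M where ds: "direct_sum S ?A M" using direct_sum_exists[OF socle_normal order_refl AN AS] by blast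
  interpret S: normal S G by (rule socle_normal)
  interpret M: normal M G by (rule direct_sum_normal(2)[OF ds])
  define l where "l = proj_left ?A M"
  have l: "l s \<in> ?A" if "s \<in> S" for s using proj(1)[OF ds that] by (simp add: l_def)
  have l_mult: "l (s \<otimes> t) = l s \<otimes> l t" if "s \<in> S" "t \<in> S" for s t
    using equivariant_homsD(3)[OF proj_homs(1)[OF ds] that] that by (simp add: l_def)
  have l_id: "l s = s" if s: "s \<in> ?A" for s
  proof -
    have "s \<in> carrier G" using s AS socle_sub by blast
    then show ?thesis using proj_eq(1)[OF ds s M.one_closed] by (simp add: l_def)
  qed
  have ch: "(\<lambda>s\<in>S. c (l s) mod int p) \<in> zp_homs p S"
    by (rule zp_homsI[OF _ prime_gt_0_nat[OF p] S.subgroup_axioms])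
       (simp add: l_mult zp_homsD(3)[OF c(1) l l])
  have "\<exists>x\<in>N. (\<lambda>s\<in>S. c (l s) mod int p) x \<noteq> 0" if N: "N \<lhd> G" "N \<subseteq> ?A" "N \<noteq> {\<one>}" for N
  proof -
    obtain x where x: "x \<in> N" "c x \<noteq> 0" using c(2) N unfolding core_free_def by blast
    have xA: "x \<in> ?A" "x \<in> S" using x N AS by auto
    show ?thesis
      by (rule bexI[OF _ x(1)]) (use xA x(2) l_id[OF xA(1)] zp_homs_mod[OF c(1) xA(1)] in simp)
  qed
  then show ?thesis using ch by blast
qed

definition sign_support :: "(nat \<Rightarrow> 'a \<Rightarrow> int) \<Rightarrow> 'a \<Rightarrow> nat set" where
  "sign_support c s = {p. Factorial_Ring.prime p \<and> c p s \<noteq> 0}"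

text \<open>For each prime, \<open>1\<close>, \<open>-1\<close> or \<open>0\<close> according to whether \<open>c p s\<close> is \<open>0\<close>, \<open>1\<close> or something else; the function
  is the product over all primes. The point is that the contribution of each prime sums to zero over \<open>\<int>/p\<close>.\<close>

definition sign_function :: "('k, 'n) ring_scheme \<Rightarrow> (nat \<Rightarrow> 'a \<Rightarrow> int) \<Rightarrow> 'a \<Rightarrow> 'k" where
  "sign_function K c s = (if \<forall>p. Factorial_Ring.prime p \<longrightarrow> c p s \<in> {0, 1}
     then (\<ominus>\<^bsub>K\<^esub> \<one>\<^bsub>K\<^esub>) [^]\<^bsub>K\<^esub> card (sign_support c s) else \<zero>\<^bsub>K\<^esub>)"

context
  fixes K :: "('k, 'n) ring_scheme" and c :: "nat \<Rightarrow> 'a \<Rightarrow> int"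
  assumes K: "field K" and c: "\<And>p. Factorial_Ring.prime p \<Longrightarrow> c p \<in> zp_homs p S"
begin

interpretation K: field K by (rule K)

text \<open>The functional for \<open>p\<close> vanishes at \<open>s\<close> unless \<open>p\<close> divides the order of \<open>s\<close>.\<close>

lemma sign_support_finite:
  assumes s: "s \<in> S"
  shows "finite (sign_support c s)"
proof -
  obtain P where P: "finite P" "\<And>p. p \<in> P \<Longrightarrow> Factorial_Ring.prime (p::nat)" "s [^] (\<Prod>P) = \<one>"
    using socle_exponent[OF s] by blast
  have "sign_support c s \<subseteq> P"
  proof
    fix p assume "p \<in> sign_support c s"
    then have p: "Factorial_Ring.prime p" "c p s \<noteq> 0" by (auto simp: sign_support_def)
    then have "p dvd \<Prod>P" using zp_homs_vanish[OF c[OF p(1)] s P(3) p(1)] by blast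
    then obtain q where "q \<in> P" "p dvd q" using prime_dvd_prod_iff[OF P(1) p(1), of "\<lambda>x. x"] by auto
    then show "p \<in> P" using P(2) p(1) primes_dvd_imp_eq by blast
  qed
  then show ?thesis using P(1) finite_subset by blast
qed

lemma sign_function_closed: "sign_function K c s \<in> carrier K"
  by (simp add: sign_function_def)

lemma sign_function_one: "sign_function K c \<one> = \<one>\<^bsub>K\<^esub>"
proof -
  have "c p \<one> = 0" if "Factorial_Ring.prime p" for p
    by (rule zp_homs_one[OF c[OF that] normal_imp_subgroup[OF socle_normal]])
  moreover from this have "sign_support c \<one> = {}" by (auto simp: sign_support_def)
  ultimately show ?thesis by (simp add: sign_function_def)
qed

text \<open>As \<open>i\<close> runs from \<open>0\<close> to \<open>p - 1\<close>, the value \<open>c p (s x\<^sup>i)\<close> takes every residue modulo \<open>p\<close> once, while the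
  functionals for the other primes do not change. So the sum has only two terms that may be nonzero, of opposite sign.\<close>

lemma sign_function_sum:
  assumes p: "Factorial_Ring.prime p" and s: "s \<in> S" and x: "x \<in> S" "x [^] p = \<one>" "c p x \<noteq> 0"
  shows "(\<Oplus>\<^bsub>K\<^esub>i\<in>{..<p}. sign_function K c (s \<otimes> x [^] (i::nat))) = \<zero>\<^bsub>K\<^esub>"
proof -
  have sg: "subgroup S G" by (rule normal_imp_subgroup[OF socle_normal])
  have xi: "x [^] (i::nat) \<in> S" for i by (rule subgroup_nat_pow_closed[OF sg x(1)])
  have p1: "p > 1" by (rule prime_gt_1_nat[OF p])
  have q: "c q (s \<otimes> x [^] (i::nat)) = c q s" if q: "Factorial_Ring.prime q" "q \<noteq> p" for q i
  proof -
    have "\<not> q dvd p" using q p primes_dvd_imp_eq by blast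
    then have "c q x = 0" using zp_homs_vanish[OF c[OF q(1)] x(1,2) q(1)] by blast
    then have "c q (x [^] i) = 0" using zp_homs_pow[OF c[OF q(1)] sg x(1), of i] by simp
    then show ?thesis using zp_homsD(3)[OF c[OF q(1)] s xi] zp_homs_mod[OF c[OF q(1)] s] by simp
  qed
  show ?thesis
  proof (cases "\<forall>q. Factorial_Ring.prime q \<and> q \<noteq> p \<longrightarrow> c q s \<in> {0, 1}")
    case False
    then obtain q where "Factorial_Ring.prime q" "q \<noteq> p" "c q s \<notin> {0, 1}" by blast
    then have "sign_function K c (s \<otimes> x [^] (i::nat)) = \<zero>\<^bsub>K\<^esub>" for i
      using q[of q i] by (auto simp: sign_function_def)
    then show ?thesis by simp
  next
    case True
    define val where "val i = c p (s \<otimes> x [^] (i::nat))" for i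
    define Q where "Q = {q. Factorial_Ring.prime q \<and> q \<noteq> p \<and> c q s \<noteq> 0}"
    define e where "e = (\<ominus>\<^bsub>K\<^esub> \<one>\<^bsub>K\<^esub>) [^]\<^bsub>K\<^esub> card Q"
    define m where "m k = (if k = (0::int) then e else if k = 1 then e \<otimes>\<^bsub>K\<^esub> (\<ominus>\<^bsub>K\<^esub> \<one>\<^bsub>K\<^esub>) else \<zero>\<^bsub>K\<^esub>)" for k
    have eK: "e \<in> carrier K" by (simp add: e_def)
    have mK: "m k \<in> carrier K" for k using eK by (simp add: m_def)
    have val_eq: "val i = (c p s + int i * c p x) mod int p" for i
      using zp_homsD(3)[OF c[OF p] s xi] zp_homs_pow[OF c[OF p] sg x(1), of i] by (simp add: val_def mod_simps)
    have "Q \<subseteq> sign_support c s" by (auto simp: Q_def sign_support_def)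
    then have Qfin: "finite Q" using sign_support_finite[OF s] finite_subset by blast
    have term_eq: "sign_function K c (s \<otimes> x [^] i) = m (val i)" for i
    proof -
      have "(\<forall>q. Factorial_Ring.prime q \<longrightarrow> c q (s \<otimes> x [^] i) \<in> {0, 1}) \<longleftrightarrow> val i \<in> {0, 1}"
        using True q p unfolding val_def by metis
      moreover have "sign_support c (s \<otimes> x [^] i) = (if val i = 0 then Q else insert p Q)"
      proof -
        have "r \<in> sign_support c (s \<otimes> x [^] i) \<longleftrightarrow> r \<in> (if val i = 0 then Q else insert p Q)" for r
          by (cases "r = p") (use q[of r i] p in \<open>auto simp: sign_support_def Q_def val_def\<close>)
        then show ?thesis by blast
      qed
      moreover have "p \<notin> Q" by (simp add: Q_def)
      ultimately show ?thesis using Qfin eK by (auto simp: sign_function_def m_def e_def)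
    qed
    have inj: "inj_on val {..<p}"
    proof (rule inj_onI)
      fix i j assume ij: "i \<in> {..<p}" "j \<in> {..<p}" "val i = val j"
      have "int p dvd (c p s + int i * c p x) - (c p s + int j * c p x)"
        using ij(3) unfolding val_eq by (simp add: mod_eq_dvd_iff)
      then have "int p dvd (int i - int j) * c p x" by (simp add: algebra_simps)
      moreover have "\<not> int p dvd c p x"
        using x(3) zp_homs_mod[OF c[OF p] x(1)] by auto
      moreover have "Factorial_Ring.prime (int p)" using p by simp
      ultimately have "int p dvd int i - int j" by (simp add: prime_dvd_mult_iff)
      then have "int i mod int p = int j mod int p" by (simp add: mod_eq_dvd_iff)
      then show "i = j" using ij(1,2) by simp
    qed
    have img: "val ` {..<p} = {0..<int p}"
    proof (rule card_subset_eq)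
      show "val ` {..<p} \<subseteq> {0..<int p}" using p1 by (auto simp: val_eq)
      show "card (val ` {..<p}) = card {0..<int p}" using card_image[OF inj] by simp
    qed simp
    have "(\<Oplus>\<^bsub>K\<^esub>i\<in>{..<p}. sign_function K c (s \<otimes> x [^] i)) = (\<Oplus>\<^bsub>K\<^esub>i\<in>{..<p}. m (val i))"
      by (rule K.finsum_cong') (use mK term_eq in auto)
    also have "\<dots> = (\<Oplus>\<^bsub>K\<^esub>k\<in>val ` {..<p}. m k)"
      by (rule K.add.finprod_reindex[symmetric, OF _ inj]) (use mK in auto)
    also have "\<dots> = (\<Oplus>\<^bsub>K\<^esub>k\<in>{0, 1}. m k)"
      unfolding img
      by (rule K.add.finprod_mono_neutral_cong_left[symmetric]) (use p1 mK in \<open>auto simp: m_def\<close>)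
    also have "\<dots> = e \<oplus>\<^bsub>K\<^esub> e \<otimes>\<^bsub>K\<^esub> (\<ominus>\<^bsub>K\<^esub> \<one>\<^bsub>K\<^esub>)" using eK by (simp add: m_def)
    also have "\<dots> = \<zero>\<^bsub>K\<^esub>" using eK by (simp add: K.r_minus K.r_neg)
    finally show ?thesis .
  qed
qed

end

text \<open>The function \<open>u\<close> below is supported on \<open>S F\<close> and is the product of the sign function on \<open>S\<close> and of a
  faithful character \<open>\<alpha>\<close> of the free abelian group \<open>F\<close>. A nontrivial kernel of the resulting simple module would
  contain an element of \<open>F\<close> at which \<open>\<alpha>\<close> is \<open>1\<close>, or an element of order \<open>p\<close> in the socle on which the
  core-free functional for \<open>p\<close> does not vanish; the latter forces characteristic \<open>p\<close>.\<close>

theorem socle_imp_faithful_irreducible: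
  fixes K :: "('k, 'n) ring_scheme"
  assumes K: "field K" "\<not> locally_finite_field K"
    and lc: "locally_cyclic (group_ring \<Z> G) (conj_module G S)"
    and char: "ring_char K \<notin> prime_orders (G\<lparr>carrier := S\<rparr>)"
  shows "has_faithful_irreducible_rep K G"
proof -
  interpret K: field K by (rule K(1))
  interpret S: normal S G by (rule socle_normal)
  obtain D T where D: "torsion_free_abelian D" and T: "comm_group.mult_independent (G\<lparr>carrier := D\<rparr>) T"
    and meets: "\<And>B. \<lbrakk>torsion_free_abelian B; B \<noteq> {\<one>}\<rbrakk> \<Longrightarrow> \<exists>y\<in>B \<inter> generate G T. y \<noteq> \<one>"
    using exists_maximal_torsion_free by blast
  have DN: "D \<lhd> G" and Dt: "\<And>x k. \<lbrakk>x \<in> D; k > 0; x [^] (k::nat) = \<one>\<rbrakk> \<Longrightarrow> x = \<one>"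
    using D unfolding torsion_free_abelian_def by blast+
  interpret D: normal D G by (rule DN)
  interpret C: comm_group "G\<lparr>carrier := D\<rparr>" by (rule torsion_free_abelian_comm_group[OF D])
  have TD: "T \<subseteq> D" using T by (auto simp: C.mult_independent_def)
  define F where "F = generate G T"
  have FD: "F \<subseteq> D" unfolding F_def by (rule generate_subgroup_incl[OF TD D.subgroup_axioms])
  have "subgroup F G" unfolding F_def by (rule generate_is_subgroup) (use TD D.mem_carrier in blast)
  then interpret F: subgroup F G .
  have F_gen: "generate (G\<lparr>carrier := D\<rparr>) T = F"
    unfolding F_def by (rule generate_consistent[OF TD D.subgroup_axioms])
  have units: "comm_group (units_of K)" by (rule K.units_comm_group)
  obtain L where L: "comm_group.mult_independent (units_of K) L" "card L = card T"
    using K.independent_sets_if_not_locally_finite[OF K(2), of "card T"] by blast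
  obtain \<alpha> where \<alpha>: "\<forall>f\<in>F. \<alpha> f \<in> carrier (units_of K)"
    "\<forall>f\<in>F. \<forall>f'\<in>F. \<alpha> (f \<otimes> f') = \<alpha> f \<otimes>\<^bsub>units_of K\<^esub> \<alpha> f'" "\<forall>f\<in>F. \<alpha> f = \<one>\<^bsub>units_of K\<^esub> \<longrightarrow> f = \<one>"
    using independent_embedding[OF C.comm_group_axioms units T L(1) L(2)[symmetric]] unfolding F_gen by auto
  have \<alpha>K: "\<alpha> f \<in> carrier K" "\<alpha> f \<noteq> \<zero>\<^bsub>K\<^esub>" if "f \<in> F" for f
    using bspec[OF \<alpha>(1) that] by (auto simp: K.units_of_carrier_eq)
  have \<alpha>_mult: "\<alpha> (f \<otimes> f') = \<alpha> f \<otimes>\<^bsub>K\<^esub> \<alpha> f'" if "f \<in> F" "f' \<in> F" for f f'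
    using \<alpha>(2) that by (simp add: units_of_mult)
  have \<alpha>_inj: "f = \<one>" if "f \<in> F" "\<alpha> f = \<one>\<^bsub>K\<^esub>" for f using \<alpha>(3) that by (simp add: units_of_one)
  have SD: "S \<inter> D = {\<one>}"
  proof -
    have "x = \<one>" if x: "x \<in> S" "x \<in> D" for x
    proof -
      obtain P where P: "finite P" "\<And>p. p \<in> P \<Longrightarrow> Factorial_Ring.prime (p::nat)" "x [^] (\<Prod>P) = \<one>"
        using socle_exponent[OF x(1)] by blast
      have "\<Prod>P > 0" using P(2) prime_gt_0_nat by (intro prod_pos) blast
      then show ?thesis using Dt[OF x(2) _ P(3)] by blast
    qed
    then show ?thesis using S.one_closed D.one_closed by blast
  qed
  then have SF: "S \<inter> F = {\<one>}" using FD F.one_closed S.one_closed by blast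
  \<comment> \<open>\<open>S\<close> and \<open>D\<close> are normal subgroups with trivial intersection, \<open>S\<close> being a torsion group\<close>
  have comm: "f \<otimes> s = s \<otimes> f" if "s \<in> S" "f \<in> F" for s f
    using commute_if_trivial_intersection[OF socle_normal DN SD that(1)] that(2) FD by (metis subsetD)
  have "\<forall>p. \<exists>\<chi>. Factorial_Ring.prime p \<longrightarrow> \<chi> \<in> zp_homs p S \<and>
      (\<forall>N. N \<lhd> G \<and> N \<subseteq> socle_part p \<and> N \<noteq> {\<one>} \<longrightarrow> (\<exists>x\<in>N. \<chi> x \<noteq> 0))"
    using socle_character[OF lc] by blast
  then obtain \<chi> where \<chi>: "\<And>p. Factorial_Ring.prime p \<Longrightarrow> \<chi> p \<in> zp_homs p S"
    and \<chi>_core: "\<And>p N. \<lbrakk>Factorial_Ring.prime p; N \<lhd> G; N \<subseteq> socle_part p; N \<noteq> {\<one>}\<rbrakk> \<Longrightarrow> \<exists>x\<in>N. \<chi> p x \<noteq> 0"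
    by metis
  define \<mu> where "\<mu> = sign_function K \<chi>"
  have \<mu>K: "\<mu> s \<in> carrier K" for s unfolding \<mu>_def by (rule sign_function_closed[OF K(1) \<chi>])
  define in_SF where "in_SF h \<longleftrightarrow> (\<exists>s\<in>S. \<exists>f\<in>F. h = s \<otimes> f)" for h
  \<comment> \<open>the component in \<open>S\<close> of an element of \<open>S F\<close>\<close>
  define \<sigma> where "\<sigma> h = (SOME s. s \<in> S \<and> (\<exists>f\<in>F. h = s \<otimes> f))" for h
  define u where "u h = (if in_SF h then \<mu> (\<sigma> h) \<otimes>\<^bsub>K\<^esub> \<alpha> (inv (\<sigma> h) \<otimes> h) else \<zero>\<^bsub>K\<^esub>)" for h
  have u_SF: "u (s \<otimes> f) = \<mu> s \<otimes>\<^bsub>K\<^esub> \<alpha> f" if s: "s \<in> S" and f: "f \<in> F" for s f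
  proof -
    have "\<exists>t. t \<in> S \<and> (\<exists>f'\<in>F. s \<otimes> f = t \<otimes> f')" using s f by blast
    then have "\<sigma> (s \<otimes> f) \<in> S \<and> (\<exists>f'\<in>F. s \<otimes> f = \<sigma> (s \<otimes> f) \<otimes> f')" unfolding \<sigma>_def by (rule someI_ex)
    then obtain f' where f': "\<sigma> (s \<otimes> f) \<in> S" "f' \<in> F" "s \<otimes> f = \<sigma> (s \<otimes> f) \<otimes> f'" by blast
    have "\<sigma> (s \<otimes> f) = s"
      by (rule conjunct1[OF decomposition_unique[OF S.subgroup_axioms F.subgroup_axioms SF s f f'], symmetric])
    moreover have "in_SF (s \<otimes> f)" using s f by (auto simp: in_SF_def)
    moreover have "inv s \<otimes> (s \<otimes> f) = f" using s f by (simp flip: m_assoc)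
    ultimately show ?thesis by (simp add: u_def)
  qed
  have u_out: "u h = \<zero>\<^bsub>K\<^esub>" if "\<not> in_SF h" for h using that by (simp add: u_def)
  have uK: "u h \<in> carrier K" for h
  proof (cases "in_SF h")
    case True
    then obtain s f where "s \<in> S" "f \<in> F" "h = s \<otimes> f" by (auto simp: in_SF_def)
    then show ?thesis using u_SF \<mu>K \<alpha>K by simp
  qed (simp add: u_out)
  interpret u: group_functional K G u
    by (intro group_functional.intro group_functional_axioms.intro group_ring_setup.intro K.ring_axioms is_group K(1) uK)
  have \<alpha>1: "\<alpha> \<one> = \<one>\<^bsub>K\<^esub>"
  proof -
    have "\<alpha> \<one> \<otimes>\<^bsub>K\<^esub> \<alpha> \<one> = \<alpha> \<one> \<otimes>\<^bsub>K\<^esub> \<one>\<^bsub>K\<^esub>" using \<alpha>_mult[OF F.one_closed F.one_closed] \<alpha>K[OF F.one_closed] by simp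
    then show ?thesis using K.m_lcancel[OF \<alpha>K(2)[OF F.one_closed] \<alpha>K(1)[OF F.one_closed] \<alpha>K(1)[OF F.one_closed] K.one_closed] by blast
  qed
  have "u \<one> = \<one>\<^bsub>K\<^esub>"
    using u_SF[OF S.one_closed F.one_closed] \<alpha>1 sign_function_one[OF K(1) \<chi>] by (simp add: \<mu>_def)
  then have u1: "u \<one> \<noteq> \<zero>\<^bsub>K\<^esub>" by simp
  have u_F: "u (h \<otimes> f) = \<alpha> f \<otimes>\<^bsub>K\<^esub> u h" if h: "h \<in> carrier G" and f: "f \<in> F" for h f
  proof (cases "in_SF h")
    case True
    then obtain s f' where sf: "s \<in> S" "f' \<in> F" "h = s \<otimes> f'" by (auto simp: in_SF_def)
    have "h \<otimes> f = s \<otimes> (f' \<otimes> f)" using sf f by (simp add: m_assoc)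
    then show ?thesis
      using u_SF[OF sf(1) F.m_closed[OF sf(2) f]] u_SF[OF sf(1,2)] sf(3) \<alpha>_mult[OF sf(2) f] \<mu>K[of s] \<alpha>K[OF f] \<alpha>K[OF sf(2)]
      by (simp add: K.m_ac)
  next
    case False
    have "\<not> in_SF (h \<otimes> f)"
    proof
      assume "in_SF (h \<otimes> f)"
      then obtain s f' where sf: "s \<in> S" "f' \<in> F" "h \<otimes> f = s \<otimes> f'" by (auto simp: in_SF_def)
      have "h = (h \<otimes> f) \<otimes> inv f" using h f by (simp add: m_assoc)
      also have "\<dots> = s \<otimes> (f' \<otimes> inv f)" unfolding sf(3) using sf f by (simp add: m_assoc)
      finally have "in_SF h" unfolding in_SF_def using sf(1) F.m_closed[OF sf(2) F.m_inv_closed[OF f]] by blast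
      then show False using False by blast
    qed
    then show ?thesis using u_out False \<alpha>K[OF f] by simp
  qed
  have u_S: "(\<Oplus>\<^bsub>K\<^esub>i\<in>{..<p}. u (h \<otimes> x [^] (i::nat))) = \<zero>\<^bsub>K\<^esub>"
    if p: "Factorial_Ring.prime p" and x: "x \<in> S" "x [^] p = \<one>" "\<chi> p x \<noteq> 0" and h: "h \<in> carrier G" for p x h
  proof -
    have xi: "x [^] (i::nat) \<in> S" for i by (rule subgroup_nat_pow_closed[OF S.subgroup_axioms x(1)])
    have xG: "x \<in> carrier G" using x(1) by simp
    show ?thesis
    proof (cases "in_SF h")
      case True
      then obtain s f where sf: "s \<in> S" "f \<in> F" "h = s \<otimes> f" by (auto simp: in_SF_def)
      have "u (h \<otimes> x [^] i) = \<mu> (s \<otimes> x [^] i) \<otimes>\<^bsub>K\<^esub> \<alpha> f" for i :: nat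
      proof -
        have "h \<otimes> x [^] i = s \<otimes> (f \<otimes> x [^] i)" using sf xG by (simp add: m_assoc)
        also have "\<dots> = (s \<otimes> x [^] i) \<otimes> f" unfolding comm[OF xi sf(2)] using sf xG by (simp add: m_assoc)
        finally show ?thesis using u_SF[OF S.m_closed[OF sf(1) xi] sf(2)] by simp
      qed
      then have "(\<Oplus>\<^bsub>K\<^esub>i\<in>{..<p}. u (h \<otimes> x [^] i)) = (\<Oplus>\<^bsub>K\<^esub>i\<in>{..<p}. \<mu> (s \<otimes> x [^] i)) \<otimes>\<^bsub>K\<^esub> \<alpha> f"
        using K.finsum_ldistr[of "{..<p}" "\<alpha> f" "\<lambda>i. \<mu> (s \<otimes> x [^] i)"] \<mu>K \<alpha>K[OF sf(2)] by (simp add: Pi_iff)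
      also have "\<dots> = \<zero>\<^bsub>K\<^esub>"
        using sign_function_sum[OF K(1) \<chi> p sf(1) x] \<alpha>K[OF sf(2)] by (simp add: \<mu>_def)
      finally show ?thesis .
    next
      case False
      have "\<not> in_SF (h \<otimes> x [^] i)" for i :: nat
      proof
        assume "in_SF (h \<otimes> x [^] i)"
        then obtain s f where sf: "s \<in> S" "f \<in> F" "h \<otimes> x [^] i = s \<otimes> f" by (auto simp: in_SF_def)
        have ix: "inv (x [^] i) \<in> S" by (rule S.m_inv_closed[OF xi])
        have "h = (h \<otimes> x [^] i) \<otimes> inv (x [^] i)" using h xG by (simp add: m_assoc)
        also have "\<dots> = s \<otimes> (f \<otimes> inv (x [^] i))" unfolding sf(3) using sf xG by (simp add: m_assoc)
        also have "\<dots> = (s \<otimes> inv (x [^] i)) \<otimes> f" unfolding comm[OF ix sf(2)] using sf xG by (simp add: m_assoc)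
        finally have "in_SF h" unfolding in_SF_def using S.m_closed[OF sf(1) ix] sf(2) by blast
        then show False using False by blast
      qed
      then show ?thesis using u_out by simp
    qed
  qed
  obtain W :: "('a \<Rightarrow> 'k, 'a \<Rightarrow> 'k) module" where W: "simple_module (group_ring K G) W"
    and N: "rep_kernel K G W \<lhd> G"
    and scalar: "\<And>g k. \<lbrakk>g \<in> rep_kernel K G W; k \<in> carrier K; \<forall>h\<in>carrier G. u (h \<otimes> g) = k \<otimes>\<^bsub>K\<^esub> u h\<rbrakk> \<Longrightarrow> k = \<one>\<^bsub>K\<^esub>"
    and cyclic: "\<And>x p. \<lbrakk>x \<in> rep_kernel K G W; \<forall>h\<in>carrier G. (\<Oplus>\<^bsub>K\<^esub>i\<in>{..<p}. u (h \<otimes> x [^] (i::nat))) = \<zero>\<^bsub>K\<^esub>\<rbrakk>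
      \<Longrightarrow> [p] \<cdot>\<^bsub>K\<^esub> \<one>\<^bsub>K\<^esub> = \<zero>\<^bsub>K\<^esub>"
    using u.simple_module_of_functional[OF u1] by metis
  have "rep_kernel K G W = {\<one>}"
  proof (rule ccontr)
    assume "rep_kernel K G W \<noteq> {\<one>}"
    then obtain A where A: "A \<lhd> G" "A \<subseteq> rep_kernel K G W" "A \<noteq> {\<one>}"
      and Ac: "\<And>x y. \<lbrakk>x \<in> A; y \<in> A\<rbrakk> \<Longrightarrow> x \<otimes> y = y \<otimes> x"
      using abelian_normal_subgroup[OF N] by blast
    show False
    proof (cases "torsion_free_abelian A")
      case True
      obtain f where f: "f \<in> A" "f \<in> F" "f \<noteq> \<one>" using meets[OF True A(3)] unfolding F_def by blast
      have "\<alpha> f = \<one>\<^bsub>K\<^esub>" by (rule scalar[of f]) (use f A(2) \<alpha>K u_F in auto)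
      then show False using \<alpha>_inj[OF f(2)] f(3) by blast
    next
      case False
      then obtain x n where "x \<in> A" "x \<noteq> \<one>" "n > 0" "x [^] (n::nat) = \<one>"
        using A(1) Ac unfolding torsion_free_abelian_def by blast
      then obtain p where p: "Factorial_Ring.prime p" "A \<inter> socle_part p \<noteq> {\<one>}"
        using torsion_meets_socle[OF A(1) Ac] by blast
      obtain z where z: "z \<in> A \<inter> socle_part p" "\<chi> p z \<noteq> 0"
        using \<chi>_core[OF p(1) normal_Int[OF A(1) socle_part_normal] _ p(2)] by blast
      have zS: "z \<in> S" "z [^] p = \<one>" "z \<in> rep_kernel K G W" using z A(2) by (auto simp: socle_part_def)
      have "[p] \<cdot>\<^bsub>K\<^esub> \<one>\<^bsub>K\<^esub> = \<zero>\<^bsub>K\<^esub>"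
        by (rule cyclic[OF zS(3)]) (use u_S[OF p(1) zS(1,2) z(2)] in blast)
      then have "ring_char K = p" using ring_char_eq_prime_iff[OF K(1) p(1)] by blast
      moreover have "socle_part p \<noteq> {\<one>}"
      proof
        assume "socle_part p = {\<one>}"
        then have "A \<inter> socle_part p = {\<one>}" using subgroup.one_closed[OF normal_imp_subgroup[OF A(1)]] by blast
        then show False using p(2) by blast
      qed
      ultimately show False using char prime_orders_socle p(1) by blast
    qed
  qed
  then have "faithful_irreducible K G W" using W by (simp add: faithful_irreducible_def)
  then show ?thesis by (rule has_faithful_irreducible_repI[OF K.ring_axioms])
qed

end

theorem theorem5p2:
  fixes G :: "('g, 'm) monoid_scheme" and K :: "('k, 'n) ring_scheme"
  assumes "group G" and "solvable G" and "finite_rank G"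
    and "field K" and "\<not> locally_finite_field K"
  shows "has_faithful_irreducible_rep K G \<longleftrightarrow>
    locally_cyclic (group_ring \<Z> G) (conj_module G (socle G)) \<and>
    ring_char K \<notin> prime_orders (G\<lparr>carrier := socle G\<rparr>)"
proof -
  interpret finite_rank_solvable_group G
    by (intro finite_rank_solvable_group.intro finite_rank_solvable_group_axioms.intro assms)
  show ?thesis
  proof
    assume "has_faithful_irreducible_rep K G"
    then obtain V :: "('g \<Rightarrow> 'k, ('g \<Rightarrow> 'k) set) module" where "faithful_irreducible K G V"
      unfolding has_faithful_irreducible_rep_def by blast
    then show "locally_cyclic (group_ring \<Z> G) (conj_module G (socle G)) \<and>
        ring_char K \<notin> prime_orders (G\<lparr>carrier := socle G\<rparr>)"
      using faithful_irreducible_imp_socle[OF assms(4)] by blast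
  next
    assume "locally_cyclic (group_ring \<Z> G) (conj_module G (socle G)) \<and>
        ring_char K \<notin> prime_orders (G\<lparr>carrier := socle G\<rparr>)"
    then show "has_faithful_irreducible_rep K G"
      using socle_imp_faithful_irreducible[OF assms(4,5)] by blast
  qed
qed

end
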